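(* (1) For every integer $n\ge1$, the twist knot $T_{4n+1}$ is the Fourier-$(1,1,2)$ knot with $n_x=2$, $\phi_x=0$, $n_y=8n+3$, $\phi_y=1/2$, $n_{z,1}=2$, $\phi_{z,1}=\pi/4$, $n_{z,2}=8n+1$, $\phi_{z,2}=\frac{8n+1+(8n+5)\pi}{2(8n+3)}$, and $A_{z,2}=1$. (2) For every integer $n\ge1$, the twist knot $T_{2n}$ is the Fourier-$(1,1,2)$ knot with $n_x=2$, $\phi_x=0$, $n_y=2n+1$, $\phi_y=1/2$, $n_{z,1}=2$, $\phi_{z,1}=\pi/4$, $n_{z,2}=2n+3$, $\phi_{z,2}=\frac{2n+3-3\pi}{2(2n+1)}$, and $A_{z,2}=1$.
   Context: The Fourier-$(1,1,2)$ knot with these data is the curve $x(t)=\cos(n_xt+\phi_x)$, $y(t)=\cos(n_yt+\phi_y)$, $z(t)=\cos(n_{z,1}t+\phi_{z,1})+A_{z,2}\cos(n_{z,2}t+\phi_{z,2})$, $0\le t\le 2\pi$. For an integer $m$, the twist knot $T_m$ is the 2-bridge knot $K_{(2m+1)/2}$, i.e. the 2-bridge knot with classifying fraction $p/q=(2m+1)/2$ (a clasp together with $m$ half-twists). Knots are considered up to mirror image. *)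

theory Defs
  imports "HOL-Analysis.Analysis"
begin

definition fourier_112 ::
  "int \<Rightarrow> real \<Rightarrow> int \<Rightarrow> real \<Rightarrow> int \<Rightarrow> real \<Rightarrow> int \<Rightarrow> real \<Rightarrow> real \<Rightarrow> real \<Rightarrow> real \<times> real \<times> real"
  where
  "fourier_112 nx phx ny phy nz1 phz1 nz2 phz2 Az2 t =
     (cos (real_of_int nx * t + phx),
      cos (real_of_int ny * t + phy),
      cos (real_of_int nz1 * t + phz1) + Az2 * cos (real_of_int nz2 * t + phz2))"

definition is_knot_param :: "(real \<Rightarrow> real \<times> real \<times> real) \<Rightarrow> bool" where
  "is_knot_param g \<longleftrightarrow>
     continuous_on {0..2*pi} g \<and> g 0 = g (2*pi) \<and> inj_on g {0..<2*pi}"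

text \<open>Two knots (as subsets of 3-space) have the same knot type up to mirror image
  iff some self-homeomorphism of 3-space (orientation preserving or reversing)
  carries one onto the other.\<close>
definition same_knot_up_to_mirror ::
  "(real \<times> real \<times> real) set \<Rightarrow> (real \<times> real \<times> real) set \<Rightarrow> bool" where
  "same_knot_up_to_mirror K L \<longleftrightarrow>
     (\<exists>h h'. homeomorphism UNIV UNIV h h' \<and> h ` K = L)"

definition polygon :: "(real \<times> real \<times> real) list \<Rightarrow> (real \<times> real \<times> real) set" where
  "polygon vs = (\<Union>i<length vs. closed_segment (vs ! i) (vs ! ((i + 1) mod length vs)))"

text \<open>An explicit polygonal representative of the twist knot T_m = K_((2m+1)/2):
  two strands twisted about the x-axis by |m| half-twists (x from 0 to |m|,
  direction given by the sign of m), capped at the right end, and the left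
  ends joined by a long arc that clasps the right cap.  The twist direction
  relative to the clasp is chosen such that T_0 is the unknot, T_1 the trefoil,
  T_2 the figure-eight knot (determinant |2m+1|).\<close>
definition twist_vertices :: "int \<Rightarrow> (real \<times> real \<times> real) list" where
  "twist_vertices m =
     (let M = nat \<bar>m\<bar>;
          s = (if m \<ge> 0 then 1 else -1 :: real);
          e = ((-1) ^ M :: real);
          A = (\<lambda>k::nat. (real k / 2, cos (real k * pi / 2), s * sin (real k * pi / 2)));
          B = (\<lambda>k::nat. (real k / 2, - cos (real k * pi / 2), - s * sin (real k * pi / 2)))
      in map A [0..<2*M+1]
         @ [(real M + 1, e, 0), (real M + 1, - e, 0)]
         @ map B (rev [0..<2*M+1])
         @ [(-1, -1, 0), (-1, -3, 0),
            (real M + 1/2, -3, 1), (real M + 1/2, 0, 1),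
            (real M + 1/2, 0, -1), (real M + 1/2, 3, -1),
            (-1, 3, 0), (-1, 1, 0)])"

definition twist_knot :: "int \<Rightarrow> (real \<times> real \<times> real) set" where
  "twist_knot m = polygon (twist_vertices m)"

end

theory Submission
  imports Defs
begin

text \<open>Both curves are read as plats of four-strand braids.  The projection of a Fourier knot with
  \<open>n\<^sub>x = 2\<close> to the \<open>(x, y)\<close>-plane is a Lissajous diagram; the signs of its crossings, computed from the
  phases, give the braid word.  A homotopy of motions of four points extends to an ambient homeomorphism,
  so the plat depends only on the braid.  Half twists of the caps, and the passage of a strand around a
  cap, are absorbed at the end of a word; the braids \<open>\<sigma>1 - \<sigma>3\<close> and \<open>\<sigma>2 + \<sigma>1 - \<sigma>3 - \<sigma>2\<close> generate a normal
  subgroup of absorbed braids, so \<open>\<sigma>1\<close> and \<open>\<sigma>3\<close> may be exchanged anywhere (flypes).  In the remaining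
  three-strand braids both words reduce to the word of the twist knot polygon.\<close>

text \<open>A knot type is a subset of space up to homeomorphism, so every move on diagrams has to
  be realized by an explicit map. Almost all maps used here either preserve the fibres x = const or
  rescale the lines parallel to the x-axis, which reduces each move to plane geometry or to a factor
  on every line. Analytic curves meet combinatorial motions through straight-line homotopies: such a
  homotopy is free of collisions as soon as both sides agree in the order of the strands and in the
  signs of the crossings, so no estimate of the curves is needed beyond signs. The two braids that
  generate the absorbed normal subgroup generate the kernel of the classical homomorphism from the
  four-strand to the three-strand braid group that identifies \<sigma>1 and \<sigma>3. The constants
  of the theorem have two jobs. The phase \<open>pi/4\<close> makes the first cosine contribute
  \<open>sqrt 2 * sin (2 * t)\<close> to crossings between different pairs of opposite strands, so
  these are decided by comparing \<open>2 * cos \<phi>\<close> and \<open>2 * sin \<phi>\<close>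
  with \<open>sqrt 2\<close>. The last phase \<phi> cancels the phase 1/2 of y, so that at the
  remaining crossings all angles are rational multiples of \<open>pi\<close>.\<close>

text \<open>A point \<open>(x, y, z)\<close> of space is written \<open>(x, y + i z)\<close>: knots are braided along the
  \<open>x\<close>-axis and their diagrams are the projections to the \<open>(x, y)\<close>-plane.\<close>
definition heq :: "(real \<times> complex) set \<Rightarrow> (real \<times> complex) set \<Rightarrow> bool" where
  "heq K L \<longleftrightarrow> (\<exists>f. continuous_on UNIV f \<and> bij f \<and> f ` K = L)"

lemma heqI: "continuous_on UNIV f \<Longrightarrow> bij f \<Longrightarrow> f ` K = L \<Longrightarrow> heq K L"
  unfolding heq_def by blast

lemma heq_refl [simp]: "heq K K"
  by (rule heqI[of id]) auto

text \<open>Invariance of domain makes the inverse of a continuous bijection of 3-space continuous;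
  hence \<open>heq\<close> can ask for so little. Orientation is left free, in accordance with
  equality up to mirror image.\<close>

lemma heq_homeomorphism:
  assumes "heq K L"
  obtains f g where "homeomorphism UNIV UNIV f g" "f ` K = L"
proof -
  obtain f where f: "continuous_on UNIV f" "bij f" "f ` K = L"
    using assms unfolding heq_def by blast
  have "inj_on f UNIV" using f(2) by (simp add: bij_is_inj)
  then obtain g where "homeomorphism UNIV (f ` UNIV) f g"
    using invariance_of_domain_homeomorphism[OF open_UNIV f(1)] by auto
  moreover have "f ` UNIV = UNIV" using f(2) by (rule bij_is_surj)
  ultimately show ?thesis using that[of f g] f(3) by simp
qed

lemma heq_sym: assumes "heq K L" shows "heq L K"
proof -
  obtain f g where fg: "homeomorphism UNIV UNIV f g" "f ` K = L"
    using heq_homeomorphism[OF assms] .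
  have gf: "\<And>x. g (f x) = x" and fg': "\<And>x. f (g x) = x" using fg(1) by (auto simp: homeomorphism_def)
  have "bij g" by (rule o_bij[of f]) (auto simp: fun_eq_iff gf fg')
  moreover have "g ` L = K" unfolding fg(2)[symmetric] by (simp add: image_image gf)
  moreover have "continuous_on UNIV g" using fg(1) by (auto simp: homeomorphism_def)
  ultimately show ?thesis by (intro heqI)
qed

lemma heq_trans [trans]: assumes "heq K L" "heq L M" shows "heq K M"
proof -
  obtain f g where f: "continuous_on UNIV f" "bij f" "f ` K = L"
    and g: "continuous_on UNIV g" "bij g" "g ` L = M"
    using assms unfolding heq_def by blast
  have "continuous_on UNIV (g \<circ> f)"
    using f(1) g(1) by (meson continuous_on_compose continuous_on_subset top_greatest)
  then show ?thesis
    using f g by (intro heqI[of "g \<circ> f"]) (auto simp: bij_comp image_comp[symmetric])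
qed

section \<open>Motions of points extend to fibrewise homeomorphisms of space\<close>

abbreviation unit_clamp :: "real \<Rightarrow> real" where "unit_clamp x \<equiv> max 0 (min 1 x)"

text \<open>A family of bijections of the fibres that carries the strands \<open>p\<close> to
  \<open>q\<close>. Over \<open>A\<close> nothing moves. Over \<open>B\<close>, where caps will sit,
  the real axis is preserved, so that a cap in it remains one. The last clause freezes the family
  outside the unit interval and thereby defines it on all of space.\<close>

definition fib_iso :: "real set \<Rightarrow> real set \<Rightarrow> (real \<Rightarrow> complex^'k) \<Rightarrow> (real \<Rightarrow> complex^'k) \<Rightarrow> bool" where
  "fib_iso A B p q \<longleftrightarrow> (\<exists>H. continuous_on UNIV (\<lambda>(x,v). H x v) \<and> (\<forall>x. bij (H x)) \<and>
     (\<forall>x\<in>{0..1}. \<forall>i. H x (p x $ i) = q x $ i) \<and> (\<forall>x\<in>A. H x = id) \<and>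
     (\<forall>x\<in>B. \<forall>v\<in>\<real>. H x v \<in> \<real>) \<and> (\<forall>x. H x = H (unit_clamp x)))"

lemma fib_iso_refl: "fib_iso A B p p"
  unfolding fib_iso_def by (rule exI[of _ "\<lambda>x v. v"]) (auto simp: case_prod_unfold continuous_on_snd id_def bij_id[unfolded id_def])

lemma fib_iso_trans:
  assumes "fib_iso A B p q" "fib_iso A B q r"
  shows "fib_iso A B p r"
proof -
  obtain H where H: "continuous_on UNIV (\<lambda>(x,v). H x v)" "\<And>x. bij (H x)"
     "\<forall>x\<in>{0..1}. \<forall>i. H x (p x $ i) = q x $ i" "\<forall>x\<in>A. H x = id"
     "\<forall>x\<in>B. \<forall>v\<in>\<real>. H x v \<in> \<real>" "\<And>x. H x = H (unit_clamp x)"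
    using assms(1) unfolding fib_iso_def by blast
  obtain G where G: "continuous_on UNIV (\<lambda>(x,v). G x v)" "\<And>x. bij (G x)"
     "\<forall>x\<in>{0..1}. \<forall>i. G x (q x $ i) = r x $ i" "\<forall>x\<in>A. G x = id"
     "\<forall>x\<in>B. \<forall>v\<in>\<real>. G x v \<in> \<real>" "\<And>x. G x = G (unit_clamp x)"
    using assms(2) unfolding fib_iso_def by blast
  have c: "continuous_on UNIV (\<lambda>z. (fst z, H (fst z) (snd z)))"
    using H(1) by (auto simp: case_prod_unfold intro!: continuous_intros)
  have "continuous_on UNIV (\<lambda>(x,v). (G x \<circ> H x) v)"
    using continuous_on_compose2[OF G(1) c] by (simp add: case_prod_unfold comp_def)
  moreover have "\<And>x. G x \<circ> H x = G (unit_clamp x) \<circ> H (unit_clamp x)"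
    using G(6) H(6) by metis
  ultimately show ?thesis unfolding fib_iso_def using H G
    by (intro exI[of _ "\<lambda>x. G x \<circ> H x"] conjI) (auto simp: bij_comp simp del: comp_apply, auto)
qed

lemma bump_lipschitz:
  fixes v w c :: complex
  assumes "r > 0"
  shows "\<bar>max 0 (1 - dist v c / r) - max 0 (1 - dist w c / r)\<bar> \<le> dist v w / r"
proof -
  have "\<bar>max 0 (1 - dist v c / r) - max 0 (1 - dist w c / r)\<bar> \<le> \<bar>(1 - dist v c / r) - (1 - dist w c / r)\<bar>"
    by (simp add: max_def)
  also have "\<dots> = \<bar>dist w c - dist v c\<bar> / r"
    using assms by (simp add: diff_divide_distrib[symmetric])
  also have "\<dots> \<le> dist v w / r"
    using assms by (intro divide_right_mono) (metis abs_dist_diff_le dist_commute, simp)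
  finally show ?thesis .
qed

text \<open>Banach's fixed point theorem: a preimage of w is a fixed point of the contraction that
  sends v to w - u v.\<close>

lemma perturbation_bij:
  fixes u :: "complex \<Rightarrow> complex"
  assumes "\<And>v w. dist (u v) (u w) \<le> dist v w / 2"
  shows "bij (\<lambda>v. v + u v)"
proof (rule bijI)
  show "inj (\<lambda>v. v + u v)"
  proof (rule injI)
    fix v w assume "v + u v = w + u w"
    then have "dist v w = dist (u v) (u w)"
      unfolding dist_norm by (metis add_diff_cancel_left' add_diff_eq diff_add_eq norm_minus_commute)
    then show "v = w" using assms[of v w] by simp
  qed
  show "surj (\<lambda>v. v + u v)"
  proof -
    have "\<exists>v. w = v + u v" for w
    proof -
      have "\<exists>!v. w - u v = v"
        by (rule banach_fix_type[of "1/2"]) (use assms in \<open>auto simp: dist_norm norm_minus_commute\<close>)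
      then show ?thesis by (metis diff_add_cancel)
    qed
    then show ?thesis by (auto simp: surj_def)
  qed
qed

text \<open>Every strand drags a tent-shaped neighbourhood of radius r with it. The tents of the
  other strands vanish at a given strand, so each strand arrives exactly at its target. The slope
  1/r of the tents against a total displacement of r/2 makes the perturbation 1/2-Lipschitz, hence
  the map bijective. Real centres with real displacements preserve the real axis.\<close>

lemma fib_iso_step:
  fixes p q :: "real \<Rightarrow> complex^'k"
  assumes pq: "continuous_on {0..1} p" "continuous_on {0..1} q" and r: "r > 0"
    and sep: "\<And>x i j. x \<in> {0..1} \<Longrightarrow> i \<noteq> j \<Longrightarrow> r \<le> dist (p x $ i) (p x $ j)"
    and near: "\<And>x. x \<in> {0..1} \<Longrightarrow> (\<Sum>i\<in>UNIV. dist (p x $ i) (q x $ i)) \<le> r / 2"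
    and AB: "A \<subseteq> {0..1}" "B \<subseteq> {0..1}" "\<And>x. x \<in> A \<Longrightarrow> p x = q x"
      "\<And>x i. x \<in> B \<Longrightarrow> p x $ i \<in> \<real> \<and> q x $ i \<in> \<real>"
  shows "fib_iso A B p q"
proof -
  define u where "u x v = (\<Sum>i\<in>UNIV. complex_of_real (max 0 (1 - dist v (p (unit_clamp x) $ i) / r)) *
      (q (unit_clamp x) $ i - p (unit_clamp x) $ i))" for x v
  define H where "H x v = v + u x v" for x v
  have contu: "continuous_on UNIV (\<lambda>x. p (unit_clamp x))" "continuous_on UNIV (\<lambda>x. q (unit_clamp x))"
    by (intro continuous_on_compose2[OF pq(1)] continuous_on_compose2[OF pq(2)] continuous_intros; auto)+
  have cp: "continuous_on UNIV (\<lambda>z::real\<times>complex. p (unit_clamp (fst z)))"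
    and cq: "continuous_on UNIV (\<lambda>z::real\<times>complex. q (unit_clamp (fst z)))"
    using continuous_on_compose2[OF contu(1), of UNIV fst] continuous_on_compose2[OF contu(2), of UNIV fst]
    by (auto simp: continuous_on_fst)
  have "continuous_on UNIV (\<lambda>(x,v). H x v)"
    unfolding H_def u_def case_prod_unfold
    by (intro continuous_intros cp cq) (use r in auto)
  moreover have "bij (H x)" for x
  proof -
    have x: "unit_clamp x \<in> {0..1}" by auto
    have "dist (u x v) (u x w) \<le> dist v w / 2" for v w
    proof -
      have "dist (u x v) (u x w) \<le> (\<Sum>i\<in>UNIV. dist v w / r * dist (p (unit_clamp x) $ i) (q (unit_clamp x) $ i))"
        unfolding u_def dist_norm sum_subtractf[symmetric] left_diff_distrib[symmetric] of_real_diff[symmetric]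
      proof (rule sum_norm_le)
        fix i :: 'k
        show "norm (complex_of_real (max 0 (1 - norm (v - p (unit_clamp x) $ i) / r) - max 0 (1 - norm (w - p (unit_clamp x) $ i) / r)) *
          (q (unit_clamp x) $ i - p (unit_clamp x) $ i)) \<le> norm (v - w) / r * norm (p (unit_clamp x) $ i - q (unit_clamp x) $ i)"
          using bump_lipschitz[OF r, of v "p (unit_clamp x) $ i" w]
          unfolding norm_mult norm_of_real dist_norm
          by (subst norm_minus_commute[of "p (unit_clamp x) $ i"]) (rule mult_right_mono, auto)
      qed
      also have "\<dots> = dist v w / r * (\<Sum>i\<in>UNIV. dist (p (unit_clamp x) $ i) (q (unit_clamp x) $ i))"
        by (simp add: sum_distrib_left)
      also have "\<dots> \<le> dist v w / r * (r / 2)"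
        using near[OF x] r by (intro mult_left_mono) auto
      finally show ?thesis using r by simp
    qed
    then show ?thesis unfolding H_def by (rule perturbation_bij)
  qed
  moreover have "H x (p x $ i) = q x $ i" if x: "x \<in> {0..1}" for x i
  proof -
    have cx: "unit_clamp x = x" using x by auto
    have "u x (p x $ i) = (\<Sum>j\<in>UNIV. if j = i then q x $ i - p x $ i else 0)"
      unfolding u_def cx
    proof (rule sum.cong[OF refl])
      fix j
      have "j \<noteq> i \<Longrightarrow> 1 \<le> dist (p x $ i) (p x $ j) / r"
        using sep[OF x, of i j] r by (auto simp: field_simps)
      then show "complex_of_real (max 0 (1 - dist (p x $ i) (p x $ j) / r)) * (q x $ j - p x $ j) =
        (if j = i then q x $ i - p x $ i else 0)" by auto
    qed
    then show ?thesis unfolding H_def by simp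
  qed
  moreover have "H x = id" if "x \<in> A" for x
  proof -
    have "unit_clamp x = x" "p x = q x" using that AB by auto
    then show ?thesis unfolding H_def u_def by auto
  qed
  moreover have "H x v \<in> \<real>" if "x \<in> B" "v \<in> \<real>" for x v
  proof -
    have "unit_clamp x = x" using that AB by auto
    then show ?thesis unfolding H_def u_def using AB(4)[OF that(1)] that(2)
      by (auto intro!: Reals_add sum_in_Reals Reals_mult Reals_diff)
  qed
  moreover have "H x = H (unit_clamp x)" for x
  proof -
    have "unit_clamp (unit_clamp x) = unit_clamp x" by auto
    then show ?thesis unfolding H_def u_def by presburger
  qed
  ultimately show ?thesis unfolding fib_iso_def by blast
qed

definition configs :: "(complex^'k) set" where "configs = {c. inj (($) c)}"

lemma configs_iff: "c \<in> configs \<longleftrightarrow> (\<forall>i j. i \<noteq> j \<longrightarrow> c $ i \<noteq> c $ j)"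
  unfolding configs_def inj_def by auto

lemma separation_on_compact:
  fixes h :: "'a::metric_space \<Rightarrow> complex^'k"
  assumes "compact T" "continuous_on T h" "h ` T \<subseteq> configs"
  shows "\<exists>r>0. \<forall>t\<in>T. \<forall>i j. i \<noteq> j \<longrightarrow> r \<le> dist (h t $ i) (h t $ j)"
proof -
  have "\<exists>r>0. \<forall>t\<in>T. i \<noteq> j \<longrightarrow> r \<le> dist (h t $ i) (h t $ j)" for i j
  proof (cases "T = {} \<or> i = j")
    case False
    have "continuous_on T (\<lambda>t. dist (h t $ i) (h t $ j))"
      by (intro continuous_intros assms)
    moreover have "T \<noteq> {}" using False by simp
    ultimately have "\<exists>t\<in>T. \<forall>s\<in>T. dist (h t $ i) (h t $ j) \<le> dist (h s $ i) (h s $ j)"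
      by (intro continuous_attains_inf[OF assms(1)])
    then obtain t where t: "t \<in> T" "\<And>s. s \<in> T \<Longrightarrow> dist (h t $ i) (h t $ j) \<le> dist (h s $ i) (h s $ j)"
      by blast
    have "h t $ i \<noteq> h t $ j" using assms(3) t(1) False unfolding configs_iff[symmetric] by (auto simp: configs_iff)
    then show ?thesis using t by (intro exI[of _ "dist (h t $ i) (h t $ j)"]) auto
  qed (auto intro: exI[of _ 1])
  then obtain R where R: "\<And>i j. R i j > 0" "\<And>i j t. t \<in> T \<Longrightarrow> i \<noteq> j \<Longrightarrow> R i j \<le> dist (h t $ i) (h t $ j)"
    by metis
  define r where "r = Min (range (\<lambda>(i,j). R i j))"
  have "r \<le> R i j" for i j unfolding r_def by (rule Min_le) auto
  moreover have "r > 0" unfolding r_def using R(1) by (subst Min_gr_iff) auto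
  ultimately show ?thesis using R(2) by (meson order_trans)
qed

text \<open>Isotopy extension. By compactness the strands keep a distance r during the whole
  homotopy, and by uniform continuity its parameter can be cut into N steps that are small enough
  for \<open>fib_iso_step\<close>.\<close>

proposition fib_iso_homotopy:
  fixes h :: "real \<times> real \<Rightarrow> complex^'k"
  assumes h: "continuous_on ({0..1} \<times> {0..1}) h" "h ` ({0..1} \<times> {0..1}) \<subseteq> configs"
    and AB: "A \<subseteq> {0..1}" "B \<subseteq> {0..1}" "\<And>s x. s \<in> {0..1} \<Longrightarrow> x \<in> A \<Longrightarrow> h (s, x) = h (0, x)"
      "\<And>s x i. s \<in> {0..1} \<Longrightarrow> x \<in> B \<Longrightarrow> h (s, x) $ i \<in> \<real>"
  shows "fib_iso A B (\<lambda>x. h (0, x)) (\<lambda>x. h (1, x))"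
proof -
  have comp: "compact ({0..1} \<times> {0..1} :: (real \<times> real) set)" by (intro compact_Times compact_Icc)
  obtain r where r: "r > 0" "\<And>t i j. t \<in> {0..1} \<times> {0..1} \<Longrightarrow> i \<noteq> j \<Longrightarrow> r \<le> dist (h t $ i) (h t $ j)"
    using separation_on_compact[OF comp h] by metis
  \<comment> \<open>Each of the \<open>CARD('k)\<close> strands may use up e of the total
    displacement r/2 allowed in one step.\<close>
  define e where "e = r / (2 * CARD('k))"
  have e: "e > 0" unfolding e_def using r(1) by simp
  have "uniformly_continuous_on ({0..1} \<times> {0..1}) h"
    using h(1) comp by (rule compact_uniformly_continuous)
  then obtain d where d: "d > 0"
    "\<And>s t. s \<in> {0..1} \<times> {0..1} \<Longrightarrow> t \<in> {0..1} \<times> {0..1} \<Longrightarrow> dist t s < d \<Longrightarrow> dist (h t) (h s) < e"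
    unfolding uniformly_continuous_on_def using e by meson
  obtain N :: nat where N: "N > 0" "1 / N < d"
    using d(1) by (metis nat_approx_posE zero_less_Suc)
  have slice: "continuous_on {0..1} (\<lambda>x. h (s, x))" if "s \<in> {0..1}" for s
    by (rule continuous_on_compose2[OF h(1)]) (use that in \<open>auto intro!: continuous_intros\<close>)
  have "fib_iso A B (\<lambda>x. h (0, x)) (\<lambda>x. h (m / N, x))" if "m \<le> N" for m :: nat
    using that
  proof (induction m)
    case 0 show ?case by (simp add: fib_iso_refl)
  next
    case (Suc m)
    have mem: "m / N \<in> {0..1}" "Suc m / N \<in> {0..1}" using Suc.prems N by (auto simp: field_simps)
    have "fib_iso A B (\<lambda>x. h (m / N, x)) (\<lambda>x. h (Suc m / N, x))"
    proof (rule fib_iso_step[OF slice slice r(1)])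
      show "m / N \<in> {0..1}" "Suc m / N \<in> {0..1}" by fact+
      show "r \<le> dist (h (m / N, x) $ i) (h (m / N, x) $ j)" if "x \<in> {0..1}" "i \<noteq> j" for x i j
        using r(2)[of "(m / N, x)"] that mem by auto
      show "(\<Sum>i\<in>UNIV. dist (h (m / N, x) $ i) (h (Suc m / N, x) $ i)) \<le> r / 2" if x: "x \<in> {0..1}" for x
      proof -
        have "dist (m / N, x) (Suc m / N, x) = 1 / N" using N by (simp add: dist_prod_def dist_real_def diff_divide_distrib[symmetric])
        then have "dist (h (m / N, x)) (h (Suc m / N, x)) < e"
          using d(2)[of "(Suc m / N, x)" "(m / N, x)"] x mem N(2) by auto
        then have "dist (h (m / N, x) $ i) (h (Suc m / N, x) $ i) \<le> e" for i
          using dist_vec_nth_le[of "h (m / N, x)" i "h (Suc m / N, x)"] by linarith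
        then have "(\<Sum>i\<in>UNIV. dist (h (m / N, x) $ i) (h (Suc m / N, x) $ i)) \<le> (\<Sum>i\<in>(UNIV::'k set). e)"
          by (intro sum_mono)
        then show ?thesis unfolding e_def by simp
      qed
      show "h (m / N, x) = h (Suc m / N, x)" if "x \<in> A" for x
        using AB(3)[OF mem(1) that] AB(3)[OF mem(2) that] by simp
      show "h (m / N, x) $ i \<in> \<real> \<and> h (Suc m / N, x) $ i \<in> \<real>" if "x \<in> B" for x i
        using AB(4) that mem by auto
    qed (use AB in auto)
    then show ?case using Suc.IH Suc.prems by (auto intro: fib_iso_trans)
  qed
  from this[of N] show ?thesis using N by simp
qed

subsection \<open>Plats\<close>

definition strands :: "(real \<Rightarrow> complex^'k) \<Rightarrow> (real \<times> complex) set" where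
  "strands p = {(x, p x $ k) | x k. x \<in> {0..1}}"

definition cap_set :: "('k \<times> 'k) set \<Rightarrow> complex^'k \<Rightarrow> complex set" where
  "cap_set J c = (\<Union>(i,j)\<in>J. closed_segment (c $ i) (c $ j))"

text \<open>Caps are segments in the two end fibres, given by pairs of labels instead of positions,
  so that the same pairing applies after a motion of the strands.\<close>

definition plat :: "('k \<times> 'k) set \<Rightarrow> ('k \<times> 'k) set \<Rightarrow> (real \<Rightarrow> complex^'k) \<Rightarrow> (real \<times> complex) set" where
  "plat I J p = {0} \<times> cap_set I (p 0) \<union> strands p \<union> {1} \<times> cap_set J (p 1)"

text \<open>A cap may be distorted along the real axis as long as it stays in it: in a line, the
  injective continuous image of an interval is the interval between the images of its ends.\<close>

lemma real_segment_image:
  fixes H :: "complex \<Rightarrow> complex"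
  assumes "continuous_on UNIV H" "inj H" "\<And>v. v \<in> \<real> \<Longrightarrow> H v \<in> \<real>" "a \<in> \<real>" "b \<in> \<real>"
  shows "H ` closed_segment a b = closed_segment (H a) (H b)"
proof -
  have real: "v \<in> \<real>" if "v \<in> closed_segment a b" for v
  proof -
    obtain x y where "a = of_real x" "b = of_real y" using assms(4,5) by (auto elim!: Reals_cases)
    then show ?thesis using that by (auto simp: closed_segment_of_real)
  qed
  have HR: "complex_of_real (Re (H v)) = H v" if "v \<in> closed_segment a b" for v
    using assms(3)[OF real[OF that]] by (simp add: of_real_Re)
  have "(Re \<circ> H) ` closed_segment a b = closed_segment ((Re \<circ> H) a) ((Re \<circ> H) b)"
  proof (rule continuous_injective_image_segment_1)
    show "continuous_on (closed_segment a b) (Re \<circ> H)"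
      unfolding comp_def using assms(1) by (auto intro!: continuous_intros intro: continuous_on_subset)
    show "inj_on (Re \<circ> H) (closed_segment a b)"
    proof (rule inj_onI)
      fix v w assume vw: "v \<in> closed_segment a b" "w \<in> closed_segment a b" "(Re \<circ> H) v = (Re \<circ> H) w"
      have "H v = H w" using HR[OF vw(1)] HR[OF vw(2)] vw(3) by (metis comp_apply)
      then show "v = w" using assms(2) by (simp add: inj_eq)
    qed
  qed
  then have "of_real ` (Re \<circ> H) ` closed_segment a b = closed_segment (complex_of_real (Re (H a))) (of_real (Re (H b)))"
    by (simp add: closed_segment_of_real)
  moreover have "of_real ` (Re \<circ> H) ` closed_segment a b = H ` closed_segment a b"
    using HR by (auto simp: image_image intro!: image_cong)
  ultimately show ?thesis using HR by simp
qed

text \<open>A map that preserves the fibres is bijective once it is so on each of them, and joint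
  continuity is all that is left to check.\<close>

lemma fibre_map_heq:
  assumes "continuous_on UNIV (\<lambda>(x,v). H x v)" "\<And>x. bij (H x :: complex \<Rightarrow> complex)" "(\<lambda>(x,v). (x, H x v)) ` K = L"
  shows "heq K L"
proof (rule heqI[OF _ _ assms(3)])
  show "continuous_on UNIV (\<lambda>(x,v). (x, H x v))"
    using assms(1) by (auto simp: case_prod_unfold intro!: continuous_intros)
  show "bij (\<lambda>(x,v). (x, H x v))"
  proof (rule bijI)
    show "inj (\<lambda>(x,v). (x, H x v))"
      using assms(2) by (auto simp: inj_def bij_def)
    show "surj (\<lambda>(x,v). (x, H x v))"
    proof -
      have "\<exists>z. (x, w) = (\<lambda>(x,v). (x, H x v)) z" for x w
      proof -
        obtain v where "w = H x v" using assms(2)[of x] by (meson bij_pointE)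
        then show ?thesis by (intro exI[of _ "(x,v)"]) simp
      qed
      then show ?thesis by (auto simp: surj_def)
    qed
  qed
qed

lemma continuous_fibre:
  fixes H :: "'a::topological_space \<Rightarrow> complex \<Rightarrow> complex"
  assumes "continuous_on UNIV (\<lambda>(x,v). H x v)"
  shows "continuous_on UNIV (H x)"
proof -
  have "continuous_on UNIV (\<lambda>v::complex. (x, v))" by (intro continuous_intros)
  then show ?thesis using continuous_on_compose2[OF assms, of UNIV "\<lambda>v. (x, v)"] by simp
qed

lemma strands_fib_image:
  assumes "\<And>x i. x \<in> {0..1} \<Longrightarrow> H x (p x $ i) = q x $ i"
  shows "(\<lambda>(x,v). (x, H x v)) ` strands p = strands q"
  unfolding strands_def
proof (intro set_eqI iffI)
  fix z assume "z \<in> (\<lambda>(x,v). (x, H x v)) ` {(x, p x $ k) |x k. x \<in> {0..1}}"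
  then show "z \<in> {(x, q x $ k) |x k. x \<in> {0..1}}" using assms by auto
next
  fix z assume "z \<in> {(x, q x $ k) |x k. x \<in> {0..1}}"
  then obtain x k where xk: "z = (x, q x $ k)" "x \<in> {0..1}" by blast
  then have "z = (\<lambda>(x,v). (x, H x v)) (x, p x $ k)" using assms by simp
  then show "z \<in> (\<lambda>(x,v). (x, H x v)) ` {(x, p x $ k) |x k. x \<in> {0..1}}" using xk(2) by blast
qed

text \<open>The caps lie in the real axes of the end fibres, which the isotopy preserves, so they
  simply follow their end points.\<close>

lemma fib_iso_plat:
  fixes p q :: "real \<Rightarrow> complex^'k"
  assumes "fib_iso {} {0,1} p q" "\<And>i. p 0 $ i \<in> \<real>" "\<And>i. p 1 $ i \<in> \<real>"
  shows "heq (plat I J p) (plat I J q)"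
proof -
  obtain H where H: "continuous_on UNIV (\<lambda>(x,v). H x v)" "\<And>x. bij (H x)"
     "\<forall>x\<in>{0..1}. \<forall>i. H x (p x $ i) = q x $ i"
     "\<forall>x\<in>{0,1}. \<forall>v\<in>\<real>. H x v \<in> \<real>"
    using assms(1) unfolding fib_iso_def by blast
  have seg: "H x ` closed_segment (p x $ i) (p x $ j) = closed_segment (q x $ i) (q x $ j)" if "x \<in> {0,1}" for x i j
  proof -
    have r: "p x $ k \<in> \<real>" for k using that assms(2,3) by auto
    have "H x ` closed_segment (p x $ i) (p x $ j) = closed_segment (H x (p x $ i)) (H x (p x $ j))"
      by (rule real_segment_image[OF continuous_fibre[OF H(1)] bij_is_inj[OF H(2)]]) (use H(4) that r in auto)
    then show ?thesis using H(3) that by auto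
  qed
  have caps: "H x ` cap_set I (p x) = cap_set I (q x)" if "x \<in> {0,1}" for x I
    unfolding cap_set_def image_UN using seg[OF that] by (auto simp: case_prod_unfold)
  have "(\<lambda>(x,v). (x, H x v)) ` plat I J p = plat I J q"
    unfolding plat_def image_Un
  proof (intro arg_cong2[where f="(\<union>)"])
    show "(\<lambda>(x,v). (x, H x v)) ` ({0} \<times> cap_set I (p 0)) = {0} \<times> cap_set I (q 0)"
      unfolding caps[of 0 I, simplified, symmetric] by auto
    show "(\<lambda>(x,v). (x, H x v)) ` ({1} \<times> cap_set J (p 1)) = {1} \<times> cap_set J (q 1)"
      unfolding caps[of 1 J, simplified, symmetric] by auto
    show "(\<lambda>(x,v). (x, H x v)) ` strands p = strands q"
      by (rule strands_fib_image) (use H(3) in blast)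
  qed
  then show ?thesis using fibre_map_heq[OF H(1,2)] by blast
qed

lemma fib_iso_linear:
  fixes p q :: "real \<Rightarrow> complex^'k"
  assumes "continuous_on {0..1} p" "continuous_on {0..1} q"
    and seg: "\<And>x. x \<in> {0..1} \<Longrightarrow> closed_segment (p x) (q x) \<subseteq> configs"
    and AB: "A \<subseteq> {0..1}" "B \<subseteq> {0..1}" "\<And>x. x \<in> A \<Longrightarrow> p x = q x"
      "\<And>x i. x \<in> B \<Longrightarrow> p x $ i \<in> \<real> \<and> q x $ i \<in> \<real>"
  shows "fib_iso A B p q"
proof -
  let ?h = "\<lambda>(s,x). (1 - s) *\<^sub>R p x + s *\<^sub>R q x"
  have "fib_iso A B (\<lambda>x. ?h (0, x)) (\<lambda>x. ?h (1, x))"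
  proof (rule fib_iso_homotopy)
    show "continuous_on ({0..1} \<times> {0..1}) ?h"
      unfolding case_prod_unfold
      by (intro continuous_intros continuous_on_compose2[OF assms(1)] continuous_on_compose2[OF assms(2)]) auto
    show "?h ` ({0..1} \<times> {0..1}) \<subseteq> configs"
      using seg by (fastforce simp: closed_segment_def)
    show "?h (s, x) = ?h (0, x)" if "s \<in> {0..1}" "x \<in> A" for s x
      using AB(3)[OF that(2)] by (simp add: scaleR_left_distrib[symmetric])
    show "?h (s, x) $ i \<in> \<real>" if "s \<in> {0..1}" "x \<in> B" for s x i
      using AB(4)[OF that(2), of i] by (auto intro!: Reals_add Reals_mult simp: scaleR_conv_of_real[where 'a=complex])
  qed (use AB in auto)
  then show ?thesis by simp
qed

lemma plat_linear_homotopy: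
  fixes p q :: "real \<Rightarrow> complex^'k"
  assumes "continuous_on {0..1} p" "continuous_on {0..1} q"
    and "\<And>x. x \<in> {0..1} \<Longrightarrow> closed_segment (p x) (q x) \<subseteq> configs"
    and "\<And>x i. x \<in> {0,1} \<Longrightarrow> p x $ i \<in> \<real> \<and> q x $ i \<in> \<real>"
  shows "heq (plat I J p) (plat I J q)"
  using assms by (intro fib_iso_plat fib_iso_linear) auto

text \<open>A homotopy of paths fixes the two end configurations, which are real; this is what
  \<open>fib_iso\<close> demands over the end fibres.\<close>

lemma plat_homotopic_paths:
  fixes p q :: "real \<Rightarrow> complex^'k"
  assumes "homotopic_paths configs p q" "\<And>i. p 0 $ i \<in> \<real>" "\<And>i. p 1 $ i \<in> \<real>"
  shows "heq (plat I J p) (plat I J q)"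
proof -
  obtain h where h: "continuous_on ({0..1} \<times> {0..1}) h" "h \<in> ({0..1} \<times> {0..1}) \<rightarrow> configs"
    "\<forall>x \<in> {0..1}. h (0,x) = p x" "\<forall>x \<in> {0..1}. h (1,x) = q x"
    "\<forall>t \<in> {0..1::real}. pathstart(h \<circ> Pair t) = pathstart p \<and> pathfinish(h \<circ> Pair t) = pathfinish p"
    using assms(1) unfolding homotopic_paths by blast
  have "fib_iso {} {0,1} (\<lambda>x. h (0, x)) (\<lambda>x. h (1, x))"
    using h(1,2,5) assms(2,3) by (intro fib_iso_homotopy) (auto simp: pathstart_def pathfinish_def)
  moreover have "\<And>i. h (0, 0) $ i \<in> \<real>" "\<And>i. h (0, 1) $ i \<in> \<real>" using h(3) assms by auto
  ultimately have "heq (plat I J (\<lambda>x. h (0, x))) (plat I J (\<lambda>x. h (1, x)))"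
    by (intro fib_iso_plat)
  moreover have "plat I J (\<lambda>x. h (0, x)) = plat I J p" "plat I J (\<lambda>x. h (1, x)) = plat I J q"
    using h(3,4) unfolding plat_def strands_def by (force intro!: arg_cong2[where f="(\<union>)"])+
  ultimately show ?thesis by simp
qed

subsection \<open>Braid words\<close>

text \<open>The four strands stand at \<open>-3, -1, 1, 3\<close>; \<open>Mid s\<close> turns the inner two and \<open>Out a b\<close> turns the
  left and the right pair, by the given numbers of half turns.\<close>
datatype letter = Mid int | Out int int

definition base_pts :: "complex set" where "base_pts = {-3, -1, 1, 3}"

fun turn :: "letter \<Rightarrow> real \<Rightarrow> complex \<Rightarrow> complex" where
  "turn (Mid s) u z = (if z \<in> {-1,1} then cis (pi * s * u) * z else z)"
| "turn (Out a b) u z = (if z \<in> {-3,-1} then -2 + cis (pi * a * u) * (z + 2)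
     else if z \<in> {1,3} then 2 + cis (pi * b * u) * (z - 2) else z)"

text \<open>Labelled configurations: letters refer to positions and not to labels, so one word acts
  on every labelling.\<close>

definition base_cfgs :: "(complex^4) set" where
  "base_cfgs = {c \<in> configs. \<forall>i. c $ i \<in> base_pts}"

definition letter_path :: "letter \<Rightarrow> complex^4 \<Rightarrow> real \<Rightarrow> complex^4" where
  "letter_path l c u = (\<chi> k. turn l u (c $ k))"

text \<open>Every word ends in a constant path; concatenation of words therefore matches joining of
  paths only up to homotopy.\<close>

fun word_path :: "letter list \<Rightarrow> complex^4 \<Rightarrow> real \<Rightarrow> complex^4" where
  "word_path [] c = linepath c c"
| "word_path (l # w) c = letter_path l c +++ word_path w (letter_path l c 1)"

lemma cis_pi_int: "cis (pi * of_int s) = (if even s then 1 else -1)"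
proof -
  have "cis (pi * of_int s) = cis pi powi s"
    by (subst cis_power_int) (simp add: mult.commute)
  also have "\<dots> = (if even s then 1 else -1)"
    by (simp add: power_int_minus_left)
  finally show ?thesis .
qed

lemma turn_0 [simp]: "turn l 0 z = z"
  by (cases l) auto

lemma turn_1_base: "z \<in> base_pts \<Longrightarrow> turn l 1 z \<in> base_pts"
  by (cases l) (auto simp: base_pts_def cis_pi_int)

lemma cos_bounds_2: "cos t < 2" "- cos t < 2" "-2 < cos t" "0 < 2 + cos t" for t :: real
  using cos_le_one[of t] cos_ge_minus_one[of t] by linarith+

text \<open>The left pair circles -2 and the right pair circles 2, both with radius 1, so the sign
  of the real part keeps the pairs apart.\<close>

lemma spin_out_inj:
  fixes s t :: real
  defines "f z \<equiv> (if z \<in> {-3,-1} then -2 + cis s * (z + 2) else if z \<in> {1,3} then 2 + cis t * (z - 2) else z)"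
  assumes "z \<in> base_pts" "z' \<in> base_pts" "f z = f z'"
  shows "z = z'"
proof -
  have L: "Re (f z) < 0" if "z \<in> {-3,-1}" for z
    using that unfolding f_def by (auto simp: cos_bounds_2)
  have R: "Re (f z) > 0" if "z \<in> {1,3}" for z
    using that unfolding f_def by (auto simp: cos_bounds_2)
  show ?thesis
  proof (cases "z \<in> {-3,-1} \<longleftrightarrow> z' \<in> {-3,-1}")
    case True
    have e: "-2 + cis s * (z + 2) = -2 + cis s * (z' + 2) \<longleftrightarrow> z = z'"
      "2 + cis t * (z - 2) = 2 + cis t * (z' - 2) \<longleftrightarrow> z = z'" by simp_all
    have "z \<in> {-3,-1} \<or> z \<in> {1,3}" "z' \<in> {-3,-1} \<or> z' \<in> {1,3}"
      using assms(2,3) unfolding base_pts_def by blast+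
    then show ?thesis using True assms(4) e unfolding f_def by presburger
  next
    case False
    then have "Re (f z) < 0 \<and> Re (f z') > 0 \<or> Re (f z) > 0 \<and> Re (f z') < 0"
      using assms(2,3) L R unfolding base_pts_def by blast
    then show ?thesis using assms(4) by auto
  qed
qed

lemma turn_inj:
  assumes "z \<in> base_pts" "z' \<in> base_pts" "turn l u z = turn l u z'"
  shows "z = z'"
proof (cases l)
  case (Mid s)
  \<comment> \<open>The inner points stay on the unit circle while the outer ones have modulus
    3.\<close>
  have "norm (cis (pi * s * u) * z) \<noteq> norm z'" if "norm z \<noteq> norm z'" for z z' :: complex
    using that by (simp add: norm_mult)
  then have ne: "cis (pi * s * u) * z \<noteq> z'" if "norm z \<noteq> norm z'" for z z' :: complex
    using that by metis
  show ?thesis using assms ne[of 1 3] ne[of 1 "-3"] ne[of "-1" "3"] ne[of "-1" "-3"]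
    unfolding base_pts_def Mid by (auto split: if_splits)
next
  case (Out a b)
  then show ?thesis using spin_out_inj[OF assms(1,2)] assms(3) by simp
qed

lemma letter_path_0 [simp]: "letter_path l c 0 = c"
  by (simp add: letter_path_def vec_eq_iff)

lemma letter_path_configs: "c \<in> base_cfgs \<Longrightarrow> letter_path l c u \<in> configs"
  unfolding base_cfgs_def configs_iff letter_path_def using turn_inj by (auto, meson)

lemma letter_path_1: "c \<in> base_cfgs \<Longrightarrow> letter_path l c 1 \<in> base_cfgs"
  using letter_path_configs[of c l 1] turn_1_base unfolding base_cfgs_def letter_path_def by auto

lemma continuous_letter_path: "continuous_on A (letter_path l c)"
proof -
  have "continuous_on A (\<lambda>u. turn l u z)" for z
  proof (cases l)
    case (Mid s)
    then show ?thesis by (cases "z \<in> {-1,1}") (auto intro!: continuous_intros)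
  next
    case (Out a b)
    consider "z \<in> {-3,-1}" | "z \<notin> {-3,-1}" "z \<in> {1,3}" | "z \<notin> {-3,-1}" "z \<notin> {1,3}" by blast
    then show ?thesis unfolding Out by cases (auto intro!: continuous_intros)
  qed
  then show ?thesis unfolding letter_path_def by (intro continuous_on_vec_lambda)
qed

lemma path_letter_path [simp]: "path (letter_path l c)"
  by (simp add: path_def continuous_letter_path)

lemma pathstart_letter_path [simp]: "pathstart (letter_path l c) = c"
  by (simp add: pathstart_def)

lemma pathfinish_letter_path [simp]: "pathfinish (letter_path l c) = letter_path l c 1"
  by (simp add: pathfinish_def)

lemma path_image_letter_path: "c \<in> base_cfgs \<Longrightarrow> path_image (letter_path l c) \<subseteq> configs"
  by (auto simp: path_image_def letter_path_configs)

lemma pathstart_word_path [simp]: "pathstart (word_path w c) = c"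
  by (cases w) auto

lemma word_path_0 [simp]: "word_path w c 0 = c"
  using pathstart_word_path unfolding pathstart_def .

lemma path_word_path [simp]: "path (word_path w c)"
  by (induction w arbitrary: c) auto

lemma pathfinish_word_path: "c \<in> base_cfgs \<Longrightarrow> pathfinish (word_path w c) \<in> base_cfgs"
  by (induction w arbitrary: c) (auto simp: letter_path_1)

lemma base_cfgs_configs: "c \<in> base_cfgs \<Longrightarrow> c \<in> configs" by (simp add: base_cfgs_def)

lemma path_image_word_path: "c \<in> base_cfgs \<Longrightarrow> path_image (word_path w c) \<subseteq> configs"
proof (induction w arbitrary: c)
  case Nil then show ?case by (simp add: base_cfgs_configs)
next
  case (Cons l w)
  then show ?case
    by (simp add: path_image_join path_image_letter_path letter_path_1)
qed

text \<open>Equality of braids. All labellings are treated at once because the second factor of a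
  concatenation starts from whatever labelling the first one leaves behind.\<close>

definition word_sim :: "letter list \<Rightarrow> letter list \<Rightarrow> bool" where
  "word_sim u v \<longleftrightarrow> (\<forall>c\<in>base_cfgs. homotopic_paths configs (word_path u c) (word_path v c))"

lemma word_sim_refl [simp]: "word_sim w w"
  unfolding word_sim_def by (simp add: path_image_word_path)

lemma word_sim_sym: "word_sim u v \<Longrightarrow> word_sim v u"
  unfolding word_sim_def by (simp add: homotopic_paths_sym)

lemma word_sim_trans: "word_sim u v \<Longrightarrow> word_sim v w \<Longrightarrow> word_sim u w"
  unfolding word_sim_def by (meson homotopic_paths_trans)

lemma word_path_append:
  assumes "c \<in> base_cfgs"
  shows "homotopic_paths configs (word_path (u @ v) c) (word_path u c +++ word_path v (pathfinish (word_path u c)))"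
  using assms
proof (induction u arbitrary: c)
  case Nil
  then show ?case
    unfolding append_Nil word_path.simps pathfinish_linepath
    by (intro homotopic_paths_lid[of "word_path v c" configs, THEN homotopic_paths_sym, unfolded pathstart_word_path])
      (simp_all add: path_image_word_path)
next
  case (Cons l u)
  have c': "letter_path l c 1 \<in> base_cfgs" using Cons.prems by (rule letter_path_1)
  have "homotopic_paths configs (letter_path l c +++ word_path (u @ v) (letter_path l c 1))
     (letter_path l c +++ (word_path u (letter_path l c 1) +++ word_path v (pathfinish (word_path u (letter_path l c 1)))))"
    using Cons.IH[OF c'] path_image_letter_path[OF Cons.prems]
    by (intro homotopic_paths_join) auto
  also have "homotopic_paths configs \<dots>
     ((letter_path l c +++ word_path u (letter_path l c 1)) +++ word_path v (pathfinish (word_path u (letter_path l c 1))))"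
    using path_image_letter_path[OF Cons.prems] path_image_word_path[OF c'] path_image_word_path[OF pathfinish_word_path[OF c']]
    by (intro homotopic_paths_assoc) auto
  finally show ?case by simp
qed

lemma word_sim_append:
  assumes "word_sim u u'" "word_sim v v'"
  shows "word_sim (u @ v) (u' @ v')"
  unfolding word_sim_def
proof
  fix c assume c: "c \<in> base_cfgs"
  have h: "homotopic_paths configs (word_path u c) (word_path u' c)"
    using assms(1) c unfolding word_sim_def by blast
  have e: "pathfinish (word_path u c) = pathfinish (word_path u' c)"
    using h by (rule homotopic_paths_imp_pathfinish)
  have "homotopic_paths configs (word_path (u @ v) c) (word_path u c +++ word_path v (pathfinish (word_path u c)))"
    using c by (rule word_path_append)
  also have "homotopic_paths configs \<dots> (word_path u' c +++ word_path v' (pathfinish (word_path u' c)))"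
    using h assms(2) pathfinish_word_path[OF c] unfolding e[symmetric] word_sim_def
    by (intro homotopic_paths_join) (auto simp: e)
  also have "homotopic_paths configs \<dots> (word_path (u' @ v') c)"
    using word_path_append[OF c] by (rule homotopic_paths_sym)
  finally show "homotopic_paths configs (word_path (u @ v) c) (word_path (u' @ v') c)" .
qed

text \<open>Motions that factor through a vector space of angles are homotopic as soon as their
  angle paths share both ends, since those paths can be deformed linearly.\<close>

lemma homotopic_paths_convex_image:
  fixes g h :: "real \<Rightarrow> 'a::real_normed_vector"
  assumes "path g" "path h" "pathstart g = pathstart h" "pathfinish g = pathfinish h"
    "continuous_on UNIV F" "range F \<subseteq> S"
  shows "homotopic_paths S (F \<circ> g) (F \<circ> h)"
proof (rule homotopic_paths_continuous_image[of UNIV])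
  show "homotopic_paths UNIV g h" using assms by (intro homotopic_paths_linear) auto
qed (use assms in auto)

text \<open>Both motions come from rotating the inner pair by \<open>pi * \<theta>\<close>, where
  \<theta> runs from 0 to s + t along two different paths in the line.\<close>

lemma word_sim_Mid_Mid: "word_sim [Mid s, Mid t] [Mid (s + t)]"
  unfolding word_sim_def
proof
  fix c assume c: "c \<in> base_cfgs"
  define F where "F \<theta> = (\<chi> k. if c $ k \<in> {-1,1} then cis (pi * \<theta>) * c $ k else c $ k)" for \<theta> :: real
  have F0: "letter_path (Mid s) c u = F (of_int s * u)" for s :: int and u :: real
    unfolding letter_path_def F_def by (auto simp: vec_eq_iff mult.assoc)
  have cF: "continuous_on UNIV F" unfolding F_def
  proof (intro continuous_on_vec_lambda)
    fix k show "continuous_on UNIV (\<lambda>\<theta>::real. if c $ k \<in> {- 1, 1} then cis (pi * \<theta>) * c $ k else c $ k)"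
      by (cases "c $ k \<in> {-1,1}") (auto intro!: continuous_intros)
  qed
  have rF: "range F \<subseteq> configs"
  proof
    fix d assume "d \<in> range F"
    then obtain \<theta> where "d = F \<theta>" by blast
    then have "d = letter_path (Mid 1) c \<theta>" by (simp add: F0)
    then show "d \<in> configs" using letter_path_configs[OF c] by simp
  qed
  \<comment> \<open>After s half turns the inner points are at -1 and 1 again, so the second letter
    continues the rotation of the first.\<close>
  have two: "letter_path (Mid t) (letter_path (Mid s) c 1) u = F (of_int s + of_int t * u)" for u :: real
  proof -
    have "turn (Mid t) u (turn (Mid s) 1 z) = (if z \<in> {-1,1} then cis (pi * (s + t * u)) * z else z)" if "z \<in> base_pts" for z
      using that unfolding base_pts_def
      by (auto simp: cis_pi_int cis_mult[symmetric] distrib_left mult.assoc mult.left_commute)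
    then show ?thesis using c unfolding letter_path_def F_def base_cfgs_def by (simp add: vec_eq_iff)
  qed
  let ?T = "real_of_int (s + t)"
  let ?g = "linepath 0 (real_of_int s) +++ (linepath (real_of_int s) ?T +++ linepath ?T ?T)"
  let ?h = "linepath 0 ?T +++ linepath ?T ?T"
  have "word_path [Mid s, Mid t] c = F \<circ> ?g"
    unfolding path_compose_join word_path.simps
  proof (intro arg_cong2[where f="(+++)"])
    show "letter_path (Mid s) c = F \<circ> linepath 0 (real_of_int s)"
      by (auto simp: fun_eq_iff F0 linepath_def mult.commute)
    show "letter_path (Mid t) (letter_path (Mid s) c 1) = F \<circ> linepath (real_of_int s) ?T"
      by (rule ext) (simp add: two linepath_def algebra_simps)
    show "linepath (letter_path (Mid t) (letter_path (Mid s) c 1) 1) (letter_path (Mid t) (letter_path (Mid s) c 1) 1)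
       = F \<circ> linepath ?T ?T"
      unfolding two by (auto simp: fun_eq_iff linepath_def algebra_simps simp flip: scaleR_left_distrib)
  qed
  moreover have "word_path [Mid (s + t)] c = F \<circ> ?h"
    unfolding path_compose_join word_path.simps
  proof (intro arg_cong2[where f="(+++)"])
    show "letter_path (Mid (s + t)) c = F \<circ> linepath 0 ?T"
      by (auto simp: fun_eq_iff F0 linepath_def mult.commute)
    show "linepath (letter_path (Mid (s + t)) c 1) (letter_path (Mid (s + t)) c 1) = F \<circ> linepath ?T ?T"
      by (auto simp: fun_eq_iff F0 linepath_def algebra_simps simp flip: scaleR_left_distrib)
  qed
  moreover have "homotopic_paths configs (F \<circ> ?g) (F \<circ> ?h)"
    by (intro homotopic_paths_convex_image cF rF) auto
  ultimately show "homotopic_paths configs (word_path [Mid s, Mid t] c) (word_path [Mid (s + t)] c)"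
    by simp
qed

text \<open>The same argument with a plane of angles, one coordinate for each outer pair; it also
  yields that \<sigma>1 and \<sigma>3 commute.\<close>

lemma word_sim_Out_Out: "word_sim [Out a b, Out a' b'] [Out (a + a') (b + b')]"
  unfolding word_sim_def
proof
  fix c assume c: "c \<in> base_cfgs"
  define F where "F \<theta> = (\<chi> k. if c $ k \<in> {-3,-1} then -2 + cis (pi * fst \<theta>) * (c $ k + 2)
    else if c $ k \<in> {1,3} then 2 + cis (pi * snd \<theta>) * (c $ k - 2) else c $ k)" for \<theta> :: "real \<times> real"
  have F0: "letter_path (Out a b) c u = F (of_int a * u, of_int b * u)" for a b :: int and u :: real
    unfolding letter_path_def F_def by (auto simp: vec_eq_iff mult.assoc)
  have cF: "continuous_on UNIV F" unfolding F_def
  proof (intro continuous_on_vec_lambda)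
    fix k
    consider "c $ k \<in> {-3,-1}" | "c $ k \<notin> {-3,-1}" "c $ k \<in> {1,3}" | "c $ k \<notin> {-3,-1}" "c $ k \<notin> {1,3}" by blast
    then show "continuous_on UNIV (\<lambda>\<theta>::real\<times>real. if c $ k \<in> {-3,-1} then -2 + cis (pi * fst \<theta>) * (c $ k + 2)
      else if c $ k \<in> {1,3} then 2 + cis (pi * snd \<theta>) * (c $ k - 2) else c $ k)"
      by cases (auto intro!: continuous_intros)
  qed
  have "F \<theta> \<in> configs" for \<theta>
  proof -
    have "F \<theta> $ i \<noteq> F \<theta> $ j" if "i \<noteq> j" for i j
    proof
      assume "F \<theta> $ i = F \<theta> $ j"
      moreover have "c $ i \<in> base_pts" "c $ j \<in> base_pts" "c $ i \<noteq> c $ j"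
        using c that unfolding base_cfgs_def configs_iff by auto
      ultimately show False
        using spin_out_inj[of "c $ i" "c $ j" "pi * fst \<theta>" "pi * snd \<theta>"] unfolding F_def by simp
    qed
    then show ?thesis unfolding configs_iff by blast
  qed
  then have rF: "range F \<subseteq> configs" by blast
  have two: "letter_path (Out a' b') (letter_path (Out a b) c 1) u = F (of_int a + of_int a' * u, of_int b + of_int b' * u)" for u :: real
  proof -
    have "turn (Out a' b') u (turn (Out a b) 1 z) = (if z \<in> {-3,-1} then -2 + cis (pi * (a + a' * u)) * (z + 2)
       else if z \<in> {1,3} then 2 + cis (pi * (b + b' * u)) * (z - 2) else z)" if "z \<in> base_pts" for z
      using that unfolding base_pts_def
      by (auto simp: cis_pi_int cis_mult[symmetric] distrib_left mult.assoc mult.left_commute)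
    then show ?thesis using c unfolding letter_path_def F_def base_cfgs_def by (simp add: vec_eq_iff)
  qed
  let ?A = "(real_of_int a, real_of_int b)" and ?B = "(real_of_int (a + a'), real_of_int (b + b'))"
  let ?g = "linepath 0 ?A +++ (linepath ?A ?B +++ linepath ?B ?B)"
  let ?h = "linepath 0 ?B +++ linepath ?B ?B"
  have const: "linepath (F x) (F x) = F \<circ> linepath x x" for x
    by (auto simp: fun_eq_iff linepath_def simp flip: scaleR_left_distrib)
  have "word_path [Out a b, Out a' b'] c = F \<circ> ?g"
    unfolding path_compose_join word_path.simps
  proof (intro arg_cong2[where f="(+++)"])
    show "letter_path (Out a b) c = F \<circ> linepath 0 ?A"
      by (auto simp: fun_eq_iff F0 linepath_def mult.commute)
    show "letter_path (Out a' b') (letter_path (Out a b) c 1) = F \<circ> linepath ?A ?B"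
      by (rule ext) (simp add: two linepath_def algebra_simps)
    show "linepath (letter_path (Out a' b') (letter_path (Out a b) c 1) 1) (letter_path (Out a' b') (letter_path (Out a b) c 1) 1)
        = F \<circ> linepath ?B ?B"
      unfolding two using const[of ?B] by simp
  qed
  moreover have "word_path [Out (a + a') (b + b')] c = F \<circ> ?h"
    unfolding path_compose_join word_path.simps
  proof (intro arg_cong2[where f="(+++)"])
    show "letter_path (Out (a + a') (b + b')) c = F \<circ> linepath 0 ?B"
      by (auto simp: fun_eq_iff F0 linepath_def mult.commute)
    show "linepath (letter_path (Out (a + a') (b + b')) c 1) (letter_path (Out (a + a') (b + b')) c 1) = F \<circ> linepath ?B ?B"
      using const[of ?B] by (simp add: F0)
  qed
  moreover have "homotopic_paths configs (F \<circ> ?g) (F \<circ> ?h)"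
    by (intro homotopic_paths_convex_image cF rF) auto
  ultimately show "homotopic_paths configs (word_path [Out a b, Out a' b'] c) (word_path [Out (a + a') (b + b')] c)"
    by simp
qed

lemma word_sim_trivial:
  assumes "\<And>u z. z \<in> base_pts \<Longrightarrow> turn l u z = z"
  shows "word_sim [l] []"
  unfolding word_sim_def
proof
  fix c assume c: "c \<in> base_cfgs"
  have "letter_path l c u = c" for u
    unfolding letter_path_def using c assms by (auto simp: base_cfgs_def vec_eq_iff)
  then have "word_path [l] c = (\<lambda>u. c)"
    by (auto simp: fun_eq_iff joinpaths_def linepath_def simp flip: scaleR_left_distrib)
  moreover have "word_path [] c = (\<lambda>u. c)"
    by (auto simp: fun_eq_iff linepath_def simp flip: scaleR_left_distrib)
  ultimately show "homotopic_paths configs (word_path [l] c) (word_path [] c)"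
    using c by (simp add: base_cfgs_configs path_def path_image_def image_subset_iff)
qed

lemma word_sim_Mid_0: "word_sim [Mid 0] []"
  by (rule word_sim_trivial) (auto simp: base_pts_def)

lemma word_sim_Out_0: "word_sim [Out 0 0] []"
  by (rule word_sim_trivial) (auto simp: base_pts_def)

section \<open>Straight-line homotopies between words and geometric motions\<close>

text \<open>A sufficient condition for the segment from a to b to miss 0: both ends lie in one
  closed half plane bounded by a coordinate axis, and at least one of them lies off that axis. The
  weak inequality admits the instants at which one of the differences is on an axis.\<close>

definition same_side :: "complex \<Rightarrow> complex \<Rightarrow> bool" where
  "same_side a b \<longleftrightarrow> a \<noteq> 0 \<and> b \<noteq> 0 \<and>
     ((Re a < 0 \<and> Re b \<le> 0) \<or> (Re a \<le> 0 \<and> Re b < 0) \<or> (Re a > 0 \<and> Re b \<ge> 0) \<or> (Re a \<ge> 0 \<and> Re b > 0) \<or>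
      (Im a < 0 \<and> Im b \<le> 0) \<or> (Im a \<le> 0 \<and> Im b < 0) \<or> (Im a > 0 \<and> Im b \<ge> 0) \<or> (Im a \<ge> 0 \<and> Im b > 0))"

lemma convex_comb_neg:
  fixes x y s :: real
  assumes "x < 0" "y \<le> 0" "s \<in> {0..1}" "(1 - s) * x + s * y = 0"
  shows "s = 1"
proof (rule ccontr)
  assume "s \<noteq> 1"
  then have "(1 - s) * x < 0" using assms(1,3) by (intro mult_pos_neg) auto
  moreover have "s * y \<le> 0" using assms(2,3) by (intro mult_nonneg_nonpos) auto
  ultimately show False using assms(4) by linarith
qed

lemma same_side_segment:
  assumes "same_side a b" "s \<in> {0..1}"
  shows "(1 - s) *\<^sub>R a + s *\<^sub>R b \<noteq> 0"
proof
  assume e: "(1 - s) *\<^sub>R a + s *\<^sub>R b = 0"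
  have R: "(1 - s) * Re a + s * Re b = 0" and I: "(1 - s) * Im a + s * Im b = 0"
    using arg_cong[OF e, of Re] arg_cong[OF e, of Im] by simp_all
  have s': "1 - s \<in> {0..1}" using assms(2) by auto
  have R': "(1 - (1 - s)) * Re b + (1 - s) * Re a = 0" and I': "(1 - (1 - s)) * Im b + (1 - s) * Im a = 0"
    using R I by simp_all
  have Rm: "(1 - s) * (- Re a) + s * (- Re b) = 0" and Im: "(1 - s) * (- Im a) + s * (- Im b) = 0"
    using R I by (simp_all add: algebra_simps)
  have Rm': "(1 - (1 - s)) * (- Re b) + (1 - s) * (- Re a) = 0" and Im': "(1 - (1 - s)) * (- Im b) + (1 - s) * (- Im a) = 0"
    using Rm Im by simp_all
  have "s = 1 \<or> s = 0"
    using assms(1) convex_comb_neg[OF _ _ assms(2) R] convex_comb_neg[OF _ _ assms(2) I]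
      convex_comb_neg[OF _ _ s' R'] convex_comb_neg[OF _ _ s' I']
      convex_comb_neg[OF _ _ assms(2) Rm] convex_comb_neg[OF _ _ assms(2) Im]
      convex_comb_neg[OF _ _ s' Rm'] convex_comb_neg[OF _ _ s' Im']
    unfolding same_side_def by auto
  then show False using e assms(1) unfolding same_side_def by auto
qed

lemma same_side_minus: "same_side (x - y) (x' - y') \<Longrightarrow> same_side (y - x) (y' - x')"
  unfolding same_side_def by auto

lemma segment_configs:
  fixes a b :: "complex^'k"
  assumes "\<And>i j. i \<noteq> j \<Longrightarrow> same_side (a $ i - a $ j) (b $ i - b $ j)"
  shows "closed_segment a b \<subseteq> configs"
proof
  fix c assume "c \<in> closed_segment a b"
  then obtain s where s: "s \<in> {0..1}" "c = (1 - s) *\<^sub>R a + s *\<^sub>R b"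
    unfolding closed_segment_def by auto
  have "c $ i \<noteq> c $ j" if "i \<noteq> j" for i j
    using same_side_segment[OF assms[OF that] s(1)] unfolding s(2) by (simp add: algebra_simps)
  then show "c \<in> configs" unfolding configs_iff by blast
qed

text \<open>The path of a strand depends only on its initial position, so collisions can be checked
  for the six pairs of base points instead of for pairs of labels.\<close>

fun point_path :: "letter list \<Rightarrow> complex \<Rightarrow> real \<Rightarrow> complex" where
  "point_path [] z = (\<lambda>u. z)"
| "point_path (l # w) z = (\<lambda>u. turn l u z) +++ point_path w (turn l 1 z)"

lemma word_path_nth: "word_path w c u $ k = point_path w (c $ k) u"
  by (induction w arbitrary: c u) (auto simp: joinpaths_def letter_path_def linepath_def simp flip: scaleR_left_distrib)

text \<open>The second argument of Q carries the global time, in which the first letter occupies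
  [0, 1/2] and the rest of the word the second half. Iteration produces the dyadic times used
  below.\<close>

lemma point_path_split:
  assumes "\<And>v. v \<in> {0..1} \<Longrightarrow> Q (\<lambda>z. turn l v (\<sigma> z)) (v / 2)"
    and "\<And>v. v \<in> {0..1} \<Longrightarrow> Q (\<lambda>z. point_path w (turn l 1 (\<sigma> z)) v) (1/2 + v/2)"
    and "u \<in> {0..1}"
  shows "Q (\<lambda>z. point_path (l # w) (\<sigma> z) u) u"
proof (cases "u \<le> 1/2")
  case True
  then show ?thesis using assms(1)[of "2 * u"] assms(3) by (simp add: joinpaths_def)
next
  case False
  have "1/2 + (2 * u - 1)/2 = u" by (simp add: field_simps)
  then show ?thesis using False assms(2)[of "2 * u - 1"] assms(3) by (simp add: joinpaths_def)
qed

definition diffs_ok :: "(complex \<Rightarrow> complex) \<Rightarrow> (complex \<Rightarrow> complex) \<Rightarrow> bool" where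
  "diffs_ok f g \<longleftrightarrow> same_side (f (-3) - f (-1)) (g (-3) - g (-1)) \<and> same_side (f (-3) - f 1) (g (-3) - g 1) \<and>
     same_side (f (-3) - f 3) (g (-3) - g 3) \<and> same_side (f (-1) - f 1) (g (-1) - g 1) \<and>
     same_side (f (-1) - f 3) (g (-1) - g 3) \<and> same_side (f 1 - f 3) (g 1 - g 3)"

lemma diffs_ok_pair:
  assumes "diffs_ok f g" "z \<in> base_pts" "z' \<in> base_pts" "z \<noteq> z'"
  shows "same_side (f z - f z') (g z - g z')"
  using assms same_side_minus unfolding diffs_ok_def base_pts_def by auto

text \<open>A word may be replaced by a simpler motion R if the difference of any two points stays
  in a common half plane with the corresponding difference of R: the linear homotopy then has no
  collisions.\<close>

lemma homotopic_word_motion: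
  assumes c: "c \<in> base_cfgs"
    and ok: "\<And>u. u \<in> {0..1} \<Longrightarrow> diffs_ok (\<lambda>z. point_path w z u) (\<lambda>z. R z u)"
    and R: "\<And>z. z \<in> base_pts \<Longrightarrow> continuous_on {0..1} (R z)" "\<And>z. z \<in> base_pts \<Longrightarrow> R z 0 = z"
      "\<And>z. z \<in> base_pts \<Longrightarrow> R z 1 = point_path w z 1"
  shows "homotopic_paths configs (word_path w c) (\<lambda>u. \<chi> k. R (c $ k) u)"
proof (rule homotopic_paths_linear)
  have cb: "c $ k \<in> base_pts" for k using c unfolding base_cfgs_def by blast
  show "path (\<lambda>u. \<chi> k. R (c $ k) u)"
    unfolding path_def by (intro continuous_on_vec_lambda R(1) cb)
  show "pathstart (\<lambda>u. \<chi> k. R (c $ k) u) = pathstart (word_path w c)"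
    unfolding pathstart_def using R(2)[OF cb] by (simp add: vec_eq_iff)
  show "pathfinish (\<lambda>u. \<chi> k. R (c $ k) u) = pathfinish (word_path w c)"
    unfolding pathfinish_def using R(3)[OF cb] by (simp add: vec_eq_iff word_path_nth)
  show "closed_segment (word_path w c u) (\<chi> k. R (c $ k) u) \<subseteq> configs" if "u \<in> {0..1}" for u
  proof (rule segment_configs)
    fix i j :: 4 assume "i \<noteq> j"
    then have "c $ i \<noteq> c $ j" using c unfolding base_cfgs_def configs_iff by blast
    then show "same_side (word_path w c u $ i - word_path w c u $ j) ((\<chi> k. R (c $ k) u) $ i - (\<chi> k. R (c $ k) u) $ j)"
      using diffs_ok_pair[OF ok[OF that] cb cb] by (simp add: word_path_nth)
  qed
qed simp

lemma half_turn_signs: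
  assumes "v \<in> {0..1}"
  shows "sin (pi * v) \<ge> 0" "cos (pi * (v / 2)) \<ge> 0" "v > 0 \<Longrightarrow> sin (pi * (v / 2)) > 0"
proof -
  have "pi * v \<le> pi * 1" "0 \<le> pi * v" using assms by (intro mult_left_mono, auto)
  then show "sin (pi * v) \<ge> 0" by (intro sin_ge_zero) auto
  have "- (pi / 2) \<le> pi * (v / 2)" "pi * (v / 2) \<le> pi / 2"
    using \<open>pi * v \<le> pi * 1\<close> \<open>0 \<le> pi * v\<close> pi_gt_zero by linarith+
  then show "cos (pi * (v / 2)) \<ge> 0" by (rule cos_ge_zero)
  show "v > 0 \<Longrightarrow> sin (pi * (v / 2)) > 0"
    using \<open>pi * v \<le> pi * 1\<close> pi_gt_zero by (intro sin_gt_zero) (auto simp del: pi_gt_zero)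
qed

lemma late_turn_signs:
  assumes "1/2 \<le> u" "u < 1"
  shows "sin (pi * u) > 0" "cos (pi * u) \<le> 0" "u > 1/2 \<Longrightarrow> cos (pi * u) < 0"
proof -
  have b: "pi * u < pi * 1" "pi * (1/2) \<le> pi * u" using assms by (intro mult_strict_left_mono mult_left_mono; simp)+
  show "sin (pi * u) > 0" using b by (intro sin_gt_zero) (use pi_gt_zero in linarith)+
  have "cos (pi * u) = - sin (pi * u - pi/2)" by (simp add: sin_diff)
  moreover have "sin (pi * u - pi/2) \<ge> 0" using b by (intro sin_ge_zero) (use pi_gt_zero in linarith)+
  moreover have "sin (pi * u - pi/2) > 0" if "u > 1/2"
  proof -
    have "pi * (1/2) < pi * u" using that by simp
    then show ?thesis using b by (intro sin_gt_zero) (use pi_gt_zero in linarith)+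
  qed
  ultimately show "cos (pi * u) \<le> 0" "u > 1/2 \<Longrightarrow> cos (pi * u) < 0" by auto
qed

lemma late_turn_signs':
  assumes "1/2 < u" "u \<le> 1"
  shows "sin (pi * u) \<ge> 0" "cos (pi * u) < 0"
  using late_turn_signs[of u] assms by (cases "u = 1"; force)+

text \<open>The rigid half turn of -3, -1, 1 about the middle one of them, with 3 at rest. It is the
  common deformation of both sides of the braid relation.\<close>

definition rot3 :: "complex \<Rightarrow> real \<Rightarrow> complex" where
  "rot3 z u = (if z = 3 then 3 else -1 + cis (pi * u) * (z + 1))"

text \<open>The letters end at the times 1/2, 3/4 and 7/8; the last interval belongs to the constant
  path that closes every word.\<close>

lemma point_path_split3:
  assumes "\<And>v. v \<in> {0..1} \<Longrightarrow> Q (\<lambda>z. turn l1 v z) (v / 2)"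
    and "\<And>v. v \<in> {0..1} \<Longrightarrow> Q (\<lambda>z. turn l2 v (turn l1 1 z)) (1/2 + v/4)"
    and "\<And>v. v \<in> {0..1} \<Longrightarrow> Q (\<lambda>z. turn l3 v (turn l2 1 (turn l1 1 z))) (3/4 + v/8)"
    and "\<And>v. v \<in> {0..1} \<Longrightarrow> Q (\<lambda>z. turn l3 1 (turn l2 1 (turn l1 1 z))) (7/8 + v/8)"
    and "u \<in> {0..1}"
  shows "Q (\<lambda>z. point_path [l1, l2, l3] z u) u"
proof (rule point_path_split[where Q=Q and \<sigma>="\<lambda>z. z", OF assms(1) _ assms(5)])
  fix v :: real assume v: "v \<in> {0..1}"
  show "Q (\<lambda>z. point_path [l2, l3] (turn l1 1 z) v) (1/2 + v/2)"
  proof (rule point_path_split[where Q="\<lambda>f u. Q f (1/2 + u/2)", OF _ _ v])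
    fix v :: real assume v: "v \<in> {0..1}"
    show "Q (\<lambda>z. turn l2 v (turn l1 1 z)) (1/2 + v/2/2)" using assms(2)[OF v] by simp
    show "Q (\<lambda>z. point_path [l3] (turn l2 1 (turn l1 1 z)) v) (1/2 + (1/2 + v/2)/2)"
    proof (rule point_path_split[where Q="\<lambda>f u. Q f (1/2 + (1/2 + u/2)/2)", OF _ _ v])
      fix v :: real assume v: "v \<in> {0..1}"
      have e: "1/2 + (1/2 + v/2/2)/2 = 3/4 + v/8" "1/2 + (1/2 + (1/2 + v/2)/2)/2 = 7/8 + v/8" by (simp_all add: field_simps)
      show "Q (\<lambda>z. turn l3 v (turn l2 1 (turn l1 1 z))) (1/2 + (1/2 + v/2/2)/2)" using assms(3)[OF v] unfolding e .
      show "Q (\<lambda>z. point_path [] (turn l3 1 (turn l2 1 (turn l1 1 z))) v) (1/2 + (1/2 + (1/2 + v/2)/2)/2)"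
        using assms(4)[OF v] unfolding e by simp
    qed
  qed
qed

lemma point_path_split4:
  assumes "\<And>v. v \<in> {0..1} \<Longrightarrow> Q (\<lambda>z. turn l0 v z) (v / 2)"
    and "\<And>v. v \<in> {0..1} \<Longrightarrow> Q (\<lambda>z. turn l1 v (turn l0 1 z)) (1/2 + v/4)"
    and "\<And>v. v \<in> {0..1} \<Longrightarrow> Q (\<lambda>z. turn l2 v (turn l1 1 (turn l0 1 z))) (3/4 + v/8)"
    and "\<And>v. v \<in> {0..1} \<Longrightarrow> Q (\<lambda>z. turn l3 v (turn l2 1 (turn l1 1 (turn l0 1 z)))) (7/8 + v/16)"
    and "\<And>v. v \<in> {0..1} \<Longrightarrow> Q (\<lambda>z. turn l3 1 (turn l2 1 (turn l1 1 (turn l0 1 z)))) (15/16 + v/16)"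
    and "u \<in> {0..1}"
  shows "Q (\<lambda>z. point_path [l0, l1, l2, l3] z u) u"
proof (rule point_path_split[where Q=Q and \<sigma>="\<lambda>z. z", OF assms(1) _ assms(6)])
  fix v :: real assume v: "v \<in> {0..1}"
  show "Q (\<lambda>z. point_path [l1, l2, l3] (turn l0 1 z) v) (1/2 + v/2)"
  proof (rule point_path_split[where Q="\<lambda>f u. Q f (1/2 + u/2)", OF _ _ v])
    fix v :: real assume v: "v \<in> {0..1}"
    show "Q (\<lambda>z. turn l1 v (turn l0 1 z)) (1/2 + v/2/2)" using assms(2)[OF v] by simp
    show "Q (\<lambda>z. point_path [l2, l3] (turn l1 1 (turn l0 1 z)) v) (1/2 + (1/2 + v/2)/2)"
    proof (rule point_path_split[where Q="\<lambda>f u. Q f (1/2 + (1/2 + u/2)/2)", OF _ _ v])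
      fix v :: real assume v: "v \<in> {0..1}"
      have e: "1/2 + (1/2 + v/2/2)/2 = 3/4 + v/8" by (simp add: field_simps)
      show "Q (\<lambda>z. turn l2 v (turn l1 1 (turn l0 1 z))) (1/2 + (1/2 + v/2/2)/2)" using assms(3)[OF v] unfolding e .
      show "Q (\<lambda>z. point_path [l3] (turn l2 1 (turn l1 1 (turn l0 1 z))) v) (1/2 + (1/2 + (1/2 + v/2)/2)/2)"
      proof (rule point_path_split[where Q="\<lambda>f u. Q f (1/2 + (1/2 + (1/2 + u/2)/2)/2)", OF _ _ v])
        fix v :: real assume v: "v \<in> {0..1}"
        have e: "1/2 + (1/2 + (1/2 + v/2/2)/2)/2 = 7/8 + v/16"
          "1/2 + (1/2 + (1/2 + (1/2 + v/2)/2)/2)/2 = 15/16 + v/16" by (simp_all add: field_simps)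
        show "Q (\<lambda>z. turn l3 v (turn l2 1 (turn l1 1 (turn l0 1 z)))) (1/2 + (1/2 + (1/2 + v/2/2)/2)/2)"
          using assms(4)[OF v] unfolding e .
        show "Q (\<lambda>z. point_path [] (turn l3 1 (turn l2 1 (turn l1 1 (turn l0 1 z)))) v) (1/2 + (1/2 + (1/2 + (1/2 + v/2)/2)/2)/2)"
          using assms(5)[OF v] unfolding e by simp
      qed
    qed
  qed
qed

lemma cos_sin_facts:
  fixes x :: real
  shows "-1 \<le> cos (pi * x)" "cos (pi * x) \<le> 1" "cos (pi * x) = 0 \<longrightarrow> sin (pi * x) \<noteq> 0"
  using sin_zero_abs_cos_one[of "pi * x"] by auto

context
  notes cos_le_one [simp del] cos_ge_minus_one [simp del]
begin

lemma braid_rot3_left: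
  assumes "u \<in> {0..1}"
  shows "diffs_ok (\<lambda>z. point_path [Mid 1, Out 1 0, Mid 1] z u) (\<lambda>z. rot3 z u)"
proof (rule point_path_split3[where Q="\<lambda>f u. diffs_ok f (\<lambda>z. rot3 z u)", OF _ _ _ _ assms], goal_cases)
  case (1 v)
  \<comment> \<open>The instant 0 is treated apart because \<open>sin (pi * (v / 2))\<close> is
    positive only for v > 0.\<close>
  show ?case
    using half_turn_signs[OF 1] cos_sin_facts[of v] cos_sin_facts[of "v/2"] 1
    by (cases "v = 0") (simp_all add: diffs_ok_def same_side_def rot3_def complex_eq_iff, (smt (verit))?)
next
  case (2 v)
  have "sin (pi * (1/2 + v/4)) > 0" "cos (pi * (1/2 + v/4)) \<le> 0" using 2 by (intro late_turn_signs; simp)+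
  then show ?case
    using half_turn_signs[OF 2] cos_sin_facts[of v] cos_sin_facts[of "1/2+v/4"] 2
    by (simp_all add: diffs_ok_def same_side_def rot3_def complex_eq_iff, (smt (verit))?)
next
  case (3 v)
  have "sin (pi * (3/4 + v/8)) > 0" "cos (pi * (3/4 + v/8)) < 0" using 3 by (intro late_turn_signs; simp)+
  then show ?case
    using half_turn_signs[OF 3] cos_sin_facts[of v] cos_sin_facts[of "3/4 + v/8"] 3
    by (simp_all add: diffs_ok_def same_side_def rot3_def complex_eq_iff, (smt (verit))?)
next
  case (4 v)
  have "cos (pi * (7/8 + v/8)) < 0" using 4 by (intro late_turn_signs'; simp)+
  then show ?case
    using cos_sin_facts[of "7/8 + v/8"]
    by (simp_all add: diffs_ok_def same_side_def rot3_def complex_eq_iff, (smt (verit))?)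
qed

lemma braid_rot3_right:
  assumes "u \<in> {0..1}"
  shows "diffs_ok (\<lambda>z. point_path [Out 1 0, Mid 1, Out 1 0] z u) (\<lambda>z. rot3 z u)"
proof (rule point_path_split3[where Q="\<lambda>f u. diffs_ok f (\<lambda>z. rot3 z u)", OF _ _ _ _ assms], goal_cases)
  case (1 v)
  show ?case
    using half_turn_signs[OF 1] cos_sin_facts[of v] cos_sin_facts[of "v/2"] 1
    by (cases "v = 0") (simp_all add: diffs_ok_def same_side_def rot3_def complex_eq_iff, (smt (verit))?)
next
  case (2 v)
  have "sin (pi * (1/2 + v/4)) > 0" "cos (pi * (1/2 + v/4)) \<le> 0" using 2 by (intro late_turn_signs; simp)+
  then show ?case
    using half_turn_signs[OF 2] cos_sin_facts[of v] cos_sin_facts[of "1/2+v/4"] 2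
    by (simp_all add: diffs_ok_def same_side_def rot3_def complex_eq_iff, (smt (verit))?)
next
  case (3 v)
  have "sin (pi * (3/4 + v/8)) > 0" "cos (pi * (3/4 + v/8)) < 0" using 3 by (intro late_turn_signs; simp)+
  then show ?case
    using half_turn_signs[OF 3] cos_sin_facts[of v] cos_sin_facts[of "3/4 + v/8"] 3
    by (simp_all add: diffs_ok_def same_side_def rot3_def complex_eq_iff, (smt (verit))?)
next
  case (4 v)
  have "cos (pi * (7/8 + v/8)) < 0" using 4 by (intro late_turn_signs'; simp)+
  then show ?case
    using cos_sin_facts[of "7/8 + v/8"]
    by (simp_all add: diffs_ok_def same_side_def rot3_def complex_eq_iff, (smt (verit))?)
qed

text \<open>Six crossings, one for each pair of strands: this word is the half twist on four
  strands, whose geometric form is the rotation of the plane by \<open>pi\<close>.\<close>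

lemma half_twist_rotation:
  assumes "u \<in> {0..1}"
  shows "diffs_ok (\<lambda>z. point_path [Mid 1, Out 1 1, Mid 1, Out 1 1] z u) (\<lambda>z. cis (pi * u) * z)"
proof (rule point_path_split4[where Q="\<lambda>f u. diffs_ok f (\<lambda>z. cis (pi * u) * z)", OF _ _ _ _ _ assms], goal_cases)
  case (1 v)
  show ?case
    using half_turn_signs[OF 1] cos_sin_facts[of v] cos_sin_facts[of "v/2"] 1
    by (cases "v = 0") (simp_all add: diffs_ok_def same_side_def complex_eq_iff, (smt (verit))?)
next
  case (2 v)
  have "sin (pi * (1/2 + v/4)) > 0" "cos (pi * (1/2 + v/4)) \<le> 0" using 2 by (intro late_turn_signs; simp)+
  then show ?case
    using half_turn_signs[OF 2] cos_sin_facts[of v] cos_sin_facts[of "1/2+v/4"] 2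
    by (simp_all add: diffs_ok_def same_side_def complex_eq_iff, (smt (verit))?)
next
  case (3 v)
  have "sin (pi * (3/4 + v/8)) > 0" "cos (pi * (3/4 + v/8)) < 0" using 3 by (intro late_turn_signs; simp)+
  then show ?case
    using half_turn_signs[OF 3] cos_sin_facts[of v] cos_sin_facts[of "3/4 + v/8"] 3
    by (simp_all add: diffs_ok_def same_side_def complex_eq_iff, (smt (verit))?)
next
  case (4 v)
  have "sin (pi * (7/8 + v/16)) > 0" "cos (pi * (7/8 + v/16)) < 0" using 4 by (intro late_turn_signs; simp)+
  then show ?case
    using half_turn_signs[OF 4] cos_sin_facts[of v] cos_sin_facts[of "7/8 + v/16"] 4
    by (simp_all add: diffs_ok_def same_side_def complex_eq_iff, (smt (verit))?)
next
  case (5 v)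
  have "cos (pi * (15/16 + v/16)) < 0" using 5 by (intro late_turn_signs'; simp)+
  then show ?case
    using cos_sin_facts[of "15/16 + v/16"]
    by (simp_all add: diffs_ok_def same_side_def complex_eq_iff, (smt (verit))?)
qed

text \<open>The time change lets the loop keep pace with the word: a quarter of the circle during
  the first letter, half of it during the second, the last quarter during the third, and rest during
  the constant tail.\<close>

definition loop_param :: "real \<Rightarrow> real" where
  "loop_param u = (if u \<le> 1/2 then u/2 else if u \<le> 7/8 then 2 * u - 3/4 else 1)"

text \<open>The point -1 runs once along the circle of radius 3 about 2, hence around 1 and 3 but
  not around -3, and all other points rest.\<close>

definition loop_motion :: "complex \<Rightarrow> real \<Rightarrow> complex" where
  "loop_motion z u = (if z = -1 then 2 - 3 * cis (2 * pi * loop_param u) else z)"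

lemma loop_motion_other [simp]: "z \<noteq> -1 \<Longrightarrow> loop_motion z u = z"
  by (simp add: loop_motion_def)

lemma loop_around:
  assumes "u \<in> {0..1}"
  shows "diffs_ok (\<lambda>z. point_path [Mid 1, Out 0 2, Mid 1] z u) (\<lambda>z. loop_motion z u)"
proof (rule point_path_split3[where Q="\<lambda>f u. diffs_ok f (\<lambda>z. loop_motion z u)", OF _ _ _ _ assms], goal_cases)
  case (1 v)
  have e: "loop_motion (-1) (v/2) = 2 - 3 * cis (pi * (v/2))" using 1 by (simp add: loop_motion_def loop_param_def)
  have e0: "loop_motion (-1) 0 = -1" by (simp add: loop_motion_def loop_param_def)
  show ?case
    using half_turn_signs[OF 1] cos_sin_facts[of v] cos_sin_facts[of "v/2"] 1
    by (cases "v = 0") (simp_all add: e e0 diffs_ok_def same_side_def complex_eq_iff, (smt (verit))?)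
next
  case (2 v)
  have g: "loop_param (1/2 + v/4) = 1/4 + v/2" using 2 by (auto simp: loop_param_def)
  have "cis (2 * pi * (1/4 + v/2)) = cis (pi/2) * cis (pi * v)"
    unfolding cis_mult by (simp add: algebra_simps)
  then have e: "loop_motion (-1) (1/2 + v/4) = 2 - 3 * \<i> * cis (pi * v)" using g by (simp add: loop_motion_def)
  define S C s2 c2 where "S = sin (pi * v)" "C = cos (pi * v)" "s2 = sin (pi * 2 * v)" "c2 = cos (pi * 2 * v)"
  note defs = this
  have d: "s2 = 2 * S * C" "c2 = C\<^sup>2 - S\<^sup>2" "S\<^sup>2 + C\<^sup>2 = 1"
    using sin_double[of "pi * v"] cos_double[of "pi * v"] unfolding defs by (simp_all add: mult.commute mult.left_commute mult.assoc)
  have S: "S \<ge> 0" using half_turn_signs(1)[OF 2] unfolding defs .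
  have c2: "-1 \<le> c2" "c2 \<le> 1" unfolding defs by (simp_all add: cos_le_one cos_ge_minus_one)
  \<comment> \<open>Of the six pairs only the moving point and 3 need thought. The word turns their
    difference by the double angle; for S > 0 the imaginary parts \<open>-4 * S * C\<close> and
    \<open>-3 * C\<close> agree in sign, and the real parts decide the cases S = 0 and C =
    0.\<close>
  have "same_side (Complex (-2 * c2) (-2 * s2)) (Complex (-1 + 3 * S) (-3 * C))"
  proof -
    consider "S = 0" | "S > 0" "C = 0" | "S > 0" "C > 0" | "S > 0" "C < 0" using S by linarith
    then show ?thesis
    proof cases
      case 1 then show ?thesis using d by (simp add: same_side_def complex_eq_iff)
    next
      case 2 then have "S = 1" using d by (simp add: power2_eq_1_iff)
      then show ?thesis using d 2 by (simp add: same_side_def complex_eq_iff)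
    next
      case 3 then have "S * C > 0" by simp
      then show ?thesis using d 3 by (simp add: same_side_def complex_eq_iff)
    next
      case 4 then have "S * C < 0" by (simp add: mult_pos_neg)
      then show ?thesis using d 4 by (simp add: same_side_def complex_eq_iff mult.commute[of C S])
    qed
  qed
  moreover have "Complex (-2 * c2) (-2 * s2) = turn (Out 0 2) v (turn (Mid 1) 1 (-1)) - turn (Out 0 2) v (turn (Mid 1) 1 3)"
    unfolding defs by (simp add: complex_eq_iff)
  moreover have "Complex (-1 + 3 * S) (-3 * C) = loop_motion (-1) (1/2 + v/4) - loop_motion 3 (1/2 + v/4)"
    unfolding e unfolding defs by (simp add: complex_eq_iff)
  ultimately have m: "same_side (turn (Out 0 2) v (turn (Mid 1) 1 (-1)) - turn (Out 0 2) v (turn (Mid 1) 1 3)) (loop_motion (-1) (1/2 + v/4) - loop_motion 3 (1/2 + v/4))"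
    by simp
  show ?case
    unfolding diffs_ok_def
  proof (intro conjI m)
  qed (use S c2 in \<open>unfold e, unfold defs, auto simp: same_side_def complex_eq_iff\<close>)
next
  case (3 v)
  have g: "loop_param (3/4 + v/8) = 3/4 + v/4" using 3 by (auto simp: loop_param_def)
  have "cis (2 * pi * (3/4 + v/4)) = cis (3/2 * pi) * cis (pi * (v/2))"
    unfolding cis_mult by (simp add: algebra_simps)
  moreover have "cis (3/2 * pi) = - \<i>"
    unfolding complex_eq_iff cis.sel cos_3over2_pi sin_3over2_pi by simp
  ultimately have e: "loop_motion (-1) (3/4 + v/8) = 2 + 3 * \<i> * cis (pi * (v/2))" using g by (simp add: loop_motion_def)
  have C': "cos (pi * (v/2)) > 0" if "v < 1"
  proof (rule cos_gt_zero_pi)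
    have "pi * v < pi * 1" "0 \<le> pi * v" using 3 that by (intro mult_strict_left_mono, auto)
    then show "- (pi/2) < pi * (v/2)" "pi * (v/2) < pi/2" using pi_gt_zero by linarith+
  qed
  show ?case
  proof (cases "v = 1")
    case True
    then show ?thesis using e[unfolded True] by (simp add: diffs_ok_def same_side_def complex_eq_iff)
  next
    case False
    then have "v < 1" using 3 by auto
    then show ?thesis
      using half_turn_signs[OF 3] cos_sin_facts[of v] cos_sin_facts[of "v/2"] 3 C'
      by (simp_all add: e diffs_ok_def same_side_def complex_eq_iff, (smt (verit))?)
  qed
next
  case (4 v)
  have "loop_param (7/8 + v/8) = 1" using 4 by (auto simp: loop_param_def)
  then show ?case by (simp add: loop_motion_def diffs_ok_def same_side_def complex_eq_iff)
qed

end

subsection \<open>The braid group\<close>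

lemma word_sim_motion:
  assumes "\<And>u. u \<in> {0..1} \<Longrightarrow> diffs_ok (\<lambda>z. point_path w z u) (\<lambda>z. R z u)"
    and "\<And>u. u \<in> {0..1} \<Longrightarrow> diffs_ok (\<lambda>z. point_path w' z u) (\<lambda>z. R z u)"
    and "\<And>z. z \<in> base_pts \<Longrightarrow> continuous_on {0..1} (R z)" "\<And>z. z \<in> base_pts \<Longrightarrow> R z 0 = z"
      "\<And>z. z \<in> base_pts \<Longrightarrow> R z 1 = point_path w z 1" "\<And>z. z \<in> base_pts \<Longrightarrow> R z 1 = point_path w' z 1"
  shows "word_sim w w'"
  unfolding word_sim_def
proof
  fix c assume c: "c \<in> base_cfgs"
  show "homotopic_paths configs (word_path w c) (word_path w' c)"
    by (rule homotopic_paths_trans[OF homotopic_word_motion[OF c assms(1,3,4,5)]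
      homotopic_paths_sym[OF homotopic_word_motion[OF c assms(2,3,4,6)]]])
qed

lemma braid_relation_left: "word_sim [Mid 1, Out 1 0, Mid 1] [Out 1 0, Mid 1, Out 1 0]"
proof (rule word_sim_motion[OF braid_rot3_left braid_rot3_right])
  fix z :: complex
  show "continuous_on {0..1} (rot3 z)"
    unfolding rot3_def[abs_def] by (cases "z = 3") (auto intro!: continuous_intros)
  assume z: "z \<in> base_pts"
  show "rot3 z 0 = z" by (simp add: rot3_def)
  show "rot3 z 1 = point_path [Mid 1, Out 1 0, Mid 1] z 1" "rot3 z 1 = point_path [Out 1 0, Mid 1, Out 1 0] z 1"
    using z by (auto simp: rot3_def base_pts_def joinpaths_def)
qed

text \<open>The effect of the rotation from z to -z, which exchanges the outer pairs and keeps the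
  sense of all turns. It carries the braid relation for \<sigma>1 to the one for \<sigma>3.\<close>

fun swap_letter :: "letter \<Rightarrow> letter" where
  "swap_letter (Mid s) = Mid s"
| "swap_letter (Out a b) = Out b a"

lemma turn_swap: "turn (swap_letter l) u (- z) = - turn l u z"
proof -
  have "- z = w \<longleftrightarrow> z = - w" for w by (metis minus_minus)
  then show ?thesis by (cases l) (auto simp: algebra_simps)
qed

lemma letter_path_swap: "letter_path (swap_letter l) (- c) u = - letter_path l c u"
  by (simp add: letter_path_def vec_eq_iff turn_swap)

lemma word_path_swap: "word_path (map swap_letter w) (- c) = uminus \<circ> word_path w c"
proof (induction w arbitrary: c)
  case Nil
  have "linepath c c = (\<lambda>u. c)" for c :: "complex^4"
    by (auto simp: linepath_def fun_eq_iff simp flip: scaleR_left_distrib)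
  then show ?case by auto
next
  case (Cons l w)
  have "letter_path (swap_letter l) (- c) = uminus \<circ> letter_path l c"
    by (auto simp: letter_path_swap)
  then show ?case using Cons.IH[of "letter_path l c 1"]
    by (auto simp: letter_path_swap joinpaths_def fun_eq_iff)
qed

lemma uminus_configs: "uminus ` configs \<subseteq> (configs :: (complex^'k) set)"
  by (auto simp: configs_iff)

lemma uminus_base_cfgs: "c \<in> base_cfgs \<Longrightarrow> - c \<in> base_cfgs"
proof -
  assume c: "c \<in> base_cfgs"
  have "- z \<in> base_pts" if "z \<in> base_pts" for z using that unfolding base_pts_def by auto
  then show "- c \<in> base_cfgs" using c uminus_configs unfolding base_cfgs_def by auto
qed

lemma word_sim_swap:
  assumes "word_sim u v"
  shows "word_sim (map swap_letter u) (map swap_letter v)"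
  unfolding word_sim_def
proof
  fix c assume "c \<in> base_cfgs"
  then have "homotopic_paths configs (word_path u (- c)) (word_path v (- c))"
    using assms uminus_base_cfgs unfolding word_sim_def by blast
  then have "homotopic_paths configs (uminus \<circ> word_path u (- c)) (uminus \<circ> word_path v (- c))"
    using uminus_configs by (intro homotopic_paths_continuous_image[of configs]) (auto intro!: continuous_intros)
  then show "homotopic_paths configs (word_path (map swap_letter u) c) (word_path (map swap_letter v) c)"
    using word_path_swap[of _ "- c"] by simp
qed

lemma braid_relation_right: "word_sim [Mid 1, Out 0 1, Mid 1] [Out 0 1, Mid 1, Out 0 1]"
  using word_sim_swap[OF braid_relation_left] by simp

fun inverse_letter :: "letter \<Rightarrow> letter" where
  "inverse_letter (Mid s) = Mid (- s)"
| "inverse_letter (Out a b) = Out (- a) (- b)"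

definition inverse_word :: "letter list \<Rightarrow> letter list" where
  "inverse_word w = rev (map inverse_letter w)"

lemma word_sim_inverse_letter: "word_sim [inverse_letter l, l] []" "word_sim [l, inverse_letter l] []"
  by (cases l; auto intro!: word_sim_trans[OF word_sim_Mid_Mid] word_sim_trans[OF word_sim_Out_Out]
     word_sim_Mid_0 word_sim_Out_0)+

lemma word_sim_inverse_word: "word_sim (inverse_word w @ w) []"
proof (induction w)
  case (Cons l w)
  have "word_sim (inverse_word w @ ([inverse_letter l, l] @ w)) (inverse_word w @ ([] @ w))"
    by (intro word_sim_append word_sim_refl word_sim_inverse_letter)
  then show ?case using Cons by (auto simp: inverse_word_def intro: word_sim_trans)
qed (simp add: inverse_word_def)

lemma inverse_word_inverse [simp]: "inverse_word (inverse_word w) = w"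
proof -
  have "inverse_letter (inverse_letter l) = l" for l by (cases l) auto
  then show ?thesis by (simp add: inverse_word_def rev_map comp_def)
qed

lemma word_sim_inverse_cong:
  assumes "word_sim u v" shows "word_sim (inverse_word u) (inverse_word v)"
proof -
  have "word_sim (inverse_word u) (inverse_word u @ (v @ inverse_word v))"
    using word_sim_append[OF word_sim_refl[of "inverse_word u"] word_sim_sym[OF word_sim_inverse_word[of "inverse_word v"]]] by simp
  moreover have "word_sim ((inverse_word u @ v) @ inverse_word v) ([] @ inverse_word v)"
    using word_sim_trans[OF word_sim_append[OF word_sim_refl word_sim_sym[OF assms]] word_sim_inverse_word]
    by (intro word_sim_append) auto
  ultimately show ?thesis by (auto intro: word_sim_trans)
qed

\<comment> \<open>The braid group on four strands, written additively because
  \<open>group_add\<close> is the class of possibly noncommutative groups.\<close>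
quotient_type braid = "letter list" / word_sim
  by (intro equivpI reflpI sympI transpI) (auto intro: word_sim_sym word_sim_trans)

instantiation braid :: group_add
begin

lift_definition zero_braid :: braid is "[]" .
lift_definition plus_braid :: "braid \<Rightarrow> braid \<Rightarrow> braid" is "(@)" by (rule word_sim_append)
lift_definition uminus_braid :: "braid \<Rightarrow> braid" is inverse_word by (rule word_sim_inverse_cong)
definition minus_braid :: "braid \<Rightarrow> braid \<Rightarrow> braid" where "minus_braid a b = a + - b"

instance
proof
  fix a b c :: braid
  show "a + b + c = a + (b + c)" by transfer simp
  show "0 + a = a" by transfer simp
  show "a + 0 = a" by transfer simp
  show "- a + a = 0" by transfer (rule word_sim_inverse_word)
  show "a + - b = a - b" by (simp add: minus_braid_def)
qed

end

lift_definition braid_of :: "letter list \<Rightarrow> braid" is "\<lambda>w. w" .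

lemma braid_of_append: "braid_of (u @ v) = braid_of u + braid_of v" by transfer simp

lemma braid_of_Nil [simp]: "braid_of [] = 0" by transfer simp

lemma braid_of_Cons: "braid_of (l # w) = braid_of [l] + braid_of w"
  using braid_of_append[of "[l]" w] by simp

lemma braid_of_eq_iff: "braid_of u = braid_of v \<longleftrightarrow> word_sim u v" by transfer simp

lemma braid_of_inverse: "braid_of (inverse_word w) = - braid_of w" by transfer simp

definition "\<sigma>1 = braid_of [Out 1 0]"
definition "\<sigma>2 = braid_of [Mid 1]"
definition "\<sigma>3 = braid_of [Out 0 1]"

lemma braid_rel_12: "\<sigma>2 + (\<sigma>1 + \<sigma>2) = \<sigma>1 + (\<sigma>2 + \<sigma>1)"
  using braid_relation_left unfolding braid_of_eq_iff[symmetric] \<sigma>1_def \<sigma>2_def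
  by (simp add: braid_of_Cons[of _ "_ # _"])

lemma braid_rel_23: "\<sigma>2 + (\<sigma>3 + \<sigma>2) = \<sigma>3 + (\<sigma>2 + \<sigma>3)"
  using braid_relation_right unfolding braid_of_eq_iff[symmetric] \<sigma>3_def \<sigma>2_def
  by (simp add: braid_of_Cons[of _ "_ # _"])

lemma braid_rel_13: "\<sigma>1 + \<sigma>3 = \<sigma>3 + \<sigma>1"
  unfolding \<sigma>1_def \<sigma>3_def braid_of_append[symmetric] braid_of_eq_iff
  using word_sim_trans[OF word_sim_Out_Out[of 1 0 0 1, simplified] word_sim_sym[OF word_sim_Out_Out[of 0 1 1 0, simplified]]] by simp

lemma braid_Out: "braid_of [Out (a + a') (b + b')] = braid_of [Out a b] + braid_of [Out a' b']"
  unfolding braid_of_append[symmetric] braid_of_eq_iff using word_sim_sym[OF word_sim_Out_Out] by simp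

lemma braid_Mid: "braid_of [Mid (s + t)] = braid_of [Mid s] + braid_of [Mid t]"
  unfolding braid_of_append[symmetric] braid_of_eq_iff using word_sim_sym[OF word_sim_Mid_Mid] by simp

subsection \<open>Plat closures of braid words\<close>

definition base_caps :: "complex set" where
  "base_caps = closed_segment (-3) (-1) \<union> closed_segment 1 3"

text \<open>The plat closure of a word. It mentions positions only, so it is independent of any
  labelling of the strands.\<close>

definition word_knot :: "letter list \<Rightarrow> (real \<times> complex) set" where
  "word_knot w = {0} \<times> base_caps \<union> {(x, point_path w z x) | x z. x \<in> {0..1} \<and> z \<in> base_pts} \<union> {1} \<times> base_caps"

text \<open>Among the base points a product equals 3 exactly for the pairs -3, -1 and 1, 3 that a
  cap joins.\<close>

definition base_pairs :: "complex^'k \<Rightarrow> ('k \<times> 'k) set" where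
  "base_pairs c = {(i, j). c $ i * c $ j = 3}"

lemma base_cfgs_range:
  assumes "c \<in> base_cfgs" shows "range (($) c) = base_pts"
proof (rule card_subset_eq)
  show "finite base_pts" "range (($) c) \<subseteq> base_pts"
    using assms by (auto simp: base_pts_def base_cfgs_def)
  have "inj (($) c)" using assms by (simp add: base_cfgs_def configs_def)
  then have "card (range (($) c)) = CARD(4)" by (rule card_image)
  also have "\<dots> = card base_pts" by (simp add: base_pts_def)
  finally show "card (range (($) c)) = card base_pts" .
qed

lemma base_cfgs_obtain:
  assumes "c \<in> base_cfgs" "z \<in> base_pts" obtains i where "c $ i = z"
  using base_cfgs_range[OF assms(1)] assms(2) by (metis imageE)

lemma base_cap_set:
  assumes "c \<in> base_cfgs" shows "cap_set (base_pairs c) c = base_caps"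
proof
  have "closed_segment (c $ i) (c $ j) \<subseteq> base_caps" if "c $ i * c $ j = 3" for i j
  proof -
    have "c $ i \<in> base_pts" "c $ j \<in> base_pts" using assms by (auto simp: base_cfgs_def)
    then have "(c $ i, c $ j) \<in> {(-3,-1), (-1,-3), (1,3), (3,1)}"
      using that unfolding base_pts_def by auto
    then show ?thesis unfolding base_caps_def
      by (auto simp: closed_segment_commute[of "-1::complex" "-3"] closed_segment_commute[of "3::complex" 1])
  qed
  then show "cap_set (base_pairs c) c \<subseteq> base_caps" unfolding cap_set_def base_pairs_def by auto
  obtain i j k l where "c $ i = -3" "c $ j = -1" "c $ k = 1" "c $ l = 3"
    using base_cfgs_obtain[OF assms] unfolding base_pts_def by (metis insertCI)
  then have "(i, j) \<in> base_pairs c" "(k, l) \<in> base_pairs c"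
    "base_caps = closed_segment (c $ i) (c $ j) \<union> closed_segment (c $ k) (c $ l)"
    unfolding base_pairs_def base_caps_def by auto
  then show "base_caps \<subseteq> cap_set (base_pairs c) c" unfolding cap_set_def by auto
qed

lemma word_knot_plat:
  assumes "c \<in> base_cfgs" "d \<in> base_cfgs" "p 0 = c" "p 1 = d"
  shows "plat (base_pairs c) (base_pairs d) p = {0} \<times> base_caps \<union> strands p \<union> {1} \<times> base_caps"
  unfolding plat_def assms(3,4) by (simp add: base_cap_set assms(1,2))

lemma strands_word_path:
  assumes "c \<in> base_cfgs"
  shows "strands (word_path w c) = {(x, point_path w z x) | x z. x \<in> {0..1} \<and> z \<in> base_pts}"
proof -
  have "\<exists>i. z = c $ i" if "z \<in> base_pts" for z using base_cfgs_obtain[OF assms that] by metis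
  moreover have "c $ i \<in> base_pts" for i using assms by (simp add: base_cfgs_def)
  ultimately show ?thesis unfolding strands_def word_path_nth by blast
qed

abbreviation plat_closure :: "(real \<Rightarrow> complex^4) \<Rightarrow> (real \<times> complex) set" where
  "plat_closure p \<equiv> {0} \<times> base_caps \<union> strands p \<union> {1} \<times> base_caps"

lemma word_knot_closure: "c \<in> base_cfgs \<Longrightarrow> word_knot w = plat_closure (word_path w c)"
  unfolding word_knot_def by (simp add: strands_word_path)

lemma base_cfgs_real: "c \<in> base_cfgs \<Longrightarrow> c $ i \<in> \<real>"
proof -
  assume "c \<in> base_cfgs"
  then have "c $ i \<in> base_pts" by (simp add: base_cfgs_def)
  then show "c $ i \<in> \<real>" unfolding base_pts_def by (elim insertE emptyE) simp_all
qed

lemma plat_closure_homotopic: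
  assumes "homotopic_paths configs p q" "pathstart p \<in> base_cfgs" "pathfinish p \<in> base_cfgs"
  shows "heq (plat_closure p) (plat_closure q)"
proof -
  have e: "p 0 = pathstart p" "p 1 = pathfinish p" "q 0 = pathstart p" "q 1 = pathfinish p"
    using homotopic_paths_imp_pathstart[OF assms(1)] homotopic_paths_imp_pathfinish[OF assms(1)]
    by (auto simp: pathstart_def pathfinish_def)
  have "heq (plat (base_pairs (pathstart p)) (base_pairs (pathfinish p)) p)
     (plat (base_pairs (pathstart p)) (base_pairs (pathfinish p)) q)"
    using assms e by (intro plat_homotopic_paths) (auto simp: base_cfgs_real)
  then show ?thesis using assms(2,3) e by (simp add: word_knot_plat)
qed

text \<open>The labels follow the order of the Lissajous strands used later, in which opposite
  strands have adjacent labels.\<close>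

definition start_cfg :: "complex^4" where "start_cfg = (\<chi> k. if k = 1 then 1 else if k = 2 then -1 else if k = 3 then 3 else -3)"

lemma start_cfg_nth [simp]: "start_cfg $ 1 = 1" "start_cfg $ 2 = -1" "start_cfg $ 3 = 3" "start_cfg $ 4 = -3"
  by (simp_all add: start_cfg_def)

lemma start_cfg_base: "start_cfg \<in> base_cfgs"
  unfolding base_cfgs_def configs_iff forall_4 by (simp add: base_pts_def)

lemma word_knot_sim:
  assumes "word_sim u v" shows "heq (word_knot u) (word_knot v)"
  using plat_closure_homotopic[of "word_path u start_cfg" "word_path v start_cfg"] assms start_cfg_base
  unfolding word_sim_def by (simp add: word_knot_closure[OF start_cfg_base] pathfinish_word_path)

section \<open>Words that are absorbed by the caps\<close>

lemma plat_closure_append: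
  assumes "c \<in> base_cfgs" "homotopic_paths configs (word_path v (pathfinish (word_path w c))) m"
  shows "heq (word_knot (w @ v)) (plat_closure (word_path w c +++ m))"
proof -
  have d: "pathfinish (word_path w c) \<in> base_cfgs" using assms(1) by (rule pathfinish_word_path)
  have "homotopic_paths configs (word_path (w @ v) c) (word_path w c +++ word_path v (pathfinish (word_path w c)))"
    using assms(1) by (rule word_path_append)
  also have "homotopic_paths configs \<dots> (word_path w c +++ m)"
    using assms path_image_word_path by (intro homotopic_paths_join) auto
  finally show ?thesis
    using assms(1) word_knot_closure[OF assms(1)] pathfinish_word_path[OF assms(1)]
    by (metis plat_closure_homotopic pathstart_word_path)
qed

text \<open>If v is traced by an isotopy of the plane that ends by preserving the caps, then this
  isotopy, run over the second half of the x-interval and frozen beyond it, turns the closure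
  without v into the closure with v.\<close>

lemma absorb_motion:
  assumes cont: "continuous_on UNIV (\<lambda>(u,v). \<Phi> u v)" and bij: "\<And>u. bij (\<Phi> u)"
    and 0: "\<Phi> 0 = id" and caps: "\<Phi> 1 ` base_caps = base_caps"
    and hom: "\<And>c. c \<in> base_cfgs \<Longrightarrow> homotopic_paths configs (word_path v c) (\<lambda>u. \<chi> k. \<Phi> u (c $ k))"
  shows "heq (word_knot (w @ v)) (word_knot w)"
proof -
  let ?c = start_cfg
  let ?p = "word_path w ?c"
  let ?d = "pathfinish ?p"
  have d: "?d \<in> base_cfgs" by (rule pathfinish_word_path[OF start_cfg_base])
  let ?m = "\<lambda>u. \<chi> k. \<Phi> u (?d $ k)"
  \<comment> \<open>Joining the paths puts v into [1/2, 1], where 2 x - 1 is its local time;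
    clamping freezes the isotopy at both ends.\<close>
  define H where "H x = \<Phi> (unit_clamp (2 * x - 1))" for x
  have cH: "continuous_on UNIV (\<lambda>(x,v). H x v)"
  proof -
    have "continuous_on UNIV (\<lambda>z::real \<times> complex. (unit_clamp (2 * fst z - 1), snd z))"
      by (intro continuous_intros)
    then show ?thesis
      using continuous_on_compose2[OF cont, of UNIV "\<lambda>z. (unit_clamp (2 * fst z - 1), snd z)"]
      unfolding H_def by (simp add: case_prod_unfold)
  qed
  have H1: "H x ((?p +++ (\<lambda>u. ?d)) x $ i) = (?p +++ ?m) x $ i" if "x \<in> {0..1}" for x i
  proof (cases "x \<le> 1/2")
    case True
    then have "unit_clamp (2 * x - 1) = 0" by auto
    then show ?thesis using True 0 unfolding H_def by (simp add: joinpaths_def)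
  next
    case False
    then have "unit_clamp (2 * x - 1) = 2 * x - 1" using that by auto
    then show ?thesis using False unfolding H_def by (simp add: joinpaths_def)
  qed
  have "(\<lambda>(x,v). (x, H x v)) ` plat_closure (?p +++ (\<lambda>u. ?d)) = plat_closure (?p +++ ?m)"
    unfolding image_Un
  proof (intro arg_cong2[where f="(\<union>)"])
    have "H 0 ` base_caps = base_caps" "H 1 ` base_caps = base_caps" using 0 caps by (simp_all add: H_def)
    moreover have "(\<lambda>(x,v). (x, H x v)) ` ({t} \<times> base_caps) = {t} \<times> H t ` base_caps" for t by auto
    ultimately show "(\<lambda>(x,v). (x, H x v)) ` ({0} \<times> base_caps) = {0} \<times> base_caps"
      "(\<lambda>(x,v). (x, H x v)) ` ({1} \<times> base_caps) = {1} \<times> base_caps" by simp_all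
    show "(\<lambda>(x,v). (x, H x v)) ` strands (?p +++ (\<lambda>u. ?d)) = strands (?p +++ ?m)"
      by (rule strands_fib_image) (rule H1)
  qed
  then have 1: "heq (plat_closure (?p +++ (\<lambda>u. ?d))) (plat_closure (?p +++ ?m))"
    by (intro fibre_map_heq[OF cH]) (auto simp: H_def bij)
  have 2: "heq (word_knot (w @ v)) (plat_closure (?p +++ ?m))"
    by (rule plat_closure_append[OF start_cfg_base hom[OF d]])
  have 3: "heq (word_knot (w @ [])) (plat_closure (?p +++ (\<lambda>u. ?d)))"
  proof (rule plat_closure_append[OF start_cfg_base])
    have "word_path [] ?d = (\<lambda>u. ?d)" by (auto simp: linepath_def fun_eq_iff simp flip: scaleR_left_distrib)
    then show "homotopic_paths configs (word_path [] ?d) (\<lambda>u. ?d)"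
      using path_image_word_path[OF d, of "[]"] path_word_path[of "[]" ?d] by simp
  qed
  show ?thesis using heq_trans[OF 2 heq_trans[OF heq_sym[OF 1] heq_sym[OF 3]]] by simp
qed

text \<open>The angle depends on the distance from s alone, which the map preserves, so the opposite
  angle gives the inverse.\<close>

lemma tapered_rotation_bij:
  fixes s :: complex
  assumes "\<Phi> = (\<lambda>v. s + cis (g (norm (v - s))) * (v - s))"
  shows "bij \<Phi>"
proof (rule o_bij[of "\<lambda>v. s + cis (- g (norm (v - s))) * (v - s)"])
  show "(\<lambda>v. s + cis (- g (norm (v - s))) * (v - s)) \<circ> \<Phi> = id"
    unfolding assms by (auto simp: fun_eq_iff norm_mult mult.assoc[symmetric] cis_mult)
  show "\<Phi> \<circ> (\<lambda>v. s + cis (- g (norm (v - s))) * (v - s)) = id"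
    unfolding assms by (auto simp: fun_eq_iff norm_mult mult.assoc[symmetric] cis_mult)
qed

lemma homotopic_single_letter:
  assumes "c \<in> base_cfgs"
  shows "homotopic_paths configs (word_path [l] c) (letter_path l c)"
  using homotopic_paths_rid[of "letter_path l c" configs] path_image_letter_path[OF assms]
  by simp

lemma cap_left_real: "closed_segment (-3) (-1) = complex_of_real ` {-3..-1}"
  using closed_segment_of_real[of "-3" "-1", where 'a=complex] by (simp add: closed_segment_eq_real_ivl)

lemma cap_right_real: "closed_segment 1 3 = complex_of_real ` {1..3}"
  using closed_segment_of_real[of 1 3, where 'a=complex] by (simp add: closed_segment_eq_real_ivl)

lemma base_caps_real: "base_caps = of_real ` ({-3..-1} \<union> {1..3})"
  unfolding base_caps_def cap_left_real cap_right_real by (simp add: image_Un)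

lemma involution_image: "(\<And>x. x \<in> A \<Longrightarrow> f x \<in> A) \<Longrightarrow> (\<And>x. x \<in> A \<Longrightarrow> f (f x) = x) \<Longrightarrow> f ` A = A"
  by force

text \<open>A rotation about the centre s of one cap: rigid within radius 1, where that cap lies,
  and tapered to rest at radius 2, before the other cap is reached. A cap turned about its centre by
  half turns is mapped to itself.\<close>

lemma absorb_Out:
  fixes s :: real
  assumes s: "s = -2 \<or> s = 2"
    and l: "\<And>z::complex. \<And>u. z \<in> base_pts \<Longrightarrow> turn l u z = (if norm (z - s) = 1 then s + cis (pi * of_int a * u) * (z - s) else z)"
  shows "heq (word_knot (w @ [l])) (word_knot w)"
proof -
  define g where "g u r = pi * of_int a * u * max 0 (min 1 (2 - r))" for u r :: real
  let ?\<Phi> = "\<lambda>u (v::complex). complex_of_real s + cis (g u (norm (v - s))) * (v - s)"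
  show ?thesis
  proof (rule absorb_motion[where \<Phi>="?\<Phi>"])
  show "continuous_on UNIV (\<lambda>(u,v). ?\<Phi> u v)"
    unfolding g_def case_prod_unfold by (intro continuous_intros)
  show "bij (?\<Phi> u)" for u by (rule tapered_rotation_bij[where g="g u"]) simp
  show "?\<Phi> 0 = id" by (auto simp: g_def)
  show "?\<Phi> 1 ` base_caps = base_caps"
  proof (rule involution_image)
    have near: "?\<Phi> 1 v = (if even a then v else 2 * s - v)" if "norm (v - s) \<le> 1" for v :: complex
      using that cis_pi_int[of a] by (simp add: g_def)
    have far: "?\<Phi> 1 v = v" if "norm (v - s) \<ge> 2" for v :: complex
      using that by (simp add: g_def)
    have nf: "(norm (complex_of_real x - s) \<le> 1 \<or> norm (complex_of_real x - s) \<ge> 2)" if "x \<in> {-3..-1} \<union> {1..3}" for x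
      using that s unfolding of_real_diff[symmetric] norm_of_real by auto
    fix v assume "v \<in> base_caps"
    then obtain x where x: "v = of_real x" "x \<in> {-3..-1} \<union> {1..3}" unfolding base_caps_real by blast
    show "?\<Phi> 1 v \<in> base_caps"
    proof (cases "norm (v - s) \<le> 1")
      case True
      then have "2 * s - x \<in> {-3..-1} \<union> {1..3}" using s x(2)
        unfolding x(1) of_real_diff[symmetric] norm_of_real by auto
      then have "2 * complex_of_real s - v \<in> base_caps" unfolding base_caps_real x(1)
        by (intro image_eqI[of _ _ "2 * s - x"]) auto
      then show ?thesis using near[OF True] \<open>v \<in> base_caps\<close> by simp
    next
      case False
      then show ?thesis using far nf[OF x(2)] x(1) \<open>v \<in> base_caps\<close> by auto
    qed
    show "?\<Phi> 1 (?\<Phi> 1 v) = v"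
    proof (cases "norm (v - s) \<le> 1")
      case True
      moreover have "norm (2 * complex_of_real s - v - s) \<le> 1" using True by (simp add: norm_minus_commute)
      ultimately show ?thesis using near[of v] near[of "2 * complex_of_real s - v"] by auto
    next
      case False
      then show ?thesis using far nf[OF x(2)] x(1) by auto
    qed
  qed
  fix c assume c: "c \<in> base_cfgs"
  have "letter_path l c = (\<lambda>u. \<chi> k. ?\<Phi> u (c $ k))"
  proof (intro ext, unfold letter_path_def, intro arg_cong[where f=vec_lambda] ext)
    fix u k
    have z: "c $ k \<in> base_pts" using c by (simp add: base_cfgs_def)
    have "norm (z - s) = 1 \<or> norm (z - s) \<ge> 2" if "z \<in> base_pts" for z :: complex
    proof -
      have "z = of_real (-3) \<or> z = of_real (-1) \<or> z = of_real 1 \<or> z = of_real 3" using that by (auto simp: base_pts_def)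
      then show ?thesis using s by (elim disjE; simp only: of_real_diff[symmetric] norm_of_real; simp)
    qed
    from this[OF z] show "turn l u (c $ k) = ?\<Phi> u (c $ k)" using l[OF z] by (auto simp: g_def)
  qed
  then show "homotopic_paths configs (word_path [l] c) (\<lambda>u. \<chi> k. ?\<Phi> u (c $ k))"
    using homotopic_single_letter[OF c, of l] by simp
  qed
qed

lemma absorb_Out_left: "heq (word_knot (w @ [Out a 0])) (word_knot w)"
proof (rule absorb_Out[where s="-2" and a=a])
  show "turn (Out a 0) u z = (if norm (z - complex_of_real (-2)) = 1 then complex_of_real (-2) + cis (pi * real_of_int a * u) * (z - complex_of_real (-2)) else z)"
    if "z \<in> base_pts" for z u using that by (auto simp: base_pts_def)
qed simp

lemma absorb_Out_right: "heq (word_knot (w @ [Out 0 b])) (word_knot w)"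
proof (rule absorb_Out[where s=2 and a=b])
  show "turn (Out 0 b) u z = (if norm (z - complex_of_real 2) = 1 then complex_of_real 2 + cis (pi * real_of_int b * u) * (z - complex_of_real 2) else z)"
    if "z \<in> base_pts" for z u using that by (auto simp: base_pts_def)
qed simp

text \<open>The rotation of the whole plane by \<open>pi\<close> exchanges the two caps.\<close>

lemma absorb_half_twist: "heq (word_knot (w @ [Mid 1, Out 1 1, Mid 1, Out 1 1])) (word_knot w)"
proof (rule absorb_motion[where \<Phi>="\<lambda>u v. cis (pi * u) * v"])
  let ?\<Phi> = "\<lambda>u v. cis (pi * u) * v"
  show "continuous_on UNIV (\<lambda>(u,v). ?\<Phi> u v)"
    unfolding case_prod_unfold by (intro continuous_intros)
  show "bij (?\<Phi> u)" for u by (rule tapered_rotation_bij[where g="\<lambda>_. pi * u" and s=0]) simp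
  show "?\<Phi> 0 = id" by auto
  show "?\<Phi> 1 ` base_caps = base_caps"
    by (rule involution_image) (auto simp: base_caps_real image_iff intro: bexI[of _ "- _"])
  fix c assume c: "c \<in> base_cfgs"
  show "homotopic_paths configs (word_path [Mid 1, Out 1 1, Mid 1, Out 1 1] c) (\<lambda>u. \<chi> k. ?\<Phi> u (c $ k))"
    by (rule homotopic_word_motion[OF c half_twist_rotation])
      (auto simp: base_pts_def joinpaths_def intro!: continuous_intros)
qed

text \<open>Rescales the part x > a of each line parallel to the x-axis by a factor that depends on
  the line. This one family of homeomorphisms shortens fingers, flattens caps and straightens the
  clasp of the polygon.\<close>

definition half_scale :: "real \<Rightarrow> (complex \<Rightarrow> real) \<Rightarrow> real \<times> complex \<Rightarrow> real \<times> complex" where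
  "half_scale a \<kappa> = (\<lambda>(x,v). (min x a + (max x a - a) * \<kappa> v, v))"

lemma half_scale_simps:
  "x \<le> a \<Longrightarrow> half_scale a \<kappa> (x, v) = (x, v)"
  "x \<ge> a \<Longrightarrow> half_scale a \<kappa> (x, v) = (a + (x - a) * \<kappa> v, v)"
  "\<kappa> v = 1 \<Longrightarrow> half_scale a \<kappa> (x, v) = (x, v)"
  by (auto simp: half_scale_def min_def max_def)

lemma half_scale_inverse:
  assumes "\<And>v. \<kappa> v > 0"
  shows "half_scale a (\<lambda>v. inverse (\<kappa> v)) (half_scale a \<kappa> z) = z"
proof (cases z)
  case (Pair x v)
  show ?thesis
  proof (cases "x \<le> a")
    case True then show ?thesis by (simp add: Pair half_scale_simps)
  next
    case False
    have "a + (x - a) * \<kappa> v \<ge> a" using False assms[of v] by simp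
    then show ?thesis using False assms[of v] by (simp add: Pair half_scale_simps mult.assoc)
  qed
qed

lemma half_scale_homeo:
  assumes "continuous_on UNIV \<kappa>" "\<And>v. \<kappa> v > 0"
  shows "continuous_on UNIV (half_scale a \<kappa>)" "bij (half_scale a \<kappa>)"
proof -
  show "continuous_on UNIV (half_scale a \<kappa>)"
    unfolding half_scale_def case_prod_unfold
    by (intro continuous_intros continuous_on_compose2[OF assms(1)]) auto
  show "bij (half_scale a \<kappa>)"
  proof (rule o_bij[of "half_scale a (\<lambda>v. inverse (\<kappa> v))"])
    show "half_scale a (\<lambda>v. inverse (\<kappa> v)) \<circ> half_scale a \<kappa> = id"
      using half_scale_inverse[of \<kappa>] assms(2) by auto
    show "half_scale a \<kappa> \<circ> half_scale a (\<lambda>v. inverse (\<kappa> v)) = id"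
      using half_scale_inverse[of "\<lambda>v. inverse (\<kappa> v)" a] assms(2) by (auto simp: fun_eq_iff)
  qed
qed

lemma heq_half_scale:
  assumes "continuous_on UNIV \<kappa>" "\<And>v. \<kappa> v > 0" "half_scale a \<kappa> ` K = L"
  shows "heq K L"
  by (rule heqI[OF half_scale_homeo[OF assms(1,2)] assms(3)])

text \<open>The strand rests at \<open>l 0\<close> over [1/2, 3/4] and runs through l over
  [3/4, 1].\<close>

definition loop_strand :: "(real \<Rightarrow> complex) \<Rightarrow> (real \<times> complex) set" where
  "loop_strand l = (\<lambda>x. (x, l (unit_clamp (4 * x - 3)))) ` {1/2..1}"

text \<open>With the finger withdrawn to x \<le> 3/4, the loop has only the strand at -3 to avoid.
  It stays at real part at least -1 and so contracts linearly to -1. The homeomorphism is the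
  identity over 3/4 and 1 and beyond them, hence on A.\<close>

lemma loop_retract:
  fixes l :: "real \<Rightarrow> complex"
  assumes "continuous_on {0..1} l" "\<And>u. u \<in> {0..1} \<Longrightarrow> Re (l u) \<ge> -1" "l 0 = -1" "l 1 = -1"
    and A: "A \<subseteq> {z. fst z \<le> 3/4 \<or> fst z \<ge> 1}"
  shows "heq (A \<union> {1/2..1} \<times> {-3} \<union> loop_strand l) (A \<union> {1/2..1} \<times> {-3} \<union> loop_strand (\<lambda>u. -1))"
proof -
  let ?p = "\<lambda>u. vector [-3, l u] :: complex^2" and ?q = "\<lambda>u. vector [-3, -1] :: complex^2"
  have nth: "vector [x, y] $ (1::2) = x" "vector [x, y] $ (2::2) = y" for x y :: complex
    by (simp_all add: vector_2)
  have "fib_iso {0,1} {} ?p ?q"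
  proof (rule fib_iso_linear)
    show "continuous_on {0..1} ?p"
    proof (rule continuous_on_cong[THEN iffD1, OF refl])
      show "continuous_on {0..1} (\<lambda>u. \<chi> k. if k = (1::2) then -3 else l u)"
      proof (intro continuous_on_vec_lambda)
        fix k :: 2
        show "continuous_on {0..1} (\<lambda>u. if k = 1 then -3 else l u)"
          using assms(1) by (cases "k = 1") auto
      qed
      show "(\<chi> k. if k = (1::2) then -3 else l u) = ?p u" for u
        by (simp add: vec_eq_iff forall_2 nth)
    qed
    show "continuous_on {0..1} ?q" by simp
    show "closed_segment (?p x) (?q x) \<subseteq> configs" if "x \<in> {0..1}" for x
    proof (rule segment_configs)
      fix i j :: 2 assume "i \<noteq> j"
      moreover have "same_side (-3 - l x) (-3 - -1)"
        using assms(2)[OF that] by (auto simp: same_side_def complex_eq_iff)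
      moreover from this have "same_side (l x - -3) (-1 - -3)" by (rule same_side_minus)
      ultimately show "same_side (?p x $ i - ?p x $ j) (?q x $ i - ?q x $ j)"
        using exhaust_2[of i] exhaust_2[of j] by (auto simp: nth)
    qed
    show "?p x = ?q x" if "x \<in> {0,1}" for x using that assms(3,4) by auto
  qed auto
  then obtain H where H: "continuous_on UNIV (\<lambda>(x,v). H x v)" "\<And>x. bij (H x)"
     "\<forall>x\<in>{0..1}. \<forall>i. H x (?p x $ i) = ?q x $ i" "\<forall>x\<in>{0,1}. H x = id" "\<And>x. H x = H (unit_clamp x)"
    unfolding fib_iso_def by blast
  have H3: "H x (-3) = -3" "H x (l x) = -1" if "x \<in> {0..1}" for x
    using H(3) that by (auto simp: forall_2 nth)
  define G where "G x = H (4 * x - 3)" for x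
  have idG: "G x = id" if "x \<le> 3/4 \<or> x \<ge> 1" for x
  proof -
    have "unit_clamp (4 * x - 3) \<in> {0,1}" using that by auto
    then show ?thesis unfolding G_def using H(4) H(5)[of "4 * x - 3"] by metis
  qed
  show ?thesis
  proof (rule fibre_map_heq)
    show "continuous_on UNIV (\<lambda>(x,v). G x v)"
    proof -
      have "continuous_on UNIV (\<lambda>z::real\<times>complex. (4 * fst z - 3, snd z))" by (intro continuous_intros)
      from continuous_on_compose2[OF H(1) this] show ?thesis unfolding G_def by (simp add: case_prod_unfold)
    qed
    show "bij (G x)" for x unfolding G_def by (rule H(2))
    show "(\<lambda>(x,v). (x, G x v)) ` (A \<union> {1/2..1} \<times> {-3} \<union> loop_strand l) = A \<union> {1/2..1} \<times> {-3} \<union> loop_strand (\<lambda>u. -1)"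
      unfolding image_Un
    proof (intro arg_cong2[where f="(\<union>)"])
      have "(case z of (x,v) \<Rightarrow> (x, G x v)) = z" if "z \<in> A" for z
        using idG[of "fst z"] A that by (auto simp: case_prod_unfold)
      then show "(\<lambda>(x,v). (x, G x v)) ` A = A" by simp
      have cl: "G x v = H (unit_clamp (4 * x - 3)) v" for x v unfolding G_def by (subst H(5)) simp
      have "G x (-3) = -3" for x unfolding cl by (rule H3) auto
      then show "(\<lambda>(x,v). (x, G x v)) ` ({1/2..1} \<times> {-3}) = {1/2..1} \<times> {-3}"
        by (auto simp: image_iff)
      have "G x (l (unit_clamp (4 * x - 3))) = -1" for x unfolding cl by (rule H3) auto
      then show "(\<lambda>(x,v). (x, G x v)) ` loop_strand l = loop_strand (\<lambda>u. -1)"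
        unfolding loop_strand_def image_image by (simp only: prod.case)
    qed
  qed
qed

text \<open>Scaling half of space shortens the finger formed by the strands \<open>1\<close>, \<open>3\<close> and their cap,
  so that the loop around them can be contracted.\<close>
lemma finger_move:
  fixes l :: "real \<Rightarrow> complex"
  assumes l: "continuous_on {0..1} l" "\<And>u. u \<in> {0..1} \<Longrightarrow> norm (l u - 2) = 3" "l 0 = -1" "l 1 = -1"
    and Z: "Z \<subseteq> {z. fst z \<le> 1/2}"
  shows "heq (Z \<union> {1/2..1} \<times> {-3,1,3} \<union> loop_strand l \<union> {1} \<times> base_caps)
    (Z \<union> {1/2..1} \<times> {-3,1,3} \<union> loop_strand (\<lambda>u. -1) \<union> {1} \<times> base_caps)"
proof -
  \<comment> \<open>The factor is 1/2 within distance 1 of the point 2, where the finger lies, and 1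
    from distance 2 on, which leaves the loop at distance 3 and the left cap in place.\<close>
  define \<kappa> where "\<kappa> v = 1 - max 0 (min 1 (2 - norm (v - 2))) / 2" for v :: complex
  let ?f = "half_scale (1/2) \<kappa>"
  let ?K = "\<lambda>l. Z \<union> {1/2..1} \<times> {-3,1,3} \<union> loop_strand l \<union> {1} \<times> base_caps"
  let ?A = "Z \<union> {1/2..3/4} \<times> {1,3} \<union> {3/4} \<times> closed_segment 1 3 \<union> {1} \<times> closed_segment (-3) (-1)"
  have \<kappa>: "continuous_on UNIV \<kappa>" "\<And>v. \<kappa> v > 0"
    unfolding \<kappa>_def by (intro continuous_intros) (auto simp: field_simps)
  have near: "?f (x, v) = (x/2 + 1/4, v)" if "norm (v - 2) \<le> 1" "x \<ge> 1/2" for x v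
  proof -
    have "\<kappa> v = 1/2" using that unfolding \<kappa>_def by auto
    then show ?thesis using that by (simp add: half_scale_simps field_simps)
  qed
  have far: "?f (x, v) = (x, v)" if "norm (v - 2) \<ge> 2" for x v
    using that by (intro half_scale_simps) (auto simp: \<kappa>_def)
  have scaled: "heq (?K l) (?A \<union> {1/2..1} \<times> {-3} \<union> loop_strand l)"
    if l: "\<And>u. u \<in> {0..1} \<Longrightarrow> norm (l u - 2) = 3" for l
  proof (rule heq_half_scale[OF \<kappa>, of "1/2"])
    have 0: "?f ` Z = Z"
    proof -
      have "?f z = z" if "z \<in> Z" for z using Z that half_scale_simps(1)[of "fst z" "1/2" \<kappa> "snd z"] by auto
      then show ?thesis by simp
    qed
    have 1: "?f ` ({1/2..1} \<times> {-3}) = {1/2..1} \<times> {-3}"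
    proof -
      have "?f z = z" if "z \<in> {1/2..1} \<times> {-3}" for z using that far[of "-3"] by auto
      then show ?thesis by simp
    qed
    have sc: "(\<lambda>x::real. x/2 + 1/4) ` {1/2..1} = {1/2..3/4}"
    proof (intro set_eqI iffI)
      fix y :: real assume "y \<in> {1/2..3/4}"
      then show "y \<in> (\<lambda>x. x/2 + 1/4) ` {1/2..1}" by (intro image_eqI[of _ _ "2 * y - 1/2"]) (auto simp: field_simps)
    qed auto
    have 2: "?f ` ({1/2..1} \<times> {v}) = {1/2..3/4} \<times> {v}" if "norm (v - 2) \<le> 1" for v
    proof -
      have "?f ` ({1/2..1} \<times> {v}) = (\<lambda>x. (x/2 + 1/4, v)) ` {1/2..1}"
        using near[OF that] by (auto simp: image_iff)
      also have "\<dots> = {1/2..3/4} \<times> {v}" unfolding sc[symmetric] by auto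
      finally show ?thesis .
    qed
    have 3: "?f ` loop_strand l = loop_strand l"
    proof -
      have "?f z = z" if z: "z \<in> loop_strand l" for z
      proof -
        obtain x where "z = (x, l (unit_clamp (4 * x - 3)))" using z unfolding loop_strand_def by blast
        moreover have "norm (l (unit_clamp (4 * x - 3)) - 2) \<ge> 2" using l[of "unit_clamp (4 * x - 3)"] by auto
        ultimately show ?thesis using far by simp
      qed
      then show ?thesis by simp
    qed
    have 4: "?f ` ({1} \<times> closed_segment 1 3) = {3/4} \<times> closed_segment 1 3"
    proof -
      have "?f (1, v) = (3/4, v)" if v: "v \<in> closed_segment 1 3" for v
      proof -
        obtain x where x: "v = of_real x" "x \<in> {1..3}"
          using v unfolding cap_right_real by blast
        have "norm (complex_of_real (x - 2)) \<le> 1" using x(2) unfolding norm_of_real by auto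
        then have "norm (v - 2) \<le> 1" unfolding x(1) by simp
        then show ?thesis by (simp add: near)
      qed
      then show ?thesis by (auto simp: image_iff)
    qed
    have 5: "?f ` ({1} \<times> closed_segment (-3) (-1)) = {1} \<times> closed_segment (-3) (-1)"
    proof -
      have "?f (1, v) = (1, v)" if "v \<in> closed_segment (-3) (-1)" for v
      proof -
        have "Re v \<le> -1" using that unfolding base_caps_def by (auto simp: closed_segment_def)
        then have "norm (v - 2) \<ge> 2" using abs_Re_le_cmod[of "v - 2"] by simp
        then show ?thesis by (simp add: far)
      qed
      then show ?thesis by (auto simp: image_iff)
    qed
    have K: "?K l = Z \<union> {1/2..1} \<times> {1} \<union> {1/2..1} \<times> {3} \<union> {1} \<times> closed_segment 1 3 \<union> {1} \<times> closed_segment (-3) (-1) \<union> {1/2..1} \<times> {-3} \<union> loop_strand l"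
      unfolding base_caps_def by auto
    have A: "?A = Z \<union> {1/2..3/4} \<times> {1} \<union> {1/2..3/4} \<times> {3} \<union> {3/4} \<times> closed_segment 1 3 \<union> {1} \<times> closed_segment (-3) (-1)"
      by auto
    show "?f ` ?K l = ?A \<union> {1/2..1} \<times> {-3} \<union> loop_strand l"
      unfolding K A image_Un 0 1 3 4 5 by (subst (1 2) 2) simp_all
  qed
  have "heq (?K l) (?A \<union> {1/2..1} \<times> {-3} \<union> loop_strand l)" by (rule scaled) (rule l(2))
  also have "heq \<dots> (?A \<union> {1/2..1} \<times> {-3} \<union> loop_strand (\<lambda>u. -1))"
  proof (rule loop_retract)
    show "Re (l u) \<ge> -1" if "u \<in> {0..1}" for u
      using l(2)[OF that] abs_Re_le_cmod[of "l u - 2"] by simp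
  qed (use l Z in auto)
  also have "heq \<dots> (?K (\<lambda>u. -1))" by (rule heq_sym, rule scaled) simp
  finally show ?thesis .
qed

text \<open>The constant path in the middle reserves the slab [1/2, 3/4], in which the withdrawn
  finger can end.\<close>

lemma strands_tail:
  assumes d: "d \<in> base_cfgs" "d = pathfinish p"
    and m: "\<And>z. z \<in> base_pts \<Longrightarrow> z \<noteq> -1 \<Longrightarrow> (\<lambda>u. m z u) = (\<lambda>u. z)" "m (-1) = l" "l 0 = -1"
  shows "plat_closure (p +++ ((\<lambda>u. d) +++ (\<lambda>u. \<chi> k. m (d $ k) u))) =
    ({0} \<times> base_caps \<union> {(x, p (2 * x) $ k) | x k. x \<in> {0..1/2}}) \<union> {1/2..1} \<times> {-3,1,3} \<union> loop_strand l \<union> {1} \<times> base_caps"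
proof -
  let ?q = "p +++ ((\<lambda>u. d) +++ (\<lambda>u. \<chi> k. m (d $ k) u))"
  have q1: "?q x = p (2 * x)" if "x \<le> 1/2" for x using that by (simp add: joinpaths_def)
  have q2: "?q x $ k = m (d $ k) (unit_clamp (4 * x - 3))" if x: "x \<in> {1/2..1}" for x k
  proof -
    have d0: "m (d $ k) 0 = d $ k" using m d(1) by (cases "d $ k = -1") (auto simp: base_cfgs_def dest: fun_cong)
    have e: "2 * (2 * x - 1) - 1 = 4 * x - 3" by simp
    consider "x = 1/2" | "x > 1/2" "x \<le> 3/4" | "x > 3/4" using x by fastforce
    then show ?thesis
    proof cases
      case 1
      show ?thesis unfolding 1 using d0 d(2) by (simp add: joinpaths_def pathfinish_def)
    next
      case 2 then show ?thesis using d0 by (simp add: joinpaths_def)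
    next
      case 3 then show ?thesis using x e by (simp add: joinpaths_def)
    qed
  qed
  have "strands ?q = {(x, ?q x $ k) |x k. x \<in> {0..1/2}} \<union> {(x, ?q x $ k) |x k. x \<in> {1/2..1}}"
    unfolding strands_def by auto
  also have "{(x, ?q x $ k) |x k. x \<in> {0..1/2}} = {(x, p (2 * x) $ k) | x k. x \<in> {0..1/2}}"
    using q1 by auto
  also have "{(x, ?q x $ k) |x k. x \<in> {1/2..1}} = {1/2..1} \<times> {-3,1,3} \<union> loop_strand l" (is "?L = ?R")
  proof (intro set_eqI iffI)
    fix y assume "y \<in> ?L"
    then obtain x k where y: "y = (x, ?q x $ k)" "x \<in> {1/2..1}" by blast
    have "d $ k \<in> base_pts" using d(1) by (simp add: base_cfgs_def)
    then show "y \<in> ?R" using y q2[OF y(2), of k] m(1)[of "d $ k"] m(2) unfolding loop_strand_def base_pts_def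
      by (cases "d $ k = -1") (auto dest: fun_cong)
  next
    fix y assume "y \<in> ?R"
    then consider x z where "y = (x, z)" "x \<in> {1/2..1}" "z \<in> {-3,1,3}" | x where "y = (x, l (unit_clamp (4 * x - 3)))" "x \<in> {1/2..1}"
      unfolding loop_strand_def by blast
    then show "y \<in> ?L"
    proof cases
      case 1
      then have z: "z \<in> base_pts" "z \<noteq> -1" by (auto simp: base_pts_def)
      then obtain k where "d $ k = z" using base_cfgs_obtain[OF d(1)] by metis
      then have "y = (x, ?q x $ k)" using 1 q2[OF 1(2), of k] m(1)[OF z] by (auto dest: fun_cong)
      then show ?thesis using 1 by blast
    next
      case 2
      obtain k where "d $ k = -1" using base_cfgs_obtain[OF d(1), of "-1"] by (auto simp: base_pts_def)
      then have "y = (x, ?q x $ k)" using 2 q2[OF 2(2), of k] m(2) by auto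
      then show ?thesis using 2 by blast
    qed
  qed
  finally show ?thesis by auto
qed

text \<open>The word moves a strand once around the finger that ends in the right cap, so the loop
  can be slipped off over the tip. In contrast to the other absorptions, this move does not preserve
  the fibres.\<close>

lemma absorb_loop: "heq (word_knot (w @ [Mid 1, Out 0 2, Mid 1])) (word_knot w)"
proof -
  let ?p = "word_path w start_cfg"
  let ?d = "pathfinish ?p"
  have d: "?d \<in> base_cfgs" by (rule pathfinish_word_path[OF start_cfg_base])
  define l where "l = loop_motion (-1)"
  have l_eq: "l u = 2 - 3 * cis (2 * pi * loop_param u)" for u by (simp add: l_def loop_motion_def)
  have lp: "continuous_on {0..1} loop_param"
  proof -
    have "loop_param u = max (u/2) (min (2 * u - 3/4) 1)" if "u \<in> {0..1}" for u
      using that by (auto simp: loop_param_def max_def min_def field_simps)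
    moreover have "continuous_on {0..1} (\<lambda>u::real. max (u/2) (min (2 * u - 3/4) 1))" by (intro continuous_intros) auto
    ultimately show ?thesis using continuous_on_eq by (metis (no_types, lifting))
  qed
  have l: "continuous_on {0..1} l" "norm (l u - 2) = 3" "l 0 = -1" "l 1 = -1" for u
    unfolding l_eq[abs_def] by (intro continuous_intros lp) (simp_all add: l_eq norm_mult loop_param_def)
  let ?m = "\<lambda>u. \<chi> k. loop_motion (?d $ k) u"
  let ?c = "\<lambda>u::real. ?d"
  have cc: "?c = (\<lambda>u. \<chi> k. (\<lambda>z u. z) (?d $ k) u)" by (simp add: vec_eq_iff)
  have const: "linepath ?d ?d = ?c" by (auto simp: linepath_def fun_eq_iff simp flip: scaleR_left_distrib)
  have m: "homotopic_paths configs (word_path [Mid 1, Out 0 2, Mid 1] ?d) ?m"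
  proof (rule homotopic_word_motion[OF d loop_around])
    show "continuous_on {0..1} (loop_motion z)" if "z \<in> base_pts" for z
      using l(1) that unfolding l_def by (cases "z = -1") (auto simp: loop_motion_def)
    have "cis (pi * 2) = 1" by (metis cis_2pi mult.commute)
    then show "loop_motion z 0 = z" "loop_motion z 1 = point_path [Mid 1, Out 0 2, Mid 1] z 1" if "z \<in> base_pts" for z
      using that by (auto simp: loop_motion_def loop_param_def base_pts_def joinpaths_def)
  qed
  have lid: "homotopic_paths configs q (?c +++ q)" if "path q" "path_image q \<subseteq> configs" "pathstart q = ?d" for q
    using homotopic_paths_lid[of q configs] that const by (simp add: homotopic_paths_sym)
  have 1: "homotopic_paths configs (word_path [Mid 1, Out 0 2, Mid 1] ?d) (?c +++ ?m)"
    using homotopic_paths_imp_path[OF m] homotopic_paths_imp_subset[OF m] homotopic_paths_imp_pathstart[OF m]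
    by (intro homotopic_paths_trans[OF m] lid) auto
  have 2: "homotopic_paths configs (word_path [] ?d) (?c +++ ?c)"
  proof -
    have "word_path [] ?d = ?c" using const by simp
    then show ?thesis using lid[of ?c] base_cfgs_configs[OF d]
      by (auto simp: path_def path_image_def pathstart_def)
  qed
  have "heq (word_knot (w @ [Mid 1, Out 0 2, Mid 1])) (plat_closure (?p +++ (?c +++ ?m)))"
    by (rule plat_closure_append[OF start_cfg_base 1])
  also have "plat_closure (?p +++ (?c +++ ?m)) =
      ({0} \<times> base_caps \<union> {(x, ?p (2 * x) $ k) | x k. x \<in> {0..1/2}}) \<union> {1/2..1} \<times> {-3,1,3} \<union> loop_strand l \<union> {1} \<times> base_caps"
    by (rule strands_tail[OF d refl, where m=loop_motion]) (auto simp: l_def l(3)[unfolded l_def])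
  also have "heq \<dots> (({0} \<times> base_caps \<union> {(x, ?p (2 * x) $ k) | x k. x \<in> {0..1/2}}) \<union> {1/2..1} \<times> {-3,1,3} \<union> loop_strand (\<lambda>u. -1) \<union> {1} \<times> base_caps)"
    by (rule finger_move) (use l in auto)
  also have "\<dots> = plat_closure (?p +++ (?c +++ ?c))"
    by (subst (2) cc, rule strands_tail[OF d refl, where m="\<lambda>z u. z", symmetric]) auto
  also have "heq \<dots> (word_knot (w @ []))"
    by (rule heq_sym, rule plat_closure_append[OF start_cfg_base 2])
  finally show ?thesis by simp
qed

subsection \<open>Reversal and mirror image\<close>

lemma letter_path_reverse:
  assumes "c \<in> base_cfgs"
  shows "letter_path (inverse_letter l) (letter_path l c 1) = reversepath (letter_path l c)"
proof
  fix u
  have "turn (inverse_letter l) u (turn l 1 z) = turn l (1 - u) z" if "z \<in> base_pts" for z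
  proof (cases l)
    case (Mid s)
    have "cis (pi * s * (1 - u)) = cis (- (pi * s * u)) * cis (pi * s)"
      by (simp add: cis_mult algebra_simps)
    then show ?thesis using that unfolding base_pts_def Mid by (auto simp: cis_pi_int)
  next
    case (Out a b)
    have "cis (pi * a * (1 - u)) = cis (- (pi * a * u)) * cis (pi * a)"
       "cis (pi * b * (1 - u)) = cis (- (pi * b * u)) * cis (pi * b)"
      by (simp_all add: cis_mult algebra_simps)
    then show ?thesis using that unfolding base_pts_def Out by (auto simp: cis_pi_int)
  qed
  then show "letter_path (inverse_letter l) (letter_path l c 1) u = reversepath (letter_path l c) u"
    using assms by (simp add: letter_path_def reversepath_def vec_eq_iff base_cfgs_def)
qed

lemma word_path_reverse:
  assumes "c \<in> base_cfgs"
  shows "homotopic_paths configs (word_path (inverse_word w) (pathfinish (word_path w c))) (reversepath (word_path w c))"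
  using assms
proof (induction w arbitrary: c)
  case Nil
  have "linepath c c = (\<lambda>u. c)" by (auto simp: linepath_def fun_eq_iff simp flip: scaleR_left_distrib)
  then show ?case using Nil base_cfgs_configs[OF Nil]
    by (auto simp: inverse_word_def reversepath_def pathfinish_def path_def path_image_def)
next
  case (Cons l w)
  let ?c = "letter_path l c 1"
  let ?e = "pathfinish (word_path w ?c)"
  have c: "?c \<in> base_cfgs" using Cons.prems by (rule letter_path_1)
  have e: "?e \<in> base_cfgs" using c by (rule pathfinish_word_path)
  have IH: "homotopic_paths configs (word_path (inverse_word w) ?e) (reversepath (word_path w ?c))"
    using Cons.IH[OF c] .
  have f: "pathfinish (word_path (inverse_word w) ?e) = ?c"
    using homotopic_paths_imp_pathfinish[OF IH] by simp
  have single: "homotopic_paths configs (word_path [inverse_letter l] ?c) (reversepath (letter_path l c))"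
    using homotopic_single_letter[OF c, of "inverse_letter l"] letter_path_reverse[OF Cons.prems] by simp
  have "homotopic_paths configs (word_path (inverse_word w @ [inverse_letter l]) ?e)
     (word_path (inverse_word w) ?e +++ word_path [inverse_letter l] ?c)"
    using word_path_append[OF e, of "inverse_word w" "[inverse_letter l]"] unfolding f .
  also have "homotopic_paths configs \<dots> (reversepath (word_path w ?c) +++ reversepath (letter_path l c))"
    using f by (intro homotopic_paths_join IH single) simp
  also have "\<dots> = reversepath (letter_path l c +++ word_path w ?c)"
    by (simp add: reversepath_joinpaths)
  finally show ?case by (simp add: inverse_word_def)
qed

text \<open>Reflecting the x-axis reads the word backwards with every turn reversed.\<close>

lemma word_knot_inverse: "heq (word_knot w) (word_knot (inverse_word w))"
proof -
  let ?p = "word_path w start_cfg"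
  let ?d = "pathfinish ?p"
  have d: "?d \<in> base_cfgs" by (rule pathfinish_word_path[OF start_cfg_base])
  let ?f = "\<lambda>(x::real, v::complex). (1 - x, v)"
  have "?f ` plat_closure ?p = plat_closure (reversepath ?p)"
  proof -
    have s: "?f ` strands ?p = strands (reversepath ?p)"
    proof (intro set_eqI iffI)
      fix y assume "y \<in> ?f ` strands ?p"
      then show "y \<in> strands (reversepath ?p)" unfolding strands_def reversepath_def by force
    next
      fix y assume "y \<in> strands (reversepath ?p)"
      then obtain x k where "y = (x, ?p (1 - x) $ k)" "x \<in> {0..1}" unfolding strands_def reversepath_def by auto
      then have "y = ?f (1 - x, ?p (1 - x) $ k)" "(1 - x, ?p (1 - x) $ k) \<in> strands ?p" unfolding strands_def by auto
      then show "y \<in> ?f ` strands ?p" by blast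
    qed
    have "?f ` ({t} \<times> base_caps) = {1 - t} \<times> base_caps" for t by auto
    then show ?thesis unfolding image_Un s by auto
  qed
  moreover have "bij ?f" by (rule o_bij[of ?f]) auto
  moreover have "continuous_on UNIV ?f" unfolding case_prod_unfold by (intro continuous_intros)
  ultimately have "heq (plat_closure ?p) (plat_closure (reversepath ?p))" by (intro heqI)
  also have "heq \<dots> (plat_closure (word_path (inverse_word w) ?d))"
    by (rule plat_closure_homotopic[OF homotopic_paths_sym[OF word_path_reverse[OF start_cfg_base]]])
      (use d start_cfg_base in auto)
  finally show ?thesis by (simp add: word_knot_closure[OF start_cfg_base, symmetric] word_knot_closure[OF d, symmetric])
qed

lemma point_path_mirror:
  assumes "z \<in> \<real>"
  shows "point_path (map inverse_letter w) z u = cnj (point_path w z u)"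
proof -
  have t: "turn (inverse_letter l) u (cnj z) = cnj (turn l u z)" for l u z
  proof -
    have "cnj z = r \<longleftrightarrow> z = r" if "r \<in> \<real>" for r using that by (metis Reals_cnj_iff complex_cnj_cancel_iff)
    then show ?thesis by (cases l) (auto simp: cis_cnj)
  qed
  have "point_path (map inverse_letter w) (cnj z) u = cnj (point_path w z u)" for z
    by (induction w arbitrary: z u) (auto simp: joinpaths_def t)
  then show ?thesis using assms by (metis Reals_cnj_iff)
qed

text \<open>Conjugation in all fibres is a reflection of space, which \<open>heq\<close> admits.
  Combined with \<open>word_knot_inverse\<close> it reads a word backwards with its exponents
  unchanged.\<close>

lemma word_knot_mirror: "heq (word_knot w) (word_knot (map inverse_letter w))"
proof (rule fibre_map_heq[where H="\<lambda>x. cnj"])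
  show "continuous_on UNIV (\<lambda>(x::real, v). cnj v)" unfolding case_prod_unfold by (intro continuous_intros)
  show "bij cnj" by (rule o_bij[of cnj]) auto
  have base: "cnj v = v" if "v \<in> base_caps \<or> v \<in> base_pts" for v
    using that by (auto simp: base_caps_real base_pts_def)
  have real: "z \<in> \<real>" if "z \<in> base_pts" for z
    using that base by (simp add: Reals_cnj_iff)
  show "(\<lambda>(x, v). (x, cnj v)) ` word_knot w = word_knot (map inverse_letter w)"
    unfolding word_knot_def image_Un
  proof (intro arg_cong2[where f="(\<union>)"])
    have "cnj ` base_caps = id ` base_caps" by (rule image_cong) (use base in auto)
    moreover have "(\<lambda>(x, v). (x, cnj v)) ` ({t} \<times> base_caps) = {t} \<times> cnj ` base_caps" for t :: real by auto
    ultimately have m: "(\<lambda>(x, v). (x, cnj v)) ` ({t} \<times> base_caps) = {t} \<times> base_caps" for t :: real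
      by (simp only: image_id id_apply)
    show "(\<lambda>(x, v). (x, cnj v)) ` ({0::real} \<times> base_caps) = {0} \<times> base_caps"
      "(\<lambda>(x, v). (x, cnj v)) ` ({1::real} \<times> base_caps) = {1} \<times> base_caps" by (rule m)+
    let ?L = "(\<lambda>(x, v). (x, cnj v)) ` {(x, point_path w z x) |x z. x \<in> {0..1} \<and> z \<in> base_pts}"
    let ?R = "{(x, point_path (map inverse_letter w) z x) |x z. x \<in> {0..1} \<and> z \<in> base_pts}"
    show "?L = ?R"
    proof (intro set_eqI iffI)
      fix y assume "y \<in> ?L"
      then obtain x z where xz: "y = (x, cnj (point_path w z x))" "x \<in> {0..1}" "z \<in> base_pts" by auto
      then have "y = (x, point_path (map inverse_letter w) z x)" using point_path_mirror[OF real[OF xz(3)]] by simp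
      then show "y \<in> ?R" using xz(2,3) by blast
    next
      fix y assume "y \<in> ?R"
      then obtain x z where xz: "y = (x, point_path (map inverse_letter w) z x)" "x \<in> {0..1}" "z \<in> base_pts" by auto
      then have "y = (\<lambda>(x, v). (x, cnj v)) (x, point_path w z x)" using point_path_mirror[OF real[OF xz(3)]] by simp
      then show "y \<in> ?L" using xz(2,3) by blast
    qed
  qed
qed

subsection \<open>Simplifying plats of four strands\<close>

context
  notes add_uminus_conv_diff [simp del]
begin

lift_definition knot_eq :: "braid \<Rightarrow> braid \<Rightarrow> bool" is "\<lambda>u v. heq (word_knot u) (word_knot v)"
  using word_knot_sim heq_trans heq_sym by blast

lemma knot_eq_refl [simp]: "knot_eq x x" by transfer simp
lemma knot_eq_sym: "knot_eq x y \<Longrightarrow> knot_eq y x" by transfer (rule heq_sym)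
lemma knot_eq_trans [trans]: "knot_eq x y \<Longrightarrow> knot_eq y z \<Longrightarrow> knot_eq x z" by transfer (rule heq_trans)

lemma knot_eq_braid_of: "knot_eq (braid_of u) (braid_of v) \<longleftrightarrow> heq (word_knot u) (word_knot v)"
  by transfer simp

lemma braid_of_surj: obtains w where "x = braid_of w"
  by transfer auto

lemma knot_eq_minus: "knot_eq x (- x)"
  by transfer (rule word_knot_inverse)

text \<open>A property of the braid at the end of a word, for all words before it. The absorbed
  braids form a subgroup, but it is not clear that conjugates are absorbed; this is what the flypes
  below provide.\<close>

definition absorbed :: "braid \<Rightarrow> bool" where
  "absorbed g \<longleftrightarrow> (\<forall>x. knot_eq (x + g) x)"

lemma absorbed_word: "(\<And>w. heq (word_knot (w @ v)) (word_knot w)) \<Longrightarrow> absorbed (braid_of v)"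
  unfolding absorbed_def by transfer simp

lemma absorbed_0 [simp]: "absorbed 0" by (simp add: absorbed_def)

lemma absorbed_add: "absorbed g \<Longrightarrow> absorbed h \<Longrightarrow> absorbed (g + h)"
  unfolding absorbed_def by (metis add.assoc knot_eq_trans)

lemma absorbed_minus: "absorbed g \<Longrightarrow> absorbed (- g)"
  unfolding absorbed_def by (metis knot_eq_sym minus_add_cancel add.assoc add.right_neutral left_minus)

lemma absorbed_\<sigma>: "absorbed \<sigma>1" "absorbed \<sigma>3"
  unfolding \<sigma>1_def \<sigma>3_def by (rule absorbed_word, rule absorb_Out_left absorb_Out_right)+

lemma braid_Out11: "braid_of [Out 1 1] = \<sigma>1 + \<sigma>3"
  using braid_Out[of 1 0 0 1] by (simp add: \<sigma>1_def \<sigma>3_def)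

lemma absorbed_half_twist: "absorbed (\<sigma>2 + (\<sigma>1 + (\<sigma>3 + (\<sigma>2 + (\<sigma>1 + \<sigma>3)))))"
  using absorbed_word[OF absorb_half_twist]
  by (simp add: braid_of_Cons[of _ "_ # _"] braid_Out11 add.assoc flip: \<sigma>2_def)

lemma absorbed_loop: "absorbed (\<sigma>2 + (\<sigma>3 + (\<sigma>3 + \<sigma>2)))"
proof -
  have "braid_of [Out 0 2] = \<sigma>3 + \<sigma>3" using braid_Out[of 0 0 1 1] by (simp add: \<sigma>3_def)
  then show ?thesis using absorbed_word[OF absorb_loop]
    by (simp add: braid_of_Cons[of _ "_ # _"] add.assoc flip: \<sigma>2_def)
qed

section \<open>The normal subgroup of flypes\<close>

lemmas braid_rel_12' = arg_cong[OF braid_rel_12, of "\<lambda>y. y + x" for x, unfolded add.assoc]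
lemmas braid_rel_23' = arg_cong[OF braid_rel_23, of "\<lambda>y. y + x" for x, unfolded add.assoc]
lemmas braid_rel_13' = arg_cong[OF braid_rel_13, of "\<lambda>y. y + x" for x, unfolded add.assoc]

text \<open>Flypes: \<open>flype_a\<close> and \<open>flype_b\<close> generate a normal subgroup of the braid group whose elements
  are all absorbed by the cap, so they may be inserted or removed anywhere in a word.\<close>
definition "flype_a = \<sigma>1 + - \<sigma>3"
definition "flype_b = \<sigma>2 + (flype_a + - \<sigma>2)"

text \<open>The braid relation as an exchange of roles in a conjugation; this form and
  \<open>conj_12\<close> slide letters through the flype generators.\<close>

lemma conj_32: "- \<sigma>3 + (- \<sigma>2 + \<sigma>3) = \<sigma>2 + (- \<sigma>3 + - \<sigma>2)"
proof -
  have "\<sigma>3 = \<sigma>2 + (\<sigma>3 + (\<sigma>2 + (- \<sigma>3 + - \<sigma>2)))" unfolding braid_rel_23' by simp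
  then have "- \<sigma>3 + (- \<sigma>2 + \<sigma>3) = - \<sigma>3 + (- \<sigma>2 + (\<sigma>2 + (\<sigma>3 + (\<sigma>2 + (- \<sigma>3 + - \<sigma>2)))))"
    by (rule arg_cong)
  then show ?thesis by simp
qed

lemma conj_12: "- \<sigma>1 + (\<sigma>2 + \<sigma>1) = \<sigma>2 + (\<sigma>1 + - \<sigma>2)"
proof -
  have "\<sigma>1 + (- \<sigma>1 + (\<sigma>2 + \<sigma>1)) + \<sigma>2 = \<sigma>1 + (\<sigma>2 + (\<sigma>1 + - \<sigma>2)) + \<sigma>2"
    by (simp add: add.assoc braid_rel_12)
  then show ?thesis by simp
qed

lemmas conj_32' = arg_cong[OF conj_32, of "\<lambda>y. y + x" for x, unfolded add.assoc]
lemmas conj_12' = arg_cong[OF conj_12, of "\<lambda>y. y + x" for x, unfolded add.assoc]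

lemma minus_flype_a: "- flype_a = \<sigma>3 + - \<sigma>1"
  by (simp add: flype_a_def minus_add)

text \<open>Together with \<open>flype_conj_3\<close>, \<open>flype_conj_2\<close> and the
  definition of \<open>flype_b\<close>, this describes how the generators of the braid group act on
  the two flypes by conjugation: the results are again words in the flypes.\<close>

lemma flype_conj_1: "\<sigma>1 + (flype_b + - \<sigma>1) = flype_b + - flype_a"
proof -
  have "flype_b + - flype_a = \<sigma>2 + (\<sigma>1 + (- \<sigma>3 + (- \<sigma>2 + (\<sigma>3 + - \<sigma>1))))"
    unfolding minus_flype_a by (simp add: flype_b_def flype_a_def add.assoc)
  also have "\<dots> = \<sigma>2 + (\<sigma>1 + (\<sigma>2 + (- \<sigma>3 + (- \<sigma>2 + - \<sigma>1))))"
    unfolding conj_32' ..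
  also have "\<dots> = \<sigma>1 + (\<sigma>2 + (\<sigma>1 + (- \<sigma>3 + (- \<sigma>2 + - \<sigma>1))))"
    by (rule braid_rel_12')
  finally show ?thesis by (simp add: flype_b_def flype_a_def add.assoc)
qed

lemma conj_23: "- \<sigma>3 + (- \<sigma>2 + - \<sigma>3) = - \<sigma>2 + (- \<sigma>3 + - \<sigma>2)"
  using arg_cong[OF braid_rel_23, of uminus] by (simp add: minus_add add.assoc)

lemma flype_conj_3: "\<sigma>3 + (flype_b + - \<sigma>3) = - flype_a + flype_b"
proof -
  have "- flype_a + flype_b = \<sigma>3 + (- \<sigma>1 + (\<sigma>2 + (\<sigma>1 + (- \<sigma>3 + - \<sigma>2))))"
    unfolding minus_flype_a by (simp add: flype_b_def flype_a_def add.assoc)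
  also have "\<dots> = \<sigma>3 + (\<sigma>2 + (\<sigma>1 + (- \<sigma>2 + (- \<sigma>3 + - \<sigma>2))))"
    unfolding conj_12' ..
  also have "\<dots> = \<sigma>3 + (\<sigma>2 + (\<sigma>1 + (- \<sigma>3 + (- \<sigma>2 + - \<sigma>3))))"
    unfolding conj_23 ..
  finally show ?thesis by (simp add: flype_b_def flype_a_def add.assoc)
qed

lemma commute_13_minus: "- \<sigma>3 + (\<sigma>1 + x) = \<sigma>1 + (- \<sigma>3 + x)"
proof -
  have "\<sigma>3 + (- \<sigma>3 + (\<sigma>1 + x)) = \<sigma>3 + (\<sigma>1 + (- \<sigma>3 + x))"
    unfolding braid_rel_13'[symmetric] by simp
  then show ?thesis by simp
qed

lemma flype_conj_2: "\<sigma>2 + (flype_b + - \<sigma>2) = flype_b + (- flype_a + flype_b)"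
proof -
  have "flype_b + (- flype_a + flype_b) =
      \<sigma>2 + (\<sigma>1 + (- \<sigma>3 + (- \<sigma>2 + (\<sigma>3 + (- \<sigma>1 + (\<sigma>2 + (\<sigma>1 + (- \<sigma>3 + - \<sigma>2))))))))"
    unfolding minus_flype_a by (simp add: flype_b_def flype_a_def add.assoc)
  also have "\<dots> = \<sigma>2 + (\<sigma>1 + (\<sigma>2 + (- \<sigma>3 + (- \<sigma>2 + (\<sigma>2 + (\<sigma>1 + (- \<sigma>2 + (- \<sigma>3 + - \<sigma>2))))))))"
    unfolding conj_32' conj_12' ..
  also have "\<dots> = \<sigma>2 + (\<sigma>1 + (\<sigma>2 + (\<sigma>1 + (- \<sigma>3 + (- \<sigma>2 + (- \<sigma>3 + - \<sigma>2))))))"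
    by (simp add: commute_13_minus)
  also have "\<dots> = \<sigma>2 + (\<sigma>2 + (\<sigma>1 + (\<sigma>2 + (- \<sigma>3 + (- \<sigma>2 + (- \<sigma>3 + - \<sigma>2))))))"
    unfolding braid_rel_12'[symmetric] ..
  also have "- \<sigma>3 + (- \<sigma>2 + (- \<sigma>3 + - \<sigma>2)) = - \<sigma>2 + (- \<sigma>3 + (- \<sigma>2 + - \<sigma>2))"
    using arg_cong[OF conj_23, of "\<lambda>y. y + - \<sigma>2"] by (simp add: add.assoc)
  finally show ?thesis by (simp add: flype_b_def flype_a_def add.assoc)
qed

text \<open>The subgroup generated by the two flypes, presented as words that grow on the left, so
  that inductions peel off one generator at a time.\<close>

inductive_set flypes :: "braid set" where
  zero: "0 \<in> flypes"
| a: "g \<in> flypes \<Longrightarrow> flype_a + g \<in> flypes"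
| a': "g \<in> flypes \<Longrightarrow> - flype_a + g \<in> flypes"
| b: "g \<in> flypes \<Longrightarrow> flype_b + g \<in> flypes"
| b': "g \<in> flypes \<Longrightarrow> - flype_b + g \<in> flypes"

lemma flypes_add: "g \<in> flypes \<Longrightarrow> h \<in> flypes \<Longrightarrow> g + h \<in> flypes"
  by (induction rule: flypes.induct) (auto simp: add.assoc intro: flypes.intros)

lemma flypes_gens: "flype_a \<in> flypes" "flype_b \<in> flypes" "- flype_a \<in> flypes" "- flype_b \<in> flypes"
  using flypes.intros(2-5)[OF flypes.zero] by simp_all

lemma flypes_minus: "g \<in> flypes \<Longrightarrow> - g \<in> flypes"
  by (induction rule: flypes.induct) (auto simp: minus_add intro!: flypes_add flypes_gens flypes.zero)

lemma flypes_conj: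
  assumes "s + (flype_a + - s) \<in> flypes" "s + (flype_b + - s) \<in> flypes" "g \<in> flypes"
  shows "s + (g + - s) \<in> flypes"
  using assms(3)
proof (induction rule: flypes.induct)
  case zero then show ?case by (simp add: flypes.zero)
next
  case (a g)
  have "s + ((flype_a + g) + - s) = (s + (flype_a + - s)) + (s + (g + - s))" by (simp add: add.assoc)
  then show ?case using flypes_add[OF assms(1) a.IH] by simp
next
  case (a' g)
  have "s + ((- flype_a + g) + - s) = - (s + (flype_a + - s)) + (s + (g + - s))" by (simp add: add.assoc minus_add)
  then show ?case using flypes_add[OF flypes_minus[OF assms(1)] a'.IH] by simp
next
  case (b g)
  have "s + ((flype_b + g) + - s) = (s + (flype_b + - s)) + (s + (g + - s))" by (simp add: add.assoc)
  then show ?case using flypes_add[OF assms(2) b.IH] by simp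
next
  case (b' g)
  have "s + ((- flype_b + g) + - s) = - (s + (flype_b + - s)) + (s + (g + - s))" by (simp add: add.assoc minus_add)
  then show ?case using flypes_add[OF flypes_minus[OF assms(2)] b'.IH] by simp
qed

text \<open>Only one inclusion is demanded, so a generator and its inverse are treated
  separately.\<close>

definition normalizes :: "braid \<Rightarrow> bool" where
  "normalizes x \<longleftrightarrow> (\<forall>g\<in>flypes. - x + (g + x) \<in> flypes)"

lemma normalizes_add: "normalizes x \<Longrightarrow> normalizes y \<Longrightarrow> normalizes (x + y)"
proof -
  assume "normalizes x" "normalizes y"
  moreover have "- (x + y) + (g + (x + y)) = - y + ((- x + (g + x)) + y)" for g
    by (simp add: minus_add add.assoc)
  ultimately show "normalizes (x + y)" unfolding normalizes_def by simp
qed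

lemma normalizesI:
  "- x + (flype_a + x) \<in> flypes \<Longrightarrow> - x + (flype_b + x) \<in> flypes \<Longrightarrow> normalizes x"
  unfolding normalizes_def using flypes_conj[of "- x"] by simp

lemma commute_a: "\<sigma>1 + (flype_a + - \<sigma>1) = flype_a" "\<sigma>3 + (flype_a + - \<sigma>3) = flype_a"
  "- \<sigma>1 + (flype_a + \<sigma>1) = flype_a" "- \<sigma>3 + (flype_a + \<sigma>3) = flype_a"
proof -
  have 3: "- \<sigma>3 + - \<sigma>1 = - \<sigma>1 + - \<sigma>3" using arg_cong[OF braid_rel_13, of uminus] by (simp add: minus_add)
  then show "\<sigma>1 + (flype_a + - \<sigma>1) = flype_a" by (simp add: flype_a_def add.assoc)
  show "\<sigma>3 + (flype_a + - \<sigma>3) = flype_a" unfolding flype_a_def add.assoc braid_rel_13'[symmetric] by simp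
  show "- \<sigma>1 + (flype_a + \<sigma>1) = flype_a" using commute_13_minus[of 0] by (simp add: flype_a_def add.assoc)
  show "- \<sigma>3 + (flype_a + \<sigma>3) = flype_a" using commute_13_minus[of 0] by (simp add: flype_a_def add.assoc)
qed

text \<open>For the inverse generators the conjugation formulas apply as they stand. For the
  generators themselves the action has to be inverted by exhibiting preimages, such as
  \<open>flype_a + (- flype_b + flype_a)\<close> for \<open>flype_a\<close> under \<sigma>2.\<close>

lemma normalizes_gens:
  "normalizes \<sigma>1" "normalizes (- \<sigma>1)" "normalizes \<sigma>2" "normalizes (- \<sigma>2)" "normalizes \<sigma>3" "normalizes (- \<sigma>3)"
proof -
  have cancel: "- s + (x + s) = y" if "s + (y + - s) = x" for s x y :: braid
    using that by (auto simp: add.assoc)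
  show "normalizes (- \<sigma>1)"
    by (rule normalizesI) (simp_all add: commute_a flype_conj_1 flypes_gens flypes_add)
  show "normalizes (- \<sigma>3)"
    by (rule normalizesI) (simp_all add: commute_a flype_conj_3 flypes_gens flypes_add)
  show "normalizes (- \<sigma>2)"
    by (rule normalizesI) (simp_all add: flype_conj_2 flypes_gens flypes_add flip: flype_b_def)
  have "\<sigma>1 + ((flype_b + flype_a) + - \<sigma>1) = (\<sigma>1 + (flype_b + - \<sigma>1)) + (\<sigma>1 + (flype_a + - \<sigma>1))"
    by (simp add: add.assoc)
  then have "- \<sigma>1 + (flype_b + \<sigma>1) = flype_b + flype_a"
    by (intro cancel) (simp add: commute_a flype_conj_1 add.assoc)
  then show "normalizes \<sigma>1"
    by (intro normalizesI) (simp_all add: commute_a flypes_gens flypes_add)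
  have "\<sigma>3 + ((flype_a + flype_b) + - \<sigma>3) = (\<sigma>3 + (flype_a + - \<sigma>3)) + (\<sigma>3 + (flype_b + - \<sigma>3))"
    by (simp add: add.assoc)
  then have "- \<sigma>3 + (flype_b + \<sigma>3) = flype_a + flype_b"
    by (intro cancel) (simp add: commute_a flype_conj_3 add.assoc)
  then show "normalizes \<sigma>3"
    by (intro normalizesI) (simp_all add: commute_a flypes_gens flypes_add)
  have "\<sigma>2 + ((flype_a + (- flype_b + flype_a)) + - \<sigma>2) =
      (\<sigma>2 + (flype_a + - \<sigma>2)) + (- (\<sigma>2 + (flype_b + - \<sigma>2)) + (\<sigma>2 + (flype_a + - \<sigma>2)))"
    by (simp add: add.assoc minus_add)
  also have "\<dots> = flype_a"
    unfolding flype_conj_2 flype_b_def[symmetric] by (simp add: add.assoc minus_add)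
  finally have "- \<sigma>2 + (flype_a + \<sigma>2) = flype_a + (- flype_b + flype_a)" by (rule cancel)
  moreover have "- \<sigma>2 + (flype_b + \<sigma>2) = flype_a" by (rule cancel) (simp add: flype_b_def)
  ultimately show "normalizes \<sigma>2"
    by (intro normalizesI) (simp_all add: flypes_gens flypes_add)
qed

lemma braid_int_induct:
  fixes f :: "int \<Rightarrow> braid"
  assumes "\<And>s t. f (s + t) = f s + f t" "normalizes (f 1)" "normalizes (f (-1))"
  shows "normalizes (f s)"
proof (induction s rule: int_induct[where k=0])
  case base
  have "f 0 + f 0 = f 0 + 0" using assms(1)[of 0 0] by simp
  then have "f 0 = 0" by (rule add_left_imp_eq)
  then show ?case by (simp add: normalizes_def)
next
  case (step1 i) then show ?case using assms by (simp add: normalizes_add)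
next
  case (step2 i)
  have "i - 1 = i + -1" by linarith
  then show ?case using step2 assms(1)[of i "-1"] assms(3) by (simp only: normalizes_add)
qed

lemma normalizes_all: "normalizes x"
proof -
  have M: "normalizes (braid_of [Mid s])" for s
  proof (rule braid_int_induct)
    have "braid_of [Mid (-1)] = - \<sigma>2" using braid_of_inverse[of "[Mid 1]"] by (simp add: \<sigma>2_def inverse_word_def)
    then show "normalizes (braid_of [Mid 1])" "normalizes (braid_of [Mid (-1)])"
      using normalizes_gens by (simp_all flip: \<sigma>2_def)
  qed (rule braid_Mid)
  have L: "normalizes (braid_of [Out a 0])" for a
  proof (rule braid_int_induct[where f="\<lambda>a. braid_of [Out a 0]"])
    have "braid_of [Out (-1) 0] = - \<sigma>1" using braid_of_inverse[of "[Out 1 0]"] by (simp add: \<sigma>1_def inverse_word_def)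
    then show "normalizes (braid_of [Out 1 0])" "normalizes (braid_of [Out (-1) 0])"
      using normalizes_gens by (simp_all flip: \<sigma>1_def)
  qed (use braid_Out[of _ _ 0 0] in simp)
  have R: "normalizes (braid_of [Out 0 b])" for b
  proof (rule braid_int_induct[where f="\<lambda>b. braid_of [Out 0 b]"])
    have "braid_of [Out 0 (-1)] = - \<sigma>3" using braid_of_inverse[of "[Out 0 1]"] by (simp add: \<sigma>3_def inverse_word_def)
    then show "normalizes (braid_of [Out 0 1])" "normalizes (braid_of [Out 0 (-1)])"
      using normalizes_gens by (simp_all flip: \<sigma>3_def)
  qed (use braid_Out[of 0 0] in simp)
  have "normalizes (braid_of [l])" for l
  proof (cases l)
    case (Mid s) then show ?thesis using M by simp
  next
    case (Out a b)
    then show ?thesis using normalizes_add[OF L R, of a b] braid_Out[of a 0 0 b] by simp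
  qed
  then have l: "normalizes (braid_of [l])" for l .
  have "normalizes (braid_of w)" for w
  proof (induction w)
    case Nil then show ?case by (simp add: normalizes_def)
  next
    case (Cons l w) then show ?case using normalizes_add[OF l] by (subst braid_of_Cons)
  qed
  then show ?thesis using braid_of_surj[of x] by metis
qed

lemma absorbed_flypes: "g \<in> flypes \<Longrightarrow> absorbed g"
proof -
  have a: "absorbed flype_a" unfolding flype_a_def using absorbed_\<sigma> by (intro absorbed_add absorbed_minus)
  \<comment> \<open>By free cancellation: the half twist without its last two letters, followed by
    the inverse of the loop word, leaves \<sigma>2 \<sigma>1 and the inverses of \<sigma>3 and
    \<sigma>2. This is where both geometric absorptions, half twist and loop, enter.\<close>
  have e: "flype_b = (\<sigma>2 + (\<sigma>1 + (\<sigma>3 + (\<sigma>2 + (\<sigma>1 + \<sigma>3))))) + (- \<sigma>3 + (- \<sigma>1 + - (\<sigma>2 + (\<sigma>3 + (\<sigma>3 + \<sigma>2)))))"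
    by (simp add: flype_b_def flype_a_def add.assoc minus_add)
  have b: "absorbed flype_b"
    unfolding e by (intro absorbed_add absorbed_minus absorbed_half_twist absorbed_loop absorbed_\<sigma>)
  show "g \<in> flypes \<Longrightarrow> absorbed g"
    by (induction rule: flypes.induct) (auto intro!: absorbed_add absorbed_minus a b)
qed

text \<open>Interchangeability in every context. This is stronger than \<open>knot_eq\<close> and,
  unlike it, compatible with sums and inverses.\<close>

definition flype_eq :: "braid \<Rightarrow> braid \<Rightarrow> bool" where
  "flype_eq x y \<longleftrightarrow> (\<forall>u v. knot_eq (u + (x + v)) (u + (y + v)))"

lemma flype_eq_refl [simp]: "flype_eq x x" by (simp add: flype_eq_def)
lemma flype_eq_sym: "flype_eq x y \<Longrightarrow> flype_eq y x" unfolding flype_eq_def using knot_eq_sym by blast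
lemma flype_eq_add: "flype_eq x y \<Longrightarrow> flype_eq x' y' \<Longrightarrow> flype_eq (x + x') (y + y')"
  unfolding flype_eq_def by (metis add.assoc knot_eq_trans)

lemma flype_eq_knot_eq: "flype_eq x y \<Longrightarrow> knot_eq x y"
  unfolding flype_eq_def by (metis add.left_neutral add.right_neutral)

text \<open>A flype in the middle of a word equals a conjugate of it at the end of the word, and
  conjugates stay in the normal subgroup, all of whose elements are absorbed.\<close>

lemma flype_eq_a: "flype_eq flype_a 0"
  unfolding flype_eq_def
proof (intro allI)
  fix u v
  have "- v + (flype_a + v) \<in> flypes" using normalizes_all flypes_gens unfolding normalizes_def by blast
  then have "knot_eq ((u + v) + (- v + (flype_a + v))) (u + v)" using absorbed_flypes unfolding absorbed_def by blast
  then show "knot_eq (u + (flype_a + v)) (u + (0 + v))" by (simp add: add.assoc)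
qed

lemma flype_eq_minus:
  assumes "flype_eq x y" shows "flype_eq (- x) (- y)"
proof -
  have "flype_eq ((- x + y) + - y) ((- x + x) + - y)"
    by (intro flype_eq_add flype_eq_refl flype_eq_sym[OF assms])
  then show ?thesis by (simp add: add.assoc)
qed

lemma flype_eq_31: "flype_eq \<sigma>3 \<sigma>1"
  using flype_eq_sym[OF flype_eq_add[OF flype_eq_a flype_eq_refl[of \<sigma>3]]] by (simp add: flype_a_def add.assoc)

section \<open>Reduction of both families of words to twist words\<close>

fun iter :: "nat \<Rightarrow> braid \<Rightarrow> braid" where
  "iter 0 g = 0"
| "iter (Suc n) g = g + iter n g"

lemma iter_add: "iter (m + n) g = iter m g + iter n g"
  by (induction m) (auto simp: add.assoc)

lemma iter_Suc': "iter (Suc n) g = iter n g + g"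
  using iter_add[of n 1 g] by simp

lemma braid_of_replicate: "braid_of (concat (replicate n w)) = iter n (braid_of w)"
  by (induction n) (auto simp: braid_of_append)

lemma iter_commute: "g + h = h + g \<Longrightarrow> iter n g + h = h + iter n g"
  by (induction n) (auto simp: add.assoc, metis add.assoc)

lemma flype_eq_iter: "flype_eq g h \<Longrightarrow> flype_eq (iter n g) (iter n h)"
  by (induction n) (auto intro: flype_eq_add)

lemma knot_eq_absorb: "absorbed g \<Longrightarrow> knot_eq (x + g) x"
  by (simp add: absorbed_def)

text \<open>Inversion exchanges the two ends of a word, so what is absorbed on the right is absorbed
  on the left.\<close>

lemma knot_eq_absorb_left:
  assumes "absorbed g" shows "knot_eq (g + x) x"
proof -
  have "knot_eq (g + x) (- x + - g)" using knot_eq_minus[of "g + x"] by (simp add: minus_add)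
  also have "knot_eq \<dots> (- x)" by (rule knot_eq_absorb[OF absorbed_minus[OF assms]])
  also have "knot_eq (- x) x" by (rule knot_eq_sym[OF knot_eq_minus])
  finally show ?thesis .
qed

text \<open>A strand that encircles two others commutes with the crossing of these two.\<close>

lemma commute_2_1221: "\<sigma>2 + (\<sigma>1 + (\<sigma>2 + (\<sigma>2 + \<sigma>1))) = (\<sigma>1 + (\<sigma>2 + (\<sigma>2 + \<sigma>1))) + \<sigma>2"
proof -
  have "\<sigma>2 + (\<sigma>1 + (\<sigma>2 + (\<sigma>2 + \<sigma>1))) = \<sigma>1 + (\<sigma>2 + (\<sigma>1 + (\<sigma>2 + \<sigma>1)))" by (rule braid_rel_12')
  also have "\<dots> = (\<sigma>1 + (\<sigma>2 + (\<sigma>2 + \<sigma>1))) + \<sigma>2" unfolding braid_rel_12[symmetric] by (simp add: add.assoc)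
  finally show ?thesis .
qed

lemma commute_minus:
  fixes g h :: braid
  assumes "g + h = h + g" shows "g + - h = - h + g"
proof -
  have "- h + ((h + g) + - h) = - h + ((g + h) + - h)" unfolding assms ..
  then show ?thesis by (simp add: add.assoc)
qed

text \<open>The full twist on three strands is the loop word in \<sigma>2 and \<sigma>1, followed by
  \<sigma>1 twice. Up to flypes the loop is the one around the right cap, which is absorbed, and so
  is \<sigma>1.\<close>

lemma absorbed_full_twist: "absorbed (\<sigma>1 + (\<sigma>2 + (\<sigma>2 + (\<sigma>1 + (\<sigma>2 + \<sigma>2)))))"
  unfolding absorbed_def
proof
  fix x
  let ?t = "\<sigma>2 + (\<sigma>1 + (\<sigma>1 + \<sigma>2))"
  have "\<sigma>1 + (\<sigma>2 + (\<sigma>2 + (\<sigma>1 + (\<sigma>2 + \<sigma>2)))) = \<sigma>1 + (\<sigma>2 + (\<sigma>1 + (\<sigma>2 + (\<sigma>1 + \<sigma>2))))"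
    unfolding braid_rel_12' ..
  also have "\<dots> = \<sigma>1 + (\<sigma>2 + (\<sigma>1 + (\<sigma>1 + (\<sigma>2 + \<sigma>1))))" unfolding braid_rel_12 ..
  also have "\<dots> = \<sigma>2 + (\<sigma>1 + (\<sigma>2 + (\<sigma>1 + (\<sigma>2 + \<sigma>1))))" by (rule braid_rel_12'[symmetric])
  also have "\<dots> = ?t + (\<sigma>1 + \<sigma>1)" by (simp only: braid_rel_12'[of \<sigma>1] add.assoc)
  finally have e: "x + (\<sigma>1 + (\<sigma>2 + (\<sigma>2 + (\<sigma>1 + (\<sigma>2 + \<sigma>2))))) = (x + ?t) + (\<sigma>1 + \<sigma>1)" by (simp only: add.assoc)
  have "knot_eq ((x + ?t) + (\<sigma>1 + \<sigma>1)) (x + ?t)" by (intro knot_eq_absorb absorbed_add absorbed_\<sigma>)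
  also have "knot_eq (x + ?t) (x + (\<sigma>2 + (\<sigma>3 + (\<sigma>3 + \<sigma>2))))"
    by (intro flype_eq_knot_eq flype_eq_add flype_eq_refl flype_eq_sym[OF flype_eq_31])
  also have "knot_eq \<dots> x" by (rule knot_eq_absorb[OF absorbed_loop])
  finally show "knot_eq (x + (\<sigma>1 + (\<sigma>2 + (\<sigma>2 + (\<sigma>1 + (\<sigma>2 + \<sigma>2)))))) x" unfolding e .
qed

text \<open>A block followed by - \<sigma>1 equals - \<sigma>1 followed by the inverse of the
  encircling braid \<open>?E\<close>. This inverse commutes with \<sigma>2, and an absorbed full
  twist converts it into two letters \<sigma>2. So every block adds two half twists to a single
  twist region.\<close>

lemma fold_block:
  "knot_eq (u + iter n (- \<sigma>1 + (- \<sigma>1 + (- \<sigma>2 + - \<sigma>2)))) ((u + - \<sigma>1) + iter (2 * n) \<sigma>2)"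
proof (induction n arbitrary: u)
  case 0 then show ?case using knot_eq_sym[OF knot_eq_absorb[OF absorbed_minus[OF absorbed_\<sigma>(1)], of u]] by simp
next
  case (Suc n)
  let ?b = "- \<sigma>1 + (- \<sigma>1 + (- \<sigma>2 + - \<sigma>2))" and ?E = "\<sigma>1 + (\<sigma>2 + (\<sigma>2 + \<sigma>1))"
  have comm: "iter (2 * n) \<sigma>2 + - ?E = - ?E + iter (2 * n) \<sigma>2"
  proof (rule iter_commute)
    show "\<sigma>2 + - ?E = - ?E + \<sigma>2" by (rule commute_minus[OF commute_2_1221])
  qed
  have "knot_eq (u + iter (Suc n) ?b) ((u + ?b) + iter n ?b)" by (simp add: add.assoc)
  also have "knot_eq \<dots> (((u + ?b) + - \<sigma>1) + iter (2 * n) \<sigma>2)" by (rule Suc.IH)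
  also have "((u + ?b) + - \<sigma>1) + iter (2 * n) \<sigma>2 = (u + - \<sigma>1) + (- ?E + iter (2 * n) \<sigma>2)"
    by (simp add: add.assoc minus_add)
  also have "\<dots> = ((u + - \<sigma>1) + (iter (2 * n) \<sigma>2 + (\<sigma>2 + \<sigma>2))) + - (\<sigma>1 + (\<sigma>2 + (\<sigma>2 + (\<sigma>1 + (\<sigma>2 + \<sigma>2)))))"
    unfolding comm[symmetric] by (simp add: add.assoc minus_add)
  also have "knot_eq \<dots> ((u + - \<sigma>1) + (iter (2 * n) \<sigma>2 + (\<sigma>2 + \<sigma>2)))"
    by (rule knot_eq_absorb[OF absorbed_minus[OF absorbed_full_twist]])
  also have "iter (2 * n) \<sigma>2 + (\<sigma>2 + \<sigma>2) = iter (2 * Suc n) \<sigma>2"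
    using iter_add[of "2 * n" 2 \<sigma>2] by (simp add: numeral_2_eq_2)
  finally show ?case .
qed

text \<open>First m half twists, then the two crossings of the clasp; this is the word that is later
  read off the polygon of the twist knot.\<close>

definition twist_word :: "nat \<Rightarrow> letter list" where
  "twist_word m = replicate m (Mid 1) @ [Out 0 (-1), Mid 1]"

lemma braid_letters:
  "braid_of [Mid 1] = \<sigma>2" "braid_of [Mid (-1)] = - \<sigma>2"
  "braid_of [Out (-1) (-1)] = - \<sigma>1 + - \<sigma>3" "braid_of [Out 1 (-1)] = flype_a"
  "braid_of [Out (-1) 1] = - flype_a" "braid_of [Out 0 (-1)] = - \<sigma>3"
proof -
  have 1: "braid_of [Out (-1) 0] = - \<sigma>1" using braid_of_inverse[of "[Out 1 0]"] by (simp add: \<sigma>1_def inverse_word_def)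
  show 3: "braid_of [Out 0 (-1)] = - \<sigma>3" using braid_of_inverse[of "[Out 0 1]"] by (simp add: \<sigma>3_def inverse_word_def)
  show "braid_of [Mid 1] = \<sigma>2" by (simp add: \<sigma>2_def)
  show "braid_of [Mid (-1)] = - \<sigma>2" using braid_of_inverse[of "[Mid 1]"] by (simp add: \<sigma>2_def inverse_word_def)
  show "braid_of [Out (-1) (-1)] = - \<sigma>1 + - \<sigma>3" using braid_Out[of "-1" 0 0 "-1"] 1 3 by simp
  show a: "braid_of [Out 1 (-1)] = flype_a" using braid_Out[of 1 0 0 "-1"] 3 by (simp add: \<sigma>1_def flype_a_def)
  show "braid_of [Out (-1) 1] = - flype_a"
    using braid_of_inverse[of "[Out 1 (-1)]"] a by (simp add: inverse_word_def)
qed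

text \<open>Reversal and mirror image together read a word backwards and so bring the clasp to its
  end; a flype replaces \<sigma>1 by \<sigma>3.\<close>

lemma twist_word_knot_eq: "knot_eq (\<sigma>2 + (- \<sigma>1 + iter m \<sigma>2)) (braid_of (twist_word m))"
proof -
  let ?w = "[Mid 1, Out 0 (-1)] @ replicate m (Mid 1)"
  have rep: "braid_of (replicate m (Mid 1)) = iter m \<sigma>2"
    using braid_of_replicate[of m "[Mid 1]"] by (simp add: braid_letters concat_replicate_single)
  have "\<sigma>2 + (- \<sigma>3 + iter m \<sigma>2) = braid_of ?w"
    by (simp add: braid_of_append rep braid_of_Cons[of _ "_ # _"] braid_of_Cons[of _ "replicate _ _"] braid_letters add.assoc)
  moreover have "knot_eq (\<sigma>2 + (- \<sigma>1 + iter m \<sigma>2)) (\<sigma>2 + (- \<sigma>3 + iter m \<sigma>2))"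
    by (intro flype_eq_knot_eq flype_eq_add flype_eq_refl flype_eq_minus flype_eq_sym[OF flype_eq_31])
  moreover have "heq (word_knot ?w) (word_knot (map inverse_letter (inverse_word ?w)))"
    by (rule heq_trans[OF word_knot_inverse word_knot_mirror])
  moreover have "map inverse_letter (inverse_word ?w) = twist_word m"
    by (simp add: inverse_word_def twist_word_def)
  ultimately show ?thesis unfolding knot_eq_braid_of[symmetric] by (metis knot_eq_trans)
qed

text \<open>Up to flypes \<open>Out 1 (-1)\<close> disappears and \<open>Out (-1) (-1)\<close>
  becomes - \<sigma>1 twice, so each of the n pieces is a block of
  \<open>fold_block\<close>.\<close>

lemma even_twist_words:
  "heq (word_knot ([Mid 1] @ concat (replicate n [Out (-1) (-1), Mid (-1), Out 1 (-1), Mid (-1)])))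
     (word_knot (twist_word (2 * n)))"
proof -
  let ?b = "- \<sigma>1 + (- \<sigma>1 + (- \<sigma>2 + - \<sigma>2))"
  have "braid_of ([Mid 1] @ concat (replicate n [Out (-1) (-1), Mid (-1), Out 1 (-1), Mid (-1)])) =
      \<sigma>2 + iter n ((- \<sigma>1 + - \<sigma>3) + (- \<sigma>2 + (flype_a + - \<sigma>2)))"
    unfolding braid_of_append braid_of_replicate by (simp add: braid_of_Cons[of _ "_ # _"] braid_letters)
  also have "knot_eq \<dots> (\<sigma>2 + iter n ((- \<sigma>1 + - \<sigma>1) + (- \<sigma>2 + (0 + - \<sigma>2))))"
    by (intro flype_eq_knot_eq flype_eq_add flype_eq_iter flype_eq_refl flype_eq_minus flype_eq_31 flype_eq_a)
  also have "\<dots> = \<sigma>2 + iter n ?b" by (simp add: add.assoc)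
  also have "knot_eq \<dots> ((\<sigma>2 + - \<sigma>1) + iter (2 * n) \<sigma>2)" by (rule fold_block)
  also have "knot_eq \<dots> (braid_of (twist_word (2 * n)))" using twist_word_knot_eq by (simp add: add.assoc)
  finally show ?thesis unfolding knot_eq_braid_of .
qed

text \<open>Up to flypes the letters \<sigma>2 cancel in all blocks except the middle one. The
  blocks before it become letters \<sigma>1, which the left caps absorb; those after it become
  letters \<sigma>1 as well, which conjugation with the half twist \<open>?d\<close> on three
  strands turns into the letters \<sigma>2 of the twist region.\<close>

lemma odd_twist_words:
  "heq (word_knot (concat (replicate (2 * n) [Mid (-1), Out (-1) 1, Mid 1, Out 1 1]) @ [Mid (-1), Out (-1) 1, Mid (-1), Out 1 1]
      @ concat (replicate (2 * n) [Mid 1, Out (-1) 1, Mid (-1), Out 1 1]) @ [Mid 1]))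
     (word_knot (twist_word (4 * n + 1)))"
proof -
  let ?m = "4 * n + 1" and ?d = "\<sigma>1 + (\<sigma>2 + \<sigma>1)" and ?i = "\<lambda>k. iter k \<sigma>1"
  have i2: "iter (2 * n) (\<sigma>1 + \<sigma>1) = iter (4 * n) \<sigma>1"
  proof -
    have "iter k (\<sigma>1 + \<sigma>1) = iter (2 * k) \<sigma>1" for k by (induction k) (auto simp: add.assoc)
    from this[of "2 * n"] show ?thesis by simp
  qed
  have "braid_of (concat (replicate (2 * n) [Mid (-1), Out (-1) 1, Mid 1, Out 1 1]) @ [Mid (-1), Out (-1) 1, Mid (-1), Out 1 1]
      @ concat (replicate (2 * n) [Mid 1, Out (-1) 1, Mid (-1), Out 1 1]) @ [Mid 1]) =
    iter (2 * n) (- \<sigma>2 + (- flype_a + (\<sigma>2 + (\<sigma>1 + \<sigma>3)))) + ((- \<sigma>2 + (- flype_a + (- \<sigma>2 + (\<sigma>1 + \<sigma>3)))) +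
     (iter (2 * n) (\<sigma>2 + (- flype_a + (- \<sigma>2 + (\<sigma>1 + \<sigma>3)))) + \<sigma>2))"
    unfolding braid_of_append braid_of_replicate
    by (simp add: braid_of_Cons[of _ "_ # _"] braid_letters braid_Out11)
  also have "knot_eq \<dots> (iter (2 * n) (- \<sigma>2 + (- 0 + (\<sigma>2 + (\<sigma>1 + \<sigma>1)))) + ((- \<sigma>2 + (- 0 + (- \<sigma>2 + (\<sigma>1 + \<sigma>1)))) +
     (iter (2 * n) (\<sigma>2 + (- 0 + (- \<sigma>2 + (\<sigma>1 + \<sigma>1)))) + \<sigma>2)))"
    by (intro flype_eq_knot_eq flype_eq_add flype_eq_iter flype_eq_refl flype_eq_minus flype_eq_31 flype_eq_a)
  also have "\<dots> = ?i (4 * n) + (- \<sigma>2 + (- \<sigma>2 + (\<sigma>1 + (?i ?m + \<sigma>2))))"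
    by (simp add: add.assoc i2)
  also have "knot_eq \<dots> (- \<sigma>2 + (- \<sigma>2 + (\<sigma>1 + (?i ?m + \<sigma>2))))"
  proof (rule knot_eq_absorb_left)
    show "absorbed (?i k)" for k by (induction k) (auto intro: absorbed_add absorbed_\<sigma>)
  qed
  \<comment> \<open>A letter \<sigma>1 is borrowed from the right caps to complete the half twist
    \<open>?d\<close>.\<close>
  also have "knot_eq \<dots> ((- \<sigma>2 + (- \<sigma>2 + (\<sigma>1 + (?i ?m + \<sigma>2)))) + \<sigma>1)"
    by (rule knot_eq_sym[OF knot_eq_absorb[OF absorbed_\<sigma>(1)]])
  also have "\<dots> = - \<sigma>2 + (- \<sigma>2 + (?i ?m + ?d))"
  proof -
    have e: "\<sigma>1 + ?i ?m = ?i ?m + \<sigma>1" using iter_Suc'[of ?m \<sigma>1] by (simp only: iter.simps)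
    have "(- \<sigma>2 + (- \<sigma>2 + (\<sigma>1 + (?i ?m + \<sigma>2)))) + \<sigma>1 = - \<sigma>2 + (- \<sigma>2 + ((\<sigma>1 + ?i ?m) + (\<sigma>2 + \<sigma>1)))"
      by (simp only: add.assoc)
    then show ?thesis unfolding e by (simp only: add.assoc)
  qed
  also have "?i ?m + ?d = ?d + iter ?m \<sigma>2"
  proof -
    have "?i k + ?d = ?d + iter k \<sigma>2" for k
    proof (induction k)
      case (Suc k)
      have "\<sigma>1 + ?d = ?d + \<sigma>2" unfolding add.assoc braid_rel_12[symmetric] by (simp add: braid_rel_12' add.assoc)
      then show ?case using Suc by (simp add: add.assoc) (metis add.assoc)
    qed simp
    then show ?thesis .
  qed
  also have "- \<sigma>2 + (- \<sigma>2 + (?d + iter ?m \<sigma>2)) = - \<sigma>2 + (\<sigma>1 + (\<sigma>2 + iter ?m \<sigma>2))"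
    unfolding braid_rel_12[symmetric] by (simp add: add.assoc)
  also have "\<dots> = \<sigma>1 + (\<sigma>2 + (- \<sigma>1 + iter ?m \<sigma>2))"
  proof -
    have "\<sigma>2 + (\<sigma>1 + (\<sigma>2 + (- \<sigma>1 + iter ?m \<sigma>2))) = \<sigma>1 + (\<sigma>2 + iter ?m \<sigma>2)"
      unfolding braid_rel_12' by simp
    then have "- \<sigma>2 + (\<sigma>2 + (\<sigma>1 + (\<sigma>2 + (- \<sigma>1 + iter ?m \<sigma>2)))) = - \<sigma>2 + (\<sigma>1 + (\<sigma>2 + iter ?m \<sigma>2))"
      by (rule arg_cong)
    then show ?thesis by (simp only: minus_add_cancel)
  qed
  also have "knot_eq \<dots> (\<sigma>2 + (- \<sigma>1 + iter ?m \<sigma>2))" by (rule knot_eq_absorb_left[OF absorbed_\<sigma>(1)])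
  also have "knot_eq \<dots> (braid_of (twist_word ?m))" by (rule twist_word_knot_eq)
  finally show ?thesis unfolding knot_eq_braid_of .
qed

end

subsection \<open>From space curves to plats\<close>

text \<open>The real part is the coordinate seen in the projection, the imaginary part the height.
  Signs of differences record the order of the strands and the instants of crossings; the product
  says that the same strand is on top.\<close>

definition same_diagram :: "complex^'k \<Rightarrow> complex^'k \<Rightarrow> bool" where
  "same_diagram a b \<longleftrightarrow> (\<forall>i j. i \<noteq> j \<longrightarrow> sgn (Re (a $ i) - Re (a $ j)) = sgn (Re (b $ i) - Re (b $ j)) \<and>
     (Re (a $ i) = Re (a $ j) \<longrightarrow> (Im (a $ i) - Im (a $ j)) * (Im (b $ i) - Im (b $ j)) > 0))"

text \<open>Two corresponding differences either lie strictly on one side of the imaginary axis, or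
  both are imaginary with the same sign.\<close>

lemma same_diagram_same_side:
  assumes "same_diagram a b" "i \<noteq> j"
  shows "same_side (a $ i - a $ j) (b $ i - b $ j)"
proof -
  have s: "sgn (Re (a $ i) - Re (a $ j)) = sgn (Re (b $ i) - Re (b $ j))"
    and z: "Re (a $ i) = Re (a $ j) \<Longrightarrow> (Im (a $ i) - Im (a $ j)) * (Im (b $ i) - Im (b $ j)) > 0"
    using assms unfolding same_diagram_def by auto
  consider "Re (a $ i) = Re (a $ j)" "Re (b $ i) = Re (b $ j)"
    | "Re (a $ i) < Re (a $ j)" "Re (b $ i) < Re (b $ j)" | "Re (a $ i) > Re (a $ j)" "Re (b $ i) > Re (b $ j)"
    using s by (cases "Re (a $ i)" "Re (a $ j)" rule: linorder_cases) (auto simp: sgn_if split: if_splits)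
  then show ?thesis
  proof cases
    case 1
    then show ?thesis using z unfolding same_side_def by (auto simp: zero_less_mult_iff complex_eq_iff)
  qed (auto simp: same_side_def complex_eq_iff)
qed

lemma plat_same_diagram:
  fixes p q :: "real \<Rightarrow> complex^'k"
  assumes "continuous_on {0..1} p" "continuous_on {0..1} q"
    and "\<And>x. x \<in> {0..1} \<Longrightarrow> same_diagram (p x) (q x)"
    and "\<And>x i. x \<in> {0,1} \<Longrightarrow> p x $ i \<in> \<real> \<and> q x $ i \<in> \<real>"
  shows "heq (plat I J p) (plat I J q)"
  using assms same_diagram_same_side by (intro plat_linear_homotopy segment_configs) blast+

lemma heq_reflect: "heq K ((\<lambda>(x, v). (1 - x, v)) ` K)"
proof (rule heqI[OF _ _ refl])
  show "bij (\<lambda>(x::real, v::complex). (1 - x, v))" by (rule o_bij[of "\<lambda>(x, v). (1 - x, v)"]) auto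
  show "continuous_on UNIV (\<lambda>(x::real, v::complex). (1 - x, v))" unfolding case_prod_unfold by (intro continuous_intros)
qed

text \<open>A shear of the heights by a function on the projection plane: points with the same
  projection keep their difference of heights.\<close>

lemma heq_shift:
  assumes "continuous_on UNIV (\<lambda>(x, y). f x y :: real)"
  shows "heq K ((\<lambda>(x, v). (x, v - \<i> * of_real (f x (Re v)))) ` K)"
proof (rule fibre_map_heq)
  have "continuous_on UNIV (\<lambda>z::real \<times> complex. (fst z, Re (snd z)))" by (intro continuous_intros)
  from continuous_on_compose2[OF assms this]
  show "continuous_on UNIV (\<lambda>(x, v). v - \<i> * of_real (f x (Re v)))"
    by (auto simp: case_prod_unfold intro!: continuous_intros)
  show "bij (\<lambda>v. v - \<i> * of_real (f x (Re v)))" for x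
    by (rule o_bij[of "\<lambda>v. v + \<i> * of_real (f x (Re v))"]) (auto simp: fun_eq_iff)
qed simp

text \<open>The bulge beyond x = 1 is compressed line by line: on the line through y, the stretch
  from 1 - \<delta> to X y is scaled to end at 1. Lines outside the arc have factor 1, and A does
  not meet the part of space that moves.\<close>

lemma flatten_right:
  fixes X :: "real \<Rightarrow> real"
  assumes X: "continuous_on {l..r} X" "\<And>y. y \<in> {l..r} \<Longrightarrow> X y \<ge> 1" "X l = 1" "X r = 1" and "l \<le> r"
    and \<delta>: "\<delta> > 0" and A: "\<And>x v. (x, v) \<in> A \<Longrightarrow> x > 1 - \<delta> \<Longrightarrow> Re v \<notin> {l<..<r}"
  shows "heq (A \<union> (\<lambda>y. (X y, of_real y)) ` {l..r}) (A \<union> {1} \<times> of_real ` {l..r})"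
proof (rule heq_half_scale)
  \<comment> \<open>Clamping y extends the factor by its value 1 at both ends of the arc.\<close>
  define \<kappa> where "\<kappa> y = \<delta> / (X (max l (min r y)) - 1 + \<delta>)" for y
  have ge: "X (max l (min r y)) \<ge> 1" for y using \<open>l \<le> r\<close> by (intro X(2)) auto
  have 1: "\<kappa> y = 1" if "y \<notin> {l<..<r}" for y
  proof -
    have "max l (min r y) = l \<or> max l (min r y) = r" using that \<open>l \<le> r\<close> by auto
    then show ?thesis unfolding \<kappa>_def using X(3,4) \<delta> by auto
  qed
  have c: "continuous_on UNIV (\<lambda>v. X (max l (min r (Re v))))"
    by (rule continuous_on_compose2[OF X(1)]) (use \<open>l \<le> r\<close> in \<open>auto intro!: continuous_intros\<close>)
  have "X (max l (min r y)) - 1 + \<delta> \<noteq> 0" for y using ge[of y] \<delta> by linarith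
  then show "continuous_on UNIV (\<lambda>v. \<kappa> (Re v))" unfolding \<kappa>_def
    by (intro continuous_intros c) auto
  show "\<kappa> (Re v) > 0" for v unfolding \<kappa>_def using ge[of "Re v"] \<delta> by (intro divide_pos_pos) linarith+
  let ?f = "half_scale (1 - \<delta>) (\<lambda>v. \<kappa> (Re v))"
  have "?f z = z" if "z \<in> A" for z
  proof (cases z)
    case (Pair x v)
    show ?thesis
    proof (cases "x \<le> 1 - \<delta>")
      case True then show ?thesis by (simp add: Pair half_scale_simps)
    next
      case False then show ?thesis using A[of x v] that 1 by (simp add: Pair half_scale_simps(3))
    qed
  qed
  then have "?f ` A = A" by simp
  moreover have "?f ` (\<lambda>y. (X y, of_real y)) ` {l..r} = {1} \<times> of_real ` {l..r}"
  proof -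
    have "?f (X y, of_real y) = (1, of_real y)" if "y \<in> {l..r}" for y
    proof -
      have "max l (min r y) = y" using that by auto
      then have "\<kappa> y = \<delta> / (X y - 1 + \<delta>)" unfolding \<kappa>_def by simp
      moreover have "X y - 1 + \<delta> > 0" using X(2)[OF that] \<delta> by linarith
      ultimately have "(X y - (1 - \<delta>)) * \<kappa> y = \<delta>" by (simp add: field_simps)
      then show ?thesis using X(2)[OF that] \<delta> by (simp add: half_scale_simps(2))
    qed
    then have "?f ` (\<lambda>y. (X y, of_real y)) ` {l..r} = (\<lambda>y. (1, of_real y)) ` {l..r}" by (simp add: image_image)
    then show ?thesis by auto
  qed
  ultimately show "?f ` (A \<union> (\<lambda>y. (X y, of_real y)) ` {l..r}) = A \<union> {1} \<times> of_real ` {l..r}"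
    by (simp add: image_Un)
qed

lemma flatten_left:
  fixes X :: "real \<Rightarrow> real"
  assumes X: "continuous_on {l..r} X" "\<And>y. y \<in> {l..r} \<Longrightarrow> X y \<le> 0" "X l = 0" "X r = 0" and "l \<le> r"
    and \<delta>: "\<delta> > 0" and A: "\<And>x v. (x, v) \<in> A \<Longrightarrow> x < \<delta> \<Longrightarrow> Re v \<notin> {l<..<r}"
  shows "heq (A \<union> (\<lambda>y. (X y, of_real y)) ` {l..r}) (A \<union> {0} \<times> of_real ` {l..r})"
proof -
  let ?r = "\<lambda>(x::real, v::complex). (1 - x, v)"
  have "heq (A \<union> (\<lambda>y. (X y, of_real y)) ` {l..r}) (?r ` (A \<union> (\<lambda>y. (X y, of_real y)) ` {l..r}))"
    by (rule heq_reflect)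
  also have "?r ` (A \<union> (\<lambda>y. (X y, of_real y)) ` {l..r}) = ?r ` A \<union> (\<lambda>y. (1 - X y, of_real y)) ` {l..r}"
    by (simp add: image_Un image_image)
  also have "heq \<dots> (?r ` A \<union> {1} \<times> of_real ` {l..r})"
  proof (rule flatten_right[where X="\<lambda>y. 1 - X y", OF _ _ _ _ \<open>l \<le> r\<close> \<delta>])
    show "continuous_on {l..r} (\<lambda>y. 1 - X y)" by (intro continuous_intros X(1))
    show "Re v \<notin> {l<..<r}" if "(x, v) \<in> ?r ` A" "x > 1 - \<delta>" for x v
      using that A[of "1 - x" v] by auto
  qed (use X in auto)
  also have "heq \<dots> (?r ` (?r ` A \<union> {1} \<times> of_real ` {l..r}))" by (rule heq_reflect)
  also have "?r ` (?r ` A \<union> {1} \<times> of_real ` {l..r}) = A \<union> {0} \<times> of_real ` {l..r}"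
    by (force simp: image_Un image_image case_prod_unfold)
  finally show ?thesis .
qed

text \<open>A continuous bijection from a compact interval has a continuous inverse; this turns arcs
  with injective y-coordinate into graphs over y.\<close>

lemma arc_graph:
  fixes \<eta> :: "real \<Rightarrow> real"
  assumes \<eta>: "continuous_on {a..b} \<eta>" "inj_on \<eta> {a..b}" and "a \<le> b"
  obtains g where "\<eta> ` {a..b} = closed_segment (\<eta> a) (\<eta> b)" "continuous_on (closed_segment (\<eta> a) (\<eta> b)) g"
    "\<And>t. t \<in> {a..b} \<Longrightarrow> g (\<eta> t) = t"
proof -
  obtain g where g: "homeomorphism {a..b} (\<eta> ` {a..b}) \<eta> g"
    using homeomorphism_compact[OF compact_Icc \<eta>(1) refl \<eta>(2)] by blast
  have "\<eta> ` closed_segment a b = closed_segment (\<eta> a) (\<eta> b)"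
    using \<eta> \<open>a \<le> b\<close> by (intro continuous_injective_image_segment_1) (auto simp: closed_segment_eq_real_ivl)
  then have e: "\<eta> ` {a..b} = closed_segment (\<eta> a) (\<eta> b)" using \<open>a \<le> b\<close> by (simp add: closed_segment_eq_real_ivl)
  show ?thesis
  proof (rule that[OF e])
    show "continuous_on (closed_segment (\<eta> a) (\<eta> b)) g" using g unfolding e[symmetric] by (simp add: homeomorphism_def)
    show "g (\<eta> t) = t" if "t \<in> {a..b}" for t using g that by (simp add: homeomorphism_def)
  qed
qed

text \<open>A cap before it is flattened. As its y-coordinate is injective, its depth in x and its
  height are both functions of y.\<close>

definition cap_arc :: "(real \<Rightarrow> real \<times> complex) \<Rightarrow> real \<Rightarrow> real \<Rightarrow> real \<Rightarrow> complex \<Rightarrow> complex \<Rightarrow> bool" where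
  "cap_arc g a b x u w \<longleftrightarrow> a \<le> b \<and> continuous_on {a..b} g \<and> inj_on (\<lambda>t. Re (snd (g t))) {a..b} \<and> g a = (x, u) \<and> g b = (x, w)"

text \<open>The heights of the two arcs are functions over disjoint intervals, and Tietze's theorem
  extends them to one function on the line. A single shear then flattens both arcs.\<close>

lemma arc_heights:
  assumes "cap_arc g a b x u w" "cap_arc g' a' b' x u' w'"
    and "closed_segment (Re u) (Re w) \<inter> closed_segment (Re u') (Re w') = {}"
  obtains \<zeta> :: "real \<Rightarrow> real" where "continuous_on UNIV \<zeta>"
    "\<And>t. t \<in> {a..b} \<Longrightarrow> \<zeta> (Re (snd (g t))) = Im (snd (g t))"
    "\<And>t. t \<in> {a'..b'} \<Longrightarrow> \<zeta> (Re (snd (g' t))) = Im (snd (g' t))"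
proof -
  have graph: "\<exists>h. continuous_on (closed_segment (Re u) (Re w)) h \<and> (\<forall>t\<in>{a..b}. Re (snd (g t)) \<in> closed_segment (Re u) (Re w) \<and> h (Re (snd (g t))) = Im (snd (g t)))"
    if "cap_arc g a b x u w" for g a b x u w
  proof -
    have c: "continuous_on {a..b} (\<lambda>t. Re (snd (g t)))" "continuous_on {a..b} (\<lambda>t. Im (snd (g t)))"
      and ab: "a \<le> b" and inj: "inj_on (\<lambda>t. Re (snd (g t))) {a..b}"
      using that unfolding cap_arc_def by (auto intro!: continuous_intros)
    have e: "Re (snd (g a)) = Re u" "Re (snd (g b)) = Re w" using that unfolding cap_arc_def by auto
    obtain h where h: "(\<lambda>t. Re (snd (g t))) ` {a..b} = closed_segment (Re (snd (g a))) (Re (snd (g b)))"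
      "continuous_on (closed_segment (Re (snd (g a))) (Re (snd (g b)))) h" "\<And>t. t \<in> {a..b} \<Longrightarrow> h (Re (snd (g t))) = t"
      using arc_graph[OF c(1) inj ab] by blast
    have "h ` closed_segment (Re u) (Re w) \<subseteq> {a..b}" using h(1,3) unfolding e by force
    then have "continuous_on (closed_segment (Re u) (Re w)) (\<lambda>y. Im (snd (g (h y))))"
      using h(2) unfolding e by (intro continuous_on_compose2[OF c(2)]) auto
    moreover have "Re (snd (g t)) \<in> closed_segment (Re u) (Re w)" if "t \<in> {a..b}" for t
      using h(1) that unfolding e by blast
    ultimately show ?thesis using h(3) by (intro exI[of _ "\<lambda>y. Im (snd (g (h y)))"]) auto
  qed
  let ?S = "closed_segment (Re u) (Re w)" and ?T = "closed_segment (Re u') (Re w')"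
  obtain h h' where h: "continuous_on ?S h" "\<forall>t\<in>{a..b}. Re (snd (g t)) \<in> ?S \<and> h (Re (snd (g t))) = Im (snd (g t))"
    and h': "continuous_on ?T h'" "\<forall>t\<in>{a'..b'}. Re (snd (g' t)) \<in> ?T \<and> h' (Re (snd (g' t))) = Im (snd (g' t))"
    using graph[OF assms(1)] graph[OF assms(2)] by metis
  let ?k = "\<lambda>y. if y \<in> ?S then h y else h' y"
  have k: "continuous_on (?S \<union> ?T) ?k"
    using h(1) h'(1) assms(3) by (intro continuous_on_cases) auto
  have "closedin (top_of_set UNIV) (?S \<union> ?T)" by (simp add: closed_Un)
  from Tietze_unbounded[OF k this]
  obtain \<zeta> where \<zeta>: "continuous_on UNIV \<zeta>" "\<And>y. y \<in> ?S \<union> ?T \<Longrightarrow> \<zeta> y = ?k y" by blast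
  show ?thesis
  proof (rule that[OF \<zeta>(1)])
    show "\<zeta> (Re (snd (g t))) = Im (snd (g t))" if "t \<in> {a..b}" for t
      using h(2) \<zeta>(2) that by auto
    show "\<zeta> (Re (snd (g' t))) = Im (snd (g' t))" if "t \<in> {a'..b'}" for t
      using h'(2) \<zeta>(2)[of "Re (snd (g' t))"] assms(3) that by auto
  qed
qed

lemma flat_arc:
  assumes "cap_arc g a b x u w"
  obtains X where "continuous_on {min (Re u) (Re w)..max (Re u) (Re w)} X"
    "(\<lambda>t. (fst (g t), complex_of_real (Re (snd (g t))))) ` {a..b} = (\<lambda>y. (X y, of_real y)) ` {min (Re u) (Re w)..max (Re u) (Re w)}"
    "X ` {min (Re u) (Re w)..max (Re u) (Re w)} \<subseteq> fst ` g ` {a..b}" "X (Re u) = x" "X (Re w) = x"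
proof -
  have ab: "a \<le> b" and c: "continuous_on {a..b} (\<lambda>t. Re (snd (g t)))" "continuous_on {a..b} (\<lambda>t. fst (g t))"
    and e: "g a = (x, u)" "g b = (x, w)" and inj: "inj_on (\<lambda>t. Re (snd (g t))) {a..b}"
    using assms unfolding cap_arc_def by (auto intro!: continuous_intros)
  obtain h where h: "(\<lambda>t. Re (snd (g t))) ` {a..b} = closed_segment (Re u) (Re w)"
    "continuous_on (closed_segment (Re u) (Re w)) h" "\<And>t. t \<in> {a..b} \<Longrightarrow> h (Re (snd (g t))) = t"
    using arc_graph[OF c(1) inj ab] unfolding e by auto
  have seg: "closed_segment (Re u) (Re w) = {min (Re u) (Re w)..max (Re u) (Re w)}"
    by (auto simp: closed_segment_eq_real_ivl min_def max_def)
  have sub: "h ` closed_segment (Re u) (Re w) \<subseteq> {a..b}" using h(1,3) by force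
  show ?thesis
  proof (rule that[of "\<lambda>y. fst (g (h y))"])
    show "continuous_on {min (Re u) (Re w)..max (Re u) (Re w)} (\<lambda>y. fst (g (h y)))"
      unfolding seg[symmetric] using h(2) sub by (intro continuous_on_compose2[OF c(2)]) auto
    have "(\<lambda>y. (fst (g (h y)), complex_of_real y)) ` (\<lambda>t. Re (snd (g t))) ` {a..b} =
        (\<lambda>t. (fst (g t), complex_of_real (Re (snd (g t))))) ` {a..b}"
      using h(3) by (auto simp: image_image intro!: image_cong)
    then show "(\<lambda>t. (fst (g t), complex_of_real (Re (snd (g t))))) ` {a..b} =
        (\<lambda>y. (fst (g (h y)), of_real y)) ` {min (Re u) (Re w)..max (Re u) (Re w)}"
      unfolding seg[symmetric] h(1) by simp
    show "(\<lambda>y. fst (g (h y))) ` {min (Re u) (Re w)..max (Re u) (Re w)} \<subseteq> fst ` g ` {a..b}"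
      unfolding seg[symmetric] using sub by auto
    show "fst (g (h (Re u))) = x" "fst (g (h (Re w))) = x" using h(3)[of a] h(3)[of b] ab e by auto
  qed
qed

lemma image_cap_arc_real:
  assumes "u \<in> \<real>" "w \<in> \<real>"
  shows "of_real ` {min (Re u) (Re w)..max (Re u) (Re w)} = closed_segment u w"
proof -
  have "{min (Re u) (Re w)..max (Re u) (Re w)} = closed_segment (Re u) (Re w)"
    by (auto simp: closed_segment_eq_real_ivl min_def max_def)
  then have "of_real ` {min (Re u) (Re w)..max (Re u) (Re w)} = closed_segment (complex_of_real (Re u)) (of_real (Re w))"
    by (simp add: closed_segment_of_real)
  then show ?thesis using assms by (simp add: of_real_Re)
qed

definition shadow :: "complex \<Rightarrow> complex \<Rightarrow> real set" where
  "shadow u w = {min (Re u) (Re w)..max (Re u) (Re w)}"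

definition open_shadow :: "complex \<Rightarrow> complex \<Rightarrow> real set" where
  "open_shadow u w = {min (Re u) (Re w)<..<max (Re u) (Re w)}"

lemma shadow_segment: "shadow u w = closed_segment (Re u) (Re w)"
  by (auto simp: shadow_def closed_segment_eq_real_ivl min_def max_def)

lemma flatten_cap_right:
  assumes g: "cap_arc g a b 1 u w" "\<And>t. t \<in> {a..b} \<Longrightarrow> fst (g t) \<ge> 1"
    and "\<delta> > 0" "\<And>x v. (x, v) \<in> A \<Longrightarrow> x > 1 - \<delta> \<Longrightarrow> Re v \<notin> open_shadow u w"
  shows "heq (A \<union> (\<lambda>t. (fst (g t), of_real (Re (snd (g t))))) ` {a..b}) (A \<union> {1} \<times> of_real ` shadow u w)"
proof -
  obtain X where X: "continuous_on {min (Re u) (Re w)..max (Re u) (Re w)} X"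
    "(\<lambda>t. (fst (g t), complex_of_real (Re (snd (g t))))) ` {a..b} = (\<lambda>y. (X y, of_real y)) ` {min (Re u) (Re w)..max (Re u) (Re w)}"
    "X ` {min (Re u) (Re w)..max (Re u) (Re w)} \<subseteq> fst ` g ` {a..b}" "X (Re u) = 1" "X (Re w) = 1"
    using flat_arc[OF g(1)] by blast
  have "X y \<ge> 1" if "y \<in> {min (Re u) (Re w)..max (Re u) (Re w)}" for y
    using X(3) g(2) that by (force simp: image_subset_iff)
  then show ?thesis unfolding X(2) shadow_def
    by (intro flatten_right[OF X(1) _ _ _ _ assms(3)]) (use X(4,5) assms(4) in \<open>auto simp: open_shadow_def min_def max_def\<close>)
qed

lemma flatten_cap_left:
  assumes g: "cap_arc g a b 0 u w" "\<And>t. t \<in> {a..b} \<Longrightarrow> fst (g t) \<le> 0"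
    and "\<delta> > 0" "\<And>x v. (x, v) \<in> A \<Longrightarrow> x < \<delta> \<Longrightarrow> Re v \<notin> open_shadow u w"
  shows "heq (A \<union> (\<lambda>t. (fst (g t), of_real (Re (snd (g t))))) ` {a..b}) (A \<union> {0} \<times> of_real ` shadow u w)"
proof -
  obtain X where X: "continuous_on {min (Re u) (Re w)..max (Re u) (Re w)} X"
    "(\<lambda>t. (fst (g t), complex_of_real (Re (snd (g t))))) ` {a..b} = (\<lambda>y. (X y, of_real y)) ` {min (Re u) (Re w)..max (Re u) (Re w)}"
    "X ` {min (Re u) (Re w)..max (Re u) (Re w)} \<subseteq> fst ` g ` {a..b}" "X (Re u) = 0" "X (Re w) = 0"
    using flat_arc[OF g(1)] by blast
  have "X y \<le> 0" if "y \<in> {min (Re u) (Re w)..max (Re u) (Re w)}" for y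
    using X(3) g(2) that by (force simp: image_subset_iff)
  then show ?thesis unfolding X(2) shadow_def
    by (intro flatten_left[OF X(1) _ _ _ _ assms(3)]) (use X(4,5) assms(4) in \<open>auto simp: open_shadow_def min_def max_def\<close>)
qed

lemma cap_arc_shadow: "cap_arc g a b x u w \<Longrightarrow> t \<in> {a..b} \<Longrightarrow> Re (snd (g t)) \<in> shadow u w"
proof -
  assume g: "cap_arc g a b x u w" and t: "t \<in> {a..b}"
  have c: "continuous_on {a..b} (\<lambda>t. Re (snd (g t)))" and ab: "a \<le> b" and inj: "inj_on (\<lambda>t. Re (snd (g t))) {a..b}"
    and e: "g a = (x, u)" "g b = (x, w)"
    using g unfolding cap_arc_def by (auto intro!: continuous_intros)
  have "(\<lambda>t. Re (snd (g t))) ` {a..b} = shadow u w"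
    using arc_graph[OF c inj ab] e unfolding shadow_segment by auto
  then show ?thesis using t by blast
qed

text \<open>A shear makes the caps and the ends of all strands real, then the four caps are pushed
  into the end fibres one after another, and a linear homotopy replaces the strands by
  \<open>q\<close>. The conditions on open shadows keep the strands out of the way of the caps near
  either end.\<close>

proposition plat_presentation:
  fixes p :: "real \<Rightarrow> complex^'k"
  assumes p: "continuous_on {0..1} p"
    and g1: "cap_arc g1 a1 b1 0 (p 0 $ i1) (p 0 $ j1)" "\<And>t. t \<in> {a1..b1} \<Longrightarrow> fst (g1 t) \<le> 0"
    and g2: "cap_arc g2 a2 b2 0 (p 0 $ i2) (p 0 $ j2)" "\<And>t. t \<in> {a2..b2} \<Longrightarrow> fst (g2 t) \<le> 0"
    and g3: "cap_arc g3 a3 b3 1 (p 1 $ i3) (p 1 $ j3)" "\<And>t. t \<in> {a3..b3} \<Longrightarrow> fst (g3 t) \<ge> 1"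
    and g4: "cap_arc g4 a4 b4 1 (p 1 $ i4) (p 1 $ j4)" "\<And>t. t \<in> {a4..b4} \<Longrightarrow> fst (g4 t) \<ge> 1"
    and d12: "shadow (p 0 $ i1) (p 0 $ j1) \<inter> shadow (p 0 $ i2) (p 0 $ j2) = {}"
    and d34: "shadow (p 1 $ i3) (p 1 $ j3) \<inter> shadow (p 1 $ i4) (p 1 $ j4) = {}"
    and all: "\<And>k. k \<in> {i1, j1, i2, j2}" "\<And>k. k \<in> {i3, j3, i4, j4}"
    and \<delta>: "0 < \<delta>" "\<delta> \<le> 1"
    and left: "\<And>x k. x \<in> {0..1} \<Longrightarrow> x < \<delta> \<Longrightarrow> Re (p x $ k) \<notin> open_shadow (p 0 $ i1) (p 0 $ j1) \<union> open_shadow (p 0 $ i2) (p 0 $ j2)"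
    and right: "\<And>x k. x \<in> {0..1} \<Longrightarrow> x > 1 - \<delta> \<Longrightarrow> Re (p x $ k) \<notin> open_shadow (p 1 $ i3) (p 1 $ j3) \<union> open_shadow (p 1 $ i4) (p 1 $ j4)"
    and q: "continuous_on {0..1} q" "\<And>x. x \<in> {0..1} \<Longrightarrow> same_diagram (p x) (q x)"
      "\<And>x i. x \<in> {0,1} \<Longrightarrow> q x $ i \<in> \<real>"
  shows "heq (strands p \<union> g1 ` {a1..b1} \<union> g2 ` {a2..b2} \<union> g3 ` {a3..b3} \<union> g4 ` {a4..b4})
     (plat {(i1, j1), (i2, j2)} {(i3, j3), (i4, j4)} q)"
proof -
  obtain \<zeta>0 where \<zeta>0: "continuous_on UNIV \<zeta>0" "\<And>t. t \<in> {a1..b1} \<Longrightarrow> \<zeta>0 (Re (snd (g1 t))) = Im (snd (g1 t))"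
    "\<And>t. t \<in> {a2..b2} \<Longrightarrow> \<zeta>0 (Re (snd (g2 t))) = Im (snd (g2 t))"
    using arc_heights[OF g1(1) g2(1)] d12 unfolding shadow_segment by blast
  obtain \<zeta>1 where \<zeta>1: "continuous_on UNIV \<zeta>1" "\<And>t. t \<in> {a3..b3} \<Longrightarrow> \<zeta>1 (Re (snd (g3 t))) = Im (snd (g3 t))"
    "\<And>t. t \<in> {a4..b4} \<Longrightarrow> \<zeta>1 (Re (snd (g4 t))) = Im (snd (g4 t))"
    using arc_heights[OF g3(1) g4(1)] d34 unfolding shadow_segment by blast
  \<comment> \<open>The shear interpolates between the heights of the left and of the right caps. As
    it depends on x and y alone, no crossing changes.\<close>
  define f where "f x y = \<zeta>0 y * (1 - unit_clamp x) + \<zeta>1 y * unit_clamp x" for x y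
  have "continuous_on UNIV (\<lambda>z::real\<times>real. \<zeta>0 (snd z))" "continuous_on UNIV (\<lambda>z::real\<times>real. \<zeta>1 (snd z))"
    by (rule continuous_on_compose2[OF \<zeta>0(1)], auto intro!: continuous_intros)
      (rule continuous_on_compose2[OF \<zeta>1(1)], auto intro!: continuous_intros)
  then have cf: "continuous_on UNIV (\<lambda>(x, y). f x y)"
    unfolding f_def case_prod_unfold by (intro continuous_intros)
  define p' where "p' x = (\<chi> k. p x $ k - \<i> * of_real (f x (Re (p x $ k))))" for x
  have Rep: "Re (p' x $ k) = Re (p x $ k)" for x k by (simp add: p'_def)
  have cp: "continuous_on {0..1} p'"
  proof -
    have "continuous_on {0..1} (\<lambda>x. f x (Re (p x $ k)))" for k
    proof -
      have "continuous_on {0..1} (\<lambda>x. (x, Re (p x $ k)))" using p by (intro continuous_intros)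
      from continuous_on_compose2[OF cf this] show ?thesis by simp
    qed
    then show ?thesis unfolding p'_def using p by (intro continuous_on_vec_lambda continuous_intros) auto
  qed
  let ?sh = "\<lambda>(x, v). (x, v - \<i> * of_real (f x (Re v)))"
  let ?fl = "\<lambda>g t. (fst (g t), complex_of_real (Re (snd (g t))))"
  have flatL: "?sh ` g ` {a..b} = ?fl g ` {a..b}"
    if "\<And>t. t \<in> {a..b} \<Longrightarrow> fst (g t) \<le> 0" "\<And>t. t \<in> {a..b} \<Longrightarrow> \<zeta>0 (Re (snd (g t))) = Im (snd (g t))" for g and a b :: real
    unfolding image_image
  proof (rule image_cong[OF refl])
    fix t assume t: "t \<in> {a..b}"
    then have "f (fst (g t)) (Re (snd (g t))) = Im (snd (g t))" using that[OF t] unfolding f_def by (simp add: max_def min_def)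
    then show "?sh (g t) = ?fl g t" by (simp add: case_prod_unfold complex_eq_iff)
  qed
  have flatR: "?sh ` g ` {a..b} = ?fl g ` {a..b}"
    if "\<And>t. t \<in> {a..b} \<Longrightarrow> fst (g t) \<ge> 1" "\<And>t. t \<in> {a..b} \<Longrightarrow> \<zeta>1 (Re (snd (g t))) = Im (snd (g t))" for g and a b :: real
    unfolding image_image
  proof (rule image_cong[OF refl])
    fix t assume t: "t \<in> {a..b}"
    then have "f (fst (g t)) (Re (snd (g t))) = Im (snd (g t))" using that[OF t] unfolding f_def by (simp add: max_def min_def)
    then show "?sh (g t) = ?fl g t" by (simp add: case_prod_unfold complex_eq_iff)
  qed
  have st: "?sh ` strands p = strands p'"
    by (rule strands_fib_image[where H="\<lambda>x v. v - \<i> * of_real (f x (Re v))"]) (simp add: p'_def)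
  let ?S = "strands p'" and ?B1 = "?fl g1 ` {a1..b1}" and ?B2 = "?fl g2 ` {a2..b2}" and ?B3 = "?fl g3 ` {a3..b3}" and ?B4 = "?fl g4 ` {a4..b4}"
  let ?s1 = "shadow (p 0 $ i1) (p 0 $ j1)" and ?s2 = "shadow (p 0 $ i2) (p 0 $ j2)"
    and ?s3 = "shadow (p 1 $ i3) (p 1 $ j3)" and ?s4 = "shadow (p 1 $ i4) (p 1 $ j4)"
  let ?o1 = "open_shadow (p 0 $ i1) (p 0 $ j1)" and ?o2 = "open_shadow (p 0 $ i2) (p 0 $ j2)"
    and ?o3 = "open_shadow (p 1 $ i3) (p 1 $ j3)" and ?o4 = "open_shadow (p 1 $ i4) (p 1 $ j4)"
  have C: "x = c \<and> Re v \<in> T" if "(x, v) \<in> {c} \<times> complex_of_real ` T" for x c :: real and v T using that by auto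
  have os: "open_shadow u w \<subseteq> shadow u w" for u w unfolding open_shadow_def shadow_def by auto
  have S: "x \<in> {0..1} \<and> (\<exists>k. Re v = Re (p x $ k))" if "(x, v) \<in> ?S" for x v
    using that unfolding strands_def by (auto simp: Rep)
  have B1: "x \<le> 0 \<and> Re v \<in> ?s1" if "(x, v) \<in> ?B1" for x v using that g1(2) cap_arc_shadow[OF g1(1)] by auto
  have B2: "x \<le> 0 \<and> Re v \<in> ?s2" if "(x, v) \<in> ?B2" for x v using that g2(2) cap_arc_shadow[OF g2(1)] by auto
  have B3: "x \<ge> 1 \<and> Re v \<in> ?s3" if "(x, v) \<in> ?B3" for x v using that g3(2) cap_arc_shadow[OF g3(1)] by auto
  have B4: "x \<ge> 1 \<and> Re v \<in> ?s4" if "(x, v) \<in> ?B4" for x v using that g4(2) cap_arc_shadow[OF g4(1)] by auto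
  have L: "Re v \<notin> ?o1 \<union> ?o2" if "(x, v) \<in> ?S" "x < \<delta>" for x v using S[OF that(1)] left[of x] that(2) by metis
  have R: "Re v \<notin> ?o3 \<union> ?o4" if "(x, v) \<in> ?S" "x > 1 - \<delta>" for x v using S[OF that(1)] right[of x] that(2) by metis
  \<comment> \<open>By \<open>all\<close> every strand ends on a cap at either side, where \<zeta>0
    and \<zeta>1 equal its height.\<close>
  have real: "p' x $ k \<in> \<real>" if "x \<in> {0,1}" for x k
  proof -
    have "Im (p' 0 $ k) = Im (p 0 $ k) - \<zeta>0 (Re (p 0 $ k))" "Im (p' 1 $ k) = Im (p 1 $ k) - \<zeta>1 (Re (p 1 $ k))"
      by (simp_all add: p'_def f_def)
    moreover have "\<zeta>0 (Re (p 0 $ k)) = Im (p 0 $ k)"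
    proof -
      have "\<exists>t g. (g = g1 \<and> t \<in> {a1..b1} \<or> g = g2 \<and> t \<in> {a2..b2}) \<and> g t = (0, p 0 $ k)"
        using all(1)[of k] g1(1) g2(1) unfolding cap_arc_def by fastforce
      then show ?thesis using \<zeta>0(2,3) by force
    qed
    moreover have "\<zeta>1 (Re (p 1 $ k)) = Im (p 1 $ k)"
    proof -
      have "\<exists>t g. (g = g3 \<and> t \<in> {a3..b3} \<or> g = g4 \<and> t \<in> {a4..b4}) \<and> g t = (1, p 1 $ k)"
        using all(2)[of k] g3(1) g4(1) unfolding cap_arc_def by fastforce
      then show ?thesis using \<zeta>1(2,3) by force
    qed
    ultimately show ?thesis using that by (auto simp: complex_is_Real_iff)
  qed
  have "heq (strands p \<union> g1 ` {a1..b1} \<union> g2 ` {a2..b2} \<union> g3 ` {a3..b3} \<union> g4 ` {a4..b4})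
     (?sh ` (strands p \<union> g1 ` {a1..b1} \<union> g2 ` {a2..b2} \<union> g3 ` {a3..b3} \<union> g4 ` {a4..b4}))"
    by (rule heq_shift[OF cf])
  also have "?sh ` (strands p \<union> g1 ` {a1..b1} \<union> g2 ` {a2..b2} \<union> g3 ` {a3..b3} \<union> g4 ` {a4..b4}) =
      (?S \<union> ?B2 \<union> ?B3 \<union> ?B4) \<union> ?B1"
  proof -
    have "?sh ` g1 ` {a1..b1} = ?B1" by (rule flatL) (fact g1(2) \<zeta>0(2))+
    moreover have "?sh ` g2 ` {a2..b2} = ?B2" by (rule flatL) (fact g2(2) \<zeta>0(3))+
    moreover have "?sh ` g3 ` {a3..b3} = ?B3" by (rule flatR) (fact g3(2) \<zeta>1(2))+
    moreover have "?sh ` g4 ` {a4..b4} = ?B4" by (rule flatR) (fact g4(2) \<zeta>1(3))+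
    ultimately show ?thesis unfolding image_Un st by (simp only: Un_ac)
  qed
  also have "heq \<dots> ((?S \<union> ?B2 \<union> ?B3 \<union> ?B4) \<union> {0} \<times> of_real ` ?s1)"
  proof (rule flatten_cap_left[OF g1 \<delta>(1)])
    fix x v assume "(x, v) \<in> ?S \<union> ?B2 \<union> ?B3 \<union> ?B4" and x: "x < \<delta>"
    then consider "(x, v) \<in> ?S" | "(x, v) \<in> ?B2" | "x \<ge> 1" using B3 B4 by blast
    then show "Re v \<notin> ?o1"
      by cases (use L x B2 d12 os \<delta> in \<open>blast, blast, linarith\<close>)
  qed
  also have "(?S \<union> ?B2 \<union> ?B3 \<union> ?B4) \<union> {0} \<times> of_real ` ?s1 = (?S \<union> {0} \<times> of_real ` ?s1 \<union> ?B3 \<union> ?B4) \<union> ?B2"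
    by (simp only: Un_ac)
  also have "heq \<dots> ((?S \<union> {0} \<times> of_real ` ?s1 \<union> ?B3 \<union> ?B4) \<union> {0} \<times> of_real ` ?s2)"
  proof (rule flatten_cap_left[OF g2 \<delta>(1)])
    fix x v assume "(x, v) \<in> ?S \<union> {0} \<times> of_real ` ?s1 \<union> ?B3 \<union> ?B4" and x: "x < \<delta>"
    then consider "(x, v) \<in> ?S" | "Re v \<in> ?s1" | "x \<ge> 1" using B3[of x v] B4[of x v] C[of x v 0 ?s1] by blast
    then show "Re v \<notin> ?o2"
      by cases (use L x d12 os \<delta> in \<open>blast, blast, linarith\<close>)
  qed
  also have "(?S \<union> {0} \<times> of_real ` ?s1 \<union> ?B3 \<union> ?B4) \<union> {0} \<times> of_real ` ?s2 =
      (?S \<union> {0} \<times> of_real ` ?s1 \<union> {0} \<times> of_real ` ?s2 \<union> ?B4) \<union> ?B3"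
    by (simp only: Un_ac)
  also have "heq \<dots> ((?S \<union> {0} \<times> of_real ` ?s1 \<union> {0} \<times> of_real ` ?s2 \<union> ?B4) \<union> {1} \<times> of_real ` ?s3)"
  proof (rule flatten_cap_right[OF g3 \<delta>(1)])
    fix x v assume "(x, v) \<in> ?S \<union> {0} \<times> of_real ` ?s1 \<union> {0} \<times> of_real ` ?s2 \<union> ?B4" and x: "x > 1 - \<delta>"
    then consider "(x, v) \<in> ?S" | "x = 0" | "(x, v) \<in> ?B4" using C[of x v 0 ?s1] C[of x v 0 ?s2] by blast
    then show "Re v \<notin> ?o3"
      by cases (use R x B4 d34 os \<delta> in \<open>blast, linarith, blast\<close>)
  qed
  also have "(?S \<union> {0} \<times> of_real ` ?s1 \<union> {0} \<times> of_real ` ?s2 \<union> ?B4) \<union> {1} \<times> of_real ` ?s3 =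
      (?S \<union> {0} \<times> of_real ` ?s1 \<union> {0} \<times> of_real ` ?s2 \<union> {1} \<times> of_real ` ?s3) \<union> ?B4"
    by (simp only: Un_ac)
  also have "heq \<dots> ((?S \<union> {0} \<times> of_real ` ?s1 \<union> {0} \<times> of_real ` ?s2 \<union> {1} \<times> of_real ` ?s3) \<union> {1} \<times> of_real ` ?s4)"
  proof (rule flatten_cap_right[OF g4 \<delta>(1)])
    fix x v assume "(x, v) \<in> ?S \<union> {0} \<times> of_real ` ?s1 \<union> {0} \<times> of_real ` ?s2 \<union> {1} \<times> of_real ` ?s3" and x: "x > 1 - \<delta>"
    then consider "(x, v) \<in> ?S" | "x = 0" | "Re v \<in> ?s3" using C[of x v 0 ?s1] C[of x v 0 ?s2] C[of x v 1 ?s3] by blast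
    then show "Re v \<notin> ?o4"
      by cases (use R x d34 os \<delta> in \<open>blast, linarith, blast\<close>)
  qed
  also have "(?S \<union> {0} \<times> of_real ` ?s1 \<union> {0} \<times> of_real ` ?s2 \<union> {1} \<times> of_real ` ?s3) \<union> {1} \<times> of_real ` ?s4 =
      plat {(i1, j1), (i2, j2)} {(i3, j3), (i4, j4)} p'"
  proof -
    have "of_real ` shadow (p x $ i) (p x $ j) = closed_segment (p' x $ i) (p' x $ j)" if "x \<in> {0,1}" for x i j
      using image_cap_arc_real[OF real[OF that] real[OF that], of i j] unfolding shadow_def Rep .
    then show ?thesis unfolding plat_def cap_set_def by auto
  qed
  also have "heq \<dots> (plat {(i1, j1), (i2, j2)} {(i3, j3), (i4, j4)} q)"
  proof (rule plat_same_diagram[OF cp q(1)])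
    show "same_diagram (p' x) (q x)" if "x \<in> {0..1}" for x
    proof -
      have "Im (p' x $ i) - Im (p' x $ j) = Im (p x $ i) - Im (p x $ j)" if "Re (p x $ i) = Re (p x $ j)" for i j
        using that by (simp add: p'_def)
      then show ?thesis using q(2)[OF that] unfolding same_diagram_def Rep by simp
    qed
    show "p' x $ i \<in> \<real> \<and> q x $ i \<in> \<real>" if "x \<in> {0,1}" for x i
      using real[OF that] q(3)[OF that] by blast
  qed
  finally show ?thesis .
qed

section \<open>Time schedules that match curves with braid words\<close>

text \<open>Each item \<open>(l, E, A)\<close> of a schedule is a letter whose crossing happens at time \<open>E\<close>
  and which ends at time \<open>A\<close>.\<close>
fun schedule_path :: "real \<Rightarrow> real \<Rightarrow> (letter \<times> real \<times> real) list \<Rightarrow> real \<Rightarrow> real" where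
  "schedule_path a e [] = linepath a e"
| "schedule_path a e ((l, E, A) # r) = (linepath a E +++ linepath E A) +++ schedule_path A e r"

fun increasing :: "real \<Rightarrow> real \<Rightarrow> (letter \<times> real \<times> real) list \<Rightarrow> bool" where
  "increasing a e [] \<longleftrightarrow> a < e"
| "increasing a e ((l, E, A) # r) \<longleftrightarrow> a < E \<and> E < A \<and> increasing A e r"

text \<open>Within a letter the time of the curve is piecewise linear and reaches the crossing E
  exactly at u = 1/2, the middle of the half turn.\<close>

fun tracks :: "(real \<Rightarrow> complex^4) \<Rightarrow> complex^4 \<Rightarrow> real \<Rightarrow> real \<Rightarrow> (letter \<times> real \<times> real) list \<Rightarrow> bool" where
  "tracks F c a e [] \<longleftrightarrow> (\<forall>T\<in>{a..e}. same_diagram (F T) c)"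
| "tracks F c a e ((l, E, A) # r) \<longleftrightarrow>
     (\<forall>u\<in>{0..1}. same_diagram (F ((linepath a E +++ linepath E A) u)) (letter_path l c u)) \<and>
     tracks F (letter_path l c 1) A e r"

lemma strict_mono_join:
  fixes f g :: "real \<Rightarrow> real"
  assumes "strict_mono_on {0..1} f" "strict_mono_on {0..1} g" "f 1 = g 0"
  shows "strict_mono_on {0..1} (f +++ g)"
proof (rule strict_mono_onI)
  fix r s :: real assume rs: "r \<in> {0..1}" "s \<in> {0..1}" "r < s"
  consider "s \<le> 1/2" | "r \<le> 1/2" "s > 1/2" | "r > 1/2" using rs by linarith
  then show "(f +++ g) r < (f +++ g) s"
  proof cases
    case 1
    then show ?thesis using rs strict_mono_onD[OF assms(1), of "2 * r" "2 * s"] by (simp add: joinpaths_def)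
  next
    case 2
    have "f (2 * r) \<le> f 1" using rs 2 strict_mono_on_leD[OF assms(1), of "2 * r" 1] by auto
    also have "f 1 < g (2 * s - 1)" using rs 2 strict_mono_onD[OF assms(2), of 0 "2 * s - 1"] assms(3) by auto
    finally show ?thesis using 2 by (simp add: joinpaths_def)
  next
    case 3
    then show ?thesis using rs strict_mono_onD[OF assms(2), of "2 * r - 1" "2 * s - 1"] by (simp add: joinpaths_def)
  qed
qed

lemma strict_mono_linepath: "a < b \<Longrightarrow> strict_mono_on {0..1} (linepath a (b::real))"
proof (rule strict_mono_onI)
  fix r s :: real assume "a < b" "r < s"
  then have "r * (b - a) < s * (b - a)" by simp
  then show "linepath a b r < linepath a b s" by (simp add: linepath_def algebra_simps)
qed

lemma pathstart_schedule_path [simp]: "pathstart (schedule_path a e r) = a"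
  by (induction a e r rule: schedule_path.induct) auto

lemma schedule_path_start [simp]: "schedule_path a e r 0 = a"
  using pathstart_schedule_path[of a e r] unfolding pathstart_def .

lemma schedule_path_end [simp]: "schedule_path a e r 1 = e"
proof -
  have "pathfinish (schedule_path a e r) = e" by (induction a e r rule: schedule_path.induct) auto
  then show ?thesis by (simp add: pathfinish_def)
qed

lemma path_schedule_path: "path (schedule_path a e r)"
  by (induction a e r rule: schedule_path.induct) auto

lemma strict_mono_schedule_path: "increasing a e r \<Longrightarrow> strict_mono_on {0..1} (schedule_path a e r)"
proof (induction a e r rule: schedule_path.induct)
  case (2 a e l E A r)
  then have "strict_mono_on {0..1} (linepath a E +++ linepath E A)"
    by (intro strict_mono_join strict_mono_linepath) (auto simp: linepath_def)
  moreover have "(linepath a E +++ linepath E A) 1 = A" by (simp add: joinpaths_def linepath_def)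
  ultimately show ?case using 2 by (simp add: strict_mono_join)
qed (simp add: strict_mono_linepath)

lemma tracks_same_diagram:
  "tracks F c a e r \<Longrightarrow> increasing a e r \<Longrightarrow> u \<in> {0..1} \<Longrightarrow> same_diagram (F (schedule_path a e r u)) (word_path (map fst r) c u)"
proof (induction F c a e r arbitrary: u rule: tracks.induct)
  case (1 F c a e)
  have "linepath a e u \<in> {a..e}"
    using 1 convex_bound_le[of a e e "1 - u" u] convex_bound_le[of "-a" "-a" "-e" "1 - u" u]
    linepath_in_path[of u a e] by (auto simp: closed_segment_eq_real_ivl)
  moreover have "linepath c c u = c" by (simp add: linepath_def flip: scaleR_left_distrib)
  ultimately show ?case using 1 by simp
next
  case (2 F c a e l E A r)
  show ?case
  proof (cases "u \<le> 1/2")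
    case True
    then show ?thesis using 2 by (auto simp: joinpaths_def[of "_ +++ _"] joinpaths_def[of "letter_path _ _"])
  next
    case False
    then show ?thesis using 2 by (auto simp: joinpaths_def[of "_ +++ _"] joinpaths_def[of "letter_path _ _"])
  qed
qed

text \<open>Bounded distance from the identity yields surjectivity by the intermediate value
  theorem.\<close>

lemma strict_mono_line_bij:
  fixes G :: "real \<Rightarrow> real"
  assumes "continuous_on UNIV G" "strict_mono G" "\<And>x. \<bar>G x - x\<bar> \<le> C"
  shows "bij G"
proof (rule bijI)
  show "inj G" using assms(2) by (rule strict_mono_imp_inj_on)
  show "surj G"
  proof -
    have "\<exists>x. y = G x" for y
    proof -
    have "\<exists>x\<ge>y - C. x \<le> y + C \<and> G x = y"
      using assms(3)[of "y - C"] assms(3)[of "y + C"] assms(3)[of y] assms(1)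
      by (intro IVT') (auto simp: abs_le_iff intro: continuous_on_subset)
    then show ?thesis by auto
    qed
    then show ?thesis by (auto simp: surj_def)
  qed
qed

text \<open>Beyond the unit interval the time change continues by translations, which makes it a
  homeomorphism of the line.\<close>

lemma reparametrize_line:
  fixes \<mu> :: "real \<Rightarrow> real"
  assumes \<mu>: "continuous_on {0..1} \<mu>" "strict_mono_on {0..1} \<mu>"
  defines "G \<equiv> \<lambda>x. \<mu> (unit_clamp x) + (x - unit_clamp x)"
  shows "continuous_on UNIV G" "bij G"
proof -
  show c: "continuous_on UNIV G" unfolding G_def
    by (intro continuous_intros continuous_on_compose2[OF \<mu>(1)]) auto
  have m: "\<mu> 0 \<le> \<mu> (unit_clamp x)" "\<mu> (unit_clamp x) \<le> \<mu> 1" for x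
    using strict_mono_on_leD[OF \<mu>(2), of 0 "unit_clamp x"] strict_mono_on_leD[OF \<mu>(2), of "unit_clamp x" 1] by auto
  show "bij G"
  proof (rule strict_mono_line_bij[OF c, where C="\<bar>\<mu> 0\<bar> + \<bar>\<mu> 1\<bar> + 1"])
    show "strict_mono G"
    proof (rule strict_monoI)
      fix x y :: real assume "x < y"
      show "G x < G y"
      proof (cases "unit_clamp x = unit_clamp y")
        case True then show ?thesis using \<open>x < y\<close> unfolding G_def by simp
      next
        case False
        then have "unit_clamp x < unit_clamp y" using \<open>x < y\<close> by auto
        then have "\<mu> (unit_clamp x) < \<mu> (unit_clamp y)" by (intro strict_mono_onD[OF \<mu>(2)]) auto
        moreover have "x - unit_clamp x \<le> y - unit_clamp y" using False \<open>x < y\<close> by auto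
        ultimately show ?thesis unfolding G_def by linarith
      qed
    qed
    show "\<bar>G x - x\<bar> \<le> \<bar>\<mu> 0\<bar> + \<bar>\<mu> 1\<bar> + 1" for x
    proof -
      have "0 \<le> unit_clamp x" "unit_clamp x \<le> 1" by auto
      then show ?thesis using m[of x] unfolding G_def by linarith
    qed
  qed
qed

lemma heq_line_map:
  assumes "continuous_on UNIV (G :: real \<Rightarrow> real)" "bij G"
  shows "heq K ((\<lambda>(x, v). (G x, v)) ` K)"
proof (rule heqI[OF _ _ refl])
  show "continuous_on UNIV (\<lambda>(x::real, v::complex). (G x, v))"
    unfolding case_prod_unfold by (intro continuous_intros continuous_on_compose2[OF assms(1)]) auto
  show "bij (\<lambda>(x::real, v::complex). (G x, v))"
    by (rule o_bij[of "\<lambda>(x, v). (inv G x, v)"])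
      (use assms(2) in \<open>auto simp: fun_eq_iff bij_is_inj bij_is_surj surj_f_inv_f\<close>)
qed

text \<open>\<open>plat_presentation\<close> for a curve in its own time. The line is reparametrized
  so that the curve passes its crossings at the pace of \<open>word_path\<close>; about the curve
  only the order of the strands, the signs of crossings and the caps enter.\<close>

proposition timed_plat:
  fixes F :: "real \<Rightarrow> complex^4"
  assumes F: "continuous_on {a..e} F"
    and r: "increasing a e r" "tracks F c a e r" and c: "c \<in> base_cfgs"
    and g1: "cap_arc g1 a1 b1 a (F a $ i1) (F a $ j1)" "\<And>t. t \<in> {a1..b1} \<Longrightarrow> fst (g1 t) \<le> a"
    and g2: "cap_arc g2 a2 b2 a (F a $ i2) (F a $ j2)" "\<And>t. t \<in> {a2..b2} \<Longrightarrow> fst (g2 t) \<le> a"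
    and g3: "cap_arc g3 a3 b3 e (F e $ i3) (F e $ j3)" "\<And>t. t \<in> {a3..b3} \<Longrightarrow> fst (g3 t) \<ge> e"
    and g4: "cap_arc g4 a4 b4 e (F e $ i4) (F e $ j4)" "\<And>t. t \<in> {a4..b4} \<Longrightarrow> fst (g4 t) \<ge> e"
    and d12: "shadow (F a $ i1) (F a $ j1) \<inter> shadow (F a $ i2) (F a $ j2) = {}"
    and d34: "shadow (F e $ i3) (F e $ j3) \<inter> shadow (F e $ i4) (F e $ j4) = {}"
    and all: "\<And>k. k \<in> {i1, j1, i2, j2}" "\<And>k. k \<in> {i3, j3, i4, j4}"
    and d: "0 < d"
    and left: "\<And>x k. x \<in> {a..e} \<Longrightarrow> x < a + d \<Longrightarrow> Re (F x $ k) \<notin> open_shadow (F a $ i1) (F a $ j1) \<union> open_shadow (F a $ i2) (F a $ j2)"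
    and right: "\<And>x k. x \<in> {a..e} \<Longrightarrow> x > e - d \<Longrightarrow> Re (F x $ k) \<notin> open_shadow (F e $ i3) (F e $ j3) \<union> open_shadow (F e $ i4) (F e $ j4)"
    and I: "cap_set {(i1, j1), (i2, j2)} c = base_caps"
    and J: "cap_set {(i3, j3), (i4, j4)} (pathfinish (word_path (map fst r) c)) = base_caps"
  shows "heq ({(x, F x $ k) | x k. x \<in> {a..e}} \<union> g1 ` {a1..b1} \<union> g2 ` {a2..b2} \<union> g3 ` {a3..b3} \<union> g4 ` {a4..b4})
     (word_knot (map fst r))"
proof -
  define \<mu> where "\<mu> = schedule_path a e r"
  have \<mu>: "continuous_on {0..1} \<mu>" "strict_mono_on {0..1} \<mu>" "\<mu> 0 = a" "\<mu> 1 = e"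
    unfolding \<mu>_def using path_schedule_path strict_mono_schedule_path[OF r(1)] by (auto simp: path_def)
  define G where "G = (\<lambda>x. \<mu> (unit_clamp x) + (x - unit_clamp x))"
  have G: "continuous_on UNIV G" "bij G" using reparametrize_line[OF \<mu>(1,2)] unfolding G_def by auto
  have G0: "G x = a + x" if "x \<le> 0" for x using that \<mu>(3) unfolding G_def by (simp add: max_def min_def)
  have G1: "G x = e + (x - 1)" if "x \<ge> 1" for x using that \<mu>(4) unfolding G_def by (simp add: max_def min_def)
  have Gm: "G x = \<mu> x" if "x \<in> {0..1}" for x using that unfolding G_def by simp
  have range: "\<mu> ` {0..1} = {a..e}"
  proof
    show "\<mu> ` {0..1} \<subseteq> {a..e}"
      using strict_mono_on_leD[OF \<mu>(2)] \<mu>(3,4) by fastforce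
    show "{a..e} \<subseteq> \<mu> ` {0..1}"
    proof
      fix y assume "y \<in> {a..e}"
      then have "\<exists>x\<ge>0. x \<le> 1 \<and> \<mu> x = y" using \<mu> by (intro IVT') auto
      then show "y \<in> \<mu> ` {0..1}" by auto
    qed
  qed
  let ?p = "\<lambda>x. F (\<mu> x)"
  have p: "continuous_on {0..1} ?p" by (rule continuous_on_compose2[OF F \<mu>(1)]) (use range in auto)
  let ?L = "\<lambda>g t. (fst (g t) - a, snd (g t))" and ?R = "\<lambda>g t. (fst (g t) - e + 1, snd (g t))"
  have arcL: "cap_arc (?L g) x y 0 u w" if "cap_arc g x y a u w" for g x y u w
    using that unfolding cap_arc_def by (auto intro!: continuous_intros)
  have arcR: "cap_arc (?R g) x y 1 u w" if "cap_arc g x y e u w" for g x y u w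
    using that unfolding cap_arc_def by (auto intro!: continuous_intros)
  obtain \<delta> where \<delta>: "0 < \<delta>" "\<delta> \<le> 1" "\<And>x. x \<in> {0..1} \<Longrightarrow> x < \<delta> \<Longrightarrow> \<mu> x < a + d" "\<And>x. x \<in> {0..1} \<Longrightarrow> x > 1 - \<delta> \<Longrightarrow> \<mu> x > e - d"
  proof -
    have "\<exists>\<delta>>0. \<forall>x\<in>{0..1}. dist x y < \<delta> \<longrightarrow> dist (\<mu> x) (\<mu> y) < d" if "y \<in> {0..1}" for y
      using \<mu>(1) d that unfolding continuous_on_iff by blast
    from this[of 0] this[of 1] obtain d0 d1 where d: "d0 > 0" "d1 > 0"
      "\<And>x. x \<in> {0..1} \<Longrightarrow> dist x 0 < d0 \<Longrightarrow> dist (\<mu> x) a < d" "\<And>x. x \<in> {0..1} \<Longrightarrow> dist x 1 < d1 \<Longrightarrow> dist (\<mu> x) e < d"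
      unfolding \<mu>(3,4) by auto
    show ?thesis
    proof (rule that[of "min (min d0 d1) 1"])
      show "\<mu> x < a + d" if "x \<in> {0..1}" "x < min (min d0 d1) 1" for x
        using d(3)[OF that(1)] that by (auto simp: dist_real_def)
      show "\<mu> x > e - d" if "x \<in> {0..1}" "x > 1 - min (min d0 d1) 1" for x
      proof -
        have "1 - x < min (min d0 d1) 1" using that(2) by linarith
        then have "dist x 1 < d1" using that(1) by (simp add: dist_real_def)
        from d(4)[OF that(1) this] show ?thesis by (simp add: dist_real_def)
      qed
    qed (use d in auto)
  qed
  let ?q = "word_path (map fst r) c"
  let ?K = "strands ?p \<union> ?L g1 ` {a1..b1} \<union> ?L g2 ` {a2..b2} \<union> ?R g3 ` {a3..b3} \<union> ?R g4 ` {a4..b4}"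
  have end_base: "pathfinish ?q \<in> base_cfgs" using c by (rule pathfinish_word_path)
  have 1: "heq ?K (plat {(i1, j1), (i2, j2)} {(i3, j3), (i4, j4)} ?q)"
  proof (rule plat_presentation[OF p _ _ _ _ _ _ _ _ _ _ all \<delta>(1,2)])
    show "cap_arc (?L g1) a1 b1 0 (F (\<mu> 0) $ i1) (F (\<mu> 0) $ j1)" "cap_arc (?L g2) a2 b2 0 (F (\<mu> 0) $ i2) (F (\<mu> 0) $ j2)"
      unfolding \<mu> by (rule arcL, fact)+
    show "cap_arc (?R g3) a3 b3 1 (F (\<mu> 1) $ i3) (F (\<mu> 1) $ j3)" "cap_arc (?R g4) a4 b4 1 (F (\<mu> 1) $ i4) (F (\<mu> 1) $ j4)"
      unfolding \<mu> by (rule arcR, fact)+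
    show "shadow (F (\<mu> 0) $ i1) (F (\<mu> 0) $ j1) \<inter> shadow (F (\<mu> 0) $ i2) (F (\<mu> 0) $ j2) = {}"
      "shadow (F (\<mu> 1) $ i3) (F (\<mu> 1) $ j3) \<inter> shadow (F (\<mu> 1) $ i4) (F (\<mu> 1) $ j4) = {}"
      unfolding \<mu> by fact+
    show "Re (F (\<mu> x) $ k) \<notin> open_shadow (F (\<mu> 0) $ i1) (F (\<mu> 0) $ j1) \<union> open_shadow (F (\<mu> 0) $ i2) (F (\<mu> 0) $ j2)"
      if "x \<in> {0..1}" "x < \<delta>" for x k
      unfolding \<mu> by (rule left) (use that \<delta>(3) range in auto)
    show "Re (F (\<mu> x) $ k) \<notin> open_shadow (F (\<mu> 1) $ i3) (F (\<mu> 1) $ j3) \<union> open_shadow (F (\<mu> 1) $ i4) (F (\<mu> 1) $ j4)"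
      if "x \<in> {0..1}" "x > 1 - \<delta>" for x k
      unfolding \<mu> by (rule right) (use that \<delta>(4) range in auto)
    show "continuous_on {0..1} ?q" using path_word_path by (simp add: path_def)
    show "same_diagram (F (\<mu> x)) (?q x)" if "x \<in> {0..1}" for x
      unfolding \<mu>_def by (rule tracks_same_diagram[OF r(2,1) that])
    show "?q x $ i \<in> \<real>" if "x \<in> {0,1}" for x i
      using that base_cfgs_real[OF c] base_cfgs_real[OF end_base] by (auto simp: pathfinish_def)
  qed (use g1(2) g2(2) g3(2) g4(2) in auto)
  have 2: "(\<lambda>(x, v). (G x, v)) ` ?K = {(x, F x $ k) | x k. x \<in> {a..e}} \<union> g1 ` {a1..b1} \<union> g2 ` {a2..b2} \<union> g3 ` {a3..b3} \<union> g4 ` {a4..b4}"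
  proof -
    have L: "(\<lambda>(x, v). (G x, v)) ` ?L g ` {x..y} = g ` {x..y}" if "\<And>t. t \<in> {x..y} \<Longrightarrow> fst (g t) \<le> a" for g :: "real \<Rightarrow> real \<times> complex" and x y
      unfolding image_image by (rule image_cong[OF refl]) (use that in \<open>auto simp: G0\<close>)
    have R: "(\<lambda>(x, v). (G x, v)) ` ?R g ` {x..y} = g ` {x..y}" if "\<And>t. t \<in> {x..y} \<Longrightarrow> fst (g t) \<ge> e" for g :: "real \<Rightarrow> real \<times> complex" and x y
      unfolding image_image by (rule image_cong[OF refl]) (use that in \<open>auto simp: G1\<close>)
    have "(\<lambda>(x, v). (G x, v)) ` strands ?p = {(x, F x $ k) | x k. x \<in> {a..e}}"
    proof (intro set_eqI iffI)
      fix y assume "y \<in> (\<lambda>(x, v). (G x, v)) ` strands ?p"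
      then obtain x k where "y = (G x, F (\<mu> x) $ k)" "x \<in> {0..1}" unfolding strands_def by auto
      then show "y \<in> {(x, F x $ k) | x k. x \<in> {a..e}}" using Gm range by auto
    next
      fix y assume "y \<in> {(x, F x $ k) | x k. x \<in> {a..e}}"
      then obtain T k where T: "y = (T, F T $ k)" "T \<in> {a..e}" by blast
      then obtain x where x: "x \<in> {0..1}" "T = \<mu> x" using range by blast
      then have "y = (\<lambda>(x, v). (G x, v)) (x, ?p x $ k)" using T Gm by simp
      then show "y \<in> (\<lambda>(x, v). (G x, v)) ` strands ?p" using x(1) unfolding strands_def by blast
    qed
    then show ?thesis unfolding image_Un using L[OF g1(2)] L[OF g2(2)] R[OF g3(2)] R[OF g4(2)] by simp
  qed
  have "heq ({(x, F x $ k) | x k. x \<in> {a..e}} \<union> g1 ` {a1..b1} \<union> g2 ` {a2..b2} \<union> g3 ` {a3..b3} \<union> g4 ` {a4..b4})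
     (plat {(i1, j1), (i2, j2)} {(i3, j3), (i4, j4)} ?q)"
    by (rule heq_trans[OF heq_sym[OF heq_line_map[OF G, of ?K, unfolded 2]] 1])
  moreover have "plat {(i1, j1), (i2, j2)} {(i3, j3), (i4, j4)} ?q = word_knot (map fst r)"
    using I J unfolding plat_def word_knot_closure[OF c] by (simp add: pathfinish_def)
  ultimately show ?thesis by simp
qed

subsection \<open>Lissajous diagrams with two maxima\<close>

definition vec4 :: "'a \<Rightarrow> 'a \<Rightarrow> 'a \<Rightarrow> 'a \<Rightarrow> 'a^4" where
  "vec4 a b c d = (\<chi> k. if k = 1 then a else if k = 2 then b else if k = 3 then c else d)"

lemma vec4_nth [simp]: "vec4 a b c d $ 1 = a" "vec4 a b c d $ 2 = b" "vec4 a b c d $ 3 = c" "vec4 a b c d $ 4 = d"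
  by (simp_all add: vec4_def)

lemma vec4_eq_iff: "v = vec4 a b c d \<longleftrightarrow> v $ 1 = a \<and> v $ 2 = b \<and> v $ 3 = c \<and> v $ 4 = d"
  by (simp add: vec_eq_iff forall_4)

lemma start_cfg_vec4: "start_cfg = vec4 1 (-1) 3 (-3)"
  by (simp add: vec4_eq_iff)

lemma same_diagram_uminus: "same_diagram (- a) (- b) \<longleftrightarrow> same_diagram a b"
  unfolding same_diagram_def by simp metis

text \<open>With strands in opposite pairs the six comparisons reduce to the signs of y1, y2, y1 -
  y2 and y1 + y2. Each of the last two governs two simultaneous crossings, which is why
  \<open>Out\<close> turns both outer pairs.\<close>

lemma same_diagram4:
  assumes y: "sgn y1 = sgn Y1" "sgn y2 = sgn Y2" "sgn (y1 - y2) = sgn (Y1 - Y2)" "sgn (y1 + y2) = sgn (Y1 + Y2)"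
    and 1: "y1 = 0 \<Longrightarrow> (z1 - z1') * (Z1 - Z1') > 0" and 2: "y2 = 0 \<Longrightarrow> (z2 - z2') * (Z2 - Z2') > 0"
    and 3: "y1 = y2 \<Longrightarrow> (z1 - z2) * (Z1 - Z2) > 0 \<and> (z1' - z2') * (Z1' - Z2') > 0"
    and 4: "y1 + y2 = 0 \<Longrightarrow> (z1 - z2') * (Z1 - Z2') > 0 \<and> (z1' - z2) * (Z1' - Z2) > 0"
  shows "same_diagram (vec4 (Complex y1 z1) (Complex (- y1) z1') (Complex y2 z2) (Complex (- y2) z2'))
    (vec4 (Complex Y1 Z1) (Complex (- Y1) Z1') (Complex Y2 Z2) (Complex (- Y2) Z2'))"
proof -
  define A :: "complex^4" where "A = vec4 (Complex y1 z1) (Complex (- y1) z1') (Complex y2 z2) (Complex (- y2) z2')"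
  define B :: "complex^4" where "B = vec4 (Complex Y1 Z1) (Complex (- Y1) Z1') (Complex Y2 Z2) (Complex (- Y2) Z2')"
  let ?P = "\<lambda>i j. sgn (Re (A $ i) - Re (A $ j)) = sgn (Re (B $ i) - Re (B $ j)) \<and>
     (Re (A $ i) = Re (A $ j) \<longrightarrow> (Im (A $ i) - Im (A $ j)) * (Im (B $ i) - Im (B $ j)) > 0)"
  have neg: "sgn (- x) = sgn (- y) \<longleftrightarrow> sgn x = sgn y" for x y :: real by (auto simp: sgn_if)
  have dbl: "sgn (x + x) = sgn x" for x :: real by (auto simp: sgn_if)
  have sym: "?P j i" if "?P i j" for i j
  proof -
    have "sgn (Re (A $ j) - Re (A $ i)) = sgn (Re (B $ j) - Re (B $ i))"
      using that neg[of "Re (A $ i) - Re (A $ j)" "Re (B $ i) - Re (B $ j)"] by simp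
    moreover have "(Im (A $ j) - Im (A $ i)) * (Im (B $ j) - Im (B $ i)) = (Im (A $ i) - Im (A $ j)) * (Im (B $ i) - Im (B $ j))"
      by (simp add: algebra_simps)
    ultimately show ?thesis using that by auto
  qed
  have 12: "?P 1 2" using y(1) 1 dbl[of y1] dbl[of Y1] by (auto simp: A_def B_def)
  have 34: "?P 3 4" using y(2) 2 dbl[of y2] dbl[of Y2] by (auto simp: A_def B_def)
  have 13: "?P 1 3" using y(3) 3 by (auto simp: A_def B_def)
  have 24: "?P 2 4" using y(3) 3 neg[of "y1 - y2" "Y1 - Y2"] by (auto simp: A_def B_def)
  have 14: "?P 1 4" using y(4) 4 by (auto simp: A_def B_def)
  have 23: "?P 2 3" using y(4) 4 neg[of "y1 + y2" "Y1 + Y2"] by (auto simp: A_def B_def)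
  have "same_diagram A B"
    unfolding same_diagram_def forall_4
    using 12 34 13 24 14 23 sym[OF 12] sym[OF 34] sym[OF 13] sym[OF 24] sym[OF 14] sym[OF 23] by blast
  then show ?thesis unfolding A_def B_def .
qed

lemma cis_pi_sign:
  assumes "a \<in> {-1, 1::int}"
  shows "cis (pi * of_int a * u) = Complex (cos (pi * u)) (of_int a * sin (pi * u))"
  using assms by (auto simp: complex_eq_iff)

text \<open>The configurations are those that follow each other in one block of the diagram: an
  inner crossing, two outer ones, an inner one, two outer ones.\<close>

lemma letter_paths_vec4:
  assumes s: "s \<in> {-1, 1}" and a: "a \<in> {-1, 1}" and b: "b \<in> {-1, 1}"
  defines "C \<equiv> \<lambda>u. cos (pi * u)" and "S \<equiv> \<lambda>u. sin (pi * u)"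
  shows "letter_path (Mid s) (vec4 1 (-1) 3 (-3)) u =
      vec4 (Complex (C u) (of_int s * S u)) (Complex (- C u) (- of_int s * S u)) (Complex 3 0) (Complex (- 3) 0)"
    and "letter_path (Out a b) (vec4 (-1) 1 3 (-3)) u =
      vec4 (Complex (-2 + C u) (of_int a * S u)) (Complex (- (-2 + C u)) (- of_int b * S u)) (Complex (2 + C u) (of_int b * S u)) (Complex (- (2 + C u)) (- of_int a * S u))"
    and "letter_path (Mid s) (vec4 (-3) 3 1 (-1)) u =
      vec4 (Complex (-3) 0) (Complex (- (-3)) 0) (Complex (C u) (of_int s * S u)) (Complex (- C u) (- of_int s * S u))"
    and "letter_path (Out a b) (vec4 (-3) 3 (-1) 1) u =
      vec4 (Complex (-2 - C u) (- of_int a * S u)) (Complex (- (-2 - C u)) (of_int b * S u)) (Complex (-2 + C u) (of_int a * S u)) (Complex (- (-2 + C u)) (- of_int b * S u))"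
  unfolding letter_path_def C_def S_def
  by (simp_all add: vec4_eq_iff cis_pi_sign[OF s] cis_pi_sign[OF a] cis_pi_sign[OF b] complex_eq_iff)

lemma letter_ends_vec4:
  assumes s: "s \<in> {-1, 1}" and a: "a \<in> {-1, 1}" and b: "b \<in> {-1, 1}"
  shows "letter_path (Mid s) (vec4 1 (-1) 3 (-3)) 1 = vec4 (-1) 1 3 (-3)"
    and "letter_path (Out a b) (vec4 (-1) 1 3 (-3)) 1 = vec4 (-3) 3 1 (-1)"
    and "letter_path (Mid s) (vec4 (-3) 3 1 (-1)) 1 = vec4 (-3) 3 (-1) 1"
    and "letter_path (Out a b) (vec4 (-3) 3 (-1) 1) 1 = vec4 (-1) 1 (-3) 3"
  unfolding letter_paths_vec4[OF assms] by (simp_all add: vec4_eq_iff complex_eq_iff)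

lemma sgn_cos:
  assumes "-(pi/2) < x" "x < 3 * pi / 2"
  shows "sgn (cos x) = sgn (pi/2 - x)"
proof -
  consider "x < pi/2" | "x = pi/2" | "x > pi/2" by linarith
  then show ?thesis
  proof cases
    case 1 then show ?thesis using cos_gt_zero_pi[of x] assms by simp
  next
    case 2 show ?thesis unfolding 2 by simp
  next
    case 3
    then have "cos (x - pi) > 0" using assms by (intro cos_gt_zero_pi) linarith+
    then have "cos x < 0" by (simp add: cos_diff)
    then show ?thesis using 3 by simp
  qed
qed

text \<open>The zeros of \<open>cos (pi * T + 1/2)\<close> and of \<open>cos (pi * T - 1/2)\<close>,
  at which a pair of opposite strands crosses.\<close>

definition "time1 = 1/2 - 1 / (2 * pi)"
definition "time3 = 1/2 + 1 / (2 * pi)"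

lemma time_bounds: "1/3 < time1" "time1 < 2/5" "3/5 < time3" "time3 < 2/3"
proof -
  have "3 < pi" "pi < 4" using pi_gt3 pi_less_4 by auto
  then show "1/3 < time1" "time1 < 2/5" "3/5 < time3" "time3 < 2/3"
    unfolding time1_def time3_def by (auto simp: field_simps)
qed

lemma sgn_mult_pos: "c > 0 \<Longrightarrow> sgn (c * x) = sgn (x::real)"
  by (simp add: sgn_mult)

lemma half_angle: "cos (1/2) > (0::real)" "sin (1/2) > (0::real)"
proof -
  show "cos (1/2) > (0::real)" using pi_gt3 by (intro cos_gt_zero_pi) linarith+
  show "sin (1/2) > (0::real)" using pi_gt3 by (intro sin_gt_zero) linarith+
qed

text \<open>Sum and difference of the two cosines factor as \<open>cos (pi * T)\<close> and
  \<open>- sin (pi * T)\<close> with the positive constants \<open>2 * cos (1/2)\<close> and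
  \<open>2 * sin (1/2)\<close>, which gives the zeros 1/2 and 1. The bound 6/5 leaves room after the
  crossing at 1, whose letter extends to 11/10.\<close>

lemma block_signs:
  assumes "0 < T" "T < 6/5"
  defines "y1 \<equiv> cos (pi * T + 1/2)" and "y2 \<equiv> cos (pi * T - 1/2)"
  shows "sgn y1 = sgn (time1 - T)" "sgn y2 = sgn (time3 - T)"
    "sgn (y1 + y2) = sgn (1/2 - T)" "sgn (y1 - y2) = sgn (T - 1)"
proof -
  have pT: "0 < pi * T" "pi * T < pi * (6/5)" using assms by (auto intro: mult_strict_left_mono)
  have p: "3 < pi" using pi_gt3 .
  have "sgn y1 = sgn (pi/2 - (pi * T + 1/2))" unfolding y1_def using pT p by (intro sgn_cos) linarith+
  also have "pi/2 - (pi * T + 1/2) = pi * (time1 - T)" by (simp add: time1_def field_simps)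
  finally show "sgn y1 = sgn (time1 - T)" by (simp add: sgn_mult_pos)
  have "sgn y2 = sgn (pi/2 - (pi * T - 1/2))" unfolding y2_def using pT p by (intro sgn_cos) linarith+
  also have "pi/2 - (pi * T - 1/2) = pi * (time3 - T)" by (simp add: time3_def field_simps)
  finally show "sgn y2 = sgn (time3 - T)" by (simp add: sgn_mult_pos)
  have "y1 + y2 = (2 * cos (1/2)) * cos (pi * T)" unfolding y1_def y2_def by (simp add: cos_add cos_diff)
  then have "sgn (y1 + y2) = sgn (cos (pi * T))" using half_angle(1) by (simp add: sgn_mult_pos)
  also have "\<dots> = sgn (pi/2 - pi * T)" using pT p by (intro sgn_cos) linarith+
  also have "pi/2 - pi * T = pi * (1/2 - T)" by (simp add: field_simps)
  finally show "sgn (y1 + y2) = sgn (1/2 - T)" by (simp add: sgn_mult_pos)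
  have "y1 - y2 = (2 * sin (1/2)) * (- sin (pi * T))" unfolding y1_def y2_def by (simp add: cos_add cos_diff)
  then have "sgn (y1 - y2) = sgn (- sin (pi * T))" using half_angle(2) by (simp add: sgn_mult_pos del: mult_minus_right)
  also have "- sin (pi * T) = - cos (pi * T - pi/2)" by (simp add: cos_diff)
  also have "sgn (- cos (pi * T - pi/2)) = - sgn (pi/2 - (pi * T - pi/2))"
    unfolding sgn_minus by (subst sgn_cos) (use pT p in linarith)+
  also have "pi/2 - (pi * T - pi/2) = pi * (1 - T)" by (simp add: field_simps)
  finally show "sgn (y1 - y2) = sgn (T - 1)" by (simp add: sgn_mult_pos) (simp add: sgn_if)
qed

lemma half_turn_sgn:
  assumes "u \<in> {0..1}" shows "sgn (cos (pi * u)) = sgn (1/2 - u)"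
proof -
  have "pi * u \<le> pi * 1" "0 \<le> pi * u" using assms by (intro mult_left_mono, auto)
  then have "sgn (cos (pi * u)) = sgn (pi/2 - pi * u)" using pi_gt_zero by (intro sgn_cos) linarith+
  also have "pi/2 - pi * u = pi * (1/2 - u)" by (simp add: field_simps)
  finally show ?thesis by (simp add: sgn_mult_pos)
qed

lemma two_piece_time:
  fixes a E A :: real
  assumes "a < E" "E < A" "u \<in> {0..1}"
  defines "T \<equiv> (linepath a E +++ linepath E A) u"
  shows "T \<in> {a..A}" "sgn (E - T) = sgn (1/2 - u)"
proof -
  have m: "strict_mono_on {0..1} (linepath a E +++ linepath E A)"
    using assms(1,2) by (intro strict_mono_join strict_mono_linepath) (auto simp: linepath_def)
  have v: "(linepath a E +++ linepath E A) 0 = a" "(linepath a E +++ linepath E A) 1 = A" "(linepath a E +++ linepath E A) (1/2) = E"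
    by (simp_all add: joinpaths_def linepath_def)
  show "T \<in> {a..A}"
    using strict_mono_on_leD[OF m, of 0 u] strict_mono_on_leD[OF m, of u 1] assms(3) v unfolding T_def by auto
  consider "u < 1/2" | "u = 1/2" | "u > 1/2" by linarith
  then show "sgn (E - T) = sgn (1/2 - u)"
  proof cases
    case 1 then show ?thesis using strict_mono_onD[OF m, of u "1/2"] assms(3) v unfolding T_def by auto
  next
    case 2 show ?thesis unfolding T_def 2 v by simp
  next
    case 3 then show ?thesis using strict_mono_onD[OF m, of "1/2" u] assms(3) v unfolding T_def by auto
  qed
qed

lemma sgn_eq_0_iff': "sgn x = sgn y \<Longrightarrow> x = 0 \<longleftrightarrow> y = (0::real)"
  by (metis sgn_0_0)

lemma sin_mid: "sgn x = sgn (1/2 - u) \<Longrightarrow> x = 0 \<Longrightarrow> sin (pi * u) = 1"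
proof -
  assume "sgn x = sgn (1/2 - u)" "x = 0"
  then have "u = 1/2" by (simp add: sgn_zero_iff)
  show ?thesis unfolding \<open>u = 1/2\<close> by simp
qed

definition liss :: "(real \<Rightarrow> real^4) \<Rightarrow> real \<Rightarrow> complex^4" where
  "liss w T = vec4 (Complex (cos (pi * T + 1/2)) (w T $ 1)) (Complex (- cos (pi * T + 1/2)) (w T $ 2))
     (Complex (cos (pi * T - 1/2)) (w T $ 3)) (Complex (- cos (pi * T - 1/2)) (w T $ 4))"

context
  fixes w :: "real \<Rightarrow> real^4" and s a b :: int
  assumes s: "s \<in> {-1, 1}" and a: "a \<in> {-1, 1}" and b: "b \<in> {-1, 1}"
begin

text \<open>Here and for the other three letters of a block, heights enter only through the one
  comparison that changes sign; the remaining ones keep strict signs during the letter.\<close>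

lemma liss_letter1:
  assumes w: "(w time1 $ 1 - w time1 $ 2) * s > 0" and "0 < p" "p < time1" "time1 < q" "q < 1/2" and u: "u \<in> {0..1}"
  shows "same_diagram (liss w ((linepath p time1 +++ linepath time1 q) u)) (letter_path (Mid s) (vec4 1 (-1) 3 (-3)) u)"
proof -
  define T where "T = (linepath p time1 +++ linepath time1 q) u"
  note T = two_piece_time[OF assms(3,4) u, folded T_def]
  have bs: "0 < T" "T < 6/5" "T < time3" "T < 1/2" "T < 1" using T(1) assms time_bounds by auto
  note B = block_signs[OF bs(1,2)]
  have c: "cos (pi * u) < 2" "- cos (pi * u) < 2" by (rule cos_bounds_2)+
  have z: "T = time1" "sin (pi * u) = 1" if "cos (pi * T + 1/2) = 0"
    using sgn_eq_0_iff'[OF B(1)] sin_mid[OF T(2)] that by auto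
  show ?thesis
    unfolding liss_def letter_paths_vec4(1)[OF s a b] T_def[symmetric]
  proof (rule same_diagram4)
    show "sgn (cos (pi * T + 1/2)) = sgn (cos (pi * u))" using B(1) T(2) half_turn_sgn[OF u] by simp
    show "sgn (cos (pi * T - 1/2)) = sgn 3" using B(2) bs by simp
    show "sgn (cos (pi * T + 1/2) - cos (pi * T - 1/2)) = sgn (cos (pi * u) - 3)" using B(4) bs c by simp
    show "sgn (cos (pi * T + 1/2) + cos (pi * T - 1/2)) = sgn (cos (pi * u) + 3)" using B(3) bs c by simp
    show "(w T $ 1 - w T $ 2) * (of_int s * sin (pi * u) - - of_int s * sin (pi * u)) > 0" if "cos (pi * T + 1/2) = 0"
      using w unfolding z[OF that] by (simp only: algebra_simps, linarith?)
  qed (use B bs in \<open>auto simp: sgn_if split: if_splits\<close>)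
qed

lemma liss_letter2:
  assumes w: "(w (1/2) $ 1 - w (1/2) $ 4) * a > 0" "(w (1/2) $ 3 - w (1/2) $ 2) * b > 0"
    and "time1 < p" "p < 1/2" "1/2 < q" "q < time3" and u: "u \<in> {0..1}"
  shows "same_diagram (liss w ((linepath p (1/2) +++ linepath (1/2) q) u)) (letter_path (Out a b) (vec4 (-1) 1 3 (-3)) u)"
proof -
  define T where "T = (linepath p (1/2) +++ linepath (1/2) q) u"
  note T = two_piece_time[OF assms(4,5) u, folded T_def]
  have bs: "0 < T" "T < 6/5" "T < time3" "T > time1" "T < 1" using T(1) assms time_bounds by auto
  note B = block_signs[OF bs(1,2)]
  have c: "cos (pi * u) < 2" "- cos (pi * u) < 2" by (rule cos_bounds_2)+
  have z: "T = 1/2" "sin (pi * u) = 1" if "cos (pi * T + 1/2) + cos (pi * T - 1/2) = 0"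
    using sgn_eq_0_iff'[OF B(3)] sin_mid[OF T(2)] that by auto
  have h: "sgn (cos (pi * T + 1/2) + cos (pi * T - 1/2)) = sgn (cos (pi * u))" using B(3) T(2) half_turn_sgn[OF u] by simp
  show ?thesis
    unfolding liss_def letter_paths_vec4(2)[OF s a b] T_def[symmetric]
  proof (rule same_diagram4)
    show "sgn (cos (pi * T + 1/2)) = sgn (-2 + cos (pi * u))" using B(1) bs c by simp
    show "sgn (cos (pi * T - 1/2)) = sgn (2 + cos (pi * u))" using B(2) bs c by simp
    show "sgn (cos (pi * T + 1/2) - cos (pi * T - 1/2)) = sgn (-2 + cos (pi * u) - (2 + cos (pi * u)))" using B(4) bs by simp
    show "sgn (cos (pi * T + 1/2) + cos (pi * T - 1/2)) = sgn (-2 + cos (pi * u) + (2 + cos (pi * u)))"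
      using h sgn_mult_pos[of 2 "cos (pi * u)"] by simp
    show "(w T $ 1 - w T $ 4) * (of_int a * sin (pi * u) - - of_int a * sin (pi * u)) > 0 \<and> (w T $ 2 - w T $ 3) * (- of_int b * sin (pi * u) - of_int b * sin (pi * u)) > 0"
      if "cos (pi * T + 1/2) + cos (pi * T - 1/2) = 0"
      using w unfolding z[OF that] by (simp only: algebra_simps, linarith?)
  qed (use B bs in \<open>auto simp: sgn_if split: if_splits\<close>)
qed

lemma liss_letter3:
  assumes w: "(w time3 $ 3 - w time3 $ 4) * s > 0" and "1/2 < p" "p < time3" "time3 < q" "q < 1" and u: "u \<in> {0..1}"
  shows "same_diagram (liss w ((linepath p time3 +++ linepath time3 q) u)) (letter_path (Mid s) (vec4 (-3) 3 1 (-1)) u)"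
proof -
  define T where "T = (linepath p time3 +++ linepath time3 q) u"
  note T = two_piece_time[OF assms(3,4) u, folded T_def]
  have bs: "0 < T" "T < 6/5" "T > time1" "T > 1/2" "T < 1" using T(1) assms time_bounds by auto
  note B = block_signs[OF bs(1,2)]
  have c: "cos (pi * u) < 2" "- cos (pi * u) < 2" by (rule cos_bounds_2)+
  have z: "T = time3" "sin (pi * u) = 1" if "cos (pi * T - 1/2) = 0"
    using sgn_eq_0_iff'[OF B(2)] sin_mid[OF T(2)] that by auto
  show ?thesis
    unfolding liss_def letter_paths_vec4(3)[OF s a b] T_def[symmetric]
  proof (rule same_diagram4)
    show "sgn (cos (pi * T + 1/2)) = sgn (-3)" using B(1) bs by simp
    show "sgn (cos (pi * T - 1/2)) = sgn (cos (pi * u))" using B(2) T(2) half_turn_sgn[OF u] by simp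
    show "sgn (cos (pi * T + 1/2) - cos (pi * T - 1/2)) = sgn (-3 - cos (pi * u))" using B(4) bs c by simp
    show "sgn (cos (pi * T + 1/2) + cos (pi * T - 1/2)) = sgn (-3 + cos (pi * u))" using B(3) bs c by simp
    show "(w T $ 3 - w T $ 4) * (of_int s * sin (pi * u) - - of_int s * sin (pi * u)) > 0" if "cos (pi * T - 1/2) = 0"
      using w unfolding z[OF that] by (simp only: algebra_simps, linarith?)
  qed (use B bs in \<open>auto simp: sgn_if split: if_splits\<close>)
qed

lemma liss_letter4:
  assumes w: "(w 1 $ 3 - w 1 $ 1) * a > 0" "(w 1 $ 2 - w 1 $ 4) * b > 0"
    and "time3 < p" "p < 1" "1 < q" "q < 6/5" and u: "u \<in> {0..1}"
  shows "same_diagram (liss w ((linepath p 1 +++ linepath 1 q) u)) (letter_path (Out a b) (vec4 (-3) 3 (-1) 1) u)"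
proof -
  define T where "T = (linepath p 1 +++ linepath 1 q) u"
  note T = two_piece_time[OF assms(4,5) u, folded T_def]
  have bs: "0 < T" "T < 6/5" "T > time3" "T > time1" "T > 1/2" using T(1) assms time_bounds by auto
  note B = block_signs[OF bs(1,2)]
  have c: "cos (pi * u) < 2" "- cos (pi * u) < 2" by (rule cos_bounds_2)+
  have z: "T = 1" "sin (pi * u) = 1" if "cos (pi * T + 1/2) = cos (pi * T - 1/2)"
    using sgn_eq_0_iff'[OF B(4)] sin_mid[OF T(2)] that by auto
  have h: "sgn (cos (pi * T + 1/2) - cos (pi * T - 1/2)) = - sgn (cos (pi * u))"
    using B(4) T(2) half_turn_sgn[OF u] sgn_minus[of "1 - T"] by simp
  show ?thesis
    unfolding liss_def letter_paths_vec4(4)[OF s a b] T_def[symmetric]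
  proof (rule same_diagram4)
    show "sgn (cos (pi * T + 1/2)) = sgn (-2 - cos (pi * u))" using B(1) bs c by simp
    show "sgn (cos (pi * T - 1/2)) = sgn (-2 + cos (pi * u))" using B(2) bs c by simp
    show "sgn (cos (pi * T + 1/2) - cos (pi * T - 1/2)) = sgn (-2 - cos (pi * u) - (-2 + cos (pi * u)))"
      unfolding h using sgn_mult_pos[of 2 "cos (pi * u)"] sgn_minus[of "2 * cos (pi * u)"] by simp
    show "sgn (cos (pi * T + 1/2) + cos (pi * T - 1/2)) = sgn (-2 - cos (pi * u) + (-2 + cos (pi * u)))" using B(3) bs by simp
    show "(w T $ 1 - w T $ 3) * (- of_int a * sin (pi * u) - of_int a * sin (pi * u)) > 0 \<and> (w T $ 2 - w T $ 4) * (of_int b * sin (pi * u) - - of_int b * sin (pi * u)) > 0"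
      if "cos (pi * T + 1/2) = cos (pi * T - 1/2)"
      using w unfolding z[OF that] by (simp only: algebra_simps, linarith?)
  qed (use B bs in \<open>auto simp: sgn_if split: if_splits\<close>)
qed

lemma liss_end:
  assumes "time1 < T" "T < 1/2"
  shows "same_diagram (liss w T) (vec4 (-1) 1 3 (-3))"
proof -
  have bs: "0 < T" "T < 6/5" "T < time3" "T < 1" using assms time_bounds by auto
  note B = block_signs[OF bs(1,2)]
  have "vec4 (-1) 1 3 (-3) = vec4 (Complex (-1) 0) (Complex (- (-1)) 0) (Complex 3 0) (Complex (- 3) 0)"
    by (simp add: vec4_eq_iff complex_eq_iff)
  then show ?thesis unfolding liss_def
    by (simp only:, intro same_diagram4) (use B bs assms in \<open>auto simp: sgn_if split: if_splits\<close>)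
qed

end

section \<open>The braid word of a Lissajous diagram\<close>

locale lissajous =
  fixes N :: nat and z :: "real \<Rightarrow> real" and \<alpha> \<beta> :: "nat \<Rightarrow> int" and a b a' b' :: int
  assumes cont_z: "continuous_on UNIV z" and per_z: "\<And>t. z (t + 2 * pi) = z t"
    and \<alpha>: "\<And>k. \<alpha> k \<in> {-1, 1}" and \<beta>: "\<And>k. \<beta> k \<in> {-1, 1}"
    and ab: "a \<in> {-1, 1}" "b \<in> {-1, 1}" "a' \<in> {-1, 1}" "b' \<in> {-1, 1}"
begin

definition ny :: real where "ny = 2 * real N + 1"

lemma ny_pos: "ny > 0" by (simp add: ny_def)

definition angle :: "real \<Rightarrow> real" where "angle T = pi * T / ny"

text \<open>With t = \<open>angle T\<close>, the parameters t, t + pi, -t, pi - t are those with the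
  same value of \<open>cos (2 * t)\<close>. As \<open>ny\<close> is odd, adding \<open>pi\<close>
  negates y, so the strands form two opposite pairs.\<close>

definition heights :: "real \<Rightarrow> real^4" where
  "heights T = vec4 (z (angle T)) (z (angle T + pi)) (z (- angle T)) (z (pi - angle T))"

definition curve :: "real \<Rightarrow> real \<times> complex" where
  "curve t = (cos (2 * t), Complex (cos (ny * t + 1/2)) (z t))"

definition left_exp :: "nat \<Rightarrow> int" where "left_exp k = (if even k then a else b)"
definition right_exp :: "nat \<Rightarrow> int" where "right_exp k = (if even k then b else a)"
definition left_exp' :: "nat \<Rightarrow> int" where "left_exp' k = (if even k then a' else b')"
definition right_exp' :: "nat \<Rightarrow> int" where "right_exp' k = (if even k then b' else a')"

text \<open>The times 2/5, 11/20, 3/4 and 11/10 separate consecutive crossings; being rational, they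
  compare with \<open>time1\<close> and \<open>time3\<close> through
  \<open>time_bounds\<close>.\<close>

definition items :: "nat \<Rightarrow> (letter \<times> real \<times> real) list" where
  "items k = [(Mid (\<alpha> k), k + time1, k + 2/5), (Out a b, k + 1/2, k + 11/20),
     (Mid (\<beta> k), k + time3, k + 3/4), (Out a' b', k + 1, k + 11/10)]"

text \<open>The x-coordinate turns at T = N + 1/2, so after N full blocks exactly one more crossing
  occurs, at N + \<open>time1\<close>.\<close>

fun schedule :: "nat \<Rightarrow> nat \<Rightarrow> (letter \<times> real \<times> real) list" where
  "schedule k 0 = [(Mid (\<alpha> k), k + time1, k + 2/5)]"
| "schedule k (Suc m) = items k @ schedule (Suc k) m"

text \<open>The power of -1 compensates for the change of sign of all y-coordinates from one block
  to the next.\<close>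

definition crossings_ok :: bool where
  "crossings_ok \<longleftrightarrow>
    (\<forall>k\<le>N. (-1) ^ k * of_int (\<alpha> k) * (heights (real k + time1) $ 1 - heights (real k + time1) $ 2) > 0) \<and>
    (\<forall>k<N. (-1) ^ k * of_int (left_exp k) * (heights (real k + 1/2) $ 1 - heights (real k + 1/2) $ 4) > 0 \<and>
      (-1) ^ k * of_int (right_exp k) * (heights (real k + 1/2) $ 3 - heights (real k + 1/2) $ 2) > 0 \<and>
      (-1) ^ k * of_int (\<beta> k) * (heights (real k + time3) $ 3 - heights (real k + time3) $ 4) > 0 \<and>
      (-1) ^ k * of_int (left_exp' k) * (heights (real k + 1) $ 3 - heights (real k + 1) $ 1) > 0 \<and>
      (-1) ^ k * of_int (right_exp' k) * (heights (real k + 1) $ 2 - heights (real k + 1) $ 4) > 0)"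

definition frame :: "real \<Rightarrow> complex^4" where "frame = liss heights"

lemma cos_shift_block: "cos (pi * (real k + T) + c) = (-1) ^ k * cos (pi * T + c)"
proof (induction k)
  case (Suc k)
  have "pi * (real (Suc k) + T) + c = (pi * (real k + T) + c) + pi" by (simp add: algebra_simps)
  then show ?case using Suc by (simp only: cos_periodic_pi) simp
qed simp

text \<open>Rotation by a half turn negates the heights together with y, while the heights of the
  curve are what they are; hence the inner minus sign for odd k.\<close>

lemma frame_block: "frame (real k + T) = (if even k then liss (\<lambda>T. heights (real k + T)) T else - liss (\<lambda>T. - heights (real k + T)) T)"
  using cos_shift_block[of k T "1/2"] cos_shift_block[of k T "-1/2"]
  unfolding frame_def liss_def by (auto simp: vec_eq_iff forall_4 complex_eq_iff)

definition block_cfg :: "nat \<Rightarrow> complex^4" where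
  "block_cfg k = (if even k then vec4 1 (-1) 3 (-3) else - vec4 1 (-1) 3 (-3))"

lemma letter_path_minus: "letter_path l (- c) u = - letter_path (swap_letter l) c u"
proof -
  have "swap_letter (swap_letter l) = l" by (cases l) auto
  then show ?thesis using letter_path_swap[of "swap_letter l" c u] by simp
qed

lemma shifted_time:
  "(linepath (real k + p) (real k + E) +++ linepath (real k + E) (real k + q)) u = real k + (linepath p E +++ linepath E q) u"
  by (auto simp: joinpaths_def linepath_def algebra_simps)

text \<open>Odd blocks are negated even blocks with the two outer pairs exchanged.\<close>
lemma block_step:
  assumes "same_diagram (liss (\<lambda>T::real. (if even k then heights (real k + T) else - heights (real k + T))) ((linepath p E +++ linepath E q) u))
      (letter_path (if even k then l else swap_letter l) c u)"
  shows "same_diagram (frame ((linepath (real k + p) (real k + E) +++ linepath (real k + E) (real k + q)) u))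
      (letter_path l (if even k then c else - c) u)"
  using assms unfolding shifted_time frame_block by (auto simp: letter_path_minus same_diagram_uminus)

lemma block_end: "letter_path l (if even k then c else - c) 1 = (if even k then letter_path l c 1 else - letter_path (swap_letter l) c 1)"
  by (simp add: letter_path_minus)

lemma block_letter_ends:
  "letter_path (Mid (\<alpha> k)) (if even k then vec4 1 (-1) 3 (-3) else - vec4 1 (-1) 3 (-3)) 1 = (if even k then vec4 (-1) 1 3 (-3) else - vec4 (-1) 1 3 (-3))"
  "letter_path (Out a b) (if even k then vec4 (-1) 1 3 (-3) else - vec4 (-1) 1 3 (-3)) 1 = (if even k then vec4 (-3) 3 1 (-1) else - vec4 (-3) 3 1 (-1))"
  "letter_path (Mid (\<beta> k)) (if even k then vec4 (-3) 3 1 (-1) else - vec4 (-3) 3 1 (-1)) 1 = (if even k then vec4 (-3) 3 (-1) 1 else - vec4 (-3) 3 (-1) 1)"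
  "letter_path (Out a' b') (if even k then vec4 (-3) 3 (-1) 1 else - vec4 (-3) 3 (-1) 1) 1 = (if even k then vec4 (-1) 1 (-3) 3 else - vec4 (-1) 1 (-3) 3)"
  unfolding block_end using letter_ends_vec4[OF \<alpha> ab(1,2)] letter_ends_vec4[OF \<alpha> ab(2,1)]
    letter_ends_vec4[OF \<beta> ab(3,4)] letter_ends_vec4[OF \<beta> ab(4,3)] by auto

lemma block_cfg_Suc: "(if even k then vec4 (-1) 1 (-3) 3 else - vec4 (-1) 1 (-3) 3) = block_cfg (Suc k)"
  unfolding block_cfg_def by (auto simp: vec_eq_iff forall_4)

lemma tracks_block:
  assumes "crossings_ok" "k < N"
    and rest: "tracks frame (block_cfg (Suc k)) (real (Suc k) + 1/10) e r"
  shows "tracks frame (block_cfg k) (real k + 1/10) e (items k @ r)"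
proof -
  let ?w = "\<lambda>T::real. (if even k then heights (real k + T) else - heights (real k + T))"
  let ?\<alpha> = "\<alpha> k" and ?\<beta> = "\<beta> k" and ?a = "left_exp k" and ?b = "right_exp k" and ?a' = "left_exp' k" and ?b' = "right_exp' k"
  have e: "?a \<in> {-1, 1}" "?b \<in> {-1, 1}" "?a' \<in> {-1, 1}" "?b' \<in> {-1, 1}"
    using ab unfolding left_exp_def right_exp_def left_exp'_def right_exp'_def by auto
  have c1: "(-1) ^ k * of_int ?\<alpha> * (heights (real k + time1) $ 1 - heights (real k + time1) $ 2) > 0"
    and c2: "(-1) ^ k * of_int ?a * (heights (real k + 1/2) $ 1 - heights (real k + 1/2) $ 4) > 0"
      "(-1) ^ k * of_int ?b * (heights (real k + 1/2) $ 3 - heights (real k + 1/2) $ 2) > 0"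
    and c3: "(-1) ^ k * of_int ?\<beta> * (heights (real k + time3) $ 3 - heights (real k + time3) $ 4) > 0"
    and c4: "(-1) ^ k * of_int ?a' * (heights (real k + 1) $ 3 - heights (real k + 1) $ 1) > 0"
      "(-1) ^ k * of_int ?b' * (heights (real k + 1) $ 2 - heights (real k + 1) $ 4) > 0"
    using assms(1,2) unfolding crossings_ok_def by auto
  have W: "(?w T $ i - ?w T $ j) * s > 0" if "(-1) ^ k * s * (heights (real k + T) $ i - heights (real k + T) $ j) > 0" for T i j and s :: real
    using that by (cases "even k") (auto simp: algebra_simps)
  have S: "(if even k then Mid s else swap_letter (Mid s)) = Mid s" for s by simp
  have O: "(if even k then Out a b else swap_letter (Out a b)) = Out ?a ?b"
    "(if even k then Out a' b' else swap_letter (Out a' b')) = Out ?a' ?b'"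
    by (simp_all add: left_exp_def right_exp_def left_exp'_def right_exp'_def)
  let ?c = "\<lambda>c. if even k then c else - c"
  have 1: "same_diagram (frame ((linepath (real k + 1/10) (real k + time1) +++ linepath (real k + time1) (real k + 2/5)) u))
      (letter_path (Mid ?\<alpha>) (?c (vec4 1 (-1) 3 (-3))) u)" if "u \<in> {0..1}" for u
    by (rule block_step, unfold S, rule liss_letter1[where w="?w", OF \<alpha> e(1) e(2) W[OF c1] _ _ _ _ that]) (use time_bounds in auto)
  have 2: "same_diagram (frame ((linepath (real k + 2/5) (real k + 1/2) +++ linepath (real k + 1/2) (real k + 11/20)) u))
      (letter_path (Out a b) (?c (vec4 (-1) 1 3 (-3))) u)" if "u \<in> {0..1}" for u
    by (rule block_step, unfold O, rule liss_letter2[where w="?w", OF \<alpha> e(1) e(2) W[OF c2(1)] W[OF c2(2)] _ _ _ _ that]) (use time_bounds in auto)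
  have 3: "same_diagram (frame ((linepath (real k + 11/20) (real k + time3) +++ linepath (real k + time3) (real k + 3/4)) u))
      (letter_path (Mid ?\<beta>) (?c (vec4 (-3) 3 1 (-1))) u)" if "u \<in> {0..1}" for u
    by (rule block_step, unfold S, rule liss_letter3[where w="?w", OF \<beta> e(1) e(2) W[OF c3] _ _ _ _ that]) (use time_bounds in auto)
  have 4: "same_diagram (frame ((linepath (real k + 3/4) (real k + 1) +++ linepath (real k + 1) (real k + 11/10)) u))
      (letter_path (Out a' b') (?c (vec4 (-3) 3 (-1) 1)) u)" if "u \<in> {0..1}" for u
    by (rule block_step, unfold O, rule liss_letter4[where w="?w", OF \<alpha> e(3) e(4) W[OF c4(1)] W[OF c4(2)] _ _ _ _ that]) (use time_bounds in auto)
  have "real (Suc k) + 1/10 = real k + 11/10" by simp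
  then have "tracks frame (block_cfg (Suc k)) (real k + 11/10) e r" using rest by (simp only:)
  then show ?thesis
    using 1 2 3 4 unfolding items_def block_cfg_def[of k] by (simp add: block_letter_ends block_cfg_Suc)
qed

definition end_cfg :: "nat \<Rightarrow> complex^4" where
  "end_cfg k = (if even k then vec4 (-1) 1 3 (-3) else - vec4 (-1) 1 3 (-3))"

text \<open>A time between the end N + 2/5 of the last letter and the turning point N + 1/2; what
  follows belongs to the right caps.\<close>

definition end_time :: real where "end_time = real N + 21/50"

lemma tracks_last:
  assumes "crossings_ok"
  shows "tracks frame (block_cfg N) (real N + 1/10) end_time (schedule N 0)"
proof -
  let ?w = "\<lambda>T::real. (if even N then heights (real N + T) else - heights (real N + T))"
  have c1: "(-1) ^ N * of_int (\<alpha> N) * (heights (real N + time1) $ 1 - heights (real N + time1) $ 2) > 0"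
    using assms unfolding crossings_ok_def by auto
  have W: "(?w time1 $ 1 - ?w time1 $ 2) * of_int (\<alpha> N) > 0"
    using c1 by (cases "even N") (auto simp: algebra_simps)
  have S: "(if even N then Mid s else swap_letter (Mid s)) = Mid s" for s by simp
  let ?c = "\<lambda>c. if even N then c else - c"
  have 1: "same_diagram (frame ((linepath (real N + 1/10) (real N + time1) +++ linepath (real N + time1) (real N + 2/5)) u))
      (letter_path (Mid (\<alpha> N)) (?c (vec4 1 (-1) 3 (-3))) u)" if "u \<in> {0..1}" for u
    by (rule block_step, unfold S, rule liss_letter1[where w="?w", OF \<alpha> ab(1,2) W _ _ _ _ that]) (use time_bounds in auto)
  have E1: "letter_path (Mid (\<alpha> N)) (?c (vec4 1 (-1) 3 (-3))) 1 = end_cfg N"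
    unfolding block_end end_cfg_def using letter_ends_vec4[OF \<alpha> ab(1,2)] by auto
  have "same_diagram (frame T) (end_cfg N)" if "T \<in> {real N + 2/5..end_time}" for T
  proof -
    have "time1 < T - N" "T - N < 1/2" using that time_bounds unfolding end_time_def by auto
    then have "same_diagram (liss ?w (T - N)) (vec4 (-1) 1 3 (-3))" by (rule liss_end[OF \<alpha> ab(1,2)])
    then show ?thesis using frame_block[of N "T - N"] unfolding end_cfg_def by (auto simp: same_diagram_uminus split: if_splits)
  qed
  then show ?thesis using 1 unfolding block_cfg_def by (simp add: E1)
qed

lemma tracks_schedule:
  assumes "crossings_ok" "k + m = N"
  shows "tracks frame (block_cfg k) (real k + 1/10) end_time (schedule k m)"
  using assms(2)
proof (induction m arbitrary: k)
  case 0 then show ?case using tracks_last[OF assms(1)] by simp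
next
  case (Suc m)
  have "tracks frame (block_cfg (Suc k)) (real (Suc k) + 1/10) end_time (schedule (Suc k) m)"
    using Suc.IH[of "Suc k"] Suc.prems by (simp del: of_nat_Suc)
  then show ?case using tracks_block[OF assms(1)] Suc.prems by simp
qed

lemma increasing_schedule: "k + m = N \<Longrightarrow> increasing (real k + 1/10) end_time (schedule k m)"
proof (induction m arbitrary: k)
  case 0 then show ?case using time_bounds by (simp add: end_time_def)
next
  case (Suc m)
  have e: "real (Suc k) + 1/10 = real k + 11/10" by simp
  have "increasing (real (Suc k) + 1/10) end_time (schedule (Suc k) m)"
    using Suc.IH[of "Suc k"] Suc.prems by (simp del: of_nat_Suc)
  then have "increasing (real k + 11/10) end_time (schedule (Suc k) m)" unfolding e .
  then show ?case using time_bounds by (simp add: items_def)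
qed

definition word :: "letter list" where "word = map fst (schedule 0 N)"

lemma end_cfg_word: "pathfinish (word_path word start_cfg) = end_cfg N"
proof -
  have "pathfinish (word_path (map fst (schedule k m)) (block_cfg k)) = end_cfg (k + m)" for k m
  proof (induction m arbitrary: k)
    case 0
    show ?case unfolding block_cfg_def end_cfg_def by (simp add: block_letter_ends)
  next
    case (Suc m)
    have "letter_path (Out a' b') (letter_path (Mid (\<beta> k)) (letter_path (Out a b) (letter_path (Mid (\<alpha> k)) (block_cfg k) 1) 1) 1) 1 = block_cfg (Suc k)"
      unfolding block_cfg_def[of k] by (simp only: block_letter_ends block_cfg_Suc)
    then show ?case using Suc[of "Suc k"] by (simp add: items_def)
  qed
  from this[of 0 N] show ?thesis unfolding word_def by (simp add: block_cfg_def start_cfg_vec4)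
qed

lemma continuous_frame: "continuous_on A frame"
proof -
  have h: "continuous_on A (\<lambda>T. heights T $ i)" for i
  proof -
    have zc: "continuous_on A (\<lambda>T. z (f T))" if "continuous_on A f" for f
      by (rule continuous_on_compose2[OF cont_z that]) auto
    have "\<forall>i. continuous_on A (\<lambda>T. heights T $ i)"
      unfolding forall_4 heights_def angle_def by (auto intro!: zc continuous_intros simp: ny_pos[THEN less_imp_neq, symmetric])
    then show ?thesis by blast
  qed
  have "\<forall>i. continuous_on A (\<lambda>T. frame T $ i)"
    unfolding forall_4 frame_def liss_def by (auto simp: Complex_eq intro!: continuous_intros h)
  then have "continuous_on A (\<lambda>T. \<chi> i. frame T $ i)" by (intro continuous_on_vec_lambda) blast
  then show ?thesis by simp
qed

end

lemma cos_add_turns: "cos (x + real n * (2 * pi)) = cos x"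
proof (induction n)
  case (Suc n)
  have "x + real (Suc n) * (2 * pi) = (x + real n * (2 * pi)) + 2 * pi" by (simp add: algebra_simps)
  then show ?case using Suc by (simp only: cos_periodic)
qed simp

context lissajous
begin

lemma frame_nth [simp]:
  "frame T $ 1 = Complex (cos (pi * T + 1/2)) (z (angle T))"
  "frame T $ 2 = Complex (- cos (pi * T + 1/2)) (z (angle T + pi))"
  "frame T $ 3 = Complex (cos (pi * T - 1/2)) (z (- angle T))"
  "frame T $ 4 = Complex (- cos (pi * T - 1/2)) (z (pi - angle T))"
  by (simp_all add: frame_def liss_def heights_def)

text \<open>The cap through the left end of x-time at the parameter c, unfolded: T is negative
  before the turning point and positive after it, and the absolute value is the fibre.\<close>

definition left_arc :: "real \<Rightarrow> real \<Rightarrow> real \<Rightarrow> real \<times> complex" where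
  "left_arc s c T = (\<bar>T\<bar>, Complex (s * cos (pi * T + 1/2)) (z (angle T + c)))"

text \<open>Folded at T = \<open>ny / 2\<close>, the other turning point, as \<open>left_arc\<close>
  is folded at 0.\<close>

definition right_arc :: "real \<Rightarrow> real \<Rightarrow> real \<Rightarrow> real \<times> complex" where
  "right_arc s c T = (ny / 2 - \<bar>T - ny / 2\<bar>, Complex (s * cos (pi * T + 1/2)) (z (angle T + c)))"

lemma ny_pi: "pi * ny = of_nat N * (2 * pi) + pi" by (simp add: ny_def algebra_simps)

lemma cos_reflect: "cos (pi * (ny - T) + 1/2) = - cos (pi * T - 1/2)"
proof -
  have "pi * (ny - T) + 1/2 = - (pi * T - 1/2) + pi + of_nat N * (2 * pi)"
    using ny_pi by (simp add: algebra_simps)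
  then show ?thesis by (simp only: cos_add_turns cos_periodic_pi cos_minus)
qed

lemma angle_reflect: "angle (ny - T) = pi - angle T"
  using ny_pos by (simp add: angle_def field_simps)

lemma z_reflect: "z (2 * pi - angle T) = z (- angle T)"
proof -
  have "2 * pi - angle T = - angle T + 2 * pi" by simp
  then show ?thesis by (simp only: per_z)
qed

lemma left_arc_values:
  assumes "T \<ge> 0"
  shows "left_arc 1 0 T = (T, frame T $ 1)" "left_arc 1 0 (- T) = (T, frame T $ 3)"
    "left_arc (-1) pi T = (T, frame T $ 2)" "left_arc (-1) pi (- T) = (T, frame T $ 4)"
proof -
  have "cos (1/2 - pi * T) = cos (pi * T - 1/2)" using cos_minus[of "pi * T - 1/2"] by simp
  then show "left_arc 1 0 T = (T, frame T $ 1)" "left_arc 1 0 (- T) = (T, frame T $ 3)"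
    "left_arc (-1) pi T = (T, frame T $ 2)" "left_arc (-1) pi (- T) = (T, frame T $ 4)"
    using assms unfolding left_arc_def by (simp_all add: angle_def)
qed

lemma right_arc_values:
  assumes "T \<le> ny / 2"
  shows "right_arc 1 0 T = (T, frame T $ 1)" "right_arc 1 0 (ny - T) = (T, frame T $ 4)"
    "right_arc (-1) pi T = (T, frame T $ 2)" "right_arc (-1) pi (ny - T) = (T, frame T $ 3)"
proof -
  have 1: "ny / 2 - \<bar>T - ny / 2\<bar> = T" "ny / 2 - \<bar>(ny - T) - ny / 2\<bar> = T" using assms by auto
  note 2 = z_reflect[of T]
  show "right_arc 1 0 T = (T, frame T $ 1)" "right_arc 1 0 (ny - T) = (T, frame T $ 4)"
    "right_arc (-1) pi T = (T, frame T $ 2)" "right_arc (-1) pi (ny - T) = (T, frame T $ 3)"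
    unfolding right_arc_def 1 cos_reflect angle_reflect by (simp_all add: 2)
qed

text \<open>The knot with linear time T as its first coordinate, in which the crossings repeat block
  by block; \<open>curve_word\<close> passes back to \<open>cos (2 * t)\<close>.\<close>

definition total :: "(real \<times> complex) set" where
  "total = {(T, frame T $ k) | T k. T \<in> {0..ny/2}}"

lemma totalI: "T \<in> {0..ny/2} \<Longrightarrow> (T, frame T $ k) \<in> total" unfolding total_def by blast

lemma end_time_bounds: "1/10 < end_time" "end_time < ny / 2" "ny - end_time = real N + 29/50"
  by (auto simp: end_time_def ny_def)

lemma total_split:
  "total = {(T, frame T $ k) | T k. T \<in> {1/10..end_time}} \<union> left_arc 1 0 ` {-(1/10)..1/10} \<union> left_arc (-1) pi ` {-(1/10)..1/10}
     \<union> right_arc 1 0 ` {end_time..ny - end_time} \<union> right_arc (-1) pi ` {end_time..ny - end_time}" (is "_ = ?R")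
proof
  show "total \<subseteq> ?R"
  proof
    fix y assume "y \<in> total"
    then obtain T k where y: "y = (T, frame T $ k)" and T: "0 \<le> T" "T \<le> ny / 2" unfolding total_def by auto
    consider "T < 1/10" | "T \<in> {1/10..end_time}" | "T > end_time" by force
    then show "y \<in> ?R"
    proof cases
      case 1
      have "y \<in> left_arc 1 0 ` {-(1/10)..1/10} \<union> left_arc (-1) pi ` {-(1/10)..1/10}"
        using 1 T(1) exhaust_4[of k] unfolding y
        by (elim disjE; simp only: left_arc_values[OF T(1), symmetric]) auto
      then show ?thesis by blast
    next
      case 2
      then show ?thesis unfolding y by blast
    next
      case 3
      have "y \<in> right_arc 1 0 ` {end_time..ny - end_time} \<union> right_arc (-1) pi ` {end_time..ny - end_time}"
        using 3 T(2) exhaust_4[of k] unfolding y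
        by (elim disjE; simp only: right_arc_values[OF T(2), symmetric]) auto
      then show ?thesis by blast
    qed
  qed
  have "left_arc 1 0 T \<in> total \<and> left_arc (-1) pi T \<in> total" if "T \<in> {-(1/10)..1/10}" for T
  proof (cases "T \<ge> 0")
    case True
    then show ?thesis using left_arc_values[of T] that totalI[of T] end_time_bounds by (auto simp del: frame_nth)
  next
    case False
    then show ?thesis using left_arc_values[of "- T"] that totalI[of "- T"] end_time_bounds by (auto simp del: frame_nth)
  qed
  moreover have "right_arc 1 0 T \<in> total \<and> right_arc (-1) pi T \<in> total" if "T \<in> {end_time..ny - end_time}" for T
  proof (cases "T \<le> ny / 2")
    case True
    then show ?thesis using right_arc_values[of T] that totalI[of T] end_time_bounds by (auto simp del: frame_nth)
  next
    case False
    then show ?thesis using right_arc_values[of "ny - T"] that totalI[of "ny - T"] end_time_bounds by (auto simp del: frame_nth)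
  qed
  moreover have "{(T, frame T $ k) | T k. T \<in> {1/10..end_time}} \<subseteq> total"
    using end_time_bounds unfolding total_def by fastforce
  ultimately show "?R \<subseteq> total" by blast
qed

lemma cap_arc_general:
  assumes "continuous_on {p..q} h" "p \<le> q" "s \<in> {-1, 1}" "inj_on (\<lambda>T. cos (pi * T + 1/2)) {p..q}"
    "(h p, Complex (s * cos (pi * p + 1/2)) (z (angle p + c))) = (x, u)" "(h q, Complex (s * cos (pi * q + 1/2)) (z (angle q + c))) = (x, w)"
  shows "cap_arc (\<lambda>T. (h T, Complex (s * cos (pi * T + 1/2)) (z (angle T + c)))) p q x u w"
proof -
  have "continuous_on {p..q} (\<lambda>T. z (angle T + c))"
    by (rule continuous_on_compose2[OF cont_z]) (auto simp: angle_def ny_pos[THEN less_imp_neq, symmetric] intro!: continuous_intros)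
  then have "continuous_on {p..q} (\<lambda>T. (h T, Complex (s * cos (pi * T + 1/2)) (z (angle T + c))))"
    unfolding Complex_eq by (intro continuous_intros assms)
  moreover have "inj_on (\<lambda>T. s * cos (pi * T + 1/2)) {p..q}"
    using assms(3,4) by (auto simp: inj_on_def)
  ultimately show ?thesis using assms unfolding cap_arc_def by auto
qed

text \<open>The interval covers the left arcs and, after subtraction of N, the right arcs.\<close>

lemma cos_half_turn_inj: "inj_on (\<lambda>T. cos (pi * T + 1/2)) {-(1/10)..3/5}"
proof -
  have "pi * T + 1/2 \<in> {0..pi}" if "T \<in> {-(1/10)..3/5}" for T
  proof -
    have "pi * T \<le> pi * (3/5)" "pi * (-(1/10)) \<le> pi * T" using that by (intro mult_left_mono; simp)+
    then show ?thesis using pi_gt3 pi_less_4 unfolding atLeastAtMost_iff by linarith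
  qed
  then show ?thesis
    using cos_inj_pi unfolding inj_on_def by (metis (no_types, lifting) add_right_cancel atLeastAtMost_iff mult_left_cancel pi_neq_zero)
qed

lemma left_cap_arc:
  "cap_arc (left_arc 1 0) (-(1/10)) (1/10) (1/10) (frame (1/10) $ 3) (frame (1/10) $ 1)"
  "cap_arc (left_arc (-1) pi) (-(1/10)) (1/10) (1/10) (frame (1/10) $ 4) (frame (1/10) $ 2)"
proof -
  have i: "inj_on (\<lambda>T. cos (pi * T + 1/2)) {-(1/10)..1/10}" by (rule inj_on_subset[OF cos_half_turn_inj]) auto
  have e: "left_arc s c = (\<lambda>T. (\<bar>T\<bar>, Complex (s * cos (pi * T + 1/2)) (z (angle T + c))))" for s c
    by (simp add: left_arc_def fun_eq_iff)
  note v = left_arc_values[of "1/10", unfolded e]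
  show "cap_arc (left_arc 1 0) (-(1/10)) (1/10) (1/10) (frame (1/10) $ 3) (frame (1/10) $ 1)"
    "cap_arc (left_arc (-1) pi) (-(1/10)) (1/10) (1/10) (frame (1/10) $ 4) (frame (1/10) $ 2)"
    unfolding e by (rule cap_arc_general; use i v in \<open>auto intro!: continuous_intros simp del: frame_nth\<close>)+
qed

lemma right_cap_arc:
  "cap_arc (right_arc 1 0) end_time (ny - end_time) end_time (frame end_time $ 1) (frame end_time $ 4)"
  "cap_arc (right_arc (-1) pi) end_time (ny - end_time) end_time (frame end_time $ 2) (frame end_time $ 3)"
proof -
  have i: "inj_on (\<lambda>T. cos (pi * T + 1/2)) {end_time..ny - end_time}"
  proof (rule inj_onI)
    fix T U assume TU: "T \<in> {end_time..ny - end_time}" "U \<in> {end_time..ny - end_time}" "cos (pi * T + 1/2) = cos (pi * U + 1/2)"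
    have "cos (pi * (T - N) + 1/2) = cos (pi * (U - N) + 1/2)"
      using TU(3) cos_shift_block[of N "T - N" "1/2"] cos_shift_block[of N "U - N" "1/2"] by simp
    moreover have "T - N \<in> {-(1/10)..3/5}" "U - N \<in> {-(1/10)..3/5}" using TU(1,2) end_time_bounds(3) unfolding end_time_def by auto
    ultimately show "T = U" using cos_half_turn_inj unfolding inj_on_def by (metis diff_add_cancel)
  qed
  have e: "right_arc s c = (\<lambda>T. (ny / 2 - \<bar>T - ny / 2\<bar>, Complex (s * cos (pi * T + 1/2)) (z (angle T + c))))" for s c
    by (simp add: right_arc_def fun_eq_iff)
  have le: "end_time \<le> ny / 2" "end_time \<le> ny - end_time" using end_time_bounds by auto
  note v = right_arc_values[OF le(1), unfolded e]
  show "cap_arc (right_arc 1 0) end_time (ny - end_time) end_time (frame end_time $ 1) (frame end_time $ 4)"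
    "cap_arc (right_arc (-1) pi) end_time (ny - end_time) end_time (frame end_time $ 2) (frame end_time $ 3)"
    unfolding e by (rule cap_arc_general; use i v le in \<open>auto intro!: continuous_intros simp del: frame_nth\<close>)+
qed

text \<open>Just after the left caps the two strands of each cap move apart, so no strand enters the
  open shadow of a cap.\<close>

lemma left_shadow_bounds:
  assumes "x \<in> {1/10..12/100}"
  defines "p \<equiv> \<lambda>x. cos (pi * x + 1/2)" and "q \<equiv> \<lambda>x. cos (pi * x - 1/2)"
  shows "0 < p x" "p x \<le> p (1/10)" "p (1/10) < q (1/10)" "q (1/10) \<le> q x"
proof -
  have b: "pi * (1/10) \<le> pi * x" "pi * x \<le> pi * (12/100)" using assms(1) by auto
  have pi: "3 < pi" "pi < 4" using pi_gt3 pi_less_4 by auto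
  show "0 < p x" unfolding p_def using b pi by (intro cos_gt_zero_pi) linarith+
  show "p x \<le> p (1/10)" unfolding p_def using b pi by (intro cos_monotone_0_pi_le) linarith+
  have e: "q y = cos (1/2 - pi * y)" for y using cos_minus[of "pi * y - 1/2"] by (simp add: q_def)
  show "p (1/10) < q (1/10)" unfolding e unfolding p_def using pi by (intro cos_monotone_0_pi) linarith+
  show "q (1/10) \<le> q x" unfolding e using b pi by (intro cos_monotone_0_pi_le) linarith+
qed

text \<open>The right caps join a strand at \<open>p\<close> with one at \<open>- q\<close>;
  followed backwards from the cap these diverge as well.\<close>

lemma right_shadow_bounds:
  assumes "x \<in> {40/100..42/100}"
  defines "p \<equiv> \<lambda>x. cos (pi * x + 1/2)" and "q \<equiv> \<lambda>x. cos (pi * x - 1/2)"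
  shows "p x < 0" "p (42/100) \<le> p x" "- p (42/100) < q (42/100)" "q (42/100) \<le> q x"
proof -
  have b: "pi * (40/100) \<le> pi * x" "pi * x \<le> pi * (42/100)" using assms(1) by auto
  have pi: "3 < pi" "pi < 4" using pi_gt3 pi_less_4 by auto
  show "p x < 0" using block_signs(1)[of x] time_bounds assms by (auto simp: sgn_if split: if_splits)
  show "p (42/100) \<le> p x" unfolding p_def using b pi by (intro cos_monotone_0_pi_le) linarith+
  show "- p (42/100) < q (42/100)" using block_signs(3)[of "42/100"] unfolding p_def q_def by (auto simp: sgn_if split: if_splits)
  show "q (42/100) \<le> q x" unfolding q_def using b pi by (intro cos_monotone_0_pi_le) linarith+
qed

theorem heq_total:
  assumes "crossings_ok"
  shows "heq total (word_knot word)"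
proof -
  define p where "p = (\<lambda>x. cos (pi * x + 1/2))"
  define q where "q = (\<lambda>x. cos (pi * x - 1/2))"
  have Re: "Re (frame T $ 1) = p T" "Re (frame T $ 2) = - p T" "Re (frame T $ 3) = q T" "Re (frame T $ 4) = - q T" for T
    unfolding p_def q_def by simp_all
  define \<sigma> :: real where "\<sigma> = (-1) ^ N"
  have \<sigma>: "\<sigma> = 1 \<or> \<sigma> = -1" unfolding \<sigma>_def by (cases "even N") auto
  have sh: "p (real N + x) = \<sigma> * p x" "q (real N + x) = \<sigma> * q x" for x
    using cos_shift_block[of N x "1/2"] cos_shift_block[of N x "-1/2"] unfolding p_def q_def \<sigma>_def by simp_all
  have e: "end_time = real N + 42/100" by (simp add: end_time_def)
  have L: "0 < p x" "p x \<le> p (1/10)" "p (1/10) < q (1/10)" "q (1/10) \<le> q x" if "x \<in> {1/10..12/100}" for x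
    using left_shadow_bounds[OF that] unfolding p_def q_def by blast+
  have R: "p x < 0" "p (42/100) \<le> p x" "- p (42/100) < q (42/100)" "q (42/100) \<le> q x" if "x \<in> {40/100..42/100}" for x
    using right_shadow_bounds[OF that] unfolding p_def q_def by blast+
  have LR: "0 < p (1/10)" "p (1/10) < q (1/10)" "p (42/100) < 0" "- p (42/100) < q (42/100)"
    using L[of "1/10"] R[of "42/100"] by simp_all
  have neq: "start_cfg = block_cfg 0" by (simp add: block_cfg_def start_cfg_vec4)
  have commute: "closed_segment 3 1 = closed_segment 1 (3::complex)" "closed_segment (-1) (-3) = closed_segment (-3) (-1::complex)"
    by (rule closed_segment_commute)+
  have lf: "fst (left_arc s c t) \<le> 1/10" if "t \<in> {-(1/10)..1/10}" for s c t using that unfolding left_arc_def by auto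
  have rf: "fst (right_arc s c t) \<ge> end_time" if "t \<in> {end_time..ny - end_time}" for s c t
      using that end_time_bounds unfolding right_arc_def by (auto simp: abs_real_def)
  show ?thesis unfolding total_split word_def
  proof (rule timed_plat[OF continuous_frame _ _ start_cfg_base left_cap_arc(1) _ left_cap_arc(2) _ right_cap_arc(1) _ right_cap_arc(2)])
    show "increasing (1/10) end_time (schedule 0 N)" using increasing_schedule[of 0 N] by simp
    show "tracks frame start_cfg (1/10) end_time (schedule 0 N)" using tracks_schedule[OF assms, of 0 N] unfolding neq by simp
    show "shadow (frame (1/10) $ 3) (frame (1/10) $ 1) \<inter> shadow (frame (1/10) $ 4) (frame (1/10) $ 2) = {}"
      using LR unfolding shadow_def Re by (auto simp: min_def max_def)
    show "shadow (frame end_time $ 1) (frame end_time $ 4) \<inter> shadow (frame end_time $ 2) (frame end_time $ 3) = {}"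
      using LR \<sigma> unfolding shadow_def Re e sh by (auto simp: min_def max_def)
    show "k \<in> {3, 1, 4, 2}" "k \<in> {1, 4, 2, 3}" for k :: 4 using exhaust_4[of k] by auto
    \<comment> \<open>The margin 1/50 turns the ends 1/10 and 42/100 into the intervals
      [1/10, 12/100] and [40/100, 42/100] of the two shadow lemmas.\<close>
    show "(0::real) < 1/50" by simp
    show "Re (frame x $ k) \<notin> open_shadow (frame (1/10) $ 3) (frame (1/10) $ 1) \<union> open_shadow (frame (1/10) $ 4) (frame (1/10) $ 2)"
      if "x \<in> {1/10..end_time}" "x < 1/10 + 1/50" for x k
      using L[of x] LR that exhaust_4[of k] unfolding open_shadow_def by (elim disjE; simp only: Re; auto simp: min_def max_def)
    show "Re (frame x $ k) \<notin> open_shadow (frame end_time $ 1) (frame end_time $ 4) \<union> open_shadow (frame end_time $ 2) (frame end_time $ 3)"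
      if "x \<in> {1/10..end_time}" "x > end_time - 1/50" for x k
    proof -
      define y where "y = x - N"
      have y: "y \<in> {40/100..42/100}" "x = real N + y" using that unfolding y_def e by auto
      show ?thesis using R[OF y(1)] LR \<sigma> exhaust_4[of k] unfolding open_shadow_def e y(2)
        by (elim disjE; simp only: Re sh; auto simp: min_def max_def)
    qed
    show "cap_set {(3, 1), (4, 2)} start_cfg = base_caps"
      unfolding cap_set_def base_caps_def by (auto simp: commute)
    show "cap_set {(1, 4), (2, 3)} (pathfinish (word_path (map fst (schedule 0 N)) start_cfg)) = base_caps"
      unfolding end_cfg_word[unfolded word_def] cap_set_def base_caps_def end_cfg_def
      by (auto simp: commute)
  qed (use lf rf in blast)+
qed

lemma curve_angles: 
  assumes "T \<in> {0..ny/2}"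
  shows "(cos (2 * angle T), frame T $ 1) = curve (angle T)" "(cos (2 * angle T), frame T $ 2) = curve (angle T + pi)"
    "(cos (2 * angle T), frame T $ 3) = curve (2 * pi - angle T)" "(cos (2 * angle T), frame T $ 4) = curve (pi - angle T)"
proof -
  have n: "ny * angle T = pi * T" using ny_pos by (simp add: angle_def)
  have c: "cos (x + pi * ny) = - cos x" for x
  proof -
    have "x + pi * ny = x + pi + of_nat N * (2 * pi)" using ny_pi by simp
    then show ?thesis by (simp only: cos_add_turns cos_periodic_pi)
  qed
  have c2: "cos (x + 2 * pi * ny) = cos x" for x using c[of "x + pi * ny"] c[of x] by (simp add: algebra_simps)
  have q: "cos (1/2 - pi * T) = cos (pi * T - 1/2)" using cos_minus[of "pi * T - 1/2"] by simp
  show "(cos (2 * angle T), frame T $ 1) = curve (angle T)" unfolding curve_def n by simp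
  have "ny * (angle T + pi) + 1/2 = (pi * T + 1/2) + pi * ny" using n by (simp add: algebra_simps)
  then have "cos (ny * (angle T + pi) + 1/2) = - cos (pi * T + 1/2)" by (simp only: c)
  moreover have "cos (2 * (angle T + pi)) = cos (2 * angle T)" using cos_periodic[of "2 * angle T"] by (simp add: algebra_simps)
  ultimately show "(cos (2 * angle T), frame T $ 2) = curve (angle T + pi)" unfolding curve_def by simp
  have "ny * (2 * pi - angle T) + 1/2 = (1/2 - pi * T) + 2 * pi * ny" using n by (simp add: algebra_simps)
  then have "cos (ny * (2 * pi - angle T) + 1/2) = cos (pi * T - 1/2)" by (simp only: c2 q)
  moreover have "cos (2 * (2 * pi - angle T)) = cos (2 * angle T)"
    using cos_add_turns[of "- (2 * angle T)" 2] by (simp add: algebra_simps)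
  moreover have "z (2 * pi - angle T) = z (- angle T)" using z_reflect[of T] by simp
  ultimately show "(cos (2 * angle T), frame T $ 3) = curve (2 * pi - angle T)" unfolding curve_def by simp
  have "ny * (pi - angle T) + 1/2 = (1/2 - pi * T) + pi * ny" using n by (simp add: algebra_simps)
  then have "cos (ny * (pi - angle T) + 1/2) = - cos (pi * T - 1/2)" by (simp only: c q)
  moreover have "cos (2 * (pi - angle T)) = cos (2 * angle T)"
    using cos_minus[of "2 * angle T"] cos_periodic[of "- (2 * angle T)"] by (simp add: algebra_simps)
  ultimately show "(cos (2 * angle T), frame T $ 4) = curve (pi - angle T)" unfolding curve_def by simp
qed

lemma curve_total: "curve ` {0..2 * pi} = (\<lambda>(T, v). (cos (2 * angle T), v)) ` total"
proof
  have half: "angle T \<in> {0..pi/2}" if "T \<in> {0..ny/2}" for T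
    using that ny_pos by (auto simp: angle_def field_simps)
  have curve_in: "curve t \<in> curve ` {0..2 * pi}" if "t \<in> {0..2*pi}" for t using that by blast
  show "(\<lambda>(T, v). (cos (2 * angle T), v)) ` total \<subseteq> curve ` {0..2 * pi}"
  proof
    fix y assume "y \<in> (\<lambda>(T, v). (cos (2 * angle T), v)) ` total"
    then obtain T k where T: "T \<in> {0..ny/2}" and y: "y = (cos (2 * angle T), frame T $ k)" unfolding total_def by auto
    have "angle T \<in> {0..2*pi}" "angle T + pi \<in> {0..2*pi}" "2 * pi - angle T \<in> {0..2*pi}" "pi - angle T \<in> {0..2*pi}"
      using half[OF T] by auto
    then show "y \<in> curve ` {0..2 * pi}" unfolding y using exhaust_4[of k]
      by (elim disjE; simp only: curve_angles[OF T] curve_in)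
  qed
  show "curve ` {0..2 * pi} \<subseteq> (\<lambda>(T, v). (cos (2 * angle T), v)) ` total"
  proof
    fix y assume "y \<in> curve ` {0..2 * pi}"
    then obtain t where t: "t \<in> {0..2*pi}" and y: "y = curve t" by blast
    have A: "angle (ny * s / pi) = s" "s \<in> {0..pi/2} \<Longrightarrow> ny * s / pi \<in> {0..ny/2}" for s
      using ny_pos by (auto simp: angle_def field_simps)
    have "\<exists>s k. s \<in> {0..pi/2} \<and> y = (cos (2 * s), frame (ny * s / pi) $ k)"
    proof -
      consider "t \<in> {0..pi/2}" | "t \<in> {pi/2..pi}" | "t \<in> {pi..3*pi/2}" | "t \<in> {3*pi/2..2*pi}" using t by force
      then show ?thesis
      proof cases
        case 1
        then show ?thesis using curve_angles(1)[OF A(2)[of t], unfolded A(1)] unfolding y by metis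
      next
        case 2
        then have s: "pi - t \<in> {0..pi/2}" by auto
        have "pi - (pi - t) = t" by simp
        then show ?thesis using s curve_angles(4)[OF A(2)[OF s], unfolded A(1)] unfolding y by metis
      next
        case 3
        then have s: "t - pi \<in> {0..pi/2}" by auto
        have "t - pi + pi = t" by simp
        then show ?thesis using s curve_angles(2)[OF A(2)[OF s], unfolded A(1)] unfolding y by metis
      next
        case 4
        then have s: "2 * pi - t \<in> {0..pi/2}" by auto
        have "2 * pi - (2 * pi - t) = t" by simp
        then show ?thesis using s curve_angles(3)[OF A(2)[OF s], unfolded A(1)] unfolding y by metis
      qed
    qed
    then obtain s k where s: "s \<in> {0..pi/2}" "y = (cos (2 * s), frame (ny * s / pi) $ k)" by blast
    then have "y = (\<lambda>(T, v). (cos (2 * angle T), v)) (ny * s / pi, frame (ny * s / pi) $ k)" using A(1)[of s] by simp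
    then show "y \<in> (\<lambda>(T, v). (cos (2 * angle T), v)) ` total" using totalI[OF A(2)[OF s(1)]] by blast
  qed
qed

text \<open>Only the first coordinate changes, by a monotone function that extends to the line. As T
  increases, \<open>cos (2 * angle T)\<close> decreases, hence the sign in \<open>H\<close>.\<close>

theorem curve_word:
  assumes "crossings_ok"
  shows "heq (word_knot word) (curve ` {0..2 * pi})"
proof -
  define \<mu> :: "real \<Rightarrow> real" where "\<mu> = (\<lambda>s. - cos (pi * s))"
  have \<mu>: "continuous_on {0..1} \<mu>" "strict_mono_on {0..1} \<mu>"
  proof -
    show "continuous_on {0..1} \<mu>" unfolding \<mu>_def by (intro continuous_intros)
    show "strict_mono_on {0..1} \<mu>"
    proof (rule strict_mono_onI)
      fix r s :: real assume "r \<in> {0..1}" "s \<in> {0..1}" "r < s"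
      then have "cos (pi * s) < cos (pi * r)" by (intro cos_monotone_0_pi) (auto intro: mult_left_le)
      then show "\<mu> r < \<mu> s" unfolding \<mu>_def by simp
    qed
  qed
  define G where "G = (\<lambda>x. \<mu> (unit_clamp x) + (x - unit_clamp x))"
  have G: "continuous_on UNIV G" "bij G" unfolding G_def by (rule reparametrize_line[OF \<mu>])+
  define H where "H x = - G (2 * x / ny)" for x
  have "continuous_on UNIV H" unfolding H_def
    by (intro continuous_intros continuous_on_compose2[OF G(1)]) (use ny_pos in auto)
  moreover have "bij H"
  proof -
    have "bij (\<lambda>x. 2 * x / ny)" by (rule o_bij[of "\<lambda>x. ny * x / 2"]) (use ny_pos in \<open>auto simp: fun_eq_iff\<close>)
    moreover have "bij (\<lambda>x::real. - x)" by (rule o_bij[of uminus]) auto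
    ultimately have "bij ((\<lambda>x::real. - x) \<circ> (G \<circ> (\<lambda>x. 2 * x / ny)))" using G(2) by (intro bij_comp)
    then show ?thesis by (simp add: H_def[abs_def] comp_def)
  qed
  ultimately have "heq total ((\<lambda>(x, v). (H x, v)) ` total)" by (rule heq_line_map)
  also have "(\<lambda>(x, v). (H x, v)) ` total = curve ` {0..2 * pi}"
    unfolding curve_total
  proof (rule image_cong[OF refl])
    fix y assume "y \<in> total"
    then obtain T v where y: "y = (T, v)" "T \<in> {0..ny/2}" unfolding total_def by auto
    then have "2 * T / ny \<in> {0..1}" using ny_pos by (auto simp: field_simps)
    then have "unit_clamp (2 * T / ny) = 2 * T / ny" by auto
    then have "H T = cos (2 * angle T)" unfolding H_def G_def \<mu>_def angle_def by (simp add: mult_ac)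
    then show "(\<lambda>(x, v). (H x, v)) y = (\<lambda>(T, v). (cos (2 * angle T), v)) y" using y by simp
  qed
  finally show ?thesis using heq_trans[OF heq_sym[OF heq_total[OF assms]]] by blast
qed

end

lemma tracks_distinct:
  assumes "tracks F c a e r" "increasing a e r" "T \<in> {a..e}" "i \<noteq> j"
  shows "F T $ i \<noteq> F T $ j"
proof -
  have "continuous_on {0..1} (schedule_path a e r)" using path_schedule_path by (simp add: path_def)
  then have "\<exists>u\<ge>0. u \<le> 1 \<and> schedule_path a e r u = T" using assms(3) by (intro IVT') auto
  then obtain u where "u \<in> {0..1}" "schedule_path a e r u = T" by auto
  then have "same_diagram (F T) (word_path (map fst r) c u)" using tracks_same_diagram[OF assms(1,2)] by blast
  then show ?thesis using assms(4) unfolding same_diagram_def by fastforce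
qed

context lissajous
begin

text \<open>Between the caps the strands follow a braid and so never meet; inside the caps already
  their projections differ.\<close>

lemma frame_distinct:
  assumes "crossings_ok" "0 < T" "T < ny / 2" "i \<noteq> j"
  shows "frame T $ i \<noteq> frame T $ j"
proof -
  have *: "frame T $ i \<noteq> frame T $ j" if "cos (pi * T + 1/2) \<noteq> 0" "cos (pi * T - 1/2) \<noteq> 0"
    "cos (pi * T + 1/2) + cos (pi * T - 1/2) \<noteq> 0" "cos (pi * T + 1/2) - cos (pi * T - 1/2) \<noteq> 0"
  proof -
    have "\<forall>i j. i \<noteq> j \<longrightarrow> Re (frame T $ i) \<noteq> Re (frame T $ j)"
      using that unfolding forall_4 by (simp add: eq_diff_eq add_eq_0_iff2) linarith?
    then show ?thesis using assms(4) by metis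
  qed
  consider "T < 1/10" | "T \<in> {1/10..end_time}" | "T > end_time" by force
  then show ?thesis
  proof cases
    case 1
    then show ?thesis using block_signs[of T] assms(2) time_bounds by (intro *) (auto simp: sgn_if split: if_splits)
  next
    case 2
    have "tracks frame start_cfg (1/10) end_time (schedule 0 N)"
      using tracks_schedule[OF assms(1), of 0 N] by (simp add: block_cfg_def start_cfg_vec4)
    moreover have "increasing (1/10) end_time (schedule 0 N)" using increasing_schedule[of 0 N] by simp
    ultimately show ?thesis using 2 assms(4) by (rule tracks_distinct)
  next
    case 3
    define y where "y = T - N"
    have y: "0 < y" "y < 1/2" "time1 < y" "y < time3" "T = real N + y"
      using 3 assms(3) time_bounds unfolding y_def end_time_def ny_def by auto
    have c: "cos (pi * T + 1/2) = (-1) ^ N * cos (pi * y + 1/2)" "cos (pi * T - 1/2) = (-1) ^ N * cos (pi * y - 1/2)"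
      using cos_shift_block[of N y "1/2"] cos_shift_block[of N y "-1/2"] unfolding y by simp_all
    have "cos (pi * y + 1/2) \<noteq> 0" "cos (pi * y - 1/2) \<noteq> 0"
      "cos (pi * y + 1/2) + cos (pi * y - 1/2) \<noteq> 0" "cos (pi * y + 1/2) - cos (pi * y - 1/2) \<noteq> 0"
      using block_signs[of y] y by (auto simp: sgn_if split: if_splits)
    then show ?thesis unfolding c
      by (intro *; unfold c) (simp_all flip: distrib_left right_diff_distrib)
  qed
qed

text \<open>\<open>pos s\<close> lists the parameters with a common x-coordinate. Away from the
  turning points s = 0 and s = \<open>pi/2\<close>, where entries coincide modulo the period,
  injectivity is the distinctness of strands.\<close>

theorem curve_inj:
  assumes "crossings_ok"
  shows "inj_on curve {0..<2 * pi}"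
proof (rule inj_onI)
  fix t t' assume t: "t \<in> {0..<2*pi}" "t' \<in> {0..<2*pi}" and eq: "curve t = curve t'"
  define pos :: "real \<Rightarrow> real^4" where "pos s = vec4 s (s + pi) (2 * pi - s) (pi - s)" for s
  have A: "angle (ny * s / pi) = s" "s \<in> {0..pi/2} \<Longrightarrow> ny * s / pi \<in> {0..ny/2}" for s
    using ny_pos by (auto simp: angle_def field_simps)
  have pos: "\<exists>s k. s \<in> {0..pi/2} \<and> t = pos s $ k" if "t \<in> {0..<2*pi}" for t
  proof -
    consider "t \<le> pi/2" | "pi/2 \<le> t" "t \<le> pi" | "pi \<le> t" "t \<le> 3*pi/2" | "3*pi/2 \<le> t" by linarith
    then show ?thesis
    proof cases
      case 1 then show ?thesis using that by (intro exI[of _ t] exI[of _ 1]) (simp add: pos_def)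
    next
      case 2 then show ?thesis by (intro exI[of _ "pi - t"] exI[of _ 4]) (simp add: pos_def)
    next
      case 3 then show ?thesis by (intro exI[of _ "t - pi"] exI[of _ 2]) (simp add: pos_def)
    next
      case 4 then show ?thesis using that by (intro exI[of _ "2 * pi - t"] exI[of _ 3]) (simp add: pos_def)
    qed
  qed
  have curve_pos: "curve (pos s $ k) = (cos (2 * s), frame (ny * s / pi) $ k)" if "s \<in> {0..pi/2}" for s k
    using exhaust_4[of k] curve_angles[OF A(2)[OF that], unfolded A(1)] unfolding pos_def by (elim disjE) simp_all
  obtain s k where s: "s \<in> {0..pi/2}" "t = pos s $ k" using pos[OF t(1)] by blast
  obtain s' k' where s': "s' \<in> {0..pi/2}" "t' = pos s' $ k'" using pos[OF t(2)] by blast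
  have "cos (2 * s) = cos (2 * s')" using eq curve_pos[OF s(1)] curve_pos[OF s'(1)] s(2) s'(2) by simp
  then have ss: "s' = s" using s(1) s'(1) cos_inj_pi[of "2 * s" "2 * s'"] by simp
  have fr: "frame (ny * s / pi) $ k = frame (ny * s / pi) $ k'"
    using eq curve_pos[OF s(1)] curve_pos[OF s'(1)] s(2) s'(2) unfolding ss by simp
  consider "s = 0" | "s = pi/2" | "0 < s" "s < pi/2" using s(1) by force
  then show "t = t'"
  proof cases
    case 1
    have "t \<in> {0, pi}" "t' \<in> {0, pi}"
      using s(2) s'(2) t exhaust_4[of k] exhaust_4[of k'] unfolding ss 1 pos_def by auto
    moreover have "curve 0 \<noteq> curve pi"
    proof -
      have "curve 0 = curve (pos 0 $ 1)" "curve pi = curve (pos 0 $ 2)" by (simp_all add: pos_def)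
      then show ?thesis using curve_pos[of 0] half_angle(1) by simp
    qed
    ultimately show ?thesis using eq by auto
  next
    case 2
    have "t \<in> {pi/2, 3*pi/2}" "t' \<in> {pi/2, 3*pi/2}"
      using s(2) s'(2) exhaust_4[of k] exhaust_4[of k'] unfolding ss 2 pos_def by auto
    moreover have "curve (pi/2) \<noteq> curve (3*pi/2)"
    proof -
      have "pi * (ny * (pi/2) / pi) + 1/2 = pi * (real N + 1/2) + 1/2" by (simp add: ny_def field_simps)
      then have "cos (pi * (ny * (pi/2) / pi) + 1/2) = (-1) ^ N * cos (pi * (1/2) + 1/2)" by (simp only: cos_shift_block)
      then have "cos (pi * (ny * (pi/2) / pi) + 1/2) \<noteq> 0" using half_angle(2) by (simp add: cos_add)
      moreover have "curve (pi/2) = curve (pos (pi/2) $ 1)" "curve (3*pi/2) = curve (pos (pi/2) $ 2)" by (simp_all add: pos_def)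
      ultimately show ?thesis using curve_pos[of "pi/2"] by simp
    qed
    ultimately show ?thesis using eq by (metis insert_iff empty_iff)
  next
    case 3
    have "0 < ny * s / pi" "ny * s / pi < ny / 2" using 3 ny_pos by (auto simp: field_simps)
    then have "k = k'" using frame_distinct[OF assms] fr by blast
    then show ?thesis using s(2) s'(2) ss by simp
  qed
qed

lemma word_blocks: "map fst (schedule k m) = concat (map (\<lambda>j. [Mid (\<alpha> j), Out a b, Mid (\<beta> j), Out a' b']) [k..<k+m]) @ [Mid (\<alpha> (k + m))]"
proof (induction m arbitrary: k)
  case (Suc m)
  have "[k..<k + Suc m] = k # [Suc k..<Suc k + m]" by (simp add: upt_rec)
  then show ?case using Suc[of "Suc k"] by (simp add: items_def del: upt_Suc)
qed simp

end

section \<open>Crossing signs of the Fourier curves\<close>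

lemma cos_add_int_turns: "cos (x + of_int k * (2 * pi)) = cos (x::real)"
proof (cases "k \<ge> 0")
  case True
  then have "of_int k = real (nat k)" by simp
  then show ?thesis by (simp only: cos_add_turns)
next
  case False
  then have "real (nat (- k)) = - of_int k" by simp
  then have "x = (x + of_int k * (2 * pi)) + real (nat (- k)) * (2 * pi)" by (simp only:)
  then show ?thesis by (metis cos_add_turns)
qed

text \<open>The threshold \<open>sqrt 2\<close> is the weight with which the cosine of phase
  \<open>pi/4\<close> enters crossings between different pairs, see \<open>AB_diff\<close>.\<close>

lemma near_zero_bounds:
  assumes "\<bar>x\<bar> < pi / 4"
  shows "sqrt 2 < 2 * cos x" "\<bar>2 * sin x\<bar> < sqrt 2"
proof -
  have "cos (pi/4) < cos \<bar>x\<bar>" using assms pi_gt_zero by (intro cos_monotone_0_pi) linarith+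
  then show "sqrt 2 < 2 * cos x" by (simp add: cos_45)
  have "sin x < sin (pi/4)" "sin (-(pi/4)) < sin x" using assms by (intro sin_monotone_2pi; linarith)+
  then show "\<bar>2 * sin x\<bar> < sqrt 2" by (simp add: sin_45 abs_if)
qed

text \<open>In the notation of the paper, \<open>ny = 2 N + 1\<close> and \<open>nz2 = ny + 2 \<delta>\<close>.\<close>
definition fourier_z :: "nat \<Rightarrow> int \<Rightarrow> real \<Rightarrow> real \<Rightarrow> real" where
  "fourier_z N \<delta> \<phi> t = cos (2 * t + pi/4) + cos ((2 * real N + 1 + 2 * of_int \<delta>) * t + \<phi>)"

locale fourier_lissajous = lissajous N "fourier_z N \<delta> \<phi>" \<alpha> \<beta> a b a' b'
  for N \<delta> \<phi> \<alpha> \<beta> a b a' b' +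
  assumes \<delta>: "\<delta> \<in> {-1, 1}"
begin

text \<open>The frequency \<open>ny + 2 * \<delta>\<close> is odd, so adding \<open>pi\<close>
  negates the second summand, while the first one has period \<open>pi\<close>.\<close>

lemma z_half_turn: "fourier_z N \<delta> \<phi> (t + pi) = cos (2 * t + pi/4) - cos ((ny + 2 * of_int \<delta>) * t + \<phi>)"
proof -
  have "(2 * real N + 1 + 2 * of_int \<delta>) * (t + pi) + \<phi> = ((ny + 2 * of_int \<delta>) * t + \<phi>) + pi + of_int (int N + \<delta>) * (2 * pi)"
    by (simp add: ny_def algebra_simps)
  then have "cos ((2 * real N + 1 + 2 * of_int \<delta>) * (t + pi) + \<phi>) = - cos ((ny + 2 * of_int \<delta>) * t + \<phi>)"
    by (simp only: cos_add_int_turns cos_periodic_pi)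
  moreover have "cos (2 * (t + pi) + pi/4) = cos (2 * t + pi/4)" using cos_periodic[of "2 * t + pi/4"] by (simp add: algebra_simps)
  ultimately show ?thesis unfolding fourier_z_def by simp
qed

text \<open>Opposite strands share A or B, so their crossings depend on v or w alone; at all other
  crossings only the difference of A and B enters.\<close>

lemma heights_fourier:
  fixes T
  defines "A \<equiv> cos (2 * angle T + pi/4)" and "B \<equiv> cos (2 * angle T - pi/4)"
    and "v \<equiv> cos (pi * T + 2 * of_int \<delta> * angle T + \<phi>)" and "w \<equiv> cos (pi * T + 2 * of_int \<delta> * angle T - \<phi>)"
  shows "heights T $ 1 = A + v" "heights T $ 2 = A - v" "heights T $ 3 = B + w" "heights T $ 4 = B - w"
proof -
  have n: "(ny + 2 * of_int \<delta>) * angle T = pi * T + 2 * of_int \<delta> * angle T" using ny_pos by (simp add: angle_def field_simps)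
  have m: "(ny + 2 * of_int \<delta>) * (- angle T) + \<phi> = - (pi * T + 2 * of_int \<delta> * angle T - \<phi>)" using n by simp
  have m': "2 * (- angle T) + pi/4 = - (2 * angle T - pi/4)" by simp
  have c: "fourier_z N \<delta> \<phi> (- angle T + pi) = B - w" unfolding z_half_turn m m' cos_minus B_def w_def by simp
  have d: "fourier_z N \<delta> \<phi> (- angle T) = B + w" unfolding fourier_z_def ny_def[symmetric] m m' cos_minus B_def w_def by simp
  have e: "fourier_z N \<delta> \<phi> (angle T + pi) = A - v" unfolding z_half_turn n A_def v_def by simp
  have f: "fourier_z N \<delta> \<phi> (angle T) = A + v" unfolding fourier_z_def ny_def[symmetric] n A_def v_def by simp
  have p: "pi - angle T = - angle T + pi" by simp
  show "heights T $ 1 = A + v" "heights T $ 2 = A - v" "heights T $ 3 = B + w" "heights T $ 4 = B - w"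
    unfolding heights_def vec4_nth p by (fact c d e f)+
qed

lemma AB_diff: "cos (2 * x - pi/4) - cos (2 * x + pi/4) = sqrt 2 * sin (2 * x)"
  by (simp add: cos_add cos_diff sin_45)

lemma sin_twist: "sin (2 * of_int \<delta> * x) = of_int \<delta> * sin (2 * x)" "cos (2 * of_int \<delta> * x) = cos (2 * x)"
  using \<delta> by auto

text \<open>The factor \<open>sin (2 * angle T)\<close> is positive between the turning points. What
  remains compares \<open>2 * cos \<phi>\<close> with \<open>sqrt 2\<close>, independently of the
  position of the crossing.\<close>

lemma middle_crossings:
  assumes "T = real k + 1/2"
  shows "(-1) ^ k * (heights T $ 1 - heights T $ 4) = sin (2 * angle T) * (- ((-1) ^ k * sqrt 2) - 2 * of_int \<delta> * cos \<phi>)"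
    "(-1) ^ k * (heights T $ 3 - heights T $ 2) = sin (2 * angle T) * ((-1) ^ k * sqrt 2 - 2 * of_int \<delta> * cos \<phi>)"
proof -
  let ?x = "2 * of_int \<delta> * angle T"
  have "pi * T + ?x = pi * (real k + 1/2) + ?x" using assms by simp
  have c: "cos (pi * T + ?x) = (-1) ^ k * cos (pi * (1/2) + ?x)" unfolding assms by (rule cos_shift_block)
  have s: "cos (pi * (1/2) + ?x) = - of_int \<delta> * sin (2 * angle T)" by (simp add: cos_add sin_twist)
  have "cos (pi * T + ?x + \<phi>) + cos (pi * T + ?x - \<phi>) = 2 * cos (pi * T + ?x) * cos \<phi>" by (simp add: cos_add cos_diff)
  then have vw: "cos (pi * T + ?x + \<phi>) + cos (pi * T + ?x - \<phi>) = - 2 * (-1) ^ k * of_int \<delta> * sin (2 * angle T) * cos \<phi>"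
    unfolding c s by simp
  have sq: "(-1) ^ k * ((-1) ^ k * y) = (y::real)" for y by (simp flip: mult.assoc power_mult_distrib)
  have h: "heights T $ 1 - heights T $ 4 = - (sqrt 2 * sin (2 * angle T)) + (- 2 * (-1) ^ k * of_int \<delta> * sin (2 * angle T) * cos \<phi>)"
    "heights T $ 3 - heights T $ 2 = sqrt 2 * sin (2 * angle T) + (- 2 * (-1) ^ k * of_int \<delta> * sin (2 * angle T) * cos \<phi>)"
    unfolding heights_fourier vw[symmetric] AB_diff[symmetric] by simp_all
  show "(-1) ^ k * (heights T $ 1 - heights T $ 4) = sin (2 * angle T) * (- ((-1) ^ k * sqrt 2) - 2 * of_int \<delta> * cos \<phi>)"
    "(-1) ^ k * (heights T $ 3 - heights T $ 2) = sin (2 * angle T) * ((-1) ^ k * sqrt 2 - 2 * of_int \<delta> * cos \<phi>)"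
    unfolding h by (simp_all add: algebra_simps sq)
qed

text \<open>Here v and w enter by their difference instead of their sum, which replaces
  \<open>cos \<phi>\<close> by \<open>sin \<phi>\<close>.\<close>

lemma last_crossings:
  assumes "T = real k + 1"
  shows "(-1) ^ k * (heights T $ 3 - heights T $ 1) = sin (2 * angle T) * ((-1) ^ k * sqrt 2 - 2 * of_int \<delta> * sin \<phi>)"
    "(-1) ^ k * (heights T $ 2 - heights T $ 4) = sin (2 * angle T) * (- ((-1) ^ k * sqrt 2) - 2 * of_int \<delta> * sin \<phi>)"
proof -
  let ?x = "2 * of_int \<delta> * angle T"
  have c: "cos (pi * T + (?x - pi/2)) = (-1) ^ k * cos (pi * 1 + (?x - pi/2))" unfolding assms by (rule cos_shift_block)
  have s: "cos (pi * 1 + (?x - pi/2)) = - of_int \<delta> * sin (2 * angle T)" by (simp add: cos_add cos_diff sin_diff sin_twist)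
  have "sin (pi * T + ?x) = cos (pi * T + (?x - pi/2))" by (simp add: add_diff_eq cos_diff[of _ "pi/2"])
  also note c
  also note s
  finally have "sin (pi * T + ?x) = (-1) ^ k * (- of_int \<delta> * sin (2 * angle T))" .
  moreover have "cos (pi * T + ?x - \<phi>) - cos (pi * T + ?x + \<phi>) = 2 * sin (pi * T + ?x) * sin \<phi>" by (simp add: cos_add cos_diff)
  ultimately have vw: "cos (pi * T + ?x - \<phi>) - cos (pi * T + ?x + \<phi>) = - 2 * (-1) ^ k * of_int \<delta> * sin (2 * angle T) * sin \<phi>" by simp
  have sq: "(-1) ^ k * ((-1) ^ k * y) = (y::real)" for y by (simp flip: mult.assoc power_mult_distrib)
  have h: "heights T $ 3 - heights T $ 1 = sqrt 2 * sin (2 * angle T) + (- 2 * (-1) ^ k * of_int \<delta> * sin (2 * angle T) * sin \<phi>)"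
    "heights T $ 2 - heights T $ 4 = - (sqrt 2 * sin (2 * angle T)) + (- 2 * (-1) ^ k * of_int \<delta> * sin (2 * angle T) * sin \<phi>)"
    unfolding heights_fourier vw[symmetric] AB_diff[symmetric] by simp_all
  show "(-1) ^ k * (heights T $ 3 - heights T $ 1) = sin (2 * angle T) * ((-1) ^ k * sqrt 2 - 2 * of_int \<delta> * sin \<phi>)"
    "(-1) ^ k * (heights T $ 2 - heights T $ 4) = sin (2 * angle T) * (- ((-1) ^ k * sqrt 2) - 2 * of_int \<delta> * sin \<phi>)"
    unfolding h by (simp_all add: algebra_simps sq)
qed

lemma sin_angle_pos:
  assumes "0 < T" "T < ny / 2" shows "sin (2 * angle T) > 0"
proof (rule sin_gt_zero)
  show "0 < 2 * angle T" "2 * angle T < pi" using assms ny_pos by (auto simp: angle_def field_simps)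
qed

lemma self_crossings:
  shows "(-1) ^ k * (heights (real k + time1) $ 1 - heights (real k + time1) $ 2) = 2 * cos (pi/2 - 1/2 + 2 * of_int \<delta> * angle (real k + time1) + \<phi>)"
    "(-1) ^ k * (heights (real k + time3) $ 3 - heights (real k + time3) $ 4) = 2 * cos (pi/2 + 1/2 + 2 * of_int \<delta> * angle (real k + time3) - \<phi>)"
proof -
  have sq: "(-1) ^ k * ((-1) ^ k * y) = (y::real)" for y by (simp flip: mult.assoc power_mult_distrib)
  have t: "pi * time1 = pi/2 - 1/2" "pi * time3 = pi/2 + 1/2" by (simp_all add: time1_def time3_def field_simps)
  show "(-1) ^ k * (heights (real k + time1) $ 1 - heights (real k + time1) $ 2) = 2 * cos (pi/2 - 1/2 + 2 * of_int \<delta> * angle (real k + time1) + \<phi>)"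
    using cos_shift_block[of k time1 "2 * of_int \<delta> * angle (real k + time1) + \<phi>"] unfolding heights_fourier t
    by (simp add: sq add.assoc)
  show "(-1) ^ k * (heights (real k + time3) $ 3 - heights (real k + time3) $ 4) = 2 * cos (pi/2 + 1/2 + 2 * of_int \<delta> * angle (real k + time3) - \<phi>)"
    using cos_shift_block[of k time3 "2 * of_int \<delta> * angle (real k + time3) - \<phi>"] unfolding heights_fourier t
    by (simp add: sq add_diff_eq add.assoc)
qed

end

lemma lissajous_fourier:
  assumes "\<And>k. \<alpha> k \<in> {-1, 1}" "\<And>k. \<beta> k \<in> {-1, 1}"
    and "a \<in> {-1, 1}" "b \<in> {-1, 1}" "a' \<in> {-1, 1}" "b' \<in> {-1, 1}" "\<delta> \<in> {-1, 1}"
  shows "fourier_lissajous N \<delta> \<phi> \<alpha> \<beta> a b a' b'"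
proof unfold_locales
  show "continuous_on UNIV (fourier_z N \<delta> \<phi>)" unfolding fourier_z_def by (intro continuous_intros)
  show "fourier_z N \<delta> \<phi> (t + 2 * pi) = fourier_z N \<delta> \<phi> t" for t
  proof -
    have "2 * (t + 2 * pi) + pi/4 = (2 * t + pi/4) + of_int 2 * (2 * pi)"
      "(2 * real N + 1 + 2 * of_int \<delta>) * (t + 2 * pi) + \<phi> = ((2 * real N + 1 + 2 * of_int \<delta>) * t + \<phi>) + of_int (2 * int N + 1 + 2 * \<delta>) * (2 * pi)"
      by (simp_all add: algebra_simps)
    then show ?thesis unfolding fourier_z_def by (simp only: cos_add_int_turns)
  qed
qed (use assms in blast)+

context fourier_lissajous
begin

lemma sin_fraction_pos: "0 < x \<Longrightarrow> x < 2 * ny \<Longrightarrow> sin (pi * x / (2 * ny)) > 0"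
  using ny_pos by (intro sin_gt_zero) (auto simp: field_simps)

lemma cos_fraction_pos: "0 \<le> x \<Longrightarrow> 4 * x < ny \<Longrightarrow> cos (2 * pi * x / ny) > 0"
proof -
  assume x: "0 \<le> x" "4 * x < ny"
  then have "2 * pi * x / ny < pi / 2" "0 \<le> 2 * pi * x / ny" using ny_pos by (simp_all add: field_simps)
  then show ?thesis using pi_gt_zero by (intro cos_gt_zero_pi) linarith+
qed

lemma cos_fraction_neg: "ny < 4 * x \<Longrightarrow> 4 * x < 3 * ny \<Longrightarrow> cos (2 * pi * x / ny) < 0"
proof -
  assume x: "ny < 4 * x" "4 * x < 3 * ny"
  then have "2 * pi * x / ny - pi < pi / 2" "- (pi / 2) < 2 * pi * x / ny - pi" using ny_pos by (simp_all add: field_simps)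
  then have "cos (2 * pi * x / ny - pi) > 0" by (intro cos_gt_zero_pi)
  then show ?thesis by (simp add: cos_diff)
qed

lemma crossing_angles:
  "2 * angle (real k + time1) = (2 * pi * real k + pi - 1) / ny"
  "2 * angle (real k + time3) = (2 * pi * real k + pi + 1) / ny"
  using ny_pos unfolding angle_def time1_def time3_def by (simp_all add: field_simps)

lemma curve_facts:
  assumes "crossings_ok"
  shows "inj_on curve {0..<2 * pi}" "heq (word_knot (concat (map (\<lambda>j. [Mid (\<alpha> j), Out a b, Mid (\<beta> j), Out a' b']) [0..<N]) @ [Mid (\<alpha> N)])) (curve ` {0..2 * pi})"
  using curve_inj[OF assms] curve_word[OF assms] unfolding word_def word_blocks by simp_all

lemma curve_fourier: "curve t = (cos (2 * t), Complex (cos ((2 * real N + 1) * t + 1/2)) (fourier_z N \<delta> \<phi> t))"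
  by (simp add: curve_def ny_def)

lemma crossings_okI:
  assumes 1: "\<And>k. k \<le> N \<Longrightarrow> of_int (\<alpha> k) * cos (pi/2 - 1/2 + 2 * of_int \<delta> * angle (real k + time1) + \<phi>) > 0"
    and 3: "\<And>k. k < N \<Longrightarrow> of_int (\<beta> k) * cos (pi/2 + 1/2 + 2 * of_int \<delta> * angle (real k + time3) - \<phi>) > 0"
    and 2: "\<And>k. k < N \<Longrightarrow> of_int (left_exp k) * (- ((-1) ^ k * sqrt 2) - 2 * of_int \<delta> * cos \<phi>) > 0"
      "\<And>k. k < N \<Longrightarrow> of_int (right_exp k) * ((-1) ^ k * sqrt 2 - 2 * of_int \<delta> * cos \<phi>) > 0"
    and 4: "\<And>k. k < N \<Longrightarrow> of_int (left_exp' k) * ((-1) ^ k * sqrt 2 - 2 * of_int \<delta> * sin \<phi>) > 0"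
      "\<And>k. k < N \<Longrightarrow> of_int (right_exp' k) * (- ((-1) ^ k * sqrt 2) - 2 * of_int \<delta> * sin \<phi>) > 0"
  shows "crossings_ok"
proof -
  have *: "(-1) ^ k * of_int s * y > 0" if "(-1) ^ k * y = x * w" "x > 0" "of_int s * w > 0" for k :: nat and s :: int and x y w :: real
  proof -
    have "(-1) ^ k * of_int s * y = of_int s * ((-1) ^ k * y)" by simp
    also have "\<dots> = x * (of_int s * w)" unfolding that(1) by simp
    finally show ?thesis using mult_pos_pos[OF that(2,3)] by (simp only:)
  qed
  have p: "sin (2 * angle (real k + 1/2)) > 0" "sin (2 * angle (real k + 1)) > 0" if "k < N" for k
    using that by (intro sin_angle_pos; simp add: ny_def)+
  show ?thesis unfolding crossings_ok_def
    using *[OF self_crossings(1) _ 1] *[OF self_crossings(2) _ 3]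
      *[OF middle_crossings(1)[OF refl] p(1) 2(1)] *[OF middle_crossings(2)[OF refl] p(1) 2(2)]
      *[OF last_crossings(1)[OF refl] p(2) 4(1)] *[OF last_crossings(2)[OF refl] p(2) 4(2)]
    by simp
qed

end

definition fourier_curve :: "nat \<Rightarrow> int \<Rightarrow> real \<Rightarrow> real \<Rightarrow> real \<times> complex" where
  "fourier_curve N \<delta> \<phi> t = (cos (2 * t), Complex (cos ((2 * real N + 1) * t + 1/2)) (fourier_z N \<delta> \<phi> t))"

text \<open>With \<open>\<delta> = 1\<close> and \<phi> within \<open>pi/4\<close> of 0,
  \<open>2 * cos \<phi>\<close> dominates \<open>sqrt 2\<close> and \<open>2 * sin \<phi>\<close>
  does not; so the first outer letter always has exponents -1, -1 and the second has opposite ones,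
  in the pattern 1, -1.\<close>

theorem even_fourier_curve:
  fixes n :: nat
  assumes "n \<ge> 1"
  defines "\<phi> \<equiv> (2 * real n + 3 - 3 * pi) / (2 * (2 * real n + 1))"
  shows "inj_on (fourier_curve n 1 \<phi>) {0..<2 * pi}"
    "heq (word_knot (twist_word (2 * n))) (fourier_curve n 1 \<phi> ` {0..2 * pi})"
proof -
  define \<alpha> :: "nat \<Rightarrow> int" where "\<alpha> = (\<lambda>k. if k = 0 then 1 else -1)"
  define \<beta> :: "nat \<Rightarrow> int" where "\<beta> = (\<lambda>k. -1)"
  interpret fourier_lissajous n 1 \<phi> \<alpha> \<beta> "-1" "-1" "1" "-1"
    by (rule lissajous_fourier) (auto simp: \<alpha>_def \<beta>_def)
  have ny: "ny = 2 * real n + 1" by (simp add: ny_def)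
  have p: "\<phi> = (ny + 2 - 3 * pi) / (2 * ny)" unfolding \<phi>_def ny by (simp add: field_simps)
  have "\<bar>\<phi>\<bar> < pi / 4"
  proof -
    \<comment> \<open>The lower bound for \<phi> in the case n = 1 amounts to
      \<open>pi < 10/3\<close>.\<close>
    have pi: "3 < pi" "pi < 10/3" using pi_gt3 pi_approx by auto
    have "real n * pi \<ge> real n * 3" "(real n - 1) * pi \<ge> (real n - 1) * 3"
      using pi assms(1) by (intro mult_left_mono; simp)+
    then have 1: "4 * (2 * real n + 3 - 3 * pi) < 2 * (2 * real n + 1) * pi" "4 * (3 * pi - 2 * real n - 3) < 2 * (2 * real n + 1) * pi"
      using pi assms(1) by (simp_all add: algebra_simps)
    have "\<phi> < pi / 4" "- \<phi> < pi / 4" using 1 unfolding \<phi>_def by (simp_all add: field_simps)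
    then show ?thesis by linarith
  qed
  note \<phi> = near_zero_bounds[OF this]
  have s: "(-1::real) ^ k = (if even k then 1 else -1)" for k by simp
  have ok: "crossings_ok"
  proof (rule crossings_okI)
    fix k assume k: "k \<le> n"
    \<comment> \<open>\<phi> contains 1/2 + 1/ny, which cancels everything that is not a multiple of
      \<open>pi\<close>. The offset from \<open>pi/2\<close> has the sign of 4 k - 1, so k = 0 is
      the only positive inner letter.\<close>
    have e: "pi/2 - 1/2 + 2 * of_int 1 * angle (real k + time1) + \<phi> = pi/2 + pi * (4 * real k - 1) / (2 * ny)"
    proof -
      have h: "2 * of_int 1 * angle (real k + time1) = ((2 * pi * real k + pi - 1) / ny)" using crossing_angles(1)[of k] by simp
      show ?thesis unfolding h p using ny_pos by (simp add: field_simps)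
    qed
    show "of_int (\<alpha> k) * cos (pi/2 - 1/2 + 2 * of_int 1 * angle (real k + time1) + \<phi>) > 0"
    proof (cases "k = 0")
      case True
      have "pi * (4 * real k - 1) / (2 * ny) = - (pi / (2 * ny))" using True by simp
      moreover have "sin (pi / (2 * ny)) > 0" using sin_fraction_pos[of 1] ny by simp
      ultimately show ?thesis unfolding e using True by (simp add: \<alpha>_def cos_add cos_diff)
    next
      case False
      have "sin (pi * (4 * real k - 1) / (2 * ny)) > 0" 
        using k False by (intro sin_fraction_pos; simp add: ny)
      then show ?thesis unfolding e using False by (simp add: \<alpha>_def cos_add)
    qed
  next
    fix k assume k: "k < n"
    have e: "pi/2 + 1/2 + 2 * of_int 1 * angle (real k + time3) - \<phi> = pi/2 + pi * (4 * real k + 5) / (2 * ny)"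
    proof -
      have h: "2 * of_int 1 * angle (real k + time3) = ((2 * pi * real k + pi + 1) / ny)" using crossing_angles(2)[of k] by simp
      show ?thesis unfolding h p using ny_pos by (simp add: field_simps)
    qed
    have "sin (pi * (4 * real k + 5) / (2 * ny)) > 0" 
      using k by (intro sin_fraction_pos; simp add: ny)
    then show "of_int (\<beta> k) * cos (pi/2 + 1/2 + 2 * of_int 1 * angle (real k + time3) - \<phi>) > 0"
      unfolding e by (simp add: \<beta>_def cos_add)
  qed (use \<phi> in \<open>auto simp: s left_exp_def right_exp_def left_exp'_def right_exp'_def\<close>)
  have c: "curve = fourier_curve n 1 \<phi>" unfolding curve_fourier[abs_def] fourier_curve_def[abs_def] ..
  have "concat (map (\<lambda>j. [Mid (\<alpha> j), Out (-1) (-1), Mid (\<beta> j), Out 1 (-1)]) [0..<m]) @ [Mid (\<alpha> m)] =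
     [Mid 1] @ concat (replicate m [Out (-1) (-1), Mid (-1), Out 1 (-1), Mid (-1)])" for m
  proof (induction m)
    case (Suc m)
    have r: "replicate (Suc m) x = replicate m x @ [x]" for x :: "letter list" by (simp add: replicate_append_same)
    have "concat (map (\<lambda>j. [Mid (\<alpha> j), Out (-1) (-1), Mid (\<beta> j), Out 1 (-1)]) [0..<Suc m]) @ [Mid (\<alpha> (Suc m))] =
      (concat (map (\<lambda>j. [Mid (\<alpha> j), Out (-1) (-1), Mid (\<beta> j), Out 1 (-1)]) [0..<m]) @ [Mid (\<alpha> m)]) @ [Out (-1) (-1), Mid (-1), Out 1 (-1), Mid (-1)]"
      by (simp add: \<alpha>_def[THEN fun_cong, of "Suc m"] \<beta>_def)
    then show ?case unfolding Suc.IH r by simp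
  qed (simp add: \<alpha>_def)
  then show "inj_on (fourier_curve n 1 \<phi>) {0..<2 * pi}" "heq (word_knot (twist_word (2 * n))) (fourier_curve n 1 \<phi> ` {0..2 * pi})"
    using curve_facts[OF ok] heq_trans[OF heq_sym[OF even_twist_words]] unfolding c by simp_all
qed

text \<open>Now \<open>\<delta> = -1\<close> and \<phi> is within \<open>pi/4\<close> of
  \<open>pi/2\<close>, so \<open>2 * sin \<phi>\<close> dominates \<open>sqrt 2\<close> and
  \<open>2 * cos \<phi>\<close> does not. The inner crossings change sign at a quarter of the
  period, \<open>ny / 4 = 2 * n + 3/4\<close>, which explains the switches of \<alpha> after 2 n and
  of \<beta> at 2 n.\<close>

theorem odd_fourier_curve:
  fixes n :: nat
  assumes "n \<ge> 1"
  defines "\<phi> \<equiv> (8 * real n + 1 + (8 * real n + 5) * pi) / (2 * (8 * real n + 3))"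
  shows "inj_on (fourier_curve (4 * n + 1) (-1) \<phi>) {0..<2 * pi}"
    "heq (word_knot (twist_word (4 * n + 1))) (fourier_curve (4 * n + 1) (-1) \<phi> ` {0..2 * pi})"
proof -
  define \<alpha> :: "nat \<Rightarrow> int" where "\<alpha> = (\<lambda>k. if k \<le> 2 * n then -1 else 1)"
  define \<beta> :: "nat \<Rightarrow> int" where "\<beta> = (\<lambda>k. if k < 2 * n then 1 else -1)"
  interpret fourier_lissajous "4 * n + 1" "-1" \<phi> \<alpha> \<beta> "-1" "1" "1" "1"
    by (rule lissajous_fourier) (auto simp: \<alpha>_def \<beta>_def)
  have ny: "ny = 8 * real n + 3" unfolding ny_def by simp
  have p: "\<phi> = (ny - 2 + (ny + 2) * pi) / (2 * ny)" unfolding \<phi>_def ny by (simp add: field_simps)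
  have "\<bar>\<phi> - pi/2\<bar> < pi / 4"
  proof -
    have pi: "3 < pi" using pi_gt3 by auto
    have "real n * pi \<ge> real n * 3" "(8 * real n - 1) * pi \<ge> (8 * real n - 1) * 3"
      using pi assms(1) by (intro mult_left_mono; simp)+
    then have 1: "(8 * real n + 3) * pi < 2 * (8 * real n + 1 + (8 * real n + 5) * pi)" "2 * (8 * real n + 1 + (8 * real n + 5) * pi) < 3 * (8 * real n + 3) * pi"
      using pi assms(1) by (simp_all add: algebra_simps)
    have "pi / 4 < \<phi>" "\<phi> < 3 * pi / 4" using 1 unfolding \<phi>_def by (simp_all add: field_simps)
    then show ?thesis by linarith
  qed
  note near_zero_bounds[OF this]
  moreover have "cos (\<phi> - pi/2) = sin \<phi>" "sin (\<phi> - pi/2) = - cos \<phi>" by (simp_all add: cos_diff sin_diff)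
  ultimately have \<phi>: "sqrt 2 < 2 * sin \<phi>" "\<bar>2 * cos \<phi>\<bar> < sqrt 2" by simp_all
  have s: "(-1::real) ^ k = (if even k then 1 else -1)" for k by simp
  have ok: "crossings_ok"
  proof (rule crossings_okI)
    fix k assume k: "k \<le> 4 * n + 1"
    have e: "pi/2 - 1/2 + 2 * of_int (-1) * angle (real k + time1) + \<phi> = pi - 2 * pi * real k / ny"
    proof -
      have h: "2 * of_int (-1) * angle (real k + time1) = - ((2 * pi * real k + pi - 1) / ny)" using crossing_angles(1)[of k] by simp
      show ?thesis unfolding h p using ny_pos by (simp add: field_simps)
    qed
    show "of_int (\<alpha> k) * cos (pi/2 - 1/2 + 2 * of_int (-1) * angle (real k + time1) + \<phi>) > 0"
    proof (cases "k \<le> 2 * n")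
      case True
      have "cos (2 * pi * real k / ny) > 0" using True by (intro cos_fraction_pos; (unfold ny)?; linarith)
      then show ?thesis unfolding e using True by (simp add: \<alpha>_def cos_diff)
    next
      case False
      have "real k \<ge> 2 * real n + 1" "real k \<le> 4 * real n + 1" "real n \<ge> 0" using False k by linarith+
      then have "ny < 4 * real k" "4 * real k < 3 * ny" unfolding ny by simp_all
      then have "cos (2 * pi * real k / ny) < 0" by (rule cos_fraction_neg)
      then show ?thesis unfolding e using False by (simp add: \<alpha>_def cos_diff)
    qed
  next
    fix k assume k: "k < 4 * n + 1"
    have e: "pi/2 + 1/2 + 2 * of_int (-1) * angle (real k + time3) - \<phi> = - (2 * pi * (real k + 1) / ny)"
    proof -
      have h: "2 * of_int (-1) * angle (real k + time3) = - ((2 * pi * real k + pi + 1) / ny)" using crossing_angles(2)[of k] by simp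
      show ?thesis unfolding h p using ny_pos by (simp add: field_simps)
    qed
    show "of_int (\<beta> k) * cos (pi/2 + 1/2 + 2 * of_int (-1) * angle (real k + time3) - \<phi>) > 0"
    proof (cases "k < 2 * n")
      case True
      then have "real k + 1 \<le> 2 * real n" by linarith
      then have "4 * (real k + 1) < ny" unfolding ny by simp
      then have "cos (2 * pi * (real k + 1) / ny) > 0" by (intro cos_fraction_pos) simp_all
      then show ?thesis unfolding e cos_minus using True by (simp add: \<beta>_def)
    next
      case False
      have "real k \<ge> 2 * real n" "real k \<le> 4 * real n" "real n \<ge> 0" using False k by linarith+
      then have "ny < 4 * (real k + 1)" "4 * (real k + 1) < 3 * ny" unfolding ny by simp_all
      then have "cos (2 * pi * (real k + 1) / ny) < 0" by (rule cos_fraction_neg)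
      then show ?thesis unfolding e cos_minus using False by (simp add: \<beta>_def)
    qed
  qed (use \<phi> in \<open>auto simp: s left_exp_def right_exp_def left_exp'_def right_exp'_def abs_less_iff\<close>)
  have c: "curve = fourier_curve (4 * n + 1) (-1) \<phi>" unfolding curve_fourier[abs_def] fourier_curve_def[abs_def] ..
  \<comment> \<open>The block k = 2 n lies between the two switches: it is the only one in which
    both inner letters are negative.\<close>
  have up: "[0..<4 * n + 1] = [0..<2 * n] @ [2 * n] @ [2 * n + 1..<4 * n + 1]"
    using upt_add_eq_append[of 0 "2 * n" "2 * n + 1"] by (simp add: upt_conv_Cons del: upt_Suc)
  have const: "map f [i..<j] = replicate (j - i) x" if "\<And>k. i \<le> k \<Longrightarrow> k < j \<Longrightarrow> f k = x" for f :: "nat \<Rightarrow> letter list" and i j x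
    using that by (intro nth_equalityI) auto
  let ?f = "\<lambda>j. [Mid (\<alpha> j), Out (-1) 1, Mid (\<beta> j), Out 1 1]"
  have "map ?f [0..<2 * n] = replicate (2 * n - 0) [Mid (-1), Out (-1) 1, Mid 1, Out 1 1]"
    "map ?f [2 * n + 1..<4 * n + 1] = replicate (4 * n + 1 - (2 * n + 1)) [Mid 1, Out (-1) 1, Mid (-1), Out 1 1]"
    by (rule const; simp add: \<alpha>_def \<beta>_def)+
  then have "concat (map ?f [0..<4 * n + 1]) @ [Mid (\<alpha> (4 * n + 1))] =
    concat (replicate (2 * n) [Mid (-1), Out (-1) 1, Mid 1, Out 1 1]) @ [Mid (-1), Out (-1) 1, Mid (-1), Out 1 1]
      @ concat (replicate (2 * n) [Mid 1, Out (-1) 1, Mid (-1), Out 1 1]) @ [Mid 1]"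
    unfolding up map_append concat_append by (simp add: \<alpha>_def \<beta>_def)
  then show "inj_on (fourier_curve (4 * n + 1) (-1) \<phi>) {0..<2 * pi}"
    "heq (word_knot (twist_word (4 * n + 1))) (fourier_curve (4 * n + 1) (-1) \<phi> ` {0..2 * pi})"
    using curve_facts[OF ok] heq_trans[OF heq_sym[OF odd_twist_words]] unfolding c by (simp_all only:)
qed

section \<open>The braided form of the twist knot\<close>

definition same_pair :: "complex \<Rightarrow> complex \<Rightarrow> complex \<Rightarrow> complex \<Rightarrow> bool" where
  "same_pair u v u' v' \<longleftrightarrow> sgn (Re u - Re v) = sgn (Re u' - Re v') \<and> (Re u = Re v \<longrightarrow> (Im u - Im v) * (Im u' - Im v') > 0)"

lemma same_pair_commute: "same_pair u v u' v' \<longleftrightarrow> same_pair v u v' u'"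
proof -
  have "sgn (Re u - Re v) = - sgn (Re v - Re u)" "sgn (Re u' - Re v') = - sgn (Re v' - Re u')" by (simp_all add: sgn_if)
  moreover have "(Im u - Im v) * (Im u' - Im v') = (Im v - Im u) * (Im v' - Im u')" by (simp add: algebra_simps)
  ultimately show ?thesis unfolding same_pair_def by auto
qed

lemma same_diagram_pairs:
  "same_diagram (vec4 a b c d) (vec4 a' b' c' d') \<longleftrightarrow> same_pair a b a' b' \<and> same_pair a c a' c' \<and> same_pair a d a' d' \<and>
     same_pair b c b' c' \<and> same_pair b d b' d' \<and> same_pair c d c' d'"
proof -
  have "same_diagram A B \<longleftrightarrow> (\<forall>i j. i \<noteq> j \<longrightarrow> same_pair (A $ i) (A $ j) (B $ i) (B $ j))" for A B :: "complex^4"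
    unfolding same_diagram_def same_pair_def ..
  then show ?thesis unfolding forall_4
    using same_pair_commute[of b a] same_pair_commute[of c a] same_pair_commute[of d a] same_pair_commute[of c b]
      same_pair_commute[of d b] same_pair_commute[of d c] by simp blast
qed

lemma same_diagram_swap: "same_diagram (vec4 b a c d) (vec4 b' a' c' d') \<longleftrightarrow> same_diagram (vec4 a b c d) (vec4 a' b' c' d')"
  unfolding same_diagram_pairs using same_pair_commute[of a b] by blast

text \<open>A half turn along two edges of the square with vertices 1, i, -1, -i; the polygonal
  counterpart of \<open>cis (pi * s)\<close>.\<close>

definition half_twist :: "real \<Rightarrow> complex" where
  "half_twist s = Complex (1 - 2 * s) (1 - \<bar>2 * s - 1\<bar>)"

text \<open>\<open>twisting M\<close> and its negative are the two twisted strands of \<open>twist_vertices\<close>; \<open>clasping M\<close> is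
  the arc that clasps their right cap, made monotone in the first coordinate.\<close>
definition twisting :: "nat \<Rightarrow> real \<Rightarrow> complex" where
  "twisting M x = 1 + (\<Sum>j<M. (-1) ^ j * (half_twist (unit_clamp (x - real j)) - 1))"

definition clasping :: "nat \<Rightarrow> real \<Rightarrow> complex" where
  "clasping M x = Complex (3 * unit_clamp (2 - 8 * (x - real M)) - 2 * unit_clamp (4 * (x - real M) - 3)) (2 * unit_clamp (2 * (x - real M) - 1/2) - 1)"

definition clasp_strands :: "nat \<Rightarrow> real \<Rightarrow> complex^4" where
  "clasp_strands M x = vec4 (twisting M x) (- twisting M x) (clasping M x) (Complex (-3) 1)"

lemma half_twist_ends [simp]: "half_twist 0 = 1" "half_twist 1 = -1"
  by (simp_all add: half_twist_def complex_eq_iff)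

lemma twisting_prefix:
  assumes "j \<le> M" "x \<le> real j"
  shows "twisting M x = twisting j x"
proof -
  have "(\<Sum>i<M. (-1) ^ i * (half_twist (unit_clamp (x - real i)) - 1)) = (\<Sum>i<j. (-1) ^ i * (half_twist (unit_clamp (x - real i)) - 1))"
    using assms by (intro sum.mono_neutral_right) auto
  then show ?thesis by (simp add: twisting_def)
qed

lemma twisting_after: "real M \<le> x \<Longrightarrow> twisting M x = (-1) ^ M"
proof (induction M)
  case (Suc M)
  then show ?case by (simp add: twisting_def min_def max_def)
qed (simp add: twisting_def)

text \<open>Earlier summands have reached their final values and later ones have not begun. For j =
  0 the claim includes negative x, since the strands are continued to x = -1.\<close>

lemma twisting_step:
  assumes "j < M" "x \<le> real j + 1" "real j \<le> x \<or> j = 0"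
  shows "twisting M x = (-1) ^ j * half_twist (unit_clamp (x - real j))"
proof -
  have "twisting M x = twisting (Suc j) x" using assms by (intro twisting_prefix) auto
  also have "\<dots> = twisting j x + (-1) ^ j * (half_twist (unit_clamp (x - real j)) - 1)" by (simp add: twisting_def)
  also have "twisting j x = (-1) ^ j" using assms(3)
  proof
    assume "j = 0" then show ?thesis by (simp add: twisting_def)
  qed (rule twisting_after)
  finally show ?thesis by (simp add: algebra_simps)
qed

lemma continuous_twisting: "continuous_on A (twisting M)"
  unfolding twisting_def half_twist_def Complex_eq by (intro continuous_intros)

lemma continuous_clasping: "continuous_on A (clasping M)"
  unfolding clasping_def Complex_eq by (intro continuous_intros)

lemma continuous_clasp_strands: "continuous_on A (clasp_strands M)"
proof -
  have "\<forall>i. continuous_on A (\<lambda>x. clasp_strands M x $ i)"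
    unfolding forall_4 clasp_strands_def by (auto intro!: continuous_intros continuous_twisting continuous_clasping)
  then have "continuous_on A (\<lambda>x. \<chi> i. clasp_strands M x $ i)" by (intro continuous_on_vec_lambda) blast
  then show ?thesis by simp
qed

lemma clasping_before: "x \<le> real M + 1/8 \<Longrightarrow> clasping M x = Complex 3 (-1)"
  unfolding clasping_def by (auto simp: min_def max_def)

definition twist_cfg :: "nat \<Rightarrow> complex^4" where "twist_cfg j = vec4 ((-1) ^ j) (- ((-1) ^ j)) 3 (-3)"

lemma letter_Mid_twist:
  "letter_path (Mid 1) (twist_cfg j) u = vec4 ((-1) ^ j * cis (pi * u)) (- ((-1) ^ j * cis (pi * u))) 3 (-3)"
  unfolding twist_cfg_def letter_path_def by (cases "even j") (simp_all add: vec4_eq_iff)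

lemma letter_Mid_end: "letter_path (Mid 1) (twist_cfg j) 1 = twist_cfg (Suc j)"
  by (subst letter_Mid_twist) (simp add: twist_cfg_def)

lemma sgn_unit_clamp: "sgn (1 - 2 * unit_clamp x) = sgn (1/2 - x)"
  by (auto simp: sgn_if min_def max_def)

text \<open>The free start \<open>a\<close> lets the first letter begin at -1, the left end of the
  diagram.\<close>

lemma tracks_twist:
  assumes "j < M" "a \<le> real j" "j = 0 \<or> a = real j" "u \<in> {0..1}"
  shows "same_diagram (clasp_strands M ((linepath a (real j + 1/2) +++ linepath (real j + 1/2) (real j + 1)) u))
    (letter_path (Mid 1) (twist_cfg j) u)"
proof -
  define T where "T = (linepath a (real j + 1/2) +++ linepath (real j + 1/2) (real j + 1)) u"
  have T: "T \<in> {a..real j + 1}" "sgn (real j + 1/2 - T) = sgn (1/2 - u)"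
    using two_piece_time[of a "real j + 1/2" "real j + 1" u] assms(2,4) unfolding T_def by auto
  define s where "s = unit_clamp (T - real j)"
  have e: "1/2 - (T - real j) = real j + 1/2 - T" by simp
  have s: "0 \<le> s" "s \<le> 1" "sgn (1 - 2 * s) = sgn (cos (pi * u))"
    unfolding half_turn_sgn[OF assms(4)] T(2)[symmetric] s_def sgn_unit_clamp e by simp_all
  have tw: "twisting M T = (-1) ^ j * half_twist s"
    unfolding s_def using assms T(1) by (intro twisting_step) auto
  have cl: "clasping M T = Complex 3 (-1)" using T(1) assms(1) by (intro clasping_before) auto
  have c: "cos (pi * u) < 2" "- cos (pi * u) < 2" by (rule cos_bounds_2)+
  have half: "s = 1/2 \<Longrightarrow> sin (pi * u) = 1" using s(3) half_turn_sgn[OF assms(4)] by (intro sin_mid[of "1 - 2 * s"]) auto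
  have base: "same_diagram (vec4 (half_twist s) (- half_twist s) (Complex 3 (-1)) (Complex (-3) 1)) (vec4 (cis (pi * u)) (- cis (pi * u)) 3 (-3))"
    "same_diagram (vec4 (- half_twist s) (half_twist s) (Complex 3 (-1)) (Complex (-3) 1)) (vec4 (- cis (pi * u)) (cis (pi * u)) 3 (-3))"
  proof -
    have "sgn (2 * (1 - 2 * s)) = sgn (2 * cos (pi * u))" using s(3) sgn_mult_pos[of 2 "1 - 2 * s"] sgn_mult_pos[of 2 "cos (pi * u)"] by simp
    then show *: "same_diagram (vec4 (half_twist s) (- half_twist s) (Complex 3 (-1)) (Complex (-3) 1)) (vec4 (cis (pi * u)) (- cis (pi * u)) 3 (-3))"
      unfolding same_diagram_pairs same_pair_def using s(1,2) c half by (auto simp: half_twist_def)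
    then show "same_diagram (vec4 (- half_twist s) (half_twist s) (Complex 3 (-1)) (Complex (-3) 1)) (vec4 (- cis (pi * u)) (cis (pi * u)) 3 (-3))"
      by (simp only: same_diagram_swap)
  qed
  show ?thesis unfolding T_def[symmetric] clasp_strands_def letter_Mid_twist tw cl using base by (cases "even j") simp_all
qed

text \<open>The parity of M decides which of the two twisted strands ends on the right.\<close>

definition clasp_cfg :: "nat \<Rightarrow> complex^4" where "clasp_cfg M = (if even M then vec4 3 (-1) 1 (-3) else vec4 (-1) 3 1 (-3))"
definition clasped_cfg :: "nat \<Rightarrow> complex^4" where "clasped_cfg M = (if even M then vec4 3 1 (-1) (-3) else vec4 1 3 (-1) (-3))"

lemma letter_clasp_start:
  fixes u defines "v \<equiv> cis (pi * u)"
  shows "letter_path (Out 0 (-1)) (vec4 1 (-1) 3 (-3)) u = vec4 (2 - cnj v) (-1) (2 + cnj v) (-3)"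
    "letter_path (Out 0 (-1)) (vec4 (-1) 1 3 (-3)) u = vec4 (-1) (2 - cnj v) (2 + cnj v) (-3)"
    "letter_path (Mid 1) (vec4 3 (-1) 1 (-3)) u = vec4 3 (- v) v (-3)"
    "letter_path (Mid 1) (vec4 (-1) 3 1 (-3)) u = vec4 (- v) 3 v (-3)"
  unfolding letter_path_def v_def cis_cnj by (simp_all add: vec4_eq_iff)

lemma letter_clasp:
  "letter_path (Out 0 (-1)) (twist_cfg M) u = (if even M then vec4 (2 - cnj (cis (pi * u))) (-1) (2 + cnj (cis (pi * u))) (-3)
      else vec4 (-1) (2 - cnj (cis (pi * u))) (2 + cnj (cis (pi * u))) (-3))"
  "letter_path (Mid 1) (clasp_cfg M) u = (if even M then vec4 3 (- cis (pi * u)) (cis (pi * u)) (-3) else vec4 (- cis (pi * u)) 3 (cis (pi * u)) (-3))"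
  by (cases "even M"; simp add: twist_cfg_def clasp_cfg_def letter_clasp_start)+

lemma letter_clasp_end:
  "letter_path (Out 0 (-1)) (twist_cfg M) 1 = clasp_cfg M" "letter_path (Mid 1) (clasp_cfg M) 1 = clasped_cfg M"
  unfolding letter_clasp by (simp_all add: clasp_cfg_def clasped_cfg_def)

lemma clasp_strands_after:
  assumes "real M \<le> T"
  shows "clasp_strands M T = (if even M then vec4 1 (-1) (clasping M T) (Complex (-3) 1) else vec4 (-1) 1 (clasping M T) (Complex (-3) 1))"
  unfolding clasp_strands_def twisting_after[OF assms] by simp

lemma same_diagram_clasp:
  assumes "real M \<le> T" "same_diagram (vec4 1 (-1) (clasping M T) (Complex (-3) 1)) (vec4 a b c d)"
  shows "same_diagram (clasp_strands M T) (if even M then vec4 a b c d else vec4 b a c d)"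
  unfolding clasp_strands_after[OF assms(1)] using assms(2) by (simp add: same_diagram_swap)

text \<open>The clasping strand passes y = 1 at height -1 when x = M + 5/24, rises at y = 0 between
  the two twisted strands, and passes y = -1 at height 1 when x = M + 7/8. Passing one strand below
  and the other above is what hooks it into their cap.\<close>

lemma tracks_clasp:
  "tracks (clasp_strands M) (twist_cfg M) (real M) (real M + 1)
     [(Out 0 (-1), real M + 5/24, real M + 1/2), (Mid 1, real M + 7/8, real M + 15/16)]"
proof -
  have 1: "same_diagram (clasp_strands M ((linepath (real M) (real M + 5/24) +++ linepath (real M + 5/24) (real M + 1/2)) u))
      (letter_path (Out 0 (-1)) (twist_cfg M) u)" if u: "u \<in> {0..1}" for u
  proof -
    define T where "T = (linepath (real M) (real M + 5/24) +++ linepath (real M + 5/24) (real M + 1/2)) u"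
    have T: "T \<in> {real M..real M + 1/2}" "sgn (real M + 5/24 - T) = sgn (1/2 - u)"
      using two_piece_time[of "real M" "real M + 5/24" "real M + 1/2" u] u unfolding T_def by auto
    define y where "y = 3 * unit_clamp (2 - 8 * (T - real M))"
    have y: "0 \<le> y" "sgn (1 - y) = - sgn (cos (pi * u))"
      unfolding half_turn_sgn[OF u] T(2)[symmetric] y_def by (auto simp: sgn_if min_def max_def)
    define h where "h = Im (clasping M T)"
    have cl: "clasping M T = Complex y h" "y = 1 \<Longrightarrow> h = -1"
      using T(1) unfolding h_def clasping_def y_def by (auto simp: min_def max_def split: if_splits)
    have c: "cos (pi * u) < 2" "- cos (pi * u) < 2" by (rule cos_bounds_2)+
    have half: "y = 1 \<Longrightarrow> sin (pi * u) = 1" using y(2) half_turn_sgn[OF u] by (intro sin_mid[of "- (1 - y)"]) auto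
    have "sgn (- (2 * cos (pi * u))) = - sgn (cos (pi * u))" using sgn_mult_pos[of 2 "cos (pi * u)"] by (simp add: sgn_minus)
    then have "same_diagram (vec4 1 (-1) (clasping M T) (Complex (-3) 1)) (vec4 (2 - cnj (cis (pi * u))) (-1) (2 + cnj (cis (pi * u))) (-3))"
      unfolding same_diagram_pairs same_pair_def using y c half cl by auto
    then show ?thesis unfolding T_def[symmetric] letter_clasp using T(1) by (intro same_diagram_clasp) auto
  qed
  have 2: "same_diagram (clasp_strands M ((linepath (real M + 1/2) (real M + 7/8) +++ linepath (real M + 7/8) (real M + 15/16)) u))
      (letter_path (Mid 1) (clasp_cfg M) u)" if u: "u \<in> {0..1}" for u
  proof -
    define T where "T = (linepath (real M + 1/2) (real M + 7/8) +++ linepath (real M + 7/8) (real M + 15/16)) u"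
    have T: "T \<in> {real M + 1/2..real M + 15/16}" "sgn (real M + 7/8 - T) = sgn (1/2 - u)"
      using two_piece_time[of "real M + 1/2" "real M + 7/8" "real M + 15/16" u] u unfolding T_def by auto
    define y where "y = - 2 * unit_clamp (4 * (T - real M) - 3)"
    have y: "-2 \<le> y" "y \<le> 0" "sgn (1 + y) = sgn (cos (pi * u))"
      unfolding half_turn_sgn[OF u] T(2)[symmetric] y_def by (auto simp: sgn_if min_def max_def)
    define h where "h = Im (clasping M T)"
    have cl: "clasping M T = Complex y h" "y = -1 \<Longrightarrow> h = 1"
      using T(1) unfolding h_def clasping_def y_def by (auto simp: min_def max_def split: if_splits)
    have c: "cos (pi * u) < 2" "- cos (pi * u) < 2" by (rule cos_bounds_2)+
    have half: "y = -1 \<Longrightarrow> sin (pi * u) = 1" using y(3) half_turn_sgn[OF u] by (intro sin_mid[of "1 + y"]) auto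
    have "sgn (- 1 - y) = - sgn (cos (pi * u))" "sgn (- (2 * cos (pi * u))) = - sgn (cos (pi * u))"
      using y(3) sgn_minus[of "1 + y"] sgn_mult_pos[of 2 "cos (pi * u)"] by (simp_all add: sgn_minus)
    then have "same_diagram (vec4 1 (-1) (clasping M T) (Complex (-3) 1)) (vec4 3 (- cis (pi * u)) (cis (pi * u)) (-3))"
      unfolding same_diagram_pairs same_pair_def using y c half cl by auto
    then show ?thesis unfolding T_def[symmetric] letter_clasp using T(1) by (intro same_diagram_clasp) auto
  qed
  have 3: "same_diagram (clasp_strands M T) (clasped_cfg M)" if T: "T \<in> {real M + 15/16..real M + 1}" for T
  proof -
    have "Re (clasping M T) < -1" "-2 \<le> Re (clasping M T)" using T unfolding clasping_def by (auto simp: min_def max_def)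
    then have "same_diagram (vec4 1 (-1) (clasping M T) (Complex (-3) 1)) (vec4 3 1 (-1) (-3))"
      unfolding same_diagram_pairs same_pair_def by auto
    then show ?thesis unfolding clasped_cfg_def using T by (intro same_diagram_clasp) auto
  qed
  show ?thesis using 1 2 3 by (simp add: letter_clasp_end)
qed

definition twist_schedule :: "nat \<Rightarrow> nat \<Rightarrow> (letter \<times> real \<times> real) list" where
  "twist_schedule M k = map (\<lambda>j. (Mid 1, real j + 1/2, real j + 1)) [k..<M] @ [(Out 0 (-1), real M + 5/24, real M + 1/2), (Mid 1, real M + 7/8, real M + 15/16)]"

lemma twist_schedule_step: "k < M \<Longrightarrow> twist_schedule M k = (Mid 1, real k + 1/2, real k + 1) # twist_schedule M (Suc k)"
  by (simp add: twist_schedule_def upt_conv_Cons)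

lemma tracks_twist_schedule:
  assumes "k \<le> M" shows "tracks (clasp_strands M) (twist_cfg k) (real k) (real M + 1) (twist_schedule M k) \<and> increasing (real k) (real M + 1) (twist_schedule M k)"
  using assms
proof (induction k rule: inc_induct)
  case base show ?case using tracks_clasp[of M] by (simp add: twist_schedule_def)
next
  case (step k)
  then show ?case using tracks_twist[of k M "real k"] by (simp add: twist_schedule_step letter_Mid_end add.commute)
qed

lemma tracks_twist_all:
  assumes "M \<ge> 1"
  shows "tracks (clasp_strands M) start_cfg (-1) (real M + 1) (twist_schedule M 0)" "increasing (-1) (real M + 1) (twist_schedule M 0)"
proof -
  have s: "start_cfg = twist_cfg 0" by (simp add: start_cfg_vec4 twist_cfg_def)
  show "tracks (clasp_strands M) start_cfg (-1) (real M + 1) (twist_schedule M 0)" "increasing (-1) (real M + 1) (twist_schedule M 0)"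
    unfolding s using tracks_twist_schedule[of 1 M] tracks_twist[of 0 M "-1"] assms by (simp_all add: twist_schedule_step letter_Mid_end)
qed

lemma twist_schedule_word: "map fst (twist_schedule M 0) = twist_word M"
  by (simp add: twist_schedule_def twist_word_def comp_def map_replicate_const)

lemma twist_schedule_end: "pathfinish (word_path (map fst (twist_schedule M 0)) start_cfg) = clasped_cfg M"
proof -
  have "pathfinish (word_path (map fst (twist_schedule M k)) (twist_cfg k)) = clasped_cfg M" if "k \<le> M" for k
    using that
  proof (induction k rule: inc_induct)
    case base show ?case by (simp add: twist_schedule_def letter_clasp_end)
  next
    case (step k)
    then show ?case by (simp add: twist_schedule_step letter_Mid_end)
  qed
  from this[of 0] have "pathfinish (word_path (map fst (twist_schedule M 0)) (twist_cfg 0)) = clasped_cfg M" by blast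
  moreover have "twist_cfg 0 = start_cfg" by (simp add: start_cfg_vec4 twist_cfg_def)
  ultimately show ?thesis by (simp only:)
qed

text \<open>The four arcs are the caps. The left ones are slanted because they lead from the twisted
  strands at height 0 to the outer strands at heights -1 and 1; the right ones lie at the constant
  heights 1 and 0.\<close>

proposition clasp_diagram:
  assumes "M \<ge> 1"
  shows "heq ({(x, clasp_strands M x $ k) | x k. x \<in> {-1..real M + 1}}
      \<union> (\<lambda>t. (-1, Complex t (- ((t - 1) / 2)))) ` {1..3} \<union> (\<lambda>t. (-1, Complex (- t) ((t - 1) / 2))) ` {1..3}
      \<union> (\<lambda>t. (real M + 1, Complex (- t) 1)) ` {2..3} \<union> (\<lambda>t. (real M + 1, Complex t 0)) ` {-1..1}) (word_knot (twist_word M))"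
proof -
  have C: "twisting M (-1) = 1" "clasping M (-1) = Complex 3 (-1)"
    using twisting_step[of 0 M "-1"] assms clasping_before[of "-1" M] by simp_all
  have E: "twisting M (real M + 1) = (-1) ^ M" "clasping M (real M + 1) = Complex (-2) 1"
    using twisting_after[of M] by (simp_all add: clasping_def)
  define p q :: 4 where "p = (if even M then 1 else 2)" and "q = (if even M then 2 else 1)"
  have commute: "closed_segment 3 1 = closed_segment 1 (3::complex)" "closed_segment (-1) (-3) = closed_segment (-3) (-1::complex)"
    by (rule closed_segment_commute)+
  show ?thesis unfolding twist_schedule_word[symmetric]
  proof (rule timed_plat[where ?i1.0=1 and ?j1.0=3 and ?i2.0=2 and ?j2.0=4 and ?i3.0=3 and ?j3.0=4 and ?i4.0=q and ?j4.0=p and d="1/8",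
        OF continuous_clasp_strands tracks_twist_all(2,1)[OF assms] start_cfg_base])
    show "cap_arc (\<lambda>t. (-1, Complex t (- ((t - 1) / 2)))) 1 3 (-1) (clasp_strands M (-1) $ 1) (clasp_strands M (-1) $ 3)"
      "cap_arc (\<lambda>t. (-1, Complex (- t) ((t - 1) / 2))) 1 3 (-1) (clasp_strands M (-1) $ 2) (clasp_strands M (-1) $ 4)"
      "cap_arc (\<lambda>t. (real M + 1, Complex (- t) 1)) 2 3 (real M + 1) (clasp_strands M (real M + 1) $ 3) (clasp_strands M (real M + 1) $ 4)"
      "cap_arc (\<lambda>t. (real M + 1, Complex t 0)) (-1) 1 (real M + 1) (clasp_strands M (real M + 1) $ q) (clasp_strands M (real M + 1) $ p)"
      unfolding cap_arc_def clasp_strands_def p_def q_def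
      by (auto simp: C E inj_on_def complex_eq_iff) (auto simp: Complex_eq intro!: continuous_intros)
    show "shadow (clasp_strands M (-1) $ 1) (clasp_strands M (-1) $ 3) \<inter> shadow (clasp_strands M (-1) $ 2) (clasp_strands M (-1) $ 4) = {}"
      "shadow (clasp_strands M (real M + 1) $ 3) (clasp_strands M (real M + 1) $ 4) \<inter> shadow (clasp_strands M (real M + 1) $ q) (clasp_strands M (real M + 1) $ p) = {}"
      unfolding shadow_def clasp_strands_def p_def q_def by (auto simp: C E)
    show "k \<in> {1, 3, 2, 4}" "k \<in> {3, 4, q, p}" for k :: 4 using exhaust_4[of k] by (auto simp: p_def q_def)
    show "Re (clasp_strands M x $ k) \<notin> open_shadow (clasp_strands M (-1) $ 1) (clasp_strands M (-1) $ 3)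
        \<union> open_shadow (clasp_strands M (-1) $ 2) (clasp_strands M (-1) $ 4)"
      if "x \<in> {-1..real M + 1}" "x < -1 + 1/8" for x k
    proof -
      have "twisting M x = 1" "clasping M x = Complex 3 (-1)"
        using twisting_step[of 0 M x] that assms clasping_before[of x M] by simp_all
      then show ?thesis using exhaust_4[of k] unfolding open_shadow_def clasp_strands_def by (auto simp: C)
    qed
    show "Re (clasp_strands M x $ k) \<notin> open_shadow (clasp_strands M (real M + 1) $ 3) (clasp_strands M (real M + 1) $ 4)
        \<union> open_shadow (clasp_strands M (real M + 1) $ q) (clasp_strands M (real M + 1) $ p)"
      if "x \<in> {-1..real M + 1}" "x > real M + 1 - 1/8" for x k
    proof -
      have "twisting M x = (-1) ^ M" using twisting_after[of M x] that by simp
      moreover have "Re (clasping M x) < -1" "-2 \<le> Re (clasping M x)" using that unfolding clasping_def by (auto simp: min_def max_def)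
      ultimately show ?thesis using exhaust_4[of k] unfolding open_shadow_def clasp_strands_def p_def q_def by (auto simp: E)
    qed
    show "cap_set {(1, 3), (2, 4)} start_cfg = base_caps" unfolding cap_set_def base_caps_def by (auto simp: commute)
    show "cap_set {(3, 4), (q, p)} (pathfinish (word_path (map fst (twist_schedule M 0)) start_cfg)) = base_caps"
      unfolding twist_schedule_end cap_set_def base_caps_def clasped_cfg_def p_def q_def by (auto simp: commute)
  qed auto
qed

section \<open>The vertices of the twist knot and the straightening of its clasp\<close>

text \<open>Open polygonal paths, which in contrast to \<open>polygon\<close> can be cut at a vertex
  and reversed.\<close>

fun chain :: "'a::real_vector list \<Rightarrow> 'a set" where
  "chain (a # b # r) = closed_segment a b \<union> chain (b # r)"
| "chain _ = {}"

lemma chain_nth: "chain xs = (\<Union>i<length xs - 1. closed_segment (xs ! i) (xs ! Suc i))"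
proof (induction xs rule: chain.induct)
  case (1 a b r)
  have "{..<length (a # b # r) - 1} = insert 0 (Suc ` {..<length (b # r) - 1})"
    by (auto simp: lessThan_Suc_eq_insert_0)
  then show ?case using 1 by simp
qed auto

text \<open>Repeating the first vertex at the end replaces the index modulo the length.\<close>

lemma polygon_chain: "polygon (v # vs) = chain (v # vs @ [v])"
proof -
  have *: "closed_segment ((v # vs) ! i) ((v # vs) ! ((i + 1) mod length (v # vs))) = closed_segment ((v # vs @ [v]) ! i) ((v # vs @ [v]) ! Suc i)"
    if "i < length (v # vs)" for i
  proof (cases "i = length vs")
    case True then show ?thesis by (simp add: nth_append nth_Cons')
  next
    case False
    then have "i < length vs" using that by simp
    then show ?thesis unfolding append_Cons[symmetric] nth_append by simp
  qed
  show ?thesis unfolding polygon_def chain_nth by (rule SUP_cong) (simp, rule *, simp)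
qed

lemma chain_append:
  assumes "xs \<noteq> []" "ys \<noteq> []"
  shows "chain (xs @ ys) = chain xs \<union> closed_segment (last xs) (hd ys) \<union> chain ys"
  using assms
proof (induction xs rule: chain.induct)
  case ("2_2" a)
  then show ?case by (cases ys) auto
qed auto

lemma chain_rev: "chain (rev xs) = chain xs"
proof (induction xs rule: chain.induct)
  case (1 a b r)
  have "chain (rev (a # b # r)) = chain (rev (b # r)) \<union> closed_segment b a"
    using chain_append[of "rev (b # r)" "[a]"] by simp
  then show ?case using 1 closed_segment_commute[of b a] by auto
qed auto

lemma chain_concat:
  assumes "xs \<noteq> []" "ys \<noteq> []" "zs \<noteq> []" "ws \<noteq> []"
  shows "chain (xs @ ys @ rev zs @ ws) = chain xs \<union> closed_segment (last xs) (hd ys) \<union> chain ys \<union> closed_segment (last ys) (last zs)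
    \<union> chain zs \<union> closed_segment (hd zs) (hd ws) \<union> chain ws"
  using assms by (simp add: chain_append chain_rev hd_rev last_rev Un_assoc)

lemma chain_linear_image:
  assumes "linear f" shows "f ` chain xs = chain (map f xs)"
  by (induction xs rule: chain.induct) (simp_all add: image_Un closed_segment_linear_image[OF assms])

lemma segment_image:
  fixes h :: "real \<Rightarrow> 'a::real_vector"
  assumes "a \<le> b" "\<And>t. t \<in> {0..1} \<Longrightarrow> h ((1 - t) * a + t * b) = (1 - t) *\<^sub>R h a + t *\<^sub>R h b"
  shows "closed_segment (h a) (h b) = h ` {a..b}"
proof -
  have "{a..b} = (\<lambda>t. (1 - t) * a + t * b) ` {0..1}"
    using assms(1) closed_segment_eq_real_ivl1[OF assms(1)] by (simp add: closed_segment_image_interval)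
  then have "h ` {a..b} = (\<lambda>t. h ((1 - t) * a + t * b)) ` {0..1}" by (simp only: image_image)
  also have "\<dots> = (\<lambda>t. (1 - t) *\<^sub>R h a + t *\<^sub>R h b) ` {0..1}" using assms(2) by (rule image_cong[OF refl])
  finally show ?thesis by (simp add: closed_segment_image_interval)
qed

lemma segment_graph:
  fixes f :: "real \<Rightarrow> 'a::real_vector"
  assumes "a \<le> b" "\<And>t. t \<in> {0..1} \<Longrightarrow> f ((1 - t) * a + t * b) = (1 - t) *\<^sub>R f a + t *\<^sub>R f b"
  shows "closed_segment (a, f a) (b, f b) = (\<lambda>x. (x, f x)) ` {a..b}"
  by (rule segment_image[OF assms(1)]) (simp add: assms(2))

definition emb :: "real \<times> real \<times> real \<Rightarrow> real \<times> complex" where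
  "emb = (\<lambda>(x, y, z). (x, Complex y z))"

lemma emb_simp [simp]: "emb (x, y, z) = (x, Complex y z)" by (simp add: emb_def)

lemma linear_emb: "linear emb"
  by (rule linearI) (auto simp: emb_def complex_eq_iff)

text \<open>\<open>half_twist\<close> has its only corner at 1/2, so the strand is affine between
  consecutive half integers, where the vertices lie.\<close>

lemma twisting_half_step:
  assumes "k < 2 * M"
  shows "closed_segment (real k / 2, twisting M (real k / 2)) (real (Suc k) / 2, twisting M (real (Suc k) / 2)) =
    (\<lambda>x. (x, twisting M x)) ` {real k / 2..real (Suc k) / 2}"
proof (rule segment_graph)
  fix t :: real assume t: "t \<in> {0..1}"
  define j where "j = k div 2"
  have j: "j < M" using assms unfolding j_def by linarith
  have tw: "twisting M x = (-1) ^ j * half_twist (x - real j)" if "real j \<le> x" "x \<le> real j + 1" for x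
    using twisting_step[OF j that(2)] that by simp
  let ?x = "(1 - t) * (real k / 2) + t * (real (Suc k) / 2)"
  have x: "?x = real k / 2 + t / 2" by (simp add: field_simps)
  show "twisting M ?x = (1 - t) *\<^sub>R twisting M (real k / 2) + t *\<^sub>R twisting M (real (Suc k) / 2)"
  proof (cases "even k")
    case True
    then have k: "real k / 2 = real j" "real (Suc k) / 2 = real j + 1/2" unfolding j_def by (auto elim!: evenE simp: field_simps)
    show ?thesis unfolding x unfolding k using t by (simp add: tw half_twist_def complex_eq_iff algebra_simps)
  next
    case False
    then have k: "real k / 2 = real j + 1/2" "real (Suc k) / 2 = real j + 1" unfolding j_def by (auto elim!: oddE simp: field_simps)
    show ?thesis unfolding x unfolding k using t by (simp add: tw half_twist_def complex_eq_iff algebra_simps)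
  qed
qed simp

text \<open>Each half step of x is a quarter turn: both sides are multiplied by i.\<close>

lemma twisting_vertex:
  assumes "k \<le> 2 * M"
  shows "twisting M (real k / 2) = Complex (cos (real k * pi / 2)) (sin (real k * pi / 2))"
  using assms
proof (induction k)
  case 0
  then show ?case by (cases "M = 0") (use twisting_step[of 0 M 0] twisting_after[of M 0] in \<open>auto simp: complex_eq_iff\<close>)
next
  case (Suc k)
  define j where "j = k div 2"
  have j: "j < M" using Suc.prems unfolding j_def by linarith
  have tw: "twisting M x = (-1) ^ j * half_twist (x - real j)" if "real j \<le> x" "x \<le> real j + 1" for x
    using twisting_step[OF j that(2)] that by simp
  have c: "Complex (cos (real (Suc k) * pi / 2)) (sin (real (Suc k) * pi / 2)) = \<i> * Complex (cos (real k * pi / 2)) (sin (real k * pi / 2))"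
  proof -
    have "real (Suc k) * pi / 2 = real k * pi / 2 + pi / 2" by (simp add: field_simps)
    then show ?thesis by (simp only: cos_add sin_add) (simp add: complex_eq_iff)
  qed
  have "twisting M (real (Suc k) / 2) = \<i> * twisting M (real k / 2)"
  proof (cases "even k")
    case True
    then have k: "real k / 2 = real j" "real (Suc k) / 2 = real j + 1/2" unfolding j_def by (auto elim!: evenE simp: field_simps)
    show ?thesis unfolding k by (simp add: tw half_twist_def complex_eq_iff)
  next
    case False
    then have k: "real k / 2 = real j + 1/2" "real (Suc k) / 2 = real j + 1" unfolding j_def by (auto elim!: oddE simp: field_simps)
    show ?thesis unfolding k by (simp add: tw half_twist_def complex_eq_iff)
  qed
  then show ?case using Suc unfolding c by simp
qed

lemma half_intervals: "(\<Union>k<2 * M. {real k / 2..real (Suc k) / 2}) = {0..real M}" if "M \<ge> 1"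
proof -
  have "(\<Union>k<Suc n. {real k / 2..real (Suc k) / 2}) = {0..real (Suc n) / 2}" for n
  proof (induction n)
    case (Suc n)
    have "{0..real (Suc n) / 2} \<union> {real (Suc n) / 2..real (Suc (Suc n)) / 2} = {0..real (Suc (Suc n)) / 2}"
      by (rule ivl_disj_un_two_touch) auto
    then show ?case using Suc by (simp only: lessThan_Suc UN_insert Un_commute)
  qed (simp add: lessThan_Suc)
  from this[of "2 * M - 1"] that show ?thesis by simp
qed

lemma chain_twisting:
  assumes "M \<ge> 1" "c \<in> {1, -1}"
  shows "chain (map (\<lambda>k. (real k / 2, c * Complex (cos (real k * pi / 2)) (sin (real k * pi / 2)))) [0..<2 * M + 1]) = (\<lambda>x. (x, c * twisting M x)) ` {0..real M}"
proof -
  let ?A = "\<lambda>k. (real k / 2, c * Complex (cos (real k * pi / 2)) (sin (real k * pi / 2)))"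
  have f: "linear (\<lambda>(x::real, v). (x, c * v))" by (rule linearI) (auto simp: algebra_simps)
  have "chain (map ?A [0..<2 * M + 1]) = (\<Union>k<2 * M. closed_segment (?A k) (?A (Suc k)))"
    unfolding chain_nth by (auto simp del: upt_Suc)
  also have "\<dots> = (\<Union>k<2 * M. (\<lambda>(x, v). (x, c * v)) ` (\<lambda>x. (x, twisting M x)) ` {real k / 2..real (Suc k) / 2})"
  proof (rule SUP_cong[OF refl])
    fix k assume "k \<in> {..<2 * M}"
    then have k: "k < 2 * M" "k \<le> 2 * M" "Suc k \<le> 2 * M" by auto
    show "closed_segment (?A k) (?A (Suc k)) = (\<lambda>(x, v). (x, c * v)) ` (\<lambda>x. (x, twisting M x)) ` {real k / 2..real (Suc k) / 2}"
      unfolding twisting_half_step[OF k(1), symmetric] closed_segment_linear_image[OF f, symmetric]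
        twisting_vertex[OF k(2)] twisting_vertex[OF k(3)] by simp
  qed
  also have "\<dots> = (\<lambda>x. (x, c * twisting M x)) ` (\<Union>k<2 * M. {real k / 2..real (Suc k) / 2})"
    by (auto simp: image_image image_UN)
  finally show ?thesis unfolding half_intervals[OF assms(1)] .
qed

text \<open>The absolute height of the two long arcs, which grows from 0 at x = -1 to 1 at x = M +
  1/2.\<close>

definition slope :: "nat \<Rightarrow> real \<Rightarrow> real" where "slope M x = (x + 1) / (real M + 3/2)"

lemma slope_values: "slope M (-1) = 0" "slope M (real M + 1/2) = 1"
  unfolding slope_def by (simp_all add: field_simps)

lemma slope_affine: "slope M ((1 - t) * a + t * b) = (1 - t) * slope M a + t * slope M b"
  unfolding slope_def by (simp add: add_divide_distrib[symmetric] algebra_simps)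

text \<open>The polygon is cut into graphs over one coordinate, on each of which
  \<open>straighten\<close> has a simple formula.\<close>

lemma twist_polygon:
  assumes "M \<ge> 1"
  shows "emb ` twist_knot (int M) =
    (\<lambda>x. (x, twisting M x)) ` {-1..real M + 1} \<union> (\<lambda>x. (x, - twisting M x)) ` {-1..real M + 1}
    \<union> (\<lambda>t. (real M + 1, Complex t 0)) ` {-1..1} \<union> (\<lambda>t. (-1, Complex t 0)) ` {1..3} \<union> (\<lambda>t. (-1, Complex (- t) 0)) ` {1..3}
    \<union> (\<lambda>x. (x, Complex (-3) (slope M x))) ` {-1..real M + 1/2} \<union> (\<lambda>x. (x, Complex 3 (- slope M x))) ` {-1..real M + 1/2}
    \<union> (\<lambda>y. (real M + 1/2, Complex y 1)) ` {-3..0} \<union> (\<lambda>z. (real M + 1/2, Complex 0 z)) ` {-1..1}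
    \<union> (\<lambda>y. (real M + 1/2, Complex y (-1))) ` {0..3}"
proof -
  define e :: real where "e = (-1) ^ M"
  let ?A = "\<lambda>k. (real k / 2, cos (real k * pi / 2), sin (real k * pi / 2))"
  let ?B = "\<lambda>k. (real k / 2, - cos (real k * pi / 2), - sin (real k * pi / 2))"
  let ?R = "[(real M + 1, e, 0), (real M + 1, - e, 0)]"
  let ?L = "[(-1, -1, 0), (-1, -3, 0), (real M + 1/2, -3, 1), (real M + 1/2, 0, 1), (real M + 1/2, 0, -1), (real M + 1/2, 3, -1), (-1, 3, 0), (-1, 1, 0)]"
  have v: "twist_vertices (int M) = map ?A [0..<2 * M + 1] @ ?R @ rev (map ?B [0..<2 * M + 1]) @ ?L"
    unfolding twist_vertices_def e_def by (simp add: Let_def rev_map)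
  have u: "[0..<2 * M + 1] = 0 # [1..<2 * M + 1]" by (simp add: upt_conv_Cons)
  let ?A' = "\<lambda>k. (real k / 2, 1 * Complex (cos (real k * pi / 2)) (sin (real k * pi / 2)))"
  let ?B' = "\<lambda>k. (real k / 2, -1 * Complex (cos (real k * pi / 2)) (sin (real k * pi / 2)))"
  let ?R' = "[(real M + 1, Complex e 0), (real M + 1, Complex (- e) 0)]"
  let ?L' = "[(-1, -1), (-1, -3), (real M + 1/2, Complex (-3) 1), (real M + 1/2, Complex 0 1), (real M + 1/2, Complex 0 (-1)), (real M + 1/2, Complex 3 (-1)), (-1, 3), (-1, 1), (0, 1)]"
  have "twist_knot (int M) = chain (map ?A [0..<2 * M + 1] @ ?R @ rev (map ?B [0..<2 * M + 1]) @ ?L @ [?A 0])"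
    unfolding twist_knot_def v u list.map append_Cons polygon_chain by simp
  then have "emb ` twist_knot (int M) = chain (map emb (map ?A [0..<2 * M + 1] @ ?R @ rev (map ?B [0..<2 * M + 1]) @ ?L @ [?A 0]))"
    by (simp only: chain_linear_image[OF linear_emb])
  also have "map emb (map ?A [0..<2 * M + 1] @ ?R @ rev (map ?B [0..<2 * M + 1]) @ ?L @ [?A 0]) =
    map ?A' [0..<2 * M + 1] @ ?R' @ rev (map ?B' [0..<2 * M + 1]) @ ?L'"
    by (simp add: rev_map complex_eq_iff o_def del: upt_Suc)
  also have "chain \<dots> = chain (map ?A' [0..<2 * M + 1]) \<union> closed_segment (?A' (2 * M)) (real M + 1, Complex e 0) \<union> chain ?R'
      \<union> closed_segment (real M + 1, Complex (- e) 0) (?B' (2 * M)) \<union> chain (map ?B' [0..<2 * M + 1]) \<union> closed_segment (?B' 0) (-1, -1) \<union> chain ?L'"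
  proof -
    have l: "last (map f [0..<2 * M + 1]) = f (2 * M)" "hd (map f [0..<2 * M + 1]) = f 0" "map f [0..<2 * M + 1] \<noteq> []" for f :: "nat \<Rightarrow> real \<times> complex"
    proof -
      show "last (map f [0..<2 * M + 1]) = f (2 * M)" by simp
      show "hd (map f [0..<2 * M + 1]) = f 0" "map f [0..<2 * M + 1] \<noteq> []" unfolding u list.map by simp_all
    qed
    have n: "?R' \<noteq> []" "?L' \<noteq> []" by simp_all
    show ?thesis unfolding chain_concat[OF l(3) n(1) l(3) n(2)] l list.sel by simp
  qed
  also have "\<dots> = (\<lambda>x. (x, twisting M x)) ` {-1..real M + 1} \<union> (\<lambda>x. (x, - twisting M x)) ` {-1..real M + 1}
      \<union> chain ?R' \<union> closed_segment (-1, -1) (-1, -3) \<union> closed_segment (-1, -3) (real M + 1/2, Complex (-3) 1)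
      \<union> closed_segment (real M + 1/2, Complex (-3) 1) (real M + 1/2, Complex 0 1) \<union> closed_segment (real M + 1/2, Complex 0 1) (real M + 1/2, Complex 0 (-1))
      \<union> closed_segment (real M + 1/2, Complex 0 (-1)) (real M + 1/2, Complex 3 (-1)) \<union> closed_segment (real M + 1/2, Complex 3 (-1)) (-1, 3) \<union> closed_segment (-1, 3) (-1, 1)"
  proof -
    have split: "{-1..real M + 1} = {-1..0} \<union> {0..real M} \<union> {real M..real M + 1}" by auto
    have before: "twisting M x = 1" if "x \<le> 0" for x using twisting_step[of 0 M x] assms that by simp
    have after: "twisting M x = Complex e 0" if "real M \<le> x" for x
      using twisting_after[OF that] unfolding e_def by (cases "even M") (auto simp: complex_eq_iff)
    have vM: "Complex (cos (real (2 * M) * pi / 2)) (sin (real (2 * M) * pi / 2)) = Complex e 0"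
      using twisting_vertex[of "2 * M" M] after[of "real M"] by simp
    have 1: "closed_segment (real M, c * Complex e 0) (real M + 1, c * Complex e 0) = (\<lambda>x. (x, c * twisting M x)) ` {real M..real M + 1}" for c
    proof -
      have "closed_segment (real M, c * Complex e 0) (real M + 1, c * Complex e 0) = (\<lambda>x. (x, c * Complex e 0)) ` {real M..real M + 1}"
        by (rule segment_graph) (auto simp flip: scaleR_left_distrib)
      then show ?thesis using after by (auto cong: image_cong)
    qed
    have 2: "closed_segment (-1, c) (0, c) = (\<lambda>x. (x, c * twisting M x)) ` {-1..0}" for c
    proof -
      have "closed_segment (-1, c) (0, c) = (\<lambda>x. (x, c)) ` {-1..0::real}"
        by (rule segment_graph) (auto simp flip: scaleR_left_distrib)
      then show ?thesis using before by (auto cong: image_cong)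
    qed
    have one: "Complex 1 0 = 1" by (simp add: complex_eq_iff)
    have 3: "closed_segment (?B' 0) (-1, -1) = (\<lambda>x. (x, -1 * twisting M x)) ` {-1..0}"
      unfolding 2[symmetric] closed_segment_commute[of "(-1, -1)" "(0, -1)"] by (simp add: one)
    have 4: "closed_segment (real M + 1, Complex (- e) 0) (?B' (2 * M)) = (\<lambda>x. (x, -1 * twisting M x)) ` {real M..real M + 1}"
    proof -
      have "Complex (- e) 0 = -1 * Complex e 0" by (simp add: complex_eq_iff)
      then show ?thesis unfolding 1[symmetric] vM by (simp add: insert_commute)
    qed
    have 5: "closed_segment (?A' (2 * M)) (real M + 1, Complex e 0) = (\<lambda>x. (x, 1 * twisting M x)) ` {real M..real M + 1}"
      unfolding 1[symmetric] vM by simp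
    have 6: "closed_segment (-1, 1) (0, 1) = (\<lambda>x. (x, 1 * twisting M x)) ` {-1..0}" unfolding 2[symmetric] by simp
    have cA: "chain (map ?A' [0..<2 * M + 1]) = (\<lambda>x. (x, 1 * twisting M x)) ` {0..real M}" by (rule chain_twisting[OF assms]) simp
    have cB: "chain (map ?B' [0..<2 * M + 1]) = (\<lambda>x. (x, -1 * twisting M x)) ` {0..real M}" by (rule chain_twisting[OF assms]) simp
    show ?thesis unfolding cA cB 3 4 5 chain.simps 6 split image_Un unfolding mult_minus1 mult_1 Un_empty_right by (simp only: Un_ac)
  qed
  also have "chain ?R' = (\<lambda>t. (real M + 1, Complex t 0)) ` {-1..1}"
  proof -
    have "closed_segment (real M + 1, Complex (-1) 0) (real M + 1, Complex 1 0) = (\<lambda>t. (real M + 1, Complex t 0)) ` {-1..1}"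
      by (rule segment_image) (auto simp: complex_eq_iff algebra_simps)
    then show ?thesis using closed_segment_commute[of "(real M + 1, Complex (-1) 0)" "(real M + 1, Complex 1 0)"]
      unfolding e_def by (cases "even M") auto
  qed
  also have "closed_segment (-1::real, -1::complex) (-1, -3) = (\<lambda>t. (-1, Complex (- t) 0)) ` {1..3}"
  proof -
    have "closed_segment (-1, Complex (-1) 0) (-1, Complex (-3) 0) = (\<lambda>t. (-1::real, Complex (- t) 0)) ` {1..3}"
      by (rule segment_image) (auto simp: complex_eq_iff algebra_simps)
    moreover have "Complex (-1) 0 = -1" "Complex (-3) 0 = -3" by (simp_all add: complex_eq_iff)
    ultimately show ?thesis by simp
  qed
  also have "closed_segment (-1::real, 3::complex) (-1, 1) = (\<lambda>t. (-1, Complex t 0)) ` {1..3}"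
  proof -
    have "closed_segment (-1, Complex 1 0) (-1, Complex 3 0) = (\<lambda>t. (-1::real, Complex t 0)) ` {1..3}"
      by (rule segment_image) (auto simp: complex_eq_iff algebra_simps)
    moreover have "Complex 1 0 = 1" "Complex 3 0 = 3" by (simp_all add: complex_eq_iff)
    ultimately show ?thesis by (simp only: closed_segment_commute[of "(-1::real, 3::complex)" "(-1, 1)"])
  qed
  also have "closed_segment (-1, -3) (real M + 1/2, Complex (-3) 1) = (\<lambda>x. (x, Complex (-3) (slope M x))) ` {-1..real M + 1/2}"
  proof -
    have "closed_segment (-1, Complex (-3) (slope M (-1))) (real M + 1/2, Complex (-3) (slope M (real M + 1/2))) = (\<lambda>x. (x, Complex (-3) (slope M x))) ` {-1..real M + 1/2}"
      by (rule segment_graph, simp, unfold slope_affine) (simp add: complex_eq_iff algebra_simps)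
    moreover have "Complex (-3) 0 = -3" by (simp add: complex_eq_iff)
    ultimately show ?thesis by (simp add: slope_values)
  qed
  also have "closed_segment (real M + 1/2, Complex 3 (-1)) (-1, 3) = (\<lambda>x. (x, Complex 3 (- slope M x))) ` {-1..real M + 1/2}"
  proof -
    have "closed_segment (-1, Complex 3 (- slope M (-1))) (real M + 1/2, Complex 3 (- slope M (real M + 1/2))) = (\<lambda>x. (x, Complex 3 (- slope M x))) ` {-1..real M + 1/2}"
      by (rule segment_graph, simp, unfold slope_affine) (simp add: complex_eq_iff algebra_simps)
    moreover have "Complex 3 0 = 3" by (simp add: complex_eq_iff)
    ultimately show ?thesis using closed_segment_commute[of "(-1::real, 3::complex)"] by (simp add: slope_values)
  qed
  also have "closed_segment (real M + 1/2, Complex (-3) 1) (real M + 1/2, Complex 0 1) = (\<lambda>y. (real M + 1/2, Complex y 1)) ` {-3..0}"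
    by (rule segment_image) (auto simp: complex_eq_iff field_simps)
  also have "closed_segment (real M + 1/2, Complex 0 1) (real M + 1/2, Complex 0 (-1)) = (\<lambda>z. (real M + 1/2, Complex 0 z)) ` {-1..1}"
    unfolding closed_segment_commute[of "(real M + 1/2, Complex 0 1)"]
    by (rule segment_image) (auto simp: complex_eq_iff field_simps)
  also have "closed_segment (real M + 1/2, Complex 0 (-1)) (real M + 1/2, Complex 3 (-1)) = (\<lambda>y. (real M + 1/2, Complex y (-1))) ` {0..3}"
    by (rule segment_image) (auto simp: complex_eq_iff field_simps)
  finally show ?thesis by (simp only: Un_ac)
qed

text \<open>Vanishes for y in [-1, 1], where the twisted strands run, and equals 1 and -1 at y = 3
  and y = -3, where the long arcs run.\<close>

definition side :: "real \<Rightarrow> real" where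
  "side y = unit_clamp ((y - 1) / 2) - unit_clamp ((- y - 1) / 2)"

text \<open>A shear that brings the long arcs to constant height: over y = -3 the height
  \<open>slope\<close> is raised to 1, over y = 3 its negative is lowered to -1.\<close>

definition tilt :: "nat \<Rightarrow> real \<times> complex \<Rightarrow> real \<times> complex" where
  "tilt M = (\<lambda>(x, v). (x, v - \<i> * of_real ((1 - slope M x) * side (Re v))))"

text \<open>The vertical clasp of the polygon sits over \<open>x = M + 1/2\<close>.  Scaling the lines to the right of
  \<open>x = M\<close> by a factor that increases along it makes it a strand followed by a cap, while the factor
  \<open>1\<close> on \<open>z = 0\<close> fixes the twisted strands and their cap.\<close>
definition stretch :: "complex \<Rightarrow> real" where
  "stretch v = 1 + unit_clamp (Im v) * (1/2 + unit_clamp (- Re v / 2) / 2) - unit_clamp (- Im v) * (1/2 + unit_clamp (Re v / 3) / 4)"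

lemma stretch_pos: "stretch v > 0"
proof -
  have "unit_clamp (- Im v) * (1/2 + unit_clamp (Re v / 3) / 4) \<le> 1 * (1/2 + 1/4)"
    by (intro mult_mono) auto
  moreover have "unit_clamp (Im v) * (1/2 + unit_clamp (- Re v / 2) / 2) \<ge> 0" by (intro mult_nonneg_nonneg) auto
  moreover have "b \<le> 1 * (1/2 + 1/4) \<Longrightarrow> 0 \<le> a \<Longrightarrow> 1 + a - b > 0" for a b :: real by simp
  ultimately show ?thesis unfolding stretch_def by blast
qed

lemma continuous_stretch: "continuous_on UNIV stretch"
  unfolding stretch_def by (intro continuous_intros) auto

definition straighten :: "nat \<Rightarrow> real \<times> complex \<Rightarrow> real \<times> complex" where
  "straighten M z = half_scale (real M) stretch (tilt M z)"

lemma heq_straighten: "heq K (straighten M ` K)"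
proof -
  have "continuous_on UNIV (\<lambda>(x, y). (1 - slope M x) * side y)"
    unfolding slope_def side_def case_prod_unfold by (intro continuous_intros) auto
  then have "heq K (tilt M ` K)" unfolding tilt_def by (rule heq_shift)
  moreover have "heq (tilt M ` K) (straighten M ` K)"
    by (rule heq_half_scale[OF continuous_stretch stretch_pos, where a="real M"]) (simp add: image_image straighten_def)
  ultimately show ?thesis by (rule heq_trans)
qed

lemma Re_twisting: "M \<ge> 1 \<Longrightarrow> \<bar>Re (twisting M x)\<bar> \<le> 1"
proof -
  assume M: "M \<ge> 1"
  have h: "\<bar>Re ((-1) ^ j * half_twist (unit_clamp t))\<bar> \<le> 1" for j t
  proof -
    have "0 \<le> unit_clamp t" "unit_clamp t \<le> 1" by auto
    then have "\<bar>1 - 2 * unit_clamp t\<bar> \<le> 1" by linarith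
    then show ?thesis by (cases "even j") (simp_all add: half_twist_def)
  qed
  consider "x \<ge> real M" | "x \<le> 0" | "0 \<le> x" "x < real M" by linarith
  then show ?thesis
  proof cases
    case 1 show ?thesis unfolding twisting_after[OF 1] by (cases "even M") simp_all
  next
    case 2 then show ?thesis using twisting_step[of 0 M x] M h[of 0 "x - real 0"] by simp
  next
    case 3
    define j where "j = nat \<lfloor>x\<rfloor>"
    have "real j \<le> x" "x \<le> real j + 1" "j < M" using 3 unfolding j_def by linarith+
    then show ?thesis using twisting_step[of j M x] h[of j "x - real j"] by simp
  qed
qed

text \<open>The shear vanishes for y in [-1, 1], and beyond x = M the twisted strands have height 0,
  where the factor is 1.\<close>

lemma straighten_twisting:
  assumes "M \<ge> 1"
  shows "straighten M (x, twisting M x) = (x, twisting M x)" "straighten M (x, - twisting M x) = (x, - twisting M x)"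
proof -
  have s: "side y = 0" if "\<bar>y\<bar> \<le> 1" for y using that by (auto simp: side_def)
  have t: "tilt M (x, twisting M x) = (x, twisting M x)" "tilt M (x, - twisting M x) = (x, - twisting M x)"
    using Re_twisting[OF assms, of x] unfolding tilt_def by (simp_all add: s)
  have "half_scale (real M) stretch (x, twisting M x) = (x, twisting M x) \<and> half_scale (real M) stretch (x, - twisting M x) = (x, - twisting M x)"
  proof (cases "x \<le> real M")
    case False
    then have "stretch (twisting M x) = 1" "stretch (- twisting M x) = 1"
      using twisting_after[of M x] by (cases "even M"; simp add: stretch_def)+
    then show ?thesis by (simp add: half_scale_simps)
  qed (simp add: half_scale_simps)
  then show "straighten M (x, twisting M x) = (x, twisting M x)" "straighten M (x, - twisting M x) = (x, - twisting M x)"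
    unfolding straighten_def t by auto
qed

text \<open>At x = M + 1/2 the value of \<open>slope\<close> is 1, so the shear is trivial there and
  only the scaling acts.\<close>

lemma straighten_mid:
  "straighten M (real M + 1/2, v) = (real M + stretch v / 2, v)" 
  unfolding straighten_def tilt_def by (simp add: slope_values half_scale_simps)

lemma straighten_right: "\<bar>t\<bar> \<le> 1 \<Longrightarrow> straighten M (real M + 1, Complex t 0) = (real M + 1, Complex t 0)"
  unfolding straighten_def tilt_def by (simp add: side_def half_scale_simps stretch_def complex_eq_iff)

lemma straighten_left: "straighten M (-1, Complex t 0) = (-1, Complex t (- side t))"
  unfolding straighten_def tilt_def by (simp add: slope_values half_scale_simps complex_eq_iff)

lemma straighten_outer:
  "straighten M (x, Complex (-3) (slope M x)) = (if x \<le> real M then x else real M + 2 * (x - real M), Complex (-3) 1)"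
  "straighten M (x, Complex 3 (- slope M x)) = (if x \<le> real M then x else real M + 1/4 * (x - real M), Complex 3 (-1))"
proof -
  have 1: "tilt M (x, Complex (-3) (slope M x)) = (x, Complex (-3) 1)" "tilt M (x, Complex 3 (- slope M x)) = (x, Complex 3 (-1))"
    unfolding tilt_def by (simp_all add: side_def complex_eq_iff)
  show "straighten M (x, Complex (-3) (slope M x)) = (if x \<le> real M then x else real M + 2 * (x - real M), Complex (-3) 1)"
    "straighten M (x, Complex 3 (- slope M x)) = (if x \<le> real M then x else real M + 1/4 * (x - real M), Complex 3 (-1))"
    unfolding straighten_def 1 by (simp_all add: half_scale_simps stretch_def)
qed

text \<open>Half of the factor, added to M, is the new x-coordinate. Along the vertical clasp it
  grows from M + 1/8 at y = 3 to M + 1 at y = -2; the rest, up to y = -3, stays in the fibre M + 1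
  and becomes a cap.\<close>

lemma stretch_arc:
  "y \<in> {-3..-2} \<Longrightarrow> stretch (Complex y 1) = 2" "y \<in> {-2..0} \<Longrightarrow> stretch (Complex y 1) = 3/2 - y / 4"
  "z \<in> {-1..1} \<Longrightarrow> stretch (Complex 0 z) = 1 + z / 2" "y \<in> {0..3} \<Longrightarrow> stretch (Complex y (-1)) = 1/2 - y / 12"
  unfolding stretch_def by (auto simp: min_def max_def)

lemma clasping_values:
  "x \<in> {real M + 1/8..real M + 1/4} \<Longrightarrow> clasping M x = Complex (24 * (real M + 1/4 - x)) (-1)"
  "x \<in> {real M + 1/4..real M + 3/4} \<Longrightarrow> clasping M x = Complex 0 (4 * (x - real M - 1/2))"
  "x \<in> {real M + 3/4..real M + 1} \<Longrightarrow> clasping M x = Complex (8 * (real M + 3/4 - x)) 1"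
  unfolding clasping_def by (auto simp: min_def max_def complex_eq_iff field_simps)

lemma straighten_arcs:
  "(\<lambda>y. straighten M (real M + 1/2, Complex y 1)) ` {-3..0} = (\<lambda>t. (real M + 1, Complex (- t) 1)) ` {2..3} \<union> (\<lambda>x. (x, clasping M x)) ` {real M + 3/4..real M + 1}"
  "(\<lambda>z. straighten M (real M + 1/2, Complex 0 z)) ` {-1..1} = (\<lambda>x. (x, clasping M x)) ` {real M + 1/4..real M + 3/4}"
  "(\<lambda>y. straighten M (real M + 1/2, Complex y (-1))) ` {0..3} = (\<lambda>x. (x, clasping M x)) ` {real M + 1/8..real M + 1/4}"
proof -
  have reparametrize: "g ` {a..b} = f ` {c..d}"
    if "\<And>x. x \<in> {c..d} \<Longrightarrow> \<theta> x \<in> {a..b} \<and> g (\<theta> x) = f x" "\<And>y. y \<in> {a..b} \<Longrightarrow> \<eta> y \<in> {c..d} \<and> \<theta> (\<eta> y) = y"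
    for f g :: "real \<Rightarrow> real \<times> complex" and \<theta> \<eta> :: "real \<Rightarrow> real" and a b c d
  proof
    show "f ` {c..d} \<subseteq> g ` {a..b}" using that(1) by (metis image_subsetI imageI)
    show "g ` {a..b} \<subseteq> f ` {c..d}" using that by (metis image_subsetI imageI)
  qed
  have "{-3..0} = {-3..-2} \<union> {-2..0::real}" by auto
  moreover have "(\<lambda>y. straighten M (real M + 1/2, Complex y 1)) ` {-3..-2} = (\<lambda>t. (real M + 1, Complex (- t) 1)) ` {2..3}"
    unfolding straighten_mid by (rule reparametrize[where \<theta>=uminus and \<eta>=uminus]) (auto simp: stretch_arc)
  moreover have "(\<lambda>y. straighten M (real M + 1/2, Complex y 1)) ` {-2..0} = (\<lambda>x. (x, clasping M x)) ` {real M + 3/4..real M + 1}"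
    unfolding straighten_mid
    by (rule reparametrize[where \<theta>="\<lambda>x. 8 * (real M + 3/4 - x)" and \<eta>="\<lambda>y. real M + 3/4 - y / 8"])
      (auto simp: stretch_arc clasping_values field_simps)
  ultimately show "(\<lambda>y. straighten M (real M + 1/2, Complex y 1)) ` {-3..0} = (\<lambda>t. (real M + 1, Complex (- t) 1)) ` {2..3} \<union> (\<lambda>x. (x, clasping M x)) ` {real M + 3/4..real M + 1}"
    by (simp only: image_Un)
  show "(\<lambda>z. straighten M (real M + 1/2, Complex 0 z)) ` {-1..1} = (\<lambda>x. (x, clasping M x)) ` {real M + 1/4..real M + 3/4}"
    unfolding straighten_mid
    by (rule reparametrize[where \<theta>="\<lambda>x. 4 * (x - real M - 1/2)" and \<eta>="\<lambda>z. real M + 1/2 + z / 4"])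
      (auto simp: stretch_arc clasping_values field_simps)
  show "(\<lambda>y. straighten M (real M + 1/2, Complex y (-1))) ` {0..3} = (\<lambda>x. (x, clasping M x)) ` {real M + 1/8..real M + 1/4}"
    unfolding straighten_mid
    by (rule reparametrize[where \<theta>="\<lambda>x. 24 * (real M + 1/4 - x)" and \<eta>="\<lambda>y. real M + 1/4 - y / 24"])
      (auto simp: stretch_arc clasping_values field_simps)
qed

text \<open>Beyond x = M the arc at y = -3 is lengthened by the factor 2 to reach M + 1, and the arc
  at y = 3 is shortened by the factor 1/4 to end at M + 1/8.\<close>

lemma straighten_sides:
  "(\<lambda>x. straighten M (x, Complex (-3) (slope M x))) ` {-1..real M + 1/2} = (\<lambda>x. (x, Complex (-3) 1)) ` {-1..real M + 1}"
  "(\<lambda>x. straighten M (x, Complex 3 (- slope M x))) ` {-1..real M + 1/2} = (\<lambda>x. (x, clasping M x)) ` {-1..real M + 1/8}"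
proof -
  have onto: "(\<lambda>x. (if x \<le> real M then x else real M + c * (x - real M), v)) ` {-1..real M + 1/2} = (\<lambda>x. (x, v)) ` {-1..real M + c / 2}"
    if "c > 0" for c and v :: complex
  proof
    show "(\<lambda>x. (if x \<le> real M then x else real M + c * (x - real M), v)) ` {-1..real M + 1/2} \<subseteq> (\<lambda>x. (x, v)) ` {-1..real M + c / 2}"
    proof safe
      fix x assume x: "x \<in> {-1..real M + 1/2}"
      have "c * (x - real M) \<le> c * (1/2)" using x that by (intro mult_left_mono) auto
      moreover have "x > real M \<Longrightarrow> c * (x - real M) > 0" using that by simp
      moreover have "(if x \<le> real M then x else real M + t) \<in> {-1..real M + c / 2}"
        if "t \<le> c * (1/2)" "x > real M \<Longrightarrow> t > 0" for t using x that \<open>c > 0\<close> by (auto split: if_split)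
      ultimately have "(if x \<le> real M then x else real M + c * (x - real M)) \<in> {-1..real M + c / 2}" by blast
      then show "(if x \<le> real M then x else real M + c * (x - real M), v) \<in> (\<lambda>x. (x, v)) ` {-1..real M + c / 2}" by blast
    qed
    show "(\<lambda>x. (x, v)) ` {-1..real M + c / 2} \<subseteq> (\<lambda>x. (if x \<le> real M then x else real M + c * (x - real M), v)) ` {-1..real M + 1/2}"
    proof safe
      fix x assume x: "x \<in> {-1..real M + c / 2}"
      define t where "t = (x - real M) / c"
      let ?y = "if x \<le> real M then x else real M + t"
      have "x > real M \<Longrightarrow> t > 0" "t \<le> 1/2" "c * t = x - real M" using x that unfolding t_def by (auto simp: field_simps)
      then have "?y \<in> {-1..real M + 1/2}" "(if ?y \<le> real M then ?y else real M + c * (?y - real M)) = x" using x that by auto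
      then show "(x, v) \<in> (\<lambda>x. (if x \<le> real M then x else real M + c * (x - real M), v)) ` {-1..real M + 1/2}"
        by (intro image_eqI[of _ _ ?y]) auto
    qed
  qed
  show "(\<lambda>x. straighten M (x, Complex (-3) (slope M x))) ` {-1..real M + 1/2} = (\<lambda>x. (x, Complex (-3) 1)) ` {-1..real M + 1}"
    unfolding straighten_outer using onto[of 2 "Complex (-3) 1"] by simp
  have "(\<lambda>x. (x, clasping M x)) ` {-1..real M + 1/8} = (\<lambda>x. (x, Complex 3 (-1))) ` {-1..real M + 1/8}"
    by (rule image_cong[OF refl]) (simp add: clasping_before)
  then show "(\<lambda>x. straighten M (x, Complex 3 (- slope M x))) ` {-1..real M + 1/2} = (\<lambda>x. (x, clasping M x)) ` {-1..real M + 1/8}"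
    unfolding straighten_outer using onto[of "1/4" "Complex 3 (-1)"] by simp
qed

theorem twist_knot_word:
  assumes "M \<ge> 1"
  shows "heq (emb ` twist_knot (int M)) (word_knot (twist_word M))"
proof -
  have side: "side t = (t - 1) / 2" "side (- t) = - ((t - 1) / 2)" if "t \<in> {1..3}" for t using that by (auto simp: side_def)
  have "{(x, clasp_strands M x $ k) | x k. x \<in> {-1..real M + 1}} = (\<lambda>x. (x, twisting M x)) ` {-1..real M + 1} \<union> (\<lambda>x. (x, - twisting M x)) ` {-1..real M + 1}
      \<union> (\<lambda>x. (x, clasping M x)) ` {-1..real M + 1} \<union> (\<lambda>x. (x, Complex (-3) 1)) ` {-1..real M + 1}"
  proof -
    have *: "{(x, F x $ k) | x k. x \<in> I} = (\<lambda>x. (x, F x $ 1)) ` I \<union> (\<lambda>x. (x, F x $ 2)) ` I \<union> (\<lambda>x. (x, F x $ 3)) ` I \<union> (\<lambda>x. (x, F x $ 4)) ` I"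
      for F :: "real \<Rightarrow> complex^4" and I
      using exhaust_4 by (auto simp: image_iff) (metis exhaust_4)
    show ?thesis unfolding * by (simp add: clasp_strands_def)
  qed
  moreover have "{-1..real M + 1} = {-1..real M + 1/8} \<union> {real M + 1/8..real M + 1/4} \<union> {real M + 1/4..real M + 3/4} \<union> {real M + 3/4..real M + 1}"
    by auto
  then have "(\<lambda>x. (x, clasping M x)) ` {-1..real M + 1} = (\<lambda>x. (x, clasping M x)) ` {-1..real M + 1/8} \<union> (\<lambda>x. (x, clasping M x)) ` {real M + 1/8..real M + 1/4}
     \<union> (\<lambda>x. (x, clasping M x)) ` {real M + 1/4..real M + 3/4} \<union> (\<lambda>x. (x, clasping M x)) ` {real M + 3/4..real M + 1}"
    by (simp only: image_Un)
  moreover have "(\<lambda>t. straighten M (real M + 1, Complex t 0)) ` {-1..1} = (\<lambda>t. (real M + 1, Complex t 0)) ` {-1..1}"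
    by (rule image_cong[OF refl]) (simp add: straighten_right abs_le_iff)
  moreover have "(\<lambda>t. straighten M (-1, Complex t 0)) ` {1..3} = (\<lambda>t. (-1, Complex t (- ((t - 1) / 2)))) ` {1..3}"
    "(\<lambda>t. straighten M (-1, Complex (- t) 0)) ` {1..3} = (\<lambda>t. (-1, Complex (- t) ((t - 1) / 2))) ` {1..3}"
    unfolding straighten_left by (rule image_cong[OF refl]; simp only: side; simp)+
  ultimately have "straighten M ` emb ` twist_knot (int M) = {(x, clasp_strands M x $ k) | x k. x \<in> {-1..real M + 1}}
      \<union> (\<lambda>t. (-1, Complex t (- ((t - 1) / 2)))) ` {1..3} \<union> (\<lambda>t. (-1, Complex (- t) ((t - 1) / 2))) ` {1..3}
      \<union> (\<lambda>t. (real M + 1, Complex (- t) 1)) ` {2..3} \<union> (\<lambda>t. (real M + 1, Complex t 0)) ` {-1..1}"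
    unfolding twist_polygon[OF assms] image_Un image_image straighten_twisting[OF assms] straighten_arcs straighten_sides
    by (simp only: Un_ac)
  then show ?thesis using heq_trans[OF heq_straighten[of "emb ` twist_knot (int M)" M]] clasp_diagram[OF assms] by simp
qed

section \<open>Conclusion for the given parametrizations\<close>

lemma homeomorphism_emb: "homeomorphism UNIV UNIV emb (\<lambda>(x, v). (x, Re v, Im v))"
proof (rule homeomorphismI)
  show "continuous_on UNIV emb" unfolding emb_def Complex_eq case_prod_unfold by (intro continuous_intros)
  show "continuous_on UNIV (\<lambda>(x::real, v). (x, Re v, Im v))" unfolding case_prod_unfold by (intro continuous_intros)
qed (auto simp: emb_def)

lemma same_knot_up_to_mirrorI:
  assumes "heq (emb ` K) (emb ` L)"
  shows "same_knot_up_to_mirror K L"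
proof -
  obtain f g where f: "homeomorphism UNIV UNIV f g" "f ` emb ` K = emb ` L" using heq_homeomorphism[OF assms] by blast
  have "homeomorphism UNIV UNIV ((\<lambda>(x, v). (x, Re v, Im v)) \<circ> (f \<circ> emb)) (((\<lambda>(x, v). (x, Re v, Im v)) \<circ> g) \<circ> emb)"
    by (rule homeomorphism_compose[OF homeomorphism_compose[OF homeomorphism_emb f(1)] homeomorphism_symD[OF homeomorphism_emb]])
  moreover have "((\<lambda>(x, v). (x, Re v, Im v)) \<circ> (f \<circ> emb)) ` K = L"
    unfolding image_comp[symmetric] f(2) by (simp add: image_image case_prod_unfold emb_def)
  ultimately show ?thesis unfolding same_knot_up_to_mirror_def by blast
qed

lemma fourier_112_knot_param:
  assumes "inj_on (\<lambda>t. emb (fourier_112 nx px ny py nz1 pz1 nz2 pz2 A t)) {0..<2 * pi}"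
  shows "is_knot_param (fourier_112 nx px ny py nz1 pz1 nz2 pz2 A)"
  unfolding is_knot_param_def
proof (intro conjI)
  show "continuous_on {0..2 * pi} (fourier_112 nx px ny py nz1 pz1 nz2 pz2 A)"
    unfolding fourier_112_def by (intro continuous_intros)
  have "of_int k * (2 * pi) + p = p + of_int k * (2 * pi)" for k :: int and p by simp
  then have "cos (of_int k * (2 * pi) + p) = cos p" for k :: int and p by (simp only: cos_add_int_turns)
  then show "fourier_112 nx px ny py nz1 pz1 nz2 pz2 A 0 = fourier_112 nx px ny py nz1 pz1 nz2 pz2 A (2 * pi)"
    unfolding fourier_112_def by simp
  show "inj_on (fourier_112 nx px ny py nz1 pz1 nz2 pz2 A) {0..<2 * pi}"
    using assms unfolding inj_on_def by metis
qed

text \<open>\<delta> unites both families: the second frequency of z exceeds that of y by 2 for even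
  twist knots and falls short of it by 2 for odd ones.\<close>

lemma fourier_knot:
  fixes N :: nat and \<delta> m :: int
  assumes "g = fourier_112 2 0 (2 * int N + 1) (1/2) 2 (pi/4) (2 * int N + 1 + 2 * \<delta>) \<phi> 1"
    and "m \<ge> 1" "inj_on (fourier_curve N \<delta> \<phi>) {0..<2 * pi}"
    and "heq (word_knot (twist_word (nat m))) (fourier_curve N \<delta> \<phi> ` {0..2 * pi})"
  shows "is_knot_param g \<and> same_knot_up_to_mirror (twist_knot m) (g ` {0..2 * pi})"
proof
  have e: "emb (g t) = fourier_curve N \<delta> \<phi> t" for t
    unfolding assms(1) fourier_112_def fourier_curve_def fourier_z_def by simp
  show "is_knot_param g" unfolding assms(1) by (rule fourier_112_knot_param) (unfold assms(1)[symmetric] e, rule assms(3))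
  have 1: "heq (emb ` twist_knot m) (word_knot (twist_word (nat m)))" using twist_knot_word[of "nat m"] assms(2) by simp
  have 2: "emb ` g ` {0..2 * pi} = fourier_curve N \<delta> \<phi> ` {0..2 * pi}" unfolding image_image e ..
  have "heq (emb ` twist_knot m) (emb ` g ` {0..2 * pi})" unfolding 2 by (rule heq_trans[OF 1 assms(4)])
  then show "same_knot_up_to_mirror (twist_knot m) (g ` {0..2 * pi})" by (rule same_knot_up_to_mirrorI)
qed

theorem theorem6:
  fixes n :: int
  assumes "n \<ge> 1"
  shows
    "(let g = fourier_112 2 0 (8*n+3) (1/2) 2 (pi/4) (8*n+1)
                ((real_of_int (8*n+1) + real_of_int (8*n+5) * pi) / (2 * real_of_int (8*n+3))) 1
      in is_knot_param g \<and> same_knot_up_to_mirror (twist_knot (4*n+1)) (g ` {0..2*pi}))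
     \<and>
     (let g = fourier_112 2 0 (2*n+1) (1/2) 2 (pi/4) (2*n+3)
                ((real_of_int (2*n+3) - 3 * pi) / (2 * real_of_int (2*n+1))) 1
      in is_knot_param g \<and> same_knot_up_to_mirror (twist_knot (2*n)) (g ` {0..2*pi}))"
proof -
  obtain k :: nat where k: "n = int k" "k \<ge> 1" using assms by (cases n) auto
  have nat: "nat (4 * n + 1) = 4 * k + 1" "nat (2 * n) = 2 * k" using k by auto
  show ?thesis unfolding Let_def
  \<comment> \<open>The values of N solve \<open>2 * N + 1 = 8 * n + 3\<close> and
    \<open>2 * N + 1 = 2 * n + 1\<close>; adding \<open>2 * \<delta>\<close> gives the frequencies
    \<open>8 * n + 1\<close> and \<open>2 * n + 3\<close>.\<close>
  proof (intro conjI[OF fourier_knot[where N="4 * k + 1" and \<delta>="-1"] fourier_knot[where N=k and \<delta>=1]])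
    show "inj_on (fourier_curve (4 * k + 1) (-1) ((real_of_int (8*n+1) + real_of_int (8*n+5) * pi) / (2 * real_of_int (8*n+3)))) {0..<2 * pi}"
      "heq (word_knot (twist_word (nat (4 * n + 1)))) (fourier_curve (4 * k + 1) (-1) ((real_of_int (8*n+1) + real_of_int (8*n+5) * pi) / (2 * real_of_int (8*n+3))) ` {0..2 * pi})"
      unfolding nat using odd_fourier_curve[OF k(2)] k(1) by simp_all
    show "inj_on (fourier_curve k 1 ((real_of_int (2*n+3) - 3 * pi) / (2 * real_of_int (2*n+1)))) {0..<2 * pi}"
      "heq (word_knot (twist_word (nat (2 * n)))) (fourier_curve k 1 ((real_of_int (2*n+3) - 3 * pi) / (2 * real_of_int (2*n+1))) ` {0..2 * pi})"
      unfolding nat using even_fourier_curve[OF k(2)] k(1) by simp_all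
  qed (use assms k in \<open>simp_all add: add_ac\<close>)
qed

end
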